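(* Let $\Omega\subset\mathbb R$ be a bounded open interval. Let the initial data satisfy (A2), (A3), (A4) of the context with $v_0,u_0,\theta_0$ independent of $\tau$, and suppose that $E_0<\epsilon_0$ for $\tau\in(0,1]$, where $\epsilon_0$ is as in the fact (G) of the context. Let $(v^\tau,u^\tau,\theta^\tau,q^\tau,S^\tau)$ be the corresponding global solutions of (P) given by (G). Then there exist functions $(v^0,u^0,\theta^0)\in L^\infty(\mathbb R^+;H^2(\Omega))$ and $(q^0,S^0)\in L^2(\mathbb R^+;H^2(\Omega))$ such that, as $\tau\to0$ and up to a subsequence, $$(v^\tau,u^\tau,\theta^\tau)\rightharpoonup(v^0,u^0,\theta^0)\quad\text{weakly-}\ast\text{ in }L^\infty(\mathbb R^+;H^2(\Omega)),$$ $$(q^\tau,S^\tau)\rightharpoonup(q^0,S^0)\quad\text{weakly in }L^2(\mathbb R^+;H^2(\Omega)),$$ where $(v^0,u^0,\theta^0)$ is the classical solution to the one-dimensional non-isentropic compressible Navier-Stokes equations $$\begin{cases}v_t=u_x,\\ u_t+p(v,\theta)_x=\left(\frac{\mu u_x}{v}\right)_x,\\ C_v\theta_t+\frac{R\theta u_x}{v}=\left(\frac{\kappa(\theta)\theta_x}{v}\right)_x+\frac{\mu u_x^2}{v},\end{cases}$$ satisfying the boundary conditions $u^0|_{\partial\Omega}=0$, $q^0|_{\partial\Omega}=0$ and the initial condition $(v^0,u^0,\theta^0)(0,x)=(v_0,u_0,\theta_0)(x)$. Moreover, $$q^0=-\frac{\kappa(\theta^0)(\theta^0)_x}{v^0},\qquad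 S^0=\mu\frac{(u^0)_x}{v^0}.$$
   Context: Constants $R,C_v,\mu>0$ are fixed; $g,\kappa:(0,\infty)\to(0,\infty)$ are smooth functions; $\tau\in(0,1]$ is the relaxation parameter. Put $\tau(\theta)=\tau g(\theta)$, $Z(\theta)=\tau(\theta)/\kappa(\theta)$, $a(\theta)=\frac{Z(\theta)}{\theta}-\frac12 Z'(\theta)$, $e(\theta,q)=C_v\theta+a(\theta)q^2$, $e_\theta=C_v+a'(\theta)q^2$, $p(v,\theta)=R\theta/v$. Problem (P): find $(v,u,\theta,q,S)$, with $v>0$ and $\theta>0$, on $[0,\infty)\times\Omega$ such that $$\begin{cases} v_t=u_x,\\ u_t+p(v,\theta)_x=S_x,\\ e_\theta\theta_t-\frac{2a(\theta)}{Z(\theta)}q\theta_x+\frac{R\theta u_x}{v}+q_x=\frac{2a(\theta)}{\tau(\theta)}q^2v+\frac{S^2v}{\mu},\\ \tau(\theta)q_t+vq+\kappa(\theta)\theta_x=0,\\ \tau S_t+vS=\mu u_x,\end{cases}$$ with initial condition $(v,u,\theta,q,S)(0,x)=(v_0,u_0,\theta_0,q_0,S_0)(x)$ and boundary condition $u|_{\partial\Omega}=q|_{\partial\Omega}=0$ for $t>0$. Notation: $D^\alpha=\partial_t^{\alpha_1}\partial_x^{\alpha_2}$, $|\alpha|=\alpha_1+\alpha_2$; $H^m=H^m(\Omega)$, $L^2=L^2(\Omega)$ in the variable $x$. Assumptions on the initial data ($q_0,S_0$ may depend on $\tau$). Time derivatives at $t=0$ are defined recursively from the equations of (P). (A2)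 $\partial_t^k u(0,x)|_{\partial\Omega}=\partial_t^k q(0,x)|_{\partial\Omega}=0$ for $k=0,1$. (A3) $\|v_0q_0+\kappa(\theta_0)(\theta_0)_x\|_{H^1}=O(\sqrt\tau)$ and $\|v_0S_0-\mu(u_0)_x\|_{H^1}=O(\sqrt\tau)$ as $\tau\to0$. (A4) $V_0^k\in H^{2-k}$ for $k=0,1,2$, where $V_0^k=\partial_t^k(v-1,u,\theta-1,\sqrt\tau q,\sqrt\tau S)(t=0,\cdot)$ for $k=0,1$ and $V_0^2=\tau\,\partial_t^2(v-1,u,\theta-1,\sqrt\tau q,\sqrt\tau S)(t=0,\cdot)$. Set $E_0=\sum_{k=0}^2\|V_0^k\|_{H^{2-k}}$. Fact (G) (global existence, which defines the solutions considered): there are constants $\epsilon_0,C>0$ independent of $\tau$ such that, under (A2)-(A4) and $E_0<\epsilon_0$, problem (P) has a unique global solution $(v,u,\theta,q,S)\in C^1([0,\infty)\times\Omega)$ with $(v-1,u,\theta-1,q,S)\in C([0,\infty),H^{2-\delta_0})\cap C^1([0,\infty),H^{1-\delta_0})$ for every $\delta_0>0$ and $$\sup_{t\ge0}\Big(\sum_{k=0}^{1}\|\partial_t^k(v-1,u,\theta-1,\sqrt\tau q,\sqrt\tau S)\|_{H^{2-k}}^2+\tau^2\|\partial_t^2(v,u,\theta,\sqrt\tau q,\sqrt\tau S)\|_{L^2}^2\Big)+\int_0^\infty\Big(\sum_{1\le|\alpha|\le2}\|D^\alpha(v,u,\theta)\|_{L^2}^2+\sum_{k=0}^1\|\partial_t^k(q,S)\|_{H^{2-k}}^2+\tau^2\|(q_{tt},S_{tt})\|_{L^2}^2\Big)dt\le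 CE_0.$$ *)

theory Defs
  imports "HOL-Analysis.Analysis" "HOL-Library.Landau_Symbols"
begin

section \<open>Sobolev spaces on an open subset of the real line\<close>

text \<open>
  Elements of \<open>L\<^sup>2\<close> and of the Sobolev spaces are represented by functions, and all notions
  of this section are invariant under changes on null sets.
\<close>

definition L2_fun :: "real set \<Rightarrow> (real \<Rightarrow> real) \<Rightarrow> bool" where
  "L2_fun \<Omega> f \<longleftrightarrow> f \<in> borel_measurable (lebesgue_on \<Omega>) \<and>
     integrable (lebesgue_on \<Omega>) (\<lambda>x. (f x)\<^sup>2)"

definition test_function :: "real set \<Rightarrow> (real \<Rightarrow> real) \<Rightarrow> bool" where
  "test_function \<Omega> \<phi> \<longleftrightarrow> (\<forall>n x. ((deriv ^^ n) \<phi>) differentiable (at x)) \<and>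
     compact (closure {x. \<phi> x \<noteq> 0}) \<and> closure {x. \<phi> x \<noteq> 0} \<subseteq> \<Omega>"

definition weak_derivative :: "real set \<Rightarrow> (real \<Rightarrow> real) \<Rightarrow> (real \<Rightarrow> real) \<Rightarrow> bool" where
  "weak_derivative \<Omega> f f' \<longleftrightarrow>
     (\<forall>K. compact K \<and> K \<subseteq> \<Omega> \<longrightarrow> integrable (lebesgue_on K) f \<and> integrable (lebesgue_on K) f') \<and>
     (\<forall>\<phi>. test_function \<Omega> \<phi> \<longrightarrow>
        (LINT x|lebesgue_on \<Omega>. f x * deriv \<phi> x) = - (LINT x|lebesgue_on \<Omega>. f' x * \<phi> x))"

text \<open>A weak derivative is unique up to null sets; \<open>wd\<close> picks one representative.\<close>

definition wd :: "real set \<Rightarrow> (real \<Rightarrow> real) \<Rightarrow> real \<Rightarrow> real" where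
  "wd \<Omega> f = (SOME f'. weak_derivative \<Omega> f f')"

definition sobolev :: "nat \<Rightarrow> real set \<Rightarrow> (real \<Rightarrow> real) set" where
  "sobolev m \<Omega> = {f. (\<forall>k\<le>m. L2_fun \<Omega> ((wd \<Omega> ^^ k) f)) \<and>
     (\<forall>k<m. weak_derivative \<Omega> ((wd \<Omega> ^^ k) f) ((wd \<Omega> ^^ Suc k) f))}"

definition Hinner :: "nat \<Rightarrow> real set \<Rightarrow> (real \<Rightarrow> real) \<Rightarrow> (real \<Rightarrow> real) \<Rightarrow> real" where
  "Hinner m \<Omega> f h =
     (\<Sum>k\<le>m. LINT x|lebesgue_on \<Omega>. (wd \<Omega> ^^ k) f x * (wd \<Omega> ^^ k) h x)"

definition Hnorm :: "nat \<Rightarrow> real set \<Rightarrow> (real \<Rightarrow> real) \<Rightarrow> real" where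
  "Hnorm m \<Omega> f = sqrt (Hinner m \<Omega> f f)"

text \<open>Norm of a vector-valued function, given by the list of its components.\<close>

definition Hnorms :: "nat \<Rightarrow> real set \<Rightarrow> (real \<Rightarrow> real) list \<Rightarrow> real" where
  "Hnorms m \<Omega> fs = sqrt (\<Sum>f\<leftarrow>fs. (Hnorm m \<Omega> f)\<^sup>2)"

text \<open>Vanishing boundary values, read off from the representative continuous up to the boundary
  (which every \<open>H\<^sup>1\<close> function on a bounded interval has).\<close>

definition trace_zero :: "real set \<Rightarrow> (real \<Rightarrow> real) \<Rightarrow> bool" where
  "trace_zero \<Omega> f \<longleftrightarrow> (\<exists>h. continuous_on (closure \<Omega>) h \<and>
     (AE x in lebesgue_on \<Omega>. h x = f x) \<and> (\<forall>x\<in>frontier \<Omega>. h x = 0))"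

text \<open>\<open>H\<^bsup>m+\<sigma>\<^esup>\<close> for \<open>0 < \<sigma> < 1\<close>, with the Sobolev-Slobodeckij (Gagliardo) norm.\<close>

definition gagliardo :: "real \<Rightarrow> (real \<Rightarrow> real) \<Rightarrow> real \<times> real \<Rightarrow> real" where
  "gagliardo \<sigma> f = (\<lambda>(x, y). (f x - f y)\<^sup>2 / \<bar>x - y\<bar> powr (1 + 2 * \<sigma>))"

definition frac_sobolev :: "nat \<Rightarrow> real \<Rightarrow> real set \<Rightarrow> (real \<Rightarrow> real) set" where
  "frac_sobolev m \<sigma> \<Omega> = {f \<in> sobolev m \<Omega>.
     integrable (lebesgue_on (\<Omega> \<times> \<Omega>)) (gagliardo \<sigma> ((wd \<Omega> ^^ m) f))}"

definition frac_Hnorm :: "nat \<Rightarrow> real \<Rightarrow> real set \<Rightarrow> (real \<Rightarrow> real) \<Rightarrow> real" where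
  "frac_Hnorm m \<sigma> \<Omega> f = sqrt ((Hnorm m \<Omega> f)\<^sup>2 +
     (LINT z|lebesgue_on (\<Omega> \<times> \<Omega>). gagliardo \<sigma> ((wd \<Omega> ^^ m) f) z))"


section \<open>Functions of time and space\<close>

text \<open>
  Functions \<open>w t x\<close> of \<open>t \<in> [0,\<infinity>)\<close> and \<open>x \<in> \<Omega>\<close>.  At \<open>t = 0\<close> the time derivative
  is one-sided.
\<close>

definition Dt :: "(real \<Rightarrow> real \<Rightarrow> real) \<Rightarrow> real \<Rightarrow> real \<Rightarrow> real" where
  "Dt w t x = vector_derivative (\<lambda>s. w s x) (at t within {0..})"

definition Dx :: "(real \<Rightarrow> real \<Rightarrow> real) \<Rightarrow> real \<Rightarrow> real \<Rightarrow> real" where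
  "Dx w t x = deriv (w t) x"

definition C1_cylinder :: "real set \<Rightarrow> (real \<Rightarrow> real \<Rightarrow> real) \<Rightarrow> bool" where
  "C1_cylinder \<Omega> w \<longleftrightarrow>
     (\<forall>t\<ge>0. \<forall>x\<in>\<Omega>. (\<lambda>s. w s x) differentiable (at t within {0..}) \<and> w t differentiable (at x)) \<and>
     continuous_on ({0..} \<times> \<Omega>) (\<lambda>(t, x). w t x) \<and>
     continuous_on ({0..} \<times> \<Omega>) (\<lambda>(t, x). Dt w t x) \<and>
     continuous_on ({0..} \<times> \<Omega>) (\<lambda>(t, x). Dx w t x)"

definition C0_frac :: "nat \<Rightarrow> real \<Rightarrow> real set \<Rightarrow> (real \<Rightarrow> real \<Rightarrow> real) \<Rightarrow> bool" where
  "C0_frac m \<sigma> \<Omega> w \<longleftrightarrow> (\<forall>t\<ge>0. w t \<in> frac_sobolev m \<sigma> \<Omega> \<and>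
     ((\<lambda>s. frac_Hnorm m \<sigma> \<Omega> (\<lambda>x. w s x - w t x)) \<longlongrightarrow> 0) (at t within {0..}))"

definition C1_frac :: "nat \<Rightarrow> real \<Rightarrow> real set \<Rightarrow> (real \<Rightarrow> real \<Rightarrow> real) \<Rightarrow> bool" where
  "C1_frac m \<sigma> \<Omega> w \<longleftrightarrow> C0_frac m \<sigma> \<Omega> w \<and> (\<exists>w'. C0_frac m \<sigma> \<Omega> w' \<and>
     (\<forall>t\<ge>0. ((\<lambda>s. frac_Hnorm m \<sigma> \<Omega> (\<lambda>x. (w s x - w t x) / (s - t) - w' t x)) \<longlongrightarrow> 0)
        (at t within {0..})))"

text \<open>The Bochner spaces \<open>L\<^sup>p(\<real>\<^sup>+; H\<^sup>m(\<Omega>))\<close>; strong measurability is convergence almost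
  everywhere, in the norm of \<open>H\<^sup>m\<close>, of a sequence of simple functions.\<close>

definition H_simple :: "nat \<Rightarrow> real set \<Rightarrow> (real \<Rightarrow> real \<Rightarrow> real) \<Rightarrow> bool" where
  "H_simple m \<Omega> s \<longleftrightarrow> finite (s ` {0<..}) \<and>
     (\<forall>h \<in> s ` {0<..}. h \<in> sobolev m \<Omega> \<and> {t \<in> {0<..}. s t = h} \<in> sets lebesgue)"

definition H_measurable :: "nat \<Rightarrow> real set \<Rightarrow> (real \<Rightarrow> real \<Rightarrow> real) \<Rightarrow> bool" where
  "H_measurable m \<Omega> w \<longleftrightarrow>
     (AE t in lebesgue_on {0<..}. w t \<in> sobolev m \<Omega>) \<and>
     (\<exists>s. (\<forall>n::nat. H_simple m \<Omega> (s n)) \<and>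
        (AE t in lebesgue_on {0<..}. (\<lambda>n. Hnorm m \<Omega> (\<lambda>x. s n t x - w t x)) \<longlonglongrightarrow> 0))"

definition Lp_H :: "nat \<Rightarrow> nat \<Rightarrow> real set \<Rightarrow> (real \<Rightarrow> real \<Rightarrow> real) set" where
  "Lp_H p m \<Omega> = {w. H_measurable m \<Omega> w \<and>
     integrable (lebesgue_on {0<..}) (\<lambda>t. Hnorm m \<Omega> (w t) ^ p)}"

definition Linf_H :: "nat \<Rightarrow> real set \<Rightarrow> (real \<Rightarrow> real \<Rightarrow> real) set" where
  "Linf_H m \<Omega> = {w. H_measurable m \<Omega> w \<and>
     (\<exists>M. AE t in lebesgue_on {0<..}. Hnorm m \<Omega> (w t) \<le> M)}"

text \<open>
  \<open>L\<^sup>\<infinity>(\<real>\<^sup>+; H\<^sup>m)\<close> is the dual of \<open>L\<^sup>1(\<real>\<^sup>+; (H\<^sup>m)')\<close>, and \<open>L\<^sup>2(\<real>\<^sup>+; H\<^sup>m)\<close> is a Hilbert space.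
  The dual of the Hilbert space \<open>H\<^sup>m\<close>, respectively of \<open>L\<^sup>2(\<real>\<^sup>+; H\<^sup>m)\<close>, is written by means of the
  Riesz isomorphism.
\<close>

definition weak_star_Linf_H ::
    "nat \<Rightarrow> real set \<Rightarrow> (nat \<Rightarrow> real \<Rightarrow> real \<Rightarrow> real) \<Rightarrow> (real \<Rightarrow> real \<Rightarrow> real) \<Rightarrow> bool" where
  "weak_star_Linf_H m \<Omega> w z \<longleftrightarrow> (\<forall>n. w n \<in> Linf_H m \<Omega>) \<and> z \<in> Linf_H m \<Omega> \<and>
     (\<forall>\<phi> \<in> Lp_H 1 m \<Omega>.
        (\<lambda>n. LINT t|lebesgue_on {0<..}. Hinner m \<Omega> (w n t) (\<phi> t))
          \<longlonglongrightarrow> (LINT t|lebesgue_on {0<..}. Hinner m \<Omega> (z t) (\<phi> t)))"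

definition weak_L2_H ::
    "nat \<Rightarrow> real set \<Rightarrow> (nat \<Rightarrow> real \<Rightarrow> real \<Rightarrow> real) \<Rightarrow> (real \<Rightarrow> real \<Rightarrow> real) \<Rightarrow> bool" where
  "weak_L2_H m \<Omega> w z \<longleftrightarrow> (\<forall>n. w n \<in> Lp_H 2 m \<Omega>) \<and> z \<in> Lp_H 2 m \<Omega> \<and>
     (\<forall>\<phi> \<in> Lp_H 2 m \<Omega>.
        (\<lambda>n. LINT t|lebesgue_on {0<..}. Hinner m \<Omega> (w n t) (\<phi> t))
          \<longlonglongrightarrow> (LINT t|lebesgue_on {0<..}. Hinner m \<Omega> (z t) (\<phi> t)))"

text \<open>\<open>z\<close> is the derivative of \<open>w\<close> in the sense of \<open>L\<^sup>2(\<Omega>)\<close>-valued distributions on \<open>(0,\<infinity>)\<close>.\<close>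

definition weak_time_derivative ::
    "real set \<Rightarrow> (real \<Rightarrow> real \<Rightarrow> real) \<Rightarrow> (real \<Rightarrow> real \<Rightarrow> real) \<Rightarrow> bool" where
  "weak_time_derivative \<Omega> w z \<longleftrightarrow> H_measurable 0 \<Omega> w \<and> H_measurable 0 \<Omega> z \<and>
     (\<forall>K. compact K \<and> K \<subseteq> {0<..} \<longrightarrow> integrable (lebesgue_on K) (\<lambda>t. Hnorm 0 \<Omega> (w t)) \<and>
        integrable (lebesgue_on K) (\<lambda>t. Hnorm 0 \<Omega> (z t))) \<and>
     (\<forall>\<phi> \<psi>. test_function {0<..} \<phi> \<and> L2_fun \<Omega> \<psi> \<longrightarrow>
        (LINT t|lebesgue_on {0<..}. deriv \<phi> t * (LINT x|lebesgue_on \<Omega>. w t x * \<psi> x)) =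
        - (LINT t|lebesgue_on {0<..}. \<phi> t * (LINT x|lebesgue_on \<Omega>. z t x * \<psi> x)))"


section \<open>The relaxed system\<close>

definition smooth_coefficient :: "(real \<Rightarrow> real) \<Rightarrow> bool" where
  "smooth_coefficient f \<longleftrightarrow>
     (\<forall>\<theta>>0. f \<theta> > 0) \<and> (\<forall>n. \<forall>\<theta>>0. ((deriv ^^ n) f) differentiable (at \<theta>))"

text \<open>Values of \<open>(v, u, \<theta>, q, S)\<close> at a point.\<close>

type_synonym state = "real \<times> real \<times> real \<times> real \<times> real"

fun components :: "(real \<Rightarrow> state) \<Rightarrow> (real \<Rightarrow> real) list" where
  "components W =
     [\<lambda>x. case W x of (v, u, \<theta>, q, S) \<Rightarrow> v,
      \<lambda>x. case W x of (v, u, \<theta>, q, S) \<Rightarrow> u,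
      \<lambda>x. case W x of (v, u, \<theta>, q, S) \<Rightarrow> \<theta>,
      \<lambda>x. case W x of (v, u, \<theta>, q, S) \<Rightarrow> q,
      \<lambda>x. case W x of (v, u, \<theta>, q, S) \<Rightarrow> S]"

definition weighted :: "real \<Rightarrow> (real \<Rightarrow> state) \<Rightarrow> (real \<Rightarrow> real) list" where
  "weighted \<tau> W =
     components (\<lambda>x. case W x of (v, u, \<theta>, q, S) \<Rightarrow> (v, u, \<theta>, sqrt \<tau> * q, sqrt \<tau> * S))"

definition wd_state :: "real set \<Rightarrow> (real \<Rightarrow> state) \<Rightarrow> real \<Rightarrow> state" where
  "wd_state \<Omega> W x =
     (wd \<Omega> (components W ! 0) x, wd \<Omega> (components W ! 1) x, wd \<Omega> (components W ! 2) x,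
      wd \<Omega> (components W ! 3) x, wd \<Omega> (components W ! 4) x)"

definition pressure :: "real \<Rightarrow> real \<Rightarrow> real \<Rightarrow> real" where
  "pressure R v \<theta> = R * \<theta> / v"

locale relaxed_fluid =
  fixes \<Omega> :: "real set" and R Cv \<mu> :: real and g \<kappa> :: "real \<Rightarrow> real"
begin

definition Z :: "real \<Rightarrow> real \<Rightarrow> real" where
  "Z \<tau> \<theta> = \<tau> * g \<theta> / \<kappa> \<theta>"

definition a :: "real \<Rightarrow> real \<Rightarrow> real" where
  "a \<tau> \<theta> = Z \<tau> \<theta> / \<theta> - 1 / 2 * deriv (Z \<tau>) \<theta>"

definition e_\<theta> :: "real \<Rightarrow> real \<Rightarrow> real \<Rightarrow> real" where
  "e_\<theta> \<tau> \<theta> q = Cv + deriv (a \<tau>) \<theta> * q\<^sup>2"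

definition problem_P where
  "problem_P \<tau> v\<^sub>0 u\<^sub>0 \<theta>\<^sub>0 q\<^sub>0 S\<^sub>0 v u \<theta> q S \<longleftrightarrow>
     (\<forall>t\<ge>0. \<forall>x\<in>\<Omega>. v t x > 0 \<and> \<theta> t x > 0 \<and>
        Dt v t x = Dx u t x \<and>
        Dt u t x + Dx (\<lambda>t x. pressure R (v t x) (\<theta> t x)) t x = Dx S t x \<and>
        e_\<theta> \<tau> (\<theta> t x) (q t x) * Dt \<theta> t x
          - 2 * a \<tau> (\<theta> t x) / Z \<tau> (\<theta> t x) * q t x * Dx \<theta> t x
          + R * \<theta> t x * Dx u t x / v t x + Dx q t x
        = 2 * a \<tau> (\<theta> t x) / (\<tau> * g (\<theta> t x)) * (q t x)\<^sup>2 * v t x + (S t x)\<^sup>2 * v t x / \<mu> \<and>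
        \<tau> * g (\<theta> t x) * Dt q t x + v t x * q t x + \<kappa> (\<theta> t x) * Dx \<theta> t x = 0 \<and>
        \<tau> * Dt S t x + v t x * S t x = \<mu> * Dx u t x) \<and>
     (\<forall>x\<in>\<Omega>. v 0 x = v\<^sub>0 x \<and> u 0 x = u\<^sub>0 x \<and> \<theta> 0 x = \<theta>\<^sub>0 x \<and> q 0 x = q\<^sub>0 x \<and> S 0 x = S\<^sub>0 x) \<and>
     (\<forall>t>0. trace_zero \<Omega> (u t) \<and> trace_zero \<Omega> (q t))"

text \<open>
  The system solved for the time derivatives, \<open>W\<^sub>t = rhs \<tau> W W\<^sub>x\<close>.  The time derivatives at
  \<open>t = 0\<close> come from this form: \<open>W\<^sub>1 = rhs \<tau> W\<^sub>0 (W\<^sub>0)\<^sub>x\<close>, and \<open>W\<^sub>2\<close> is obtained by applying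
  \<open>\<partial>\<^sub>t\<close> to \<open>rhs \<tau> W W\<^sub>x\<close> with the chain rule, that is, as the derivative of \<open>rhs \<tau>\<close> at
  \<open>(W\<^sub>0, (W\<^sub>0)\<^sub>x)\<close> in the direction \<open>(W\<^sub>1, (W\<^sub>1)\<^sub>x)\<close>.
\<close>

fun rhs :: "real \<Rightarrow> state \<Rightarrow> state \<Rightarrow> state" where
  "rhs \<tau> (v, u, \<theta>, q, S) (vx, ux, \<theta>x, qx, Sx) =
     (ux,
      - (R * \<theta>x / v - R * \<theta> * vx / v\<^sup>2) + Sx,
      (2 * a \<tau> \<theta> / Z \<tau> \<theta> * q * \<theta>x - R * \<theta> * ux / v - qx
         + 2 * a \<tau> \<theta> / (\<tau> * g \<theta>) * q\<^sup>2 * v + S\<^sup>2 * v / \<mu>) / e_\<theta> \<tau> \<theta> q,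
      - (v * q + \<kappa> \<theta> * \<theta>x) / (\<tau> * g \<theta>),
      (\<mu> * ux - v * S) / \<tau>)"

definition initial_dt :: "real \<Rightarrow> (real \<Rightarrow> state) \<Rightarrow> real \<Rightarrow> state" where
  "initial_dt \<tau> W x = rhs \<tau> (W x) (wd_state \<Omega> W x)"

definition initial_dtt :: "real \<Rightarrow> (real \<Rightarrow> state) \<Rightarrow> real \<Rightarrow> state" where
  "initial_dtt \<tau> W x = vector_derivative
     (\<lambda>s. rhs \<tau> (W x + s *\<^sub>R initial_dt \<tau> W x)
                (wd_state \<Omega> W x + s *\<^sub>R wd_state \<Omega> (initial_dt \<tau> W) x)) (at 0)"

definition initial_state ::
    "(real \<Rightarrow> real) \<Rightarrow> (real \<Rightarrow> real) \<Rightarrow> (real \<Rightarrow> real) \<Rightarrow> (real \<Rightarrow> real) \<Rightarrow> (real \<Rightarrow> real) \<Rightarrow> real \<Rightarrow> state"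
  where "initial_state v\<^sub>0 u\<^sub>0 \<theta>\<^sub>0 q\<^sub>0 S\<^sub>0 x = (v\<^sub>0 x, u\<^sub>0 x, \<theta>\<^sub>0 x, q\<^sub>0 x, S\<^sub>0 x)"

definition V0 :: "real \<Rightarrow> (real \<Rightarrow> state) \<Rightarrow> nat \<Rightarrow> (real \<Rightarrow> real) list" where
  "V0 \<tau> W k = weighted \<tau>
     (if k = 0 then (\<lambda>x. W x - (1, 0, 1, 0, 0))
      else if k = 1 then initial_dt \<tau> W
      else (\<lambda>x. \<tau> *\<^sub>R initial_dtt \<tau> W x))"

definition A2 :: "real \<Rightarrow> (real \<Rightarrow> state) \<Rightarrow> bool" where
  "A2 \<tau> W \<longleftrightarrow>
     trace_zero \<Omega> (components W ! 1) \<and> trace_zero \<Omega> (components W ! 3) \<and>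
     trace_zero \<Omega> (components (initial_dt \<tau> W) ! 1) \<and>
     trace_zero \<Omega> (components (initial_dt \<tau> W) ! 3)"

text \<open>Here \<open>q\<^sub>0\<close> and \<open>S\<^sub>0\<close> take the parameter \<open>\<tau> \<in> (0,1]\<close> as first argument.\<close>

definition A3 ::
    "(real \<Rightarrow> real) \<Rightarrow> (real \<Rightarrow> real) \<Rightarrow> (real \<Rightarrow> real) \<Rightarrow> (real \<Rightarrow> real \<Rightarrow> real) \<Rightarrow> (real \<Rightarrow> real \<Rightarrow> real) \<Rightarrow> bool"
  where
  "A3 v\<^sub>0 u\<^sub>0 \<theta>\<^sub>0 q\<^sub>0 S\<^sub>0 \<longleftrightarrow>
     (\<lambda>\<tau>. Hnorm 1 \<Omega> (\<lambda>x. v\<^sub>0 x * q\<^sub>0 \<tau> x + \<kappa> (\<theta>\<^sub>0 x) * wd \<Omega> \<theta>\<^sub>0 x)) \<in> O[at_right 0](sqrt) \<and>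
     (\<lambda>\<tau>. Hnorm 1 \<Omega> (\<lambda>x. v\<^sub>0 x * S\<^sub>0 \<tau> x - \<mu> * wd \<Omega> u\<^sub>0 x)) \<in> O[at_right 0](sqrt)"

definition A4 :: "real \<Rightarrow> (real \<Rightarrow> state) \<Rightarrow> bool" where
  "A4 \<tau> W \<longleftrightarrow> (\<forall>k\<le>2. set (V0 \<tau> W k) \<subseteq> sobolev (2 - k) \<Omega>)"

definition E0 :: "real \<Rightarrow> (real \<Rightarrow> state) \<Rightarrow> real" where
  "E0 \<tau> W = (\<Sum>k\<le>2. Hnorms (2 - k) \<Omega> (V0 \<tau> W k))"

text \<open>Since \<open>H\<^sup>s\<close> decreases with \<open>s\<close>, it suffices to let \<open>\<delta>\<^sub>0\<close> range over \<open>(0,1)\<close>;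
  then \<open>2 - \<delta>\<^sub>0 = 1 + (1 - \<delta>\<^sub>0)\<close> and \<open>1 - \<delta>\<^sub>0 = 0 + (1 - \<delta>\<^sub>0)\<close>.\<close>

definition regularity_class where
  "regularity_class v u \<theta> q S \<longleftrightarrow>
     C1_cylinder \<Omega> v \<and> C1_cylinder \<Omega> u \<and> C1_cylinder \<Omega> \<theta> \<and>
     C1_cylinder \<Omega> q \<and> C1_cylinder \<Omega> S \<and>
     (\<forall>\<delta>\<^sub>0. 0 < \<delta>\<^sub>0 \<and> \<delta>\<^sub>0 < 1 \<longrightarrow>
        (\<forall>w \<in> {\<lambda>t x. v t x - 1, u, \<lambda>t x. \<theta> t x - 1, q, S}.
           C0_frac 1 (1 - \<delta>\<^sub>0) \<Omega> w \<and> C1_frac 0 (1 - \<delta>\<^sub>0) \<Omega> w))"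

text \<open>The sum of the squared \<open>L\<^sup>2\<close> norms of \<open>w\<^sub>x\<close>, \<open>w\<^sub>t\<close>, \<open>w\<^sub>x\<^sub>x\<close>, \<open>w\<^sub>t\<^sub>x\<close> and \<open>w\<^sub>t\<^sub>t = wtt\<close>.\<close>

definition D12 :: "(real \<Rightarrow> real \<Rightarrow> real) \<Rightarrow> (real \<Rightarrow> real \<Rightarrow> real) \<Rightarrow> real \<Rightarrow> real" where
  "D12 w wtt t = (Hnorms 0 \<Omega>
     [wd \<Omega> (w t), Dt w t, wd \<Omega> (wd \<Omega> (w t)), wd \<Omega> (Dt w t), wtt t])\<^sup>2"

text \<open>
  The solutions are only once continuously differentiable, so the second time derivatives are
  weak ones; being determined for almost every \<open>t\<close> only, they are existentially quantified.
\<close>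

definition energy_estimate where
  "energy_estimate \<tau> B v u \<theta> q S \<longleftrightarrow>
     (\<exists>vtt utt \<theta>tt qtt Stt.
        weak_time_derivative \<Omega> (Dt v) vtt \<and> weak_time_derivative \<Omega> (Dt u) utt \<and>
        weak_time_derivative \<Omega> (Dt \<theta>) \<theta>tt \<and> weak_time_derivative \<Omega> (Dt q) qtt \<and>
        weak_time_derivative \<Omega> (Dt S) Stt \<and>
        (let W = (\<lambda>t. weighted \<tau> (\<lambda>x. (v t x - 1, u t x, \<theta> t x - 1, q t x, S t x)));
             Wt = (\<lambda>t. weighted \<tau> (\<lambda>x. (Dt v t x, Dt u t x, Dt \<theta> t x, Dt q t x, Dt S t x)));
             Wtt = (\<lambda>t. weighted \<tau> (\<lambda>x. (vtt t x, utt t x, \<theta>tt t x, qtt t x, Stt t x)));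
             D = (\<lambda>t. D12 v vtt t + D12 u utt t + D12 \<theta> \<theta>tt t
                    + (Hnorms 2 \<Omega> [q t, S t])\<^sup>2 + (Hnorms 1 \<Omega> [Dt q t, Dt S t])\<^sup>2
                    + \<tau>\<^sup>2 * (Hnorms 0 \<Omega> [qtt t, Stt t])\<^sup>2)
         in (\<forall>t\<ge>0. set (W t) \<subseteq> sobolev 2 \<Omega> \<and> set (Wt t) \<subseteq> sobolev 1 \<Omega> \<and>
                    set (Wtt t) \<subseteq> sobolev 0 \<Omega>) \<and>
            integrable (lebesgue_on {0<..}) D \<and>
            (\<forall>t\<ge>0. (Hnorms 2 \<Omega> (W t))\<^sup>2 + (Hnorms 1 \<Omega> (Wt t))\<^sup>2 + \<tau>\<^sup>2 * (Hnorms 0 \<Omega> (Wtt t))\<^sup>2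
                    + (LINT s|lebesgue_on {0<..}. D s) \<le> B)))"

text \<open>A global solution as furnished by the global existence theorem, with its constant \<open>C\<close>.\<close>

definition global_solution where
  "global_solution C \<tau> v\<^sub>0 u\<^sub>0 \<theta>\<^sub>0 q\<^sub>0 S\<^sub>0 v u \<theta> q S \<longleftrightarrow>
     problem_P \<tau> v\<^sub>0 u\<^sub>0 \<theta>\<^sub>0 q\<^sub>0 S\<^sub>0 v u \<theta> q S \<and>
     regularity_class v u \<theta> q S \<and>
     energy_estimate \<tau> (C * E0 \<tau> (initial_state v\<^sub>0 u\<^sub>0 \<theta>\<^sub>0 q\<^sub>0 S\<^sub>0)) v u \<theta> q S"

end


section \<open>Classical solutions of the compressible Navier-Stokes equations\<close>

definition navier_stokes_classical ::
    "real set \<Rightarrow> real \<Rightarrow> real \<Rightarrow> real \<Rightarrow> (real \<Rightarrow> real) \<Rightarrow>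
     (real \<Rightarrow> real \<Rightarrow> real) \<Rightarrow> (real \<Rightarrow> real \<Rightarrow> real) \<Rightarrow> (real \<Rightarrow> real \<Rightarrow> real) \<Rightarrow> bool" where
  "navier_stokes_classical \<Omega> R Cv \<mu> \<kappa> v u \<theta> \<longleftrightarrow>
     C1_cylinder \<Omega> v \<and> C1_cylinder \<Omega> u \<and> C1_cylinder \<Omega> \<theta> \<and>
     (\<forall>w \<in> {u, \<theta>}. (\<forall>t\<ge>0. \<forall>x\<in>\<Omega>. Dx w t differentiable (at x)) \<and>
        continuous_on ({0..} \<times> \<Omega>) (\<lambda>(t, x). Dx (Dx w) t x)) \<and>
     (\<forall>t\<ge>0. \<forall>x\<in>\<Omega>. v t x > 0 \<and> \<theta> t x > 0 \<and>
        Dt v t x = Dx u t x \<and>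
        Dt u t x + Dx (\<lambda>t x. pressure R (v t x) (\<theta> t x)) t x
          = Dx (\<lambda>t x. \<mu> * Dx u t x / v t x) t x \<and>
        Cv * Dt \<theta> t x + R * \<theta> t x * Dx u t x / v t x
          = Dx (\<lambda>t x. \<kappa> (\<theta> t x) * Dx \<theta> t x / v t x) t x + \<mu> * (Dx u t x)\<^sup>2 / v t x)"

end

theory Submission
  imports Defs "HOL-Complex_Analysis.Great_Picard"
begin

text \<open>
  The energy estimate gives moduli of continuity, uniform in \<open>\<tau>\<close>, for \<open>v\<close>, \<open>u\<close>, \<open>\<theta>\<close>, for their first
  derivatives, and for \<open>q\<close> and \<open>S\<close>.  A diagonal subsequence therefore converges pointwise everywhere,
  the first derivatives of \<open>v\<close>, \<open>u\<close>, \<open>\<theta>\<close> converge along with it, and the bounds turn pointwise into weak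
  convergence.  In the constitutive laws \<open>\<tau> q\<^sub>t\<close> and \<open>\<tau> S\<^sub>t\<close> vanish in the limit, because \<open>\<surd>\<tau> q\<^sub>t\<close> and
  \<open>\<surd>\<tau> S\<^sub>t\<close> are bounded.  The energy bounds \<open>q\<^sub>x\<close> and \<open>S\<^sub>x\<close> in the mean over time only, but the equations
  express \<open>q\<^sub>x\<close> and \<open>(S - p)\<^sub>x\<close> by equicontinuous quantities, so their limits exist pointwise; the terms with \<open>2 a / Z\<close> and
  \<open>2 a / \<tau>(\<theta>)\<close>, which do not tend to zero, cancel in the limit by Fourier's law.

  All this presupposes that the limits of \<open>v\<close> and \<open>\<theta>\<close> are positive.  For \<open>v\<close> this follows from
  \<open>v\<^sub>t = v S / \<mu>\<close> with \<open>S\<close> bounded.  For \<open>\<theta>\<close> a minimum principle keeps a lower bound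
  \<open>c exp (- K t)\<close> as long as \<open>\<theta>\<close> is positive, so that a first zero cannot occur.
\<close>

section \<open>Square integrable functions\<close>

text \<open>In space the moduli are the Hoelder bound of exponent 1/2 for \<open>H\<^sup>1\<close>
  functions. In time v, u, \<theta> are Lipschitz. Their time derivatives are Hoelder of exponent
  1/2 with values in \<open>L\<^sup>2\<close>, because the second time derivatives are square
  integrable uniformly in \<tau>; interpolation with the bound in \<open>H\<^sup>1\<close> gives
  exponent 1/4 at every point. For q and S the energy at a fixed time controls only the multiples by
  sqrt \<tau>. A bound free of \<tau> holds at some time in every unit interval and is carried to
  the other times by the square integrability of q_t and S_t. The constants
  \<open>\<epsilon>\<^sub>0\<close> and C are arbitrary, so the energy does not keep v and \<theta>
  near 1, and positivity must be drawn from the equations. The obstacle is that the infimum of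
  \<theta> over the open interval may be approached only at the boundary, where the equations say
  nothing. The boundary condition on q then supplies points at which \<theta> is nearly minimal and
  q_x is almost nonpositive.\<close>

definition square_integrable :: "'a measure \<Rightarrow> ('a \<Rightarrow> real) \<Rightarrow> bool" where
  "square_integrable M f \<longleftrightarrow> f \<in> borel_measurable M \<and> integrable M (\<lambda>x. (f x)\<^sup>2)"

definition norm2 :: "'a measure \<Rightarrow> ('a \<Rightarrow> real) \<Rightarrow> real" where
  "norm2 M f = sqrt (LINT x|M. (f x)\<^sup>2)"

lemma L2_fun_iff: "L2_fun \<Omega> f \<longleftrightarrow> square_integrable (lebesgue_on \<Omega>) f"
  by (simp add: L2_fun_def square_integrable_def)

lemma square_integrable_measurable [measurable_dest]:
  "square_integrable M f \<Longrightarrow> f \<in> borel_measurable M"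
  by (simp add: square_integrable_def)

lemma square_integrable_square: "square_integrable M f \<Longrightarrow> integrable M (\<lambda>x. (f x)\<^sup>2)"
  by (simp add: square_integrable_def)

lemma norm2_nonneg [simp]: "norm2 M f \<ge> 0"
  by (simp add: norm2_def)

lemma norm2_power2: "(norm2 M f)\<^sup>2 = (LINT x|M. (f x)\<^sup>2)"
  by (simp add: norm2_def)

lemma norm2_zero [simp]: "norm2 M (\<lambda>x. 0) = 0"
  by (simp add: norm2_def)

lemma square_integrable_zero [simp]: "square_integrable M (\<lambda>x. 0)"
  by (simp add: square_integrable_def)

lemma square_integrable_mult:
  assumes "square_integrable M f" "square_integrable M g"
  shows "integrable M (\<lambda>x. f x * g x)"
proof (rule Bochner_Integration.integrable_bound)
  show "integrable M (\<lambda>x. (f x)\<^sup>2 + (g x)\<^sup>2)"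
    using assms by (auto simp: square_integrable_def)
  show "(\<lambda>x. f x * g x) \<in> borel_measurable M"
    using assms by (auto simp: square_integrable_def)
  have "\<bar>f x * g x\<bar> \<le> \<bar>(f x)\<^sup>2 + (g x)\<^sup>2\<bar>" for x
  proof -
    have "0 \<le> (\<bar>f x\<bar> - \<bar>g x\<bar>)\<^sup>2" by simp
    then have "2 * (\<bar>f x\<bar> * \<bar>g x\<bar>) \<le> (f x)\<^sup>2 + (g x)\<^sup>2"
      by (simp add: power2_diff)
    moreover have "0 \<le> \<bar>f x\<bar> * \<bar>g x\<bar>" by simp
    ultimately have "\<bar>f x\<bar> * \<bar>g x\<bar> \<le> (f x)\<^sup>2 + (g x)\<^sup>2" by linarith
    then show ?thesis by (simp add: abs_mult)
  qed
  then show "AE x in M. norm (f x * g x) \<le> norm ((f x)\<^sup>2 + (g x)\<^sup>2)"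
    by auto
qed

lemma square_integrable_cmult:
  "square_integrable M f \<Longrightarrow> square_integrable M (\<lambda>x. c * f x)"
  by (auto simp: square_integrable_def power_mult_distrib)

lemma square_integrable_add:
  assumes "square_integrable M f" "square_integrable M g"
  shows "square_integrable M (\<lambda>x. f x + g x)"
  using assms square_integrable_mult[OF assms]
  by (auto simp: square_integrable_def power2_sum mult.assoc)

lemma square_integrable_diff:
  assumes "square_integrable M f" "square_integrable M g"
  shows "square_integrable M (\<lambda>x. f x - g x)"
  using square_integrable_add[OF assms(1) square_integrable_cmult[OF assms(2), of "-1"]] by simp

lemma square_integrable_sum:
  assumes "\<And>i. i \<in> I \<Longrightarrow> square_integrable M (f i)"
  shows "square_integrable M (\<lambda>x. \<Sum>i\<in>I. f i x)"
  using assms by (induction I rule: infinite_finite_induct) (auto intro: square_integrable_add)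

lemma square_integrable_abs:
  "square_integrable M f \<Longrightarrow> square_integrable M (\<lambda>x. \<bar>f x\<bar>)"
  by (auto simp: square_integrable_def)

lemma square_integrable_AE_cong:
  assumes "square_integrable M f" "g \<in> borel_measurable M" "AE x in M. f x = g x"
  shows "square_integrable M g"
proof -
  have "integrable M (\<lambda>x. (g x)\<^sup>2)"
    using square_integrable_square[OF assms(1)]
    by (rule integrable_cong_AE_imp) (use assms in \<open>auto elim: eventually_mono\<close>)
  then show ?thesis using assms by (simp add: square_integrable_def)
qed

lemma norm2_AE_cong:
  assumes "f \<in> borel_measurable M" "g \<in> borel_measurable M" "AE x in M. f x = g x"
  shows "norm2 M f = norm2 M g"
  unfolding norm2_def by (intro arg_cong[where f=sqrt] integral_cong_AE) (use assms in auto)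

lemma norm2_cmult: "norm2 M (\<lambda>x. c * f x) = \<bar>c\<bar> * norm2 M f"
  by (simp add: norm2_def power_mult_distrib real_sqrt_mult)

lemma norm2_abs: "norm2 M (\<lambda>x. \<bar>f x\<bar>) = norm2 M f"
  by (simp add: norm2_def)

text \<open>The integral of the square of s f + t g is a nonnegative quadratic form in (s, t), so
  its discriminant has a sign.\<close>

lemma Cauchy_Schwarz_norm2:
  assumes f: "square_integrable M f" and g: "square_integrable M g"
  shows "\<bar>LINT x|M. f x * g x\<bar> \<le> norm2 M f * norm2 M g"
proof -
  define A where "A = (LINT x|M. (f x)\<^sup>2)"
  define B where "B = (LINT x|M. f x * g x)"
  define D where "D = (LINT x|M. (g x)\<^sup>2)"
  have quad: "0 \<le> A * s\<^sup>2 + 2 * B * s * t + D * t\<^sup>2" for s t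
  proof -
    have "0 \<le> (LINT x|M. (s * f x + t * g x)\<^sup>2)" by simp
    also have "(LINT x|M. (s * f x + t * g x)\<^sup>2)
      = (LINT x|M. s\<^sup>2 * (f x)\<^sup>2 + (2 * s * t) * (f x * g x) + t\<^sup>2 * (g x)\<^sup>2)"
      by (intro Bochner_Integration.integral_cong) (auto simp: power2_eq_square algebra_simps)
    also have "\<dots> = s\<^sup>2 * A + (2 * s * t) * B + t\<^sup>2 * D"
      unfolding A_def B_def D_def
      using square_integrable_square[OF f] square_integrable_square[OF g]
        square_integrable_mult[OF f g] by simp
    finally show ?thesis by (simp add: algebra_simps)
  qed
  have A0: "A \<ge> 0" and D0: "D \<ge> 0" by (auto simp: A_def D_def)
  have "B\<^sup>2 \<le> A * D"
  proof (cases "A = 0")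
    case True
    have "2 * B * s + D \<ge> 0" for s using quad[of s 1] True by simp
    \<comment> \<open>If B were nonzero, this s would make the left side equal to -1.\<close>
    from this[of "- (D + 1) / (2 * B)"] have "B = 0"
      by (cases "B = 0") (auto simp: field_simps)
    then show ?thesis using True by simp
  next
    case False
    with A0 have "A > 0" by simp
    \<comment> \<open>For t = - A the form is minimal at s = B, with value
      \<open>A * (A * D - B\<^sup>2)\<close>.\<close>
    from quad[of B "-A"] have "0 \<le> A * (A * D - B\<^sup>2)"
      by (simp add: power2_eq_square algebra_simps)
    with \<open>A > 0\<close> show ?thesis by (simp add: zero_le_mult_iff)
  qed
  then have "sqrt (B\<^sup>2) \<le> sqrt (A * D)" by (rule real_sqrt_le_mono)
  then show ?thesis by (simp add: A_def B_def D_def norm2_def real_sqrt_mult)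
qed

lemma norm2_triangle:
  assumes f: "square_integrable M f" and g: "square_integrable M g"
  shows "norm2 M (\<lambda>x. f x + g x) \<le> norm2 M f + norm2 M g"
proof (rule power2_le_imp_le)
  have "(norm2 M (\<lambda>x. f x + g x))\<^sup>2 = (LINT x|M. (f x)\<^sup>2 + (g x)\<^sup>2 + 2 * (f x * g x))"
    unfolding norm2_power2 by (simp add: power2_sum mult.assoc)
  also have "\<dots> = (norm2 M f)\<^sup>2 + (norm2 M g)\<^sup>2 + 2 * (LINT x|M. f x * g x)"
    using square_integrable_square[OF f] square_integrable_square[OF g]
      square_integrable_mult[OF f g] by (simp add: norm2_power2)
  also have "\<dots> \<le> (norm2 M f + norm2 M g)\<^sup>2"
    using Cauchy_Schwarz_norm2[OF f g] by (simp add: power2_sum abs_le_iff)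
  finally show "(norm2 M (\<lambda>x. f x + g x))\<^sup>2 \<le> (norm2 M f + norm2 M g)\<^sup>2" .
qed simp

lemma norm2_diff_triangle:
  assumes "square_integrable M f" "square_integrable M g" "square_integrable M h"
  shows "norm2 M (\<lambda>x. f x - h x) \<le> norm2 M (\<lambda>x. f x - g x) + norm2 M (\<lambda>x. g x - h x)"
  using norm2_triangle[of M "\<lambda>x. f x - g x" "\<lambda>x. g x - h x"] assms
  by (auto intro: square_integrable_diff)

lemma norm2_sum_le:
  assumes "\<And>i. i \<in> I \<Longrightarrow> square_integrable M (f i)"
  shows "norm2 M (\<lambda>x. \<Sum>i\<in>I. f i x) \<le> (\<Sum>i\<in>I. norm2 M (f i))"
  using assms
proof (induction I rule: infinite_finite_induct)
  case (insert i I)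
  then have "norm2 M (\<lambda>x. f i x + (\<Sum>i\<in>I. f i x)) \<le> norm2 M (f i) + norm2 M (\<lambda>x. \<Sum>i\<in>I. f i x)"
    by (intro norm2_triangle square_integrable_sum) auto
  with insert show ?case by force
qed auto

text \<open>Fatou's lemma for the squares. The bound is asked only for late indices, because in
  \<open>Riesz_Fischer\<close> it comes from the Cauchy property.\<close>

lemma norm2_Fatou:
  assumes s: "\<And>n. square_integrable M (f n)" and m: "g \<in> borel_measurable M"
    and lim: "AE x in M. (\<lambda>n. f n x) \<longlonglongrightarrow> g x"
    and B: "\<forall>\<^sub>F n in sequentially. norm2 M (f n) \<le> B"
  shows "square_integrable M g" "norm2 M g \<le> B"
proof -
  have [measurable]: "\<And>n. f n \<in> borel_measurable M" using s by (auto simp: square_integrable_def)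
  note m [measurable]
  obtain n0 where "norm2 M (f n0) \<le> B" using B by (auto simp: eventually_sequentially)
  then have B0: "B \<ge> 0" using norm2_nonneg order_trans by blast
  have "(\<integral>\<^sup>+x. ennreal ((g x)\<^sup>2) \<partial>M) = (\<integral>\<^sup>+x. liminf (\<lambda>n. ennreal ((f n x)\<^sup>2)) \<partial>M)"
  proof (rule nn_integral_cong_AE)
    show "AE x in M. ennreal ((g x)\<^sup>2) = liminf (\<lambda>n. ennreal ((f n x)\<^sup>2))"
      using lim
    proof eventually_elim
      fix x assume "(\<lambda>n. f n x) \<longlonglongrightarrow> g x"
      then have "(\<lambda>n. ennreal ((f n x)\<^sup>2)) \<longlonglongrightarrow> ennreal ((g x)\<^sup>2)"
        by (intro tendsto_ennrealI tendsto_intros)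
      then show "ennreal ((g x)\<^sup>2) = liminf (\<lambda>n. ennreal ((f n x)\<^sup>2))"
        by (rule lim_imp_Liminf[symmetric, rotated]) simp
    qed
  qed
  also have "\<dots> \<le> liminf (\<lambda>n. \<integral>\<^sup>+x. ennreal ((f n x)\<^sup>2) \<partial>M)"
    by (rule nn_integral_liminf) measurable
  also have "\<dots> \<le> ennreal (B\<^sup>2)"
  proof (rule Liminf_le)
    show "sequentially \<noteq> bot" by simp
    show "\<forall>\<^sub>F n in sequentially. (\<integral>\<^sup>+x. ennreal ((f n x)\<^sup>2) \<partial>M) \<le> ennreal (B\<^sup>2)"
      using B
    proof eventually_elim
      case (elim n)
      have "(\<integral>\<^sup>+x. ennreal ((f n x)\<^sup>2) \<partial>M) = ennreal ((norm2 M (f n))\<^sup>2)"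
        unfolding norm2_power2
        by (rule nn_integral_eq_integral) (use s in \<open>auto simp: square_integrable_def\<close>)
      also have "\<dots> \<le> ennreal (B\<^sup>2)"
        using elim by (intro ennreal_leI power_mono) auto
      finally show ?case .
    qed
  qed
  finally have le: "(\<integral>\<^sup>+x. ennreal ((g x)\<^sup>2) \<partial>M) \<le> ennreal (B\<^sup>2)" .
  have int: "integrable M (\<lambda>x. (g x)\<^sup>2)"
    by (rule integrableI_bounded) (use le in \<open>auto simp: le_less_trans[OF _ ennreal_less_top]\<close>)
  then show "square_integrable M g" using m by (simp add: square_integrable_def)
  have "ennreal (LINT x|M. (g x)\<^sup>2) \<le> ennreal (B\<^sup>2)"
    using le nn_integral_eq_integral[OF int] by simp
  then have "(LINT x|M. (g x)\<^sup>2) \<le> B\<^sup>2" by simp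
  then have "(norm2 M g)\<^sup>2 \<le> B\<^sup>2" by (simp add: norm2_power2)
  then show "norm2 M g \<le> B" using B0 by (rule power2_le_imp_le)
qed

text \<open>A subsequence whose consecutive distances are at most \<open>(1/2)^i\<close> has square
  integrable total variation, so it converges almost everywhere; Fatou's lemma then identifies its
  limit as the limit in norm.\<close>

theorem Riesz_Fischer:
  assumes s: "\<And>n. square_integrable M (f n)"
    and cau: "\<And>e. e > 0 \<Longrightarrow> \<exists>N. \<forall>m\<ge>N. \<forall>n\<ge>N. norm2 M (\<lambda>x. f m x - f n x) < e"
  obtains g where "square_integrable M g" "(\<lambda>n. norm2 M (\<lambda>x. f n x - g x)) \<longlonglongrightarrow> 0"
proof -
  have [measurable]: "\<And>n. f n \<in> borel_measurable M" using s by (auto simp: square_integrable_def)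
  have "\<exists>N. \<forall>m\<ge>N. \<forall>n\<ge>N. norm2 M (\<lambda>x. f m x - f n x) < (1/2)^i" for i :: nat
    by (rule cau) simp
  then obtain N where N: "\<And>i m n. m \<ge> N i \<Longrightarrow> n \<ge> N i \<Longrightarrow> norm2 M (\<lambda>x. f m x - f n x) < (1/2)^i"
    by metis
  \<comment> \<open>The sum makes r nondecreasing with r i at least N i; the added i makes it tend
    to infinity, which is needed when Fatou's lemma is applied along r.\<close>
  define r where "r i = i + (\<Sum>j\<le>i. N j)" for i
  have rN: "r i \<ge> N i" for i
  proof -
    have "N i \<le> (\<Sum>j\<le>i. N j)" by (rule member_le_sum) auto
    then show ?thesis by (simp add: r_def)
  qed
  have rS: "r (Suc i) \<ge> r i" for i by (simp add: r_def)
  have r_ge: "r i \<ge> i" for i by (simp add: r_def)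
  define d where "d i x = f (r (Suc i)) x - f (r i) x" for i x
  have sd: "square_integrable M (d i)" for i
    unfolding d_def by (intro square_integrable_diff s)
  have nd: "norm2 M (d i) \<le> (1/2)^i" for i
    unfolding d_def using N[of i "r (Suc i)" "r i"] rN[of i] rS[of i] by fastforce
  define G where "G n x = (\<Sum>i<n. \<bar>d i x\<bar>)" for n x
  have sG: "square_integrable M (G n)" for n
    unfolding G_def by (intro square_integrable_sum square_integrable_abs sd)
  have [measurable]: "\<And>n. G n \<in> borel_measurable M" using sG by (auto simp: square_integrable_def)
  have G2: "norm2 M (G n) \<le> 2" for n
  proof -
    have "norm2 M (G n) \<le> (\<Sum>i<n. norm2 M (\<lambda>x. \<bar>d i x\<bar>))"
      unfolding G_def by (intro norm2_sum_le square_integrable_abs sd)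
    also have "\<dots> \<le> (\<Sum>i<n. (1/2)^i)" by (intro sum_mono) (simp add: norm2_abs nd)
    also have "\<dots> \<le> 2" by (simp add: geometric_sum)
    finally show ?thesis .
  qed
  have Gmono: "G n x \<le> G (Suc n) x" for n x by (simp add: G_def)
  have G0: "G n x \<ge> 0" for n x by (auto simp: G_def intro: sum_nonneg)
  \<comment> \<open>By monotone convergence the supremum of the partial sums of |d i| is finite
    almost everywhere, so the telescoping series converges absolutely there.\<close>
  have "(\<integral>\<^sup>+x. (SUP n. ennreal ((G n x)\<^sup>2)) \<partial>M) = (SUP n. \<integral>\<^sup>+x. ennreal ((G n x)\<^sup>2) \<partial>M)"
    by (rule nn_integral_monotone_convergence_SUP)
       (auto simp: incseq_Suc_iff le_fun_def intro!: ennreal_leI power_mono Gmono G0)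
  also have "\<dots> \<le> ennreal 4"
  proof (rule SUP_least)
    fix n
    have "(\<integral>\<^sup>+x. ennreal ((G n x)\<^sup>2) \<partial>M) = ennreal ((norm2 M (G n))\<^sup>2)"
      unfolding norm2_power2
      by (rule nn_integral_eq_integral) (use sG in \<open>auto simp: square_integrable_def\<close>)
    also have "\<dots> \<le> ennreal (2\<^sup>2)"
      using G2[of n] by (intro ennreal_leI power_mono) auto
    finally show "(\<integral>\<^sup>+x. ennreal ((G n x)\<^sup>2) \<partial>M) \<le> ennreal 4" by simp
  qed
  finally have le4: "(\<integral>\<^sup>+x. (SUP n. ennreal ((G n x)\<^sup>2)) \<partial>M) \<le> ennreal 4" .
  have "(\<integral>\<^sup>+x. (SUP n. ennreal ((G n x)\<^sup>2)) \<partial>M) < \<infinity>"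
    using le_less_trans[OF le4 ennreal_less_top] by simp
  then have "AE x in M. (SUP n. ennreal ((G n x)\<^sup>2)) \<noteq> \<infinity>"
    by (intro nn_integral_PInf_AE) auto
  then have conv: "AE x in M. convergent (\<lambda>n. f (r n) x)"
  proof eventually_elim
    fix x assume fin: "(SUP n. ennreal ((G n x)\<^sup>2)) \<noteq> \<infinity>"
    then obtain K where K: "(SUP n. ennreal ((G n x)\<^sup>2)) = ennreal K" "K \<ge> 0"
      by (metis ennreal_cases infinity_ennreal_def)
    have "(G n x)\<^sup>2 \<le> K" for n
    proof -
      have "ennreal ((G n x)\<^sup>2) \<le> ennreal K" unfolding K(1)[symmetric] by (rule SUP_upper) simp
      then show ?thesis using K(2) by simp
    qed
    then have Gs: "G n x \<le> sqrt K" for n by (simp add: real_le_rsqrt)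
    have "summable (\<lambda>i. norm (d i x))"
    proof (rule bounded_imp_summable[of _ "sqrt K"])
      show "(\<Sum>i\<le>n. norm (d i x)) \<le> sqrt K" for n
        using Gs[of "Suc n"] by (simp only: G_def real_norm_def lessThan_Suc_atMost)
    qed simp
    then have "summable (\<lambda>i. d i x)" by (rule summable_norm_cancel)
    then have "convergent (\<lambda>n. \<Sum>i<n. d i x)" by (simp add: summable_iff_convergent)
    moreover have "(\<Sum>i<n. d i x) = f (r n) x - f (r 0) x" for n
      unfolding d_def by (rule sum_lessThan_telescope)
    ultimately have "convergent (\<lambda>n. f (r n) x - f (r 0) x)" by simp
    then have "convergent (\<lambda>n. (f (r n) x - f (r 0) x) + f (r 0) x)"
      by (intro convergent_add convergent_const)
    then show "convergent (\<lambda>n. f (r n) x)" by simp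
  qed
  define g where "g x = lim (\<lambda>n. f (r n) x)" for x
  have [measurable]: "g \<in> borel_measurable M"
    unfolding g_def by measurable
  have lim: "AE x in M. (\<lambda>n. f (r n) x) \<longlonglongrightarrow> g x"
    using conv by eventually_elim (simp add: g_def convergent_LIMSEQ_iff)
  \<comment> \<open>Fatou's lemma with n fixed, while the other index runs along r.\<close>
  have main: "square_integrable M (\<lambda>x. f n x - g x) \<and> norm2 M (\<lambda>x. f n x - g x) \<le> e"
    if n: "\<And>m k. m \<ge> N0 \<Longrightarrow> k \<ge> N0 \<Longrightarrow> norm2 M (\<lambda>x. f m x - f k x) < e" "n \<ge> N0" for n N0 e
  proof -
    have 1: "\<And>k. square_integrable M (\<lambda>x. f n x - f (r k) x)"
      by (intro square_integrable_diff s)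
    have 2: "AE x in M. (\<lambda>k. f n x - f (r k) x) \<longlonglongrightarrow> f n x - g x"
      using lim by eventually_elim (intro tendsto_intros)
    have 3: "\<forall>\<^sub>F k in sequentially. norm2 M (\<lambda>x. f n x - f (r k) x) \<le> e"
      unfolding eventually_sequentially
      by (rule exI[of _ N0]) (metis n(1) n(2) r_ge less_imp_le order_trans)
    show ?thesis
      using norm2_Fatou[OF 1 _ 2 3] by auto
  qed
  have sg: "square_integrable M g"
  proof -
    obtain N0 where "\<And>m k. m \<ge> N0 \<Longrightarrow> k \<ge> N0 \<Longrightarrow> norm2 M (\<lambda>x. f m x - f k x) < 1"
      using cau[of 1] by auto
    from main[OF this order_refl] have "square_integrable M (\<lambda>x. f N0 x - g x)" by blast
    from square_integrable_diff[OF s[of N0] this] show ?thesis by simp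
  qed
  have "(\<lambda>n. norm2 M (\<lambda>x. f n x - g x)) \<longlonglongrightarrow> 0"
  proof (rule LIMSEQ_I)
    fix e :: real assume "e > 0"
    then obtain N0 where "\<And>m k. m \<ge> N0 \<Longrightarrow> k \<ge> N0 \<Longrightarrow> norm2 M (\<lambda>x. f m x - f k x) < e/2"
      using cau[of "e/2"] by auto
    from main[OF this] have "norm2 M (\<lambda>x. f n x - g x) \<le> e/2" if "n \<ge> N0" for n
      using that by blast
    with \<open>e > 0\<close> show "\<exists>N0. \<forall>n\<ge>N0. norm (norm2 M (\<lambda>x. f n x - g x) - 0) < e"
      by (intro exI[of _ N0]) force
  qed
  with sg show thesis by (rule that)
qed

section \<open>Smooth cutoff functions\<close>

definition smooth :: "(real \<Rightarrow> real) \<Rightarrow> bool" where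
  "smooth f \<longleftrightarrow> (\<forall>n x. ((deriv ^^ n) f) differentiable (at x))"

lemma smooth_deriv: "smooth f \<Longrightarrow> smooth (deriv f)"
  unfolding smooth_def by (metis funpow_Suc_right o_apply)

lemma smooth_differentiable: "smooth f \<Longrightarrow> f differentiable (at x)"
  unfolding smooth_def by (metis funpow_0)

lemma smooth_DERIV: "smooth f \<Longrightarrow> (f has_real_derivative deriv f x) (at x)"
  using smooth_differentiable DERIV_deriv_iff_real_differentiable by blast

lemma smooth_continuous_on: "smooth f \<Longrightarrow> continuous_on S f"
  by (meson smooth_DERIV DERIV_isCont continuous_at_imp_continuous_on)

text \<open>Coinduction for smoothness: every iterated derivative stays in F, so one differentiation
  has to be checked for the whole family at once.\<close>

lemma smooth_closed_family:
  assumes "f \<in> F" and "\<And>f. f \<in> F \<Longrightarrow> \<exists>f'\<in>F. \<forall>x. (f has_real_derivative f' x) (at x)"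
  shows "smooth f"
proof -
  have *: "(deriv ^^ n) f \<in> F" for n
  proof (induction n)
    case (Suc n)
    then obtain f' where f': "f' \<in> F" "\<And>x. ((deriv ^^ n) f has_real_derivative f' x) (at x)"
      using assms(2) by blast
    then have "deriv ((deriv ^^ n) f) = f'" by (intro ext DERIV_imp_deriv)
    with f' show ?case by simp
  qed (use assms in simp)
  show ?thesis unfolding smooth_def
    using assms(2)[OF *] real_differentiable_def by blast
qed

text \<open>A single product is not closed under differentiation, but finite sums of products are,
  by the product rule. This is the family to which \<open>smooth_closed_family\<close> is
  applied.\<close>

inductive_set product_span :: "(real \<Rightarrow> real) set" where
  product: "smooth f \<Longrightarrow> smooth g \<Longrightarrow> (\<lambda>x. f x * g x) \<in> product_span"
| sum: "f \<in> product_span \<Longrightarrow> g \<in> product_span \<Longrightarrow> (\<lambda>x. f x + g x) \<in> product_span"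

lemma product_span_smooth:
  assumes "f \<in> product_span" shows "smooth f"
proof (rule smooth_closed_family[OF assms])
  fix f assume "f \<in> product_span"
  then show "\<exists>f'\<in>product_span. \<forall>x. (f has_real_derivative f' x) (at x)"
  proof induction
    case (product f g)
    have "(\<lambda>x. deriv f x * g x + f x * deriv g x) \<in> product_span"
      using product by (intro product_span.intros smooth_deriv)
    moreover have "((\<lambda>x. f x * g x) has_real_derivative deriv f x * g x + f x * deriv g x) (at x)" for x
      using product by (auto intro!: derivative_eq_intros smooth_DERIV)
    ultimately show ?case
      by (intro bexI[of _ "\<lambda>x. deriv f x * g x + f x * deriv g x"] allI)
  next
    case (sum f g)
    then obtain f' g' where "f' \<in> product_span" "\<And>x. (f has_real_derivative f' x) (at x)"
      "g' \<in> product_span" "\<And>x. (g has_real_derivative g' x) (at x)" by blast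
    then show ?case
      by (intro bexI[of _ "\<lambda>x. f' x + g' x"]) (auto intro!: DERIV_add product_span.sum)
  qed
qed

lemma smooth_const: "smooth (\<lambda>x. c)"
  by (rule smooth_closed_family[where F = "{f. \<exists>c. f = (\<lambda>x. c)}"])
     (auto intro!: exI[of _ "\<lambda>x. 0"])

lemma smooth_mult: "smooth f \<Longrightarrow> smooth g \<Longrightarrow> smooth (\<lambda>x. f x * g x)"
  by (rule product_span_smooth) (rule product_span.product)

lemma smooth_add: assumes "smooth f" "smooth g" shows "smooth (\<lambda>x. f x + g x)"
proof -
  have "(\<lambda>x. f x * 1 + g x * 1) \<in> product_span"
    by (intro product_span.intros assms smooth_const)
  then show ?thesis using product_span_smooth by simp
qed

lemma smooth_affine:
  assumes "smooth f" shows "smooth (\<lambda>x. f (p * x + q))"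
proof (rule smooth_closed_family[where F = "{h. \<exists>c g. smooth g \<and> h = (\<lambda>x. c * g (p * x + q))}"])
  show "(\<lambda>x. f (p * x + q)) \<in> {h. \<exists>c g. smooth g \<and> h = (\<lambda>x. c * g (p * x + q))}"
    using assms by (auto intro!: exI[of _ 1])
next
  fix h assume "h \<in> {h. \<exists>c g. smooth g \<and> h = (\<lambda>x. c * g (p * x + q))}"
  then obtain c g where g: "smooth g" "h = (\<lambda>x. c * g (p * x + q))" by auto
  have "(h has_real_derivative (c * p) * deriv g (p * x + q)) (at x)" for x
    unfolding g(2)
    by (auto intro!: derivative_eq_intros DERIV_chain2[of g] smooth_DERIV g)
  then show "\<exists>f'\<in>{h. \<exists>c g. smooth g \<and> h = (\<lambda>x. c * g (p * x + q))}.
      \<forall>x. (h has_real_derivative f' x) (at x)"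
    using smooth_deriv[OF g(1)]
    by (intro bexI[of _ "\<lambda>x. (c * p) * deriv g (p * x + q)"]) blast+
qed

lemma smooth_antiderivative:
  assumes "\<And>x. (F has_real_derivative f x) (at x)" "smooth f"
  shows "smooth F"
proof -
  have d: "deriv F = f" by (intro ext DERIV_imp_deriv assms)
  show ?thesis unfolding smooth_def
  proof (intro allI)
    fix n x show "((deriv ^^ n) F) differentiable (at x)"
    proof (cases n)
      case 0 then show ?thesis using assms(1) real_differentiable_def by auto
    next
      case (Suc m)
      then have "(deriv ^^ n) F = (deriv ^^ m) f" by (simp only: funpow_Suc_right o_apply d)
      then show ?thesis using assms(2) by (simp add: smooth_def)
    qed
  qed
qed

text \<open>All derivatives of exp (- 1 / x) to the right of 0 are a polynomial in 1 / x times exp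
  (- 1 / x); indexing by the polynomial gives a family closed under differentiation.\<close>

definition flat :: "real poly \<Rightarrow> real \<Rightarrow> real" where
  "flat p x = (if x > 0 then poly p (1 / x) * exp (- 1 / x) else 0)"

lemma poly_times_exp_tendsto_0: "((\<lambda>y. poly p y * exp (- y)) \<longlongrightarrow> (0::real)) at_top"
proof -
  have *: "((\<lambda>y. y ^ k * exp (- y)) \<longlongrightarrow> (0::real)) at_top" for k
    using tendsto_power_div_exp_0[of k] by (simp add: exp_minus divide_inverse)
  have "((\<lambda>y. \<Sum>i\<le>degree p. coeff p i * (y ^ i * exp (- y))) \<longlongrightarrow> (\<Sum>i\<le>degree p. coeff p i * 0)) at_top"
    by (intro tendsto_intros *)
  then show ?thesis by (simp add: poly_altdef sum_distrib_right mult.assoc)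
qed

lemma flat_DERIV:
  "(flat p has_real_derivative flat ([:0, 0, 1:] * (p - pderiv p)) x) (at x)"
proof -
  consider "x > 0" | "x = 0" | "x < 0" by linarith
  then show ?thesis
  proof cases
    case 1
    have "((\<lambda>x. poly p (1 / x) * exp (- 1 / x)) has_real_derivative
      flat ([:0, 0, 1:] * (p - pderiv p)) x) (at x)"
      using 1 by (auto intro!: derivative_eq_intros DERIV_chain2[of "poly p"] poly_DERIV
          simp: flat_def field_simps power2_eq_square)
    then show ?thesis
      by (rule has_field_derivative_transform_within_open[where S="{0<..}"])
         (use 1 in \<open>auto simp: flat_def\<close>)
  next
    case 2
    \<comment> \<open>The difference quotient at 0 from the right is y p(y) exp (- y) with y = 1 /
      h; the factor \<open>[:0,1:]\<close> is the division by h.\<close>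
    have "((\<lambda>h. poly ([:0,1:] * p) (inverse h) * exp (- inverse h)) \<longlongrightarrow> 0) (at_right 0)"
      by (rule filterlim_compose[OF poly_times_exp_tendsto_0 filterlim_inverse_at_top_right])
    then have "((\<lambda>h. flat p h / h) \<longlongrightarrow> 0) (at_right 0)"
      by (rule Lim_transform_eventually)
         (auto simp: eventually_at_filter flat_def field_simps)
    moreover have "((\<lambda>h. flat p h / h) \<longlongrightarrow> 0) (at_left 0)"
      by (rule tendsto_eventually) (auto simp: eventually_at_filter flat_def)
    ultimately have "((\<lambda>h. flat p h / h) \<longlongrightarrow> 0) (at 0)"
      by (simp add: filterlim_split_at)
    then show ?thesis using 2 by (simp add: DERIV_def flat_def)
  next
    case 3
    have "((\<lambda>x. 0) has_real_derivative 0) (at x)" by simp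
    then have "(flat p has_real_derivative 0) (at x)"
      by (rule has_field_derivative_transform_within_open[where S="{..<0}"])
         (use 3 in \<open>auto simp: flat_def\<close>)
    then show ?thesis using 3 by (simp add: flat_def)
  qed
qed

lemma smooth_flat: "smooth (flat p)"
  by (rule smooth_closed_family[where F = "range flat"]) (use flat_DERIV in blast)+

definition bump :: "real \<Rightarrow> real" where
  "bump x = flat 1 x * flat 1 (1 - x)"

lemma smooth_bump: "smooth bump"
proof -
  have "smooth (\<lambda>x. flat 1 x * flat 1 ((-1) * x + 1))"
    by (intro smooth_mult smooth_affine smooth_flat)
  then show ?thesis by (simp add: bump_def[abs_def])
qed

lemma bump_nonneg: "bump x \<ge> 0"
  and bump_pos: "0 < x \<Longrightarrow> x < 1 \<Longrightarrow> bump x > 0"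
  and bump_outside: "x \<le> 0 \<or> x \<ge> 1 \<Longrightarrow> bump x = 0"
  by (auto simp: bump_def flat_def)

text \<open>A primitive of \<open>bump\<close>, shifted and scaled to run from 0 to 1; it is
  monotone because \<open>bump\<close> is nonnegative and constant where \<open>bump\<close>
  vanishes.\<close>

lemma ex_smooth_step:
  obtains H where "smooth H" "\<And>x. x \<le> 0 \<Longrightarrow> H x = 0" "\<And>x. x \<ge> 1 \<Longrightarrow> H x = 1"
    "mono H" "\<And>x. deriv H x \<ge> 0"
proof -
  have cont: "continuous_on S bump" for S using smooth_bump by (rule smooth_continuous_on)
  obtain G where G: "\<And>x. (G has_real_derivative bump x) (at x)"
  proof -
    have "\<And>x. isCont bump x" using cont[of UNIV] by (simp add: continuous_on_eq_continuous_at)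
    then show ?thesis
      using that einterval_antiderivative[of "-\<infinity>" "\<infinity>" bump]
      by (auto simp: has_real_derivative_iff_has_vector_derivative)
  qed
  have mono: "G x \<le> G y" if "x \<le> y" for x y
    by (rule DERIV_nonneg_imp_nondecreasing[OF that]) (use G bump_nonneg in blast)
  have const: "G x = G y" if "x \<le> y" "y \<le> 0 \<or> x \<ge> 1" for x y
  proof (cases "x = y")
    case False
    then have "x < y" using that by simp
    then obtain z where "x < z" "z < y" "G y - G x = (y - x) * bump z"
      using MVT2[of x y G bump] G by blast
    then show ?thesis using that bump_outside[of z] by auto
  qed simp
  have less: "G 0 < G 1"
  proof -
    obtain z where "0 < z" "z < 1" "G 1 - G 0 = (1 - 0) * bump z"
      using MVT2[of 0 1 G bump] G by auto
    then show ?thesis using bump_pos[of z] by simp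
  qed
  define c where "c = 1 / (G 1 - G 0)"
  have c: "c > 0" using less by (simp add: c_def)
  define H where "H x = c * (G x - G 0)" for x
  have dH: "(H has_real_derivative c * bump x) (at x)" for x
    unfolding H_def by (auto intro!: derivative_eq_intros G)
  show thesis
  proof
    show "smooth H"
      by (rule smooth_antiderivative[OF dH]) (intro smooth_mult smooth_const smooth_bump)
    show "H x = 0" if "x \<le> 0" for x using const[of x 0] that by (simp add: H_def)
    show "H x = 1" if "x \<ge> 1" for x using const[of 1 x] that less by (simp add: H_def c_def)
    show "mono H" using mono c by (auto simp: mono_def H_def)
    show "deriv H x \<ge> 0" for x using DERIV_imp_deriv[OF dH] c bump_nonneg by simp
  qed
qed

lemma test_function_iff:
  "test_function \<Omega> \<phi> \<longleftrightarrow> smooth \<phi> \<and> compact (closure {x. \<phi> x \<noteq> 0}) \<and> closure {x. \<phi> x \<noteq> 0} \<subseteq> \<Omega>"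
  by (simp add: test_function_def smooth_def)

text \<open>Smooth approximations of the indicator of \<open>{c<..d}\<close> whose derivatives are bumps of mass one
  next to \<open>c\<close> and \<open>d\<close>.\<close>

lemma ex_smooth_indicator:
  fixes c d :: real assumes "c \<le> d"
  obtains \<eta> k1 k2 where
    "\<And>e x. e > 0 \<Longrightarrow> smooth (\<eta> e)" "\<And>e x. e > 0 \<Longrightarrow> 0 \<le> \<eta> e x \<and> \<eta> e x \<le> 1"
    "\<And>e x. e > 0 \<Longrightarrow> \<eta> e x \<noteq> 0 \<Longrightarrow> c \<le> x \<and> x \<le> d + e"
    "\<And>x. \<forall>\<^sub>F e in at_right 0. \<eta> e x = indicator {c<..d} x"
    "\<And>e x. e > 0 \<Longrightarrow> deriv (\<eta> e) x = k1 e x - k2 e x"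
    "\<And>e. e > 0 \<Longrightarrow> continuous_on UNIV (k1 e) \<and> continuous_on UNIV (k2 e)"
    "\<And>e x. e > 0 \<Longrightarrow> k1 e x \<ge> 0 \<and> k2 e x \<ge> 0"
    "\<And>e x. e > 0 \<Longrightarrow> x \<notin> {c..c + e} \<Longrightarrow> k1 e x = 0"
    "\<And>e x. e > 0 \<Longrightarrow> x \<notin> {d..d + e} \<Longrightarrow> k2 e x = 0"
    "\<And>e. e > 0 \<Longrightarrow> (k1 e has_integral 1) {c..c + e}"
    "\<And>e. e > 0 \<Longrightarrow> (k2 e has_integral 1) {d..d + e}"
proof -
  obtain H where H: "smooth H" "\<And>x. x \<le> 0 \<Longrightarrow> H x = 0" "\<And>x. x \<ge> 1 \<Longrightarrow> H x = 1"
    "mono H" "\<And>x. deriv H x \<ge> 0" using ex_smooth_step by blast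
  \<comment> \<open>K y e is a ramp that climbs from 0 to 1 between y and y + e, and k y e is its
    derivative. The ramp at c minus the ramp at d is the smooth indicator.\<close>
  define k where "k y e x = (1/e) * deriv H ((1/e) * x + (- y/e))" for y e x :: real
  define K where "K y e x = H ((1/e) * x + (- y/e))" for y e x :: real
  define \<eta> where "\<eta> e x = K c e x + (-1) * K d e x" for e x
  have dK: "(K y e has_real_derivative k y e x) (at x)" for y e x
    
  proof -
    have "((\<lambda>x. (1/e) * x + (- y/e)) has_real_derivative (1/e) * 1 + 0) (at x)"
      by (intro DERIV_add DERIV_cmult DERIV_ident DERIV_const)
    from DERIV_chain2[OF smooth_DERIV[OF H(1)] this] show ?thesis
      by (simp add: K_def[abs_def] k_def mult.commute)
  qed
  have sK: "smooth (K y e)" for y e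
    unfolding K_def[abs_def] by (intro smooth_affine H)
  have K0: "K y e x = 0" if "x \<le> y" "e > 0" for x y e
    using that by (auto simp: K_def intro!: H(2) simp: field_simps)
  have K1: "K y e x = 1" if "x \<ge> y + e" "e > 0" for x y e
    using that by (auto simp: K_def intro!: H(3) simp: field_simps)
  have Kmono: "K y e x \<le> K y' e x" if "y' \<le> y" "e > 0" for y y' e x
    unfolding K_def using that by (intro monoD[OF H(4)]) (auto simp: field_simps)
  have K01: "0 \<le> K y e x" "K y e x \<le> 1" for y e x
  proof -
    let ?z = "(1/e) * x + (- y/e)"
    have "H (min ?z 0) \<le> H ?z" "H ?z \<le> H (max ?z 1)" by (intro monoD[OF H(4)]; simp)+
    then show "0 \<le> K y e x" "K y e x \<le> 1" using H(2)[of "min ?z 0"] H(3)[of "max ?z 1"]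
      by (auto simp: K_def)
  qed
  have k0: "k y e x = 0" if "x \<notin> {y..y+e}" "e > 0" for y e x
  proof -
    have "(K y e has_real_derivative 0) (at x)"
    proof (cases "x < y")
      case True
      have "(K y e has_real_derivative 0) (at x)"
        by (rule has_field_derivative_transform_within_open[where S="{..<y}" and f="\<lambda>_. 0"])
           (use True that in \<open>auto simp: K0\<close>)
      then show ?thesis .
    next
      case False
      have "(K y e has_real_derivative 0) (at x)"
        by (rule has_field_derivative_transform_within_open[where S="{y+e<..}" and f="\<lambda>_. 1"])
           (use False that in \<open>auto simp: K1\<close>)
      then show ?thesis .
    qed
    from DERIV_unique[OF dK this] show ?thesis .
  qed
  have kint: "(k y e has_integral 1) {y..y+e}" if "e > 0" for y e
  proof -
    have "(k y e has_integral K y e (y + e) - K y e y) {y..y+e}"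
      by (rule fundamental_theorem_of_calculus)
         (use that dK in \<open>auto simp: has_real_derivative_iff_has_vector_derivative[symmetric]
            intro: has_field_derivative_at_within\<close>)
    then show ?thesis using that by (simp add: K0 K1)
  qed
  show thesis
  proof (rule that[of \<eta> "k c" "k d"])
    fix e :: real assume e: "e > 0"
    show "smooth (\<eta> e)" unfolding \<eta>_def[abs_def]
      by (intro smooth_add smooth_mult smooth_const sK)
    fix x
    show "0 \<le> \<eta> e x \<and> \<eta> e x \<le> 1"
      using K01[of c e x] K01[of d e x] Kmono[OF assms e, of x] by (simp add: \<eta>_def)
    show "c \<le> x \<and> x \<le> d + e" if "\<eta> e x \<noteq> 0"
      using that K0[of x c e] K0[of x d e] K1[of c e x] K1[of d e x] e assms
      by (force simp: \<eta>_def)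
    show "deriv (\<eta> e) x = k c e x - k d e x"
      unfolding \<eta>_def by (intro DERIV_imp_deriv) (auto intro!: derivative_eq_intros dK)
    show "k c e x \<ge> 0 \<and> k d e x \<ge> 0" using H(5) e by (simp add: k_def)
    show "x \<notin> {c..c + e} \<Longrightarrow> k c e x = 0" "x \<notin> {d..d + e} \<Longrightarrow> k d e x = 0"
      using k0 e by blast+
    have "continuous_on UNIV (k y e)" for y
      unfolding k_def by (intro smooth_continuous_on smooth_mult smooth_const smooth_affine smooth_deriv H)
    then show "continuous_on UNIV (k c e) \<and> continuous_on UNIV (k d e)" by blast
    show "(k c e has_integral 1) {c..c + e}" "(k d e has_integral 1) {d..d + e}"
      using kint e by blast+
  next
    fix x
    have ev: "\<forall>\<^sub>F e in at_right 0. K y e x = (if x \<le> y then 0 else 1)" for y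
    proof (cases "x \<le> y")
      case True
      then show ?thesis using K0[OF True] by (auto simp: eventually_at_filter)
    next
      case False
      then have "x - y > 0" by simp
      then have "\<forall>\<^sub>F e in at_right 0. e < x - y"
        using eventually_at_right_real[of 0 "x-y"] by (auto elim: eventually_mono)
      then have "\<forall>\<^sub>F e in at_right 0. e < x - y \<and> e > 0"
        by (intro eventually_conj eventually_at_right_less)
      then show ?thesis by (rule eventually_mono) (use False in \<open>auto intro!: K1\<close>)
    qed
    show "\<forall>\<^sub>F e in at_right 0. \<eta> e x = indicator {c<..d} x"
      using ev[of c] ev[of d] by eventually_elim (use assms in \<open>auto simp: \<eta>_def indicator_def\<close>)
  qed
qed

section \<open>Weak derivatives on an open interval\<close>

text \<open>The integral of h from c to d. It is written over all of \<Omega>, so that one measure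
  serves every pair of ends, and with half-open intervals, so that adjacent ones are
  disjoint.\<close>

abbreviation increment :: "real set \<Rightarrow> (real \<Rightarrow> real) \<Rightarrow> real \<Rightarrow> real \<Rightarrow> real" where
  "increment \<Omega> h c d \<equiv> LINT x|lebesgue_on \<Omega>. indicator {c<..d} x * h x"

definition loc_integrable :: "real set \<Rightarrow> (real \<Rightarrow> real) \<Rightarrow> bool" where
  "loc_integrable \<Omega> h \<longleftrightarrow> (\<forall>K. compact K \<and> K \<subseteq> \<Omega> \<longrightarrow> integrable (lebesgue_on K) h)"

lemma weak_derivative_iff:
  "weak_derivative \<Omega> f f' \<longleftrightarrow> loc_integrable \<Omega> f \<and> loc_integrable \<Omega> f' \<and>
     (\<forall>\<phi>. test_function \<Omega> \<phi> \<longrightarrow>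
        (LINT x|lebesgue_on \<Omega>. f x * deriv \<phi> x) = - (LINT x|lebesgue_on \<Omega>. f' x * \<phi> x))"
  by (auto simp: weak_derivative_def loc_integrable_def)

section \<open>Restricted Lebesgue measure and changes on null sets\<close>

lemma integrable_indicator_mult:
  fixes f :: "'a \<Rightarrow> real"
  assumes "integrable M f" "A \<in> sets M"
  shows "integrable M (\<lambda>x. indicator A x * f x)"
  using integrable_mult_indicator[OF assms(2,1)] by simp

lemma lebesgue_on_restrict_support:
  fixes g :: "real \<Rightarrow> real"
  assumes "K \<subseteq> \<Omega>" "K \<in> sets lebesgue" "\<Omega> \<in> sets lebesgue" "\<And>x. x \<in> \<Omega> - K \<Longrightarrow> g x = 0"
  shows "integrable (lebesgue_on \<Omega>) g \<longleftrightarrow> integrable (lebesgue_on K) g"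
    and "(LINT x|lebesgue_on \<Omega>. g x) = (LINT x|lebesgue_on K. g x)"
proof -
  have "(\<lambda>x. indicator \<Omega> x *\<^sub>R g x) = (\<lambda>x. indicator K x *\<^sub>R g x)"
    using assms by (auto simp: fun_eq_iff indicator_def)
  then show "integrable (lebesgue_on \<Omega>) g \<longleftrightarrow> integrable (lebesgue_on K) g"
    and "(LINT x|lebesgue_on \<Omega>. g x) = (LINT x|lebesgue_on K. g x)"
    using assms by (simp_all add: integrable_restrict_space integral_restrict_space)
qed

lemma AE_lebesgue_on_iff:
  "S \<in> sets lebesgue \<Longrightarrow> (AE x in lebesgue_on S. P x) \<longleftrightarrow> (AE x in lebesgue. x \<in> S \<longrightarrow> P x)"
  by (simp add: AE_restrict_space_iff)

lemma AE_lebesgue_on_subset: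
  assumes "AE x in lebesgue_on S. P x" "T \<subseteq> S" "S \<in> sets lebesgue" "T \<in> sets lebesgue"
  shows "AE x in lebesgue_on T. P x"
  using assms by (auto simp: AE_lebesgue_on_iff elim: eventually_mono)

text \<open>Lebesgue measure is complete: preimages under f and under g differ by part of a null
  set, and such a part is measurable.\<close>

lemma borel_measurable_lebesgue_on_AE_cong:
  assumes f: "f \<in> borel_measurable (lebesgue_on S)" and S: "S \<in> sets lebesgue"
    and eq: "AE x in lebesgue_on S. f x = g x"
  shows "g \<in> borel_measurable (lebesgue_on S)"
proof -
  have "AE x in lebesgue. x \<in> S \<longrightarrow> f x = g x" using eq S by (simp add: AE_lebesgue_on_iff)
  then obtain N where N: "N \<in> null_sets lebesgue" "{x \<in> space lebesgue. \<not> (x \<in> S \<longrightarrow> f x = g x)} \<subseteq> N"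
    unfolding eventually_ae_filter by blast
  show ?thesis
  proof (rule measurableI)
    fix A :: "'b set" assume A: "A \<in> sets borel"
    have 1: "f -` A \<inter> S \<in> sets lebesgue"
      using measurable_sets[OF f A] S by (auto simp: sets_restrict_space_iff)
    have "N \<inter> S \<inter> g -` A \<in> null_sets lebesgue"
      by (rule null_sets_completion_subset[OF _ N(1)]) auto
    then have 2: "N \<inter> S \<inter> g -` A \<in> sets lebesgue" by auto
    have "g -` A \<inter> S = ((f -` A \<inter> S) - N) \<union> (N \<inter> S \<inter> g -` A)"
      using N(2) by auto
    also have "\<dots> \<in> sets lebesgue" using 1 2 N(1) by auto
    finally show "g -` A \<inter> space (lebesgue_on S) \<in> sets (lebesgue_on S)"
      using S by (auto simp: sets_restrict_space_iff)
  qed simp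
qed

lemma integrable_lebesgue_on_AE_cong:
  fixes f g :: "'a::euclidean_space \<Rightarrow> real"
  assumes "integrable (lebesgue_on S) f" "S \<in> sets lebesgue" "AE x in lebesgue_on S. f x = g x"
  shows "integrable (lebesgue_on S) g"
  using assms borel_measurable_lebesgue_on_AE_cong[OF _ assms(2,3)]
  by (intro integrable_cong_AE_imp[OF assms(1)]) (auto elim: eventually_mono)

lemma LINT_lebesgue_on_AE_cong:
  fixes f g :: "'a::euclidean_space \<Rightarrow> real"
  assumes "S \<in> sets lebesgue" "AE x in lebesgue_on S. f x = g x"
  shows "(LINT x|lebesgue_on S. f x) = (LINT x|lebesgue_on S. g x)"
proof (cases "f \<in> borel_measurable (lebesgue_on S)")
  case True
  then show ?thesis
    using assms borel_measurable_lebesgue_on_AE_cong[OF _ assms] by (intro integral_cong_AE) auto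
next
  case False
  have "AE x in lebesgue_on S. g x = f x" using assms(2) by (auto elim: eventually_mono)
  then have "g \<notin> borel_measurable (lebesgue_on S)"
    using False borel_measurable_lebesgue_on_AE_cong[OF _ assms(1), of g f] by auto
  \<comment> \<open>A function that is not integrable has integral 0 by convention, so both sides
    are 0.\<close>
  then have "\<not> integrable (lebesgue_on S) f" "\<not> integrable (lebesgue_on S) g" using False by auto
  then show ?thesis by (simp add: not_integrable_integral_eq)
qed

text \<open>The positive and negative parts of G are densities of two finite measures that agree on
  all rays, hence everywhere, and a measure determines its density almost everywhere.\<close>

lemma AE_eq_0_from_rays:
  fixes G :: "real \<Rightarrow> real"
  assumes G: "integrable lebesgue G"
    and z: "\<And>c. (LINT x|lebesgue. indicator {c<..} x * G x) = 0"
  shows "AE x in lebesgue. G x = 0"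
proof -
  \<comment> \<open>A Borel representative, because the comparison of measures on rays is made on
    the Borel sets.\<close>
  obtain H where H: "H \<in> borel_measurable lborel" "AE x in lborel. G x = H x"
    using completion_ex_borel_measurable_real[of G lborel] G by auto
  have eq: "AE x in lebesgue. G x = H x" using H(2) by (rule AE_completion)
  have Hm: "H \<in> borel_measurable lebesgue" using H(1) by (simp add: measurable_completion)
  have "integrable lebesgue H"
    using G Hm eq by (intro integrable_cong_AE_imp[OF G]) (auto elim: eventually_mono)
  then have iH: "integrable lborel H" using H(1) by (simp add: integrable_completion)
  have zH: "(LINT x|lborel. indicator {c<..} x * H x) = 0" for c
  proof -
    have "(LINT x|lborel. indicator {c<..} x * H x) = (LINT x|lebesgue. indicator {c<..} x * H x)"
      using H(1) by (subst integral_completion) auto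
    also have "\<dots> = (LINT x|lebesgue. indicator {c<..} x * G x)"
    proof (rule integral_cong_AE)
      have "indicat_real {c<..} \<in> borel_measurable lebesgue" by (rule borel_measurable_indicator) simp
      then show "(\<lambda>x. indicator {c<..} x * H x) \<in> borel_measurable lebesgue"
        "(\<lambda>x. indicator {c<..} x * G x) \<in> borel_measurable lebesgue" using Hm G by auto
    qed (use eq in \<open>auto elim: eventually_mono\<close>)
    finally show ?thesis using z by simp
  qed
  define P where "P x = max 0 (H x)" for x
  define Q where "Q x = max 0 (- H x)" for x
  have [measurable]: "P \<in> borel_measurable borel" "Q \<in> borel_measurable borel"
    using H(1) by (auto simp: P_def[abs_def] Q_def[abs_def])
  have iP: "integrable lborel P" and iQ: "integrable lborel Q"
    unfolding P_def Q_def using iH by auto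
  have eP: "emeasure (density lborel (\<lambda>x. ennreal (F x))) {c<..}
      = ennreal (LINT x|lborel. indicator {c<..} x * F x)"
    if "integrable lborel F" "\<And>x. F x \<ge> 0" "F \<in> borel_measurable borel" for F :: "real \<Rightarrow> real" and c
  proof -
    have "emeasure (density lborel (\<lambda>x. ennreal (F x))) {c<..}
        = (\<integral>\<^sup>+x. ennreal (indicator {c<..} x * F x) \<partial>lborel)"
    proof (subst emeasure_density)
      show "(\<integral>\<^sup>+x. ennreal (F x) * indicator {c<..} x \<partial>lborel)
        = (\<integral>\<^sup>+x. ennreal (indicator {c<..} x * F x) \<partial>lborel)"
        by (intro nn_integral_cong) (auto split: split_indicator)
      show "{c<..} \<in> sets lborel" by simp
    qed (use that(3) in auto)
    also have "\<dots> = ennreal (LINT x|lborel. indicator {c<..} x * F x)"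
      using that by (intro nn_integral_eq_integral)
        (auto intro!: integrable_indicator_mult)
    finally show ?thesis .
  qed
  have P0: "P x \<ge> 0" and Q0: "Q x \<ge> 0" for x by (auto simp: P_def Q_def)
  note eP = eP[OF iP P0 \<open>P \<in> borel_measurable borel\<close>] eP[OF iQ Q0 \<open>Q \<in> borel_measurable borel\<close>]
  have "density lborel (\<lambda>x. ennreal (P x)) = density lborel (\<lambda>x. ennreal (Q x))"
  proof (rule measure_eqI_lessThan)
    fix c :: real
    have ii: "integrable lborel (\<lambda>x. indicator {c<..} x * P x)"
         "integrable lborel (\<lambda>x. indicator {c<..} x * Q x)"
      using iP iQ by (auto intro!: integrable_indicator_mult)
    have "(LINT x|lborel. indicator {c<..} x * P x) - (LINT x|lborel. indicator {c<..} x * Q x)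
       = (LINT x|lborel. indicator {c<..} x * P x - indicator {c<..} x * Q x)"
      using ii by simp
    also have "\<dots> = (LINT x|lborel. indicator {c<..} x * H x)"
      by (intro Bochner_Integration.integral_cong) (auto simp: P_def Q_def max_def indicator_def)
    finally have "(LINT x|lborel. indicator {c<..} x * P x) = (LINT x|lborel. indicator {c<..} x * Q x)"
      using zH by simp
    then show "emeasure (density lborel (\<lambda>x. ennreal (P x))) {c<..}
      = emeasure (density lborel (\<lambda>x. ennreal (Q x))) {c<..}"
      by (simp add: eP)
    show "emeasure (density lborel (\<lambda>x. ennreal (P x))) {c<..} < \<infinity>"
      by (simp add: eP)
  qed auto
  then have "AE x in lborel. ennreal (P x) = ennreal (Q x)"
    using sigma_finite_measure.density_unique_iff[OF sigma_finite_lborel, of "\<lambda>x. ennreal (P x)" "\<lambda>x. ennreal (Q x)"] by auto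
  then have "AE x in lborel. H x = 0"
    by eventually_elim (auto simp: P_def Q_def max_def split: if_splits)
  then have "AE x in lebesgue. H x = 0" by (rule AE_completion)
  with eq show ?thesis by eventually_elim auto
qed

text \<open>Increments of G and of M add up along a chain from c to d with steps shorter than
  \<delta>, so the local comparison becomes a global one.\<close>

lemma small_increments_chain:
  fixes G M :: "real \<Rightarrow> real"
  assumes "c \<le> d" "\<delta> > 0"
    and inc: "\<And>x y. c \<le> x \<Longrightarrow> x \<le> y \<Longrightarrow> y \<le> d \<Longrightarrow> y - x < \<delta> \<Longrightarrow> \<bar>G y - G x\<bar> \<le> e * (M y - M x)"
  shows "\<bar>G d - G c\<bar> \<le> e * (M d - M c)"
proof -
  have *: "\<bar>G d - G x\<bar> \<le> e * (M d - M x)" if "c \<le> x" "x \<le> d" "d - x \<le> real n * (\<delta> / 2)" for n x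
    using that
  proof (induction n arbitrary: x)
    case 0 then show ?case by simp
  next
    case (Suc n)
    define y where "y = min d (x + \<delta> / 2)"
    have y: "x \<le> y" "y \<le> d" "y - x < \<delta>" "c \<le> y" using Suc.prems assms(2) by (auto simp: y_def)
    have "d - y \<le> real n * (\<delta> / 2)"
    proof -
      have "0 \<le> real n * (\<delta> / 2)" using assms(2) by simp
      then show ?thesis using Suc.prems by (auto simp: y_def min_def algebra_simps)
    qed
    then have "\<bar>G d - G y\<bar> \<le> e * (M d - M y)" using Suc.IH y by blast
    moreover have "\<bar>G y - G x\<bar> \<le> e * (M y - M x)" using inc y Suc.prems by blast
    ultimately show ?case by (simp add: algebra_simps)
  qed
  obtain n :: nat where "(d - c) / (\<delta> / 2) \<le> real n" using real_arch_simple by blast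
  then have "d - c \<le> real n * (\<delta> / 2)" using assms(2) by (simp add: field_simps)
  then show ?thesis using * assms(1) by blast
qed

text \<open>Unbounded intervals are included: the same lemmas serve \<Omega> and the half-line of
  positive times.\<close>

locale open_interval =
  fixes \<Omega> :: "real set"
  assumes open_\<Omega>: "open \<Omega>" and interval_\<Omega>: "is_interval \<Omega>"
begin

lemma sets_\<Omega> [simp, intro]: "\<Omega> \<in> sets lebesgue"
  using open_\<Omega> by (simp add: borel_open)

lemma Icc_subset: "c \<in> \<Omega> \<Longrightarrow> d \<in> \<Omega> \<Longrightarrow> {c..d} \<subseteq> \<Omega>"
  using interval_\<Omega> by (meson atLeastAtMost_iff mem_is_interval_1_I subsetI)

lemma extend_right:
  assumes "d \<in> \<Omega>" obtains e where "e > 0" "d + e \<in> \<Omega>"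
proof -
  obtain r where r: "r > 0" "ball d r \<subseteq> \<Omega>" using open_\<Omega> assms openE by blast
  have "d + r/2 \<in> ball d r" using r by (simp add: dist_real_def)
  then show thesis using r by (intro that[of "r/2"]) auto
qed

lemma extend_left:
  assumes "d \<in> \<Omega>" obtains e where "e > 0" "d - e \<in> \<Omega>"
proof -
  obtain r where r: "r > 0" "ball d r \<subseteq> \<Omega>" using open_\<Omega> assms openE by blast
  have "d - r/2 \<in> ball d r" using r by (simp add: dist_real_def)
  then show thesis using r by (intro that[of "r/2"]) auto
qed

lemma sets_compact: "compact K \<Longrightarrow> K \<in> sets (lebesgue :: real measure)"
  by (simp add: borel_compact)

lemma measurable_loc:
  assumes "loc_integrable \<Omega> h" "compact K" "K \<subseteq> \<Omega>"
  shows "h \<in> borel_measurable (lebesgue_on K)"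
  using assms by (auto simp: loc_integrable_def)

lemma integrable_mult_compact_support:
  assumes h: "loc_integrable \<Omega> h" and K: "compact K" "K \<subseteq> \<Omega>"
    and \<phi>: "\<phi> \<in> borel_measurable (lebesgue_on K)" "\<And>x. x \<in> K \<Longrightarrow> \<bar>\<phi> x\<bar> \<le> B" "\<And>x. x \<in> \<Omega> - K \<Longrightarrow> \<phi> x = 0"
  shows "integrable (lebesgue_on \<Omega>) (\<lambda>x. h x * \<phi> x)"
proof -
  have "integrable (lebesgue_on K) (\<lambda>x. h x * \<phi> x)"
  proof (rule Bochner_Integration.integrable_bound)
    show "integrable (lebesgue_on K) (\<lambda>x. B * h x)" using h K by (simp add: loc_integrable_def)
    show "(\<lambda>x. h x * \<phi> x) \<in> borel_measurable (lebesgue_on K)"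
      using \<phi> measurable_loc[OF h K] by simp
    show "AE x in lebesgue_on K. norm (h x * \<phi> x) \<le> norm (B * h x)"
    proof (rule AE_I2)
      fix x assume "x \<in> space (lebesgue_on K)"
      then have "\<bar>\<phi> x\<bar> \<le> \<bar>B\<bar>" using \<phi>(2)[of x] by force
      then show "norm (h x * \<phi> x) \<le> norm (B * h x)"
        by (simp add: abs_mult mult.commute mult_right_mono)
    qed
  qed
  then show ?thesis
    by (subst lebesgue_on_restrict_support(1)[of K]) (use K \<phi>(3) sets_compact in auto)
qed

lemma integrable_mult_continuous:
  assumes h: "loc_integrable \<Omega> h" and K: "compact K" "K \<subseteq> \<Omega>"
    and \<phi>: "continuous_on K \<phi>" "\<And>x. x \<in> \<Omega> - K \<Longrightarrow> \<phi> x = 0"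
  shows "integrable (lebesgue_on \<Omega>) (\<lambda>x. h x * \<phi> x)"
proof -
  have "bounded (\<phi> ` K)" using compact_continuous_image[OF \<phi>(1) K(1)] by (rule compact_imp_bounded)
  then obtain B where "\<And>x. x \<in> K \<Longrightarrow> \<bar>\<phi> x\<bar> \<le> B" by (auto simp: bounded_iff)
  then show ?thesis
    using \<phi> K sets_compact by (intro integrable_mult_compact_support[OF h K])
      (auto intro: continuous_imp_measurable_on_sets_lebesgue)
qed

lemma integrable_increment:
  assumes "loc_integrable \<Omega> h" "c \<in> \<Omega>" "d \<in> \<Omega>"
  shows "integrable (lebesgue_on \<Omega>) (\<lambda>x. indicator {c<..d} x * h x)"
proof -
  have "integrable (lebesgue_on \<Omega>) (\<lambda>x. h x * indicator {c<..d} x)"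
  proof (rule integrable_mult_compact_support[OF assms(1) compact_Icc Icc_subset[OF assms(2,3)], of _ 1])
    show "indicat_real {c<..d} \<in> borel_measurable (lebesgue_on {c..d})"
      by (rule borel_measurable_indicator) (auto simp: sets_restrict_space_iff)
  qed (auto simp: indicator_def)
  then show ?thesis by (simp add: mult.commute)
qed

lemma increment_add:
  assumes "loc_integrable \<Omega> h" "c \<in> \<Omega>" "d \<in> \<Omega>" "e \<in> \<Omega>" "c \<le> d" "d \<le> e"
  shows "increment \<Omega> h c e = increment \<Omega> h c d + increment \<Omega> h d e"
proof -
  have "increment \<Omega> h c e
      = (LINT x|lebesgue_on \<Omega>. indicator {c<..d} x * h x + indicator {d<..e} x * h x)"
    by (intro Bochner_Integration.integral_cong) (use assms in \<open>auto simp: indicator_def\<close>)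
  also have "\<dots> = increment \<Omega> h c d + increment \<Omega> h d e"
    using assms by (intro Bochner_Integration.integral_add integrable_increment)
  finally show ?thesis .
qed

lemma loc_integrable_continuous: "continuous_on \<Omega> f \<Longrightarrow> loc_integrable \<Omega> f"
  unfolding loc_integrable_def
proof (intro allI impI)
  fix K assume f: "continuous_on \<Omega> f" and K: "compact K \<and> K \<subseteq> \<Omega>"
  have "continuous_on K f" using f K continuous_on_subset by blast
  moreover have "bounded (f ` K)"
    using compact_continuous_image[OF \<open>continuous_on K f\<close>] K by (auto intro: compact_imp_bounded)
  then obtain B where "\<And>x. x \<in> K \<Longrightarrow> \<bar>f x\<bar> \<le> B" by (auto simp: bounded_iff)
  moreover have "finite_measure (lebesgue_on K)"
    using K by (intro finite_measure_lebesgue_on) (simp add: lmeasurable_compact)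
  ultimately show "integrable (lebesgue_on K) f"
    using K sets_compact
    by (intro finite_measure.integrable_const_bound[of _ _ B])
       (auto intro: continuous_imp_measurable_on_sets_lebesgue AE_I2)
qed

lemma increment_continuous:
  assumes "continuous_on {c..d} g" "{c..d} \<subseteq> \<Omega>"
  shows "increment \<Omega> g c d = integral {c..d} g"
proof -
  have i: "integrable (lebesgue_on {c..d}) g" using assms by (intro continuous_imp_integrable_real)
  have "increment \<Omega> g c d = (LINT x|lebesgue_on {c..d}. indicator {c<..d} x * g x)"
    using assms by (intro lebesgue_on_restrict_support) (auto simp: indicator_def)
  also have "\<dots> = (LINT x|lebesgue_on {c..d}. g x)"
  proof (rule LINT_lebesgue_on_AE_cong)
    have "AE x in lebesgue. x \<noteq> c" by (rule AE_completion) (rule AE_lborel_singleton)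
    then show "AE x in lebesgue_on {c..d}. indicator {c<..d} x * g x = g x"
      by (subst AE_lebesgue_on_iff) (auto elim!: eventually_mono simp: indicator_def)
  qed simp
  also have "\<dots> = integral {c..d} g" using i by (rule lebesgue_integral_eq_integral) simp
  finally show ?thesis .
qed

lemma increment_FTC:
  assumes "c \<in> \<Omega>" "d \<in> \<Omega>" "c \<le> d" "continuous_on \<Omega> f'"
    and "\<And>x. x \<in> \<Omega> \<Longrightarrow> (f has_real_derivative f' x) (at x)"
  shows "f d - f c = increment \<Omega> f' c d"
proof -
  have s: "{c..d} \<subseteq> \<Omega>" using assms Icc_subset by blast
  have "(f' has_integral f d - f c) {c..d}"
  proof (rule fundamental_theorem_of_calculus[OF assms(3)])
    fix x assume "x \<in> {c..d}"
    then have "(f has_real_derivative f' x) (at x within {c..d})"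
      using assms(5) s has_field_derivative_at_within by blast
    then show "(f has_vector_derivative f' x) (at x within {c..d})"
      by (simp add: has_real_derivative_iff_has_vector_derivative)
  qed
  then show ?thesis
    using increment_continuous[OF continuous_on_subset[OF assms(4) s] s] by (simp add: integral_unique)
qed

text \<open>Test with smooth approximations of the indicator of (c, d]. Their derivatives are bumps
  of mass one next to c and next to d, with opposite signs, and pick out f c - f d in the
  limit.\<close>

lemma weak_primitive_increment:
  assumes f: "continuous_on \<Omega> f" and h: "loc_integrable \<Omega> h"
    and w: "\<And>\<phi>. test_function \<Omega> \<phi> \<Longrightarrow>
        (LINT x|lebesgue_on \<Omega>. f x * deriv \<phi> x) = - (LINT x|lebesgue_on \<Omega>. h x * \<phi> x)"
    and cd: "c \<in> \<Omega>" "d \<in> \<Omega>" "c \<le> d"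
  shows "f d - f c = increment \<Omega> h c d"
proof -
  obtain \<eta> k1 k2 where eta:
    "\<And>e x. e > 0 \<Longrightarrow> smooth (\<eta> e)" "\<And>e x. e > 0 \<Longrightarrow> 0 \<le> \<eta> e x \<and> \<eta> e x \<le> 1"
    "\<And>e x. e > 0 \<Longrightarrow> \<eta> e x \<noteq> 0 \<Longrightarrow> c \<le> x \<and> x \<le> d + e"
    "\<And>x. \<forall>\<^sub>F e in at_right 0. \<eta> e x = indicator {c<..d} x"
    "\<And>e x. e > 0 \<Longrightarrow> deriv (\<eta> e) x = k1 e x - k2 e x"
    and kc: "\<And>e. e > 0 \<Longrightarrow> continuous_on UNIV (k1 e) \<and> continuous_on UNIV (k2 e)"
    and k0: "\<And>e x. e > 0 \<Longrightarrow> k1 e x \<ge> 0 \<and> k2 e x \<ge> 0"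
    and ks: "\<And>e x. e > 0 \<Longrightarrow> x \<notin> {c..c + e} \<Longrightarrow> k1 e x = 0"
    "\<And>e x. e > 0 \<Longrightarrow> x \<notin> {d..d + e} \<Longrightarrow> k2 e x = 0"
    and ki: "\<And>e. e > 0 \<Longrightarrow> (k1 e has_integral 1) {c..c + e}"
    "\<And>e. e > 0 \<Longrightarrow> (k2 e has_integral 1) {d..d + e}"
    by (rule ex_smooth_indicator[OF cd(3)]) (rule that; assumption)
  \<comment> \<open>The ramp at d reaches beyond d, so the supports stay in \<Omega> only if there
    is room to the right of d.\<close>
  obtain e0 where e0: "e0 > 0" "d + e0 \<in> \<Omega>" using extend_right[OF cd(2)] .
  have sub: "{c..d + e} \<subseteq> \<Omega>" if "e \<le> e0" for e
    using Icc_subset[OF cd(1) e0(2)] that by auto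
  define \<epsilon> where "\<epsilon> n = e0 / real (Suc n)" for n
  have eps: "\<epsilon> n > 0" "\<epsilon> n \<le> e0" for n
    using e0(1) by (auto simp: \<epsilon>_def field_simps)
  have eps_lim: "filterlim \<epsilon> (at_right 0) sequentially"
  proof (rule tendsto_imp_filterlim_at_right)
    show "\<epsilon> \<longlonglongrightarrow> 0" unfolding \<epsilon>_def
      using tendsto_mult_right_zero[OF LIMSEQ_inverse_real_of_nat, of e0] by (simp add: divide_inverse)
  qed (use eps in auto)
  \<comment> \<open>The bumps concentrate at y, so the weighted means of the continuous f tend to f
    y.\<close>
  have mean: "(\<lambda>n. LINT x|lebesgue_on \<Omega>. f x * k (\<epsilon> n) x) \<longlonglongrightarrow> f y"
    "\<And>n. integrable (lebesgue_on \<Omega>) (\<lambda>x. f x * k (\<epsilon> n) x)"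
    if y: "y \<in> \<Omega>" "y + e0 \<in> \<Omega>" and k: "\<And>e. e > 0 \<Longrightarrow> continuous_on UNIV (k e)" "\<And>e x. e > 0 \<Longrightarrow> k e x \<ge> 0"
      "\<And>e x. e > 0 \<Longrightarrow> x \<notin> {y..y + e} \<Longrightarrow> k e x = 0" "\<And>e. e > 0 \<Longrightarrow> (k e has_integral 1) {y..y + e}"
    for y and k :: "real \<Rightarrow> real \<Rightarrow> real"
  proof -
    have s: "{y..y + \<epsilon> n} \<subseteq> \<Omega>" for n
      using Icc_subset[OF y] eps(2)[of n] by auto
    show int: "integrable (lebesgue_on \<Omega>) (\<lambda>x. f x * k (\<epsilon> n) x)" for n
      by (rule integrable_mult_continuous[OF loc_integrable_continuous[OF f] compact_Icc s[of n]])
         (use k(3) eps in \<open>auto intro: continuous_on_subset[OF k(1)[OF eps(1)] subset_UNIV]\<close>)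
    have eq: "((\<lambda>x. f x * k (\<epsilon> n) x) has_integral (LINT x|lebesgue_on \<Omega>. f x * k (\<epsilon> n) x)) {y..y + \<epsilon> n}" for n
    proof -
      have c: "continuous_on {y..y + \<epsilon> n} (\<lambda>x. f x * k (\<epsilon> n) x)"
        by (intro continuous_on_mult continuous_on_subset[OF f s]
            continuous_on_subset[OF k(1)[OF eps(1)] subset_UNIV])
      have "(LINT x|lebesgue_on \<Omega>. f x * k (\<epsilon> n) x) = (LINT x|lebesgue_on {y..y + \<epsilon> n}. f x * k (\<epsilon> n) x)"
        using s k(3) eps by (intro lebesgue_on_restrict_support) auto
      also have "\<dots> = integral {y..y + \<epsilon> n} (\<lambda>x. f x * k (\<epsilon> n) x)"
        using continuous_imp_integrable_real[OF c] by (rule lebesgue_integral_eq_integral) simp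
      finally show ?thesis using integrable_continuous_real[OF c] by (simp add: has_integral_integral)
    qed
    show "(\<lambda>n. LINT x|lebesgue_on \<Omega>. f x * k (\<epsilon> n) x) \<longlonglongrightarrow> f y"
    proof (rule LIMSEQ_I)
      fix r :: real assume r: "r > 0"
      have "isCont f y" using f open_\<Omega> y(1) by (simp add: continuous_on_eq_continuous_at)
      then obtain s where s: "s > 0" "\<forall>x. dist x y < s \<longrightarrow> dist (f x) (f y) < r/2"
        using half_gt_zero[OF r] unfolding continuous_at_eps_delta by blast
      have s0: "s > 0" "\<And>x. \<bar>x - y\<bar> < s \<Longrightarrow> \<bar>f x - f y\<bar> < r/2"
        using s by (auto simp: dist_real_def)
      have "\<forall>\<^sub>F n in sequentially. \<epsilon> n < s"
        using eps_lim s0(1) by (auto simp: filterlim_at elim: order_tendstoD)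
      then obtain N where N: "\<And>n. n \<ge> N \<Longrightarrow> \<epsilon> n < s" by (auto simp: eventually_sequentially)
      have "norm ((LINT x|lebesgue_on \<Omega>. f x * k (\<epsilon> n) x) - f y) < r" if n: "n \<ge> N" for n
      proof -
        have near: "\<bar>f x - f y\<bar> < r/2" if "x \<in> {y..y+\<epsilon> n}" for x
          using that N[OF n] by (intro s0) auto
        have "((\<lambda>x. (f y + r/2) * k (\<epsilon> n) x) has_integral (f y + r/2) * 1) {y..y + \<epsilon> n}"
          "((\<lambda>x. (f y - r/2) * k (\<epsilon> n) x) has_integral (f y - r/2) * 1) {y..y + \<epsilon> n}"
          using k(4) eps by (intro has_integral_mult_right; simp)+
        then have "(LINT x|lebesgue_on \<Omega>. f x * k (\<epsilon> n) x) \<le> (f y + r/2) * 1"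
          "(f y - r/2) * 1 \<le> (LINT x|lebesgue_on \<Omega>. f x * k (\<epsilon> n) x)"
        proof -
          have "f x \<le> f y + r/2" "f y - r/2 \<le> f x" if "x \<in> {y..y+\<epsilon> n}" for x
            using near[OF that] by linarith+
          then have le: "f x * k (\<epsilon> n) x \<le> (f y + r/2) * k (\<epsilon> n) x"
            "(f y - r/2) * k (\<epsilon> n) x \<le> f x * k (\<epsilon> n) x" if "x \<in> {y..y+\<epsilon> n}" for x
            using k(2)[OF eps(1)] that by (auto intro!: mult_right_mono)
          assume i: "((\<lambda>x. (f y + r/2) * k (\<epsilon> n) x) has_integral (f y + r/2) * 1) {y..y + \<epsilon> n}"
            "((\<lambda>x. (f y - r/2) * k (\<epsilon> n) x) has_integral (f y - r/2) * 1) {y..y + \<epsilon> n}"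
          show "(LINT x|lebesgue_on \<Omega>. f x * k (\<epsilon> n) x) \<le> (f y + r/2) * 1"
            by (rule has_integral_le[OF eq i(1)]) (rule le(1))
          show "(f y - r/2) * 1 \<le> (LINT x|lebesgue_on \<Omega>. f x * k (\<epsilon> n) x)"
            by (rule has_integral_le[OF i(2) eq]) (rule le(2))
        qed
        then show ?thesis using r by (simp add: abs_less_iff field_simps)
      qed
      then show "\<exists>N. \<forall>n\<ge>N. norm ((LINT x|lebesgue_on \<Omega>. f x * k (\<epsilon> n) x) - f y) < r" by blast
    qed
  qed
  have cc: "c + e0 \<in> \<Omega>" using Icc_subset[OF cd(1) e0(2)] cd(3) e0(1) by auto
  have lim1: "(\<lambda>n. (LINT x|lebesgue_on \<Omega>. f x * k1 (\<epsilon> n) x) - (LINT x|lebesgue_on \<Omega>. f x * k2 (\<epsilon> n) x))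
      \<longlonglongrightarrow> f c - f d"
    using kc k0 ks ki by (intro tendsto_diff mean(1) cd cc e0) auto
  have test: "test_function \<Omega> (\<eta> (\<epsilon> n))" for n
  proof -
    have cl: "closure {x. \<eta> (\<epsilon> n) x \<noteq> 0} \<subseteq> {c..d + \<epsilon> n}"
      by (rule closure_minimal) (use eta(3)[OF eps(1)[of n]] in \<open>auto simp del: not_le\<close>)
    have "compact ({c..d + \<epsilon> n} \<inter> closure {x. \<eta> (\<epsilon> n) x \<noteq> 0})"
      by (rule compact_Int_closed) auto
    then have "compact (closure {x. \<eta> (\<epsilon> n) x \<noteq> 0})"
      using cl by (simp add: inf.absorb2)
    then show ?thesis
      using cl sub[OF eps(2)] eta(1) eps by (auto simp: test_function_iff)
  qed
  have eq: "(LINT x|lebesgue_on \<Omega>. f x * k1 (\<epsilon> n) x) - (LINT x|lebesgue_on \<Omega>. f x * k2 (\<epsilon> n) x)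
     = - (LINT x|lebesgue_on \<Omega>. h x * \<eta> (\<epsilon> n) x)" for n
  proof -
    have "(LINT x|lebesgue_on \<Omega>. f x * k1 (\<epsilon> n) x) - (LINT x|lebesgue_on \<Omega>. f x * k2 (\<epsilon> n) x)
      = (LINT x|lebesgue_on \<Omega>. f x * k1 (\<epsilon> n) x - f x * k2 (\<epsilon> n) x)"
      using kc k0 ks ki
      by (intro Bochner_Integration.integral_diff[symmetric] mean(2)[OF cd(1) cc] mean(2)[OF cd(2) e0(2)]) auto
    also have "\<dots> = (LINT x|lebesgue_on \<Omega>. f x * deriv (\<eta> (\<epsilon> n)) x)"
      by (simp add: eta(5)[OF eps(1)] right_diff_distrib)
    finally show ?thesis using w[OF test[of n]] by simp
  qed
  \<comment> \<open>All approximations are between 0 and 1 and vanish outside [c, d + e0], so |h|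
    cut off to this interval is a common majorant.\<close>
  have lim2: "(\<lambda>n. LINT x|lebesgue_on \<Omega>. h x * \<eta> (\<epsilon> n) x) \<longlonglongrightarrow> (LINT x|lebesgue_on \<Omega>. h x * indicator {c<..d} x)"
  proof (rule integral_dominated_convergence)
    let ?K = "{c..d + e0}"
    have K: "compact ?K" "?K \<subseteq> \<Omega>" using sub by auto
    show "(\<lambda>x. h x * indicator {c<..d} x) \<in> borel_measurable (lebesgue_on \<Omega>)"
      using integrable_increment[OF h cd(1,2)] by (auto simp: mult.commute)
    show "(\<lambda>x. h x * \<eta> (\<epsilon> n) x) \<in> borel_measurable (lebesgue_on \<Omega>)" for n
    proof -
      have "\<eta> (\<epsilon> n) x = 0" if "x \<in> \<Omega> - ?K" for x
        using eta(3)[OF eps(1)[of n], of x] eps(2)[of n] that by force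
      then have "integrable (lebesgue_on \<Omega>) (\<lambda>x. h x * \<eta> (\<epsilon> n) x)"
        by (rule integrable_mult_continuous[OF h K smooth_continuous_on[OF eta(1)[OF eps(1)]]])
      then show ?thesis by auto
    qed
    show "integrable (lebesgue_on \<Omega>) (\<lambda>x. \<bar>h x * indicator ?K x\<bar>)"
    proof (intro integrable_abs integrable_mult_compact_support[OF h K, of _ 1])
      show "indicat_real ?K \<in> borel_measurable (lebesgue_on ?K)"
        by (rule borel_measurable_indicator) (auto simp: sets_restrict_space_iff)
    qed (auto simp: indicator_def)
    show "AE x in lebesgue_on \<Omega>. norm (h x * \<eta> (\<epsilon> n) x) \<le> \<bar>h x * indicator ?K x\<bar>" for n
    proof (rule AE_I2)
      fix x
      show "norm (h x * \<eta> (\<epsilon> n) x) \<le> \<bar>h x * indicator ?K x\<bar>"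
      proof (cases "x \<in> ?K")
        case True
        then show ?thesis using eta(2)[OF eps(1)[of n], of x] by (simp add: abs_mult mult_left_le)
      next
        case False
        then have "\<eta> (\<epsilon> n) x = 0"
          using eta(3)[OF eps(1)[of n], of x] eps(2)[of n] by force
        then show ?thesis by simp
      qed
    qed
    show "AE x in lebesgue_on \<Omega>. (\<lambda>n. h x * \<eta> (\<epsilon> n) x) \<longlonglongrightarrow> h x * indicator {c<..d} x"
    proof (rule AE_I2)
      fix x
      have "\<forall>\<^sub>F n in sequentially. \<eta> (\<epsilon> n) x = indicator {c<..d} x"
        using eta(4)[of x] eps_lim by (auto simp: filterlim_iff)
      then show "(\<lambda>n. h x * \<eta> (\<epsilon> n) x) \<longlonglongrightarrow> h x * indicator {c<..d} x"
        by (intro tendsto_intros tendsto_eventually)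
    qed
  qed
  have "(\<lambda>n. - (LINT x|lebesgue_on \<Omega>. h x * \<eta> (\<epsilon> n) x)) \<longlonglongrightarrow> f c - f d"
    using lim1 unfolding eq .
  from LIMSEQ_unique[OF this tendsto_minus[OF lim2]] show ?thesis
    by (simp add: mult.commute)
qed


lemma compact_subset_interior:
  assumes "compact K" "K \<subseteq> \<Omega>" "K \<noteq> {}"
  obtains c d where "c \<in> \<Omega>" "d \<in> \<Omega>" "c < d" "K \<subseteq> {c<..<d}"
proof -
  obtain l u where l: "l \<in> K" "\<And>x. x \<in> K \<Longrightarrow> l \<le> x" and u: "u \<in> K" "\<And>x. x \<in> K \<Longrightarrow> x \<le> u"
    using compact_attains_inf[OF assms(1,3)] compact_attains_sup[OF assms(1,3)] by blast
  obtain e1 where e1: "e1 > 0" "l - e1 \<in> \<Omega>" using extend_left l(1) assms(2) by blast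
  obtain e2 where e2: "e2 > 0" "u + e2 \<in> \<Omega>" using extend_right u(1) assms(2) by blast
  have "l \<le> u" using l u by blast
  then show thesis
    using l(2) u(2) e1 e2 by (intro that[of "l - e1" "u + e2"]) (auto, force+)
qed

lemma increment_bound_within:
  assumes "loc_integrable \<Omega> h" "p \<in> \<Omega>" "q \<in> \<Omega>" "p \<le> x" "x \<le> y" "y \<le> q"
  shows "\<bar>increment \<Omega> h x y\<bar> \<le> increment \<Omega> (\<lambda>x. \<bar>h x\<bar>) x y"
proof -
  have xy: "x \<in> \<Omega>" "y \<in> \<Omega>" using Icc_subset[OF assms(2,3)] assms by auto
  have "\<bar>increment \<Omega> h x y\<bar> \<le> (LINT z|lebesgue_on \<Omega>. \<bar>indicator {x<..y} z * h z\<bar>)"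
    by (rule integral_abs_bound)
  also have "\<dots> = increment \<Omega> (\<lambda>x. \<bar>h x\<bar>) x y"
    by (intro Bochner_Integration.integral_cong) (auto simp: indicator_def)
  finally show ?thesis .
qed

lemma loc_integrable_abs: "loc_integrable \<Omega> h \<Longrightarrow> loc_integrable \<Omega> (\<lambda>x. \<bar>h x\<bar>)"
  by (auto simp: loc_integrable_def)

lemma loc_integrable_add:
  "loc_integrable \<Omega> f \<Longrightarrow> loc_integrable \<Omega> g \<Longrightarrow> loc_integrable \<Omega> (\<lambda>x. f x + c * g x)"
  by (auto simp: loc_integrable_def)

lemma loc_integrable_cmult: "loc_integrable \<Omega> f \<Longrightarrow> loc_integrable \<Omega> (\<lambda>x. c * f x)"
  by (auto simp: loc_integrable_def)

lemma loc_integrable_mult_continuous: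
  assumes h: "loc_integrable \<Omega> h" and \<phi>: "continuous_on \<Omega> \<phi>"
  shows "loc_integrable \<Omega> (\<lambda>x. h x * \<phi> x)"
  unfolding loc_integrable_def
proof (intro allI impI)
  fix K assume K: "compact K \<and> K \<subseteq> \<Omega>"
  let ?\<phi> = "\<lambda>x. if x \<in> K then \<phi> x else 0"
  have "continuous_on K ?\<phi>"
    using \<phi> K by (subst continuous_on_cong[OF refl, of _ _ \<phi>]) (auto intro: continuous_on_subset)
  then have "integrable (lebesgue_on \<Omega>) (\<lambda>x. h x * ?\<phi> x)"
    using K by (intro integrable_mult_continuous[OF h, of K]) auto
  then have "integrable (lebesgue_on K) (\<lambda>x. h x * ?\<phi> x)"
    using K sets_compact by (subst (asm) lebesgue_on_restrict_support(1)[of K]) auto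
  moreover have "integrable (lebesgue_on K) (\<lambda>x. h x * ?\<phi> x) \<longleftrightarrow> integrable (lebesgue_on K) (\<lambda>x. h x * \<phi> x)"
    by (intro Bochner_Integration.integrable_cong) auto
  ultimately show "integrable (lebesgue_on K) (\<lambda>x. h x * \<phi> x)" by simp
qed

lemma increment_cmult: "increment \<Omega> (\<lambda>x. c * h x) p q = c * increment \<Omega> h p q"
proof -
  have "increment \<Omega> (\<lambda>x. c * h x) p q = (LINT x|lebesgue_on \<Omega>. c * (indicator {p<..q} x * h x))"
    by (intro Bochner_Integration.integral_cong) auto
  then show ?thesis by simp
qed

lemma increment_linear:
  assumes "loc_integrable \<Omega> f" "loc_integrable \<Omega> g" "p \<in> \<Omega>" "q \<in> \<Omega>"
  shows "increment \<Omega> (\<lambda>x. f x + c * g x) p q = increment \<Omega> f p q + c * increment \<Omega> g p q"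
proof -
  have "increment \<Omega> (\<lambda>x. f x + c * g x) p q
    = (LINT x|lebesgue_on \<Omega>. indicator {p<..q} x * f x + c * (indicator {p<..q} x * g x))"
    by (intro Bochner_Integration.integral_cong) (auto simp: algebra_simps)
  then show ?thesis
    using integrable_increment[OF assms(1,3,4)] integrable_increment[OF assms(2,3,4)] by simp
qed

lemma increment_mono:
  assumes "loc_integrable \<Omega> f" "loc_integrable \<Omega> g" "p \<in> \<Omega>" "q \<in> \<Omega>"
    and "\<And>x. p < x \<Longrightarrow> x \<le> q \<Longrightarrow> f x \<le> g x"
  shows "increment \<Omega> f p q \<le> increment \<Omega> g p q"
  using assms by (intro integral_mono integrable_increment) (auto simp: indicator_def)

lemma increment_tendsto:
  assumes h: "loc_integrable \<Omega> h" and x: "x \<in> \<Omega>" and p: "p \<in> \<Omega>" and x': "\<And>n. x' n \<in> \<Omega>" "x' \<longlonglongrightarrow> x"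
  shows "(\<lambda>n. increment \<Omega> h p (x' n)) \<longlonglongrightarrow> increment \<Omega> h p x"
proof -
  obtain e where e: "e > 0" "x + e \<in> \<Omega>" using extend_right[OF x] .
  let ?q = "max p (x + e)"
  have q: "?q \<in> \<Omega>" using e p by (auto simp: max_def)
  obtain N where N: "\<And>n. n \<ge> N \<Longrightarrow> x' n < x + e"
    using order_tendstoD(2)[OF x'(2), of "x + e"] e by (auto simp: eventually_sequentially)
  have "(\<lambda>n. increment \<Omega> h p (x' (n + N))) \<longlonglongrightarrow> increment \<Omega> h p x"
  proof (rule integral_dominated_convergence)
    show "(\<lambda>z. indicat_real {p<..x} z * h z) \<in> borel_measurable (lebesgue_on \<Omega>)"
      "(\<lambda>z. indicat_real {p<..x' (n + N)} z * h z) \<in> borel_measurable (lebesgue_on \<Omega>)" for n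
      using integrable_increment[OF h p] x x' by auto
    show "integrable (lebesgue_on \<Omega>) (\<lambda>z. \<bar>indicat_real {p<..?q} z * h z\<bar>)"
      using integrable_increment[OF h p q] by (rule integrable_abs)
    show "AE z in lebesgue_on \<Omega>. norm (indicat_real {p<..x' (n + N)} z * h z) \<le> \<bar>indicat_real {p<..?q} z * h z\<bar>" for n
      using N[of "n + N"] by (intro AE_I2) (auto simp: indicator_def)
    have "AE z in lebesgue. z \<noteq> x" by (rule AE_completion) (rule AE_lborel_singleton)
    then have "AE z in lebesgue_on \<Omega>. z \<noteq> x" by (auto simp: AE_lebesgue_on_iff elim: eventually_mono)
    then show "AE z in lebesgue_on \<Omega>. (\<lambda>n. indicat_real {p<..x' (n + N)} z * h z) \<longlonglongrightarrow> indicat_real {p<..x} z * h z"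
    proof eventually_elim
      case (elim z)
      have "\<forall>\<^sub>F n in sequentially. indicat_real {p<..x' n} z = indicat_real {p<..x} z"
      proof (cases "z < x")
        case True
        show ?thesis using order_tendstoD(1)[OF x'(2) True]
          by eventually_elim (use True in \<open>auto simp: indicator_def\<close>)
      next
        case False
        then have "x < z" using elim by simp
        from order_tendstoD(2)[OF x'(2) this] show ?thesis
          by eventually_elim (use \<open>x < z\<close> in \<open>auto simp: indicator_def\<close>)
      qed
      then have "(\<lambda>n. indicat_real {p<..x' n} z * h z) \<longlonglongrightarrow> indicat_real {p<..x} z * h z"
        by (intro tendsto_intros tendsto_eventually)
      then show ?case by (rule LIMSEQ_ignore_initial_segment)
    qed
  qed
  then show ?thesis by (rule LIMSEQ_offset)
qed

text \<open>Dominated convergence for the integral from a base point x - e to the left of x; a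
  sequence tending to x is eventually to the right of it, so all increments are well
  oriented.\<close>

lemma primitive_continuous:
  assumes h: "loc_integrable \<Omega> h"
    and inc: "\<And>x y. x \<in> \<Omega> \<Longrightarrow> y \<in> \<Omega> \<Longrightarrow> x \<le> y \<Longrightarrow> f y - f x = increment \<Omega> h x y"
  shows "continuous_on \<Omega> f"
  unfolding continuous_on_sequentially
proof (intro allI ballI impI, elim conjE)
  fix x' x assume x: "x \<in> \<Omega>" "\<forall>n. x' n \<in> \<Omega>" "x' \<longlonglongrightarrow> x"
  obtain e where e: "e > 0" "x - e \<in> \<Omega>" using extend_left[OF x(1)] .
  have "\<forall>\<^sub>F n in sequentially. x - e < x' n"
    using order_tendstoD(1)[OF x(3), of "x - e"] e(1) by simp
  then have "\<forall>\<^sub>F n in sequentially. f (x - e) + increment \<Omega> h (x - e) (x' n) = f (x' n)"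
  proof (rule eventually_mono)
    fix n assume "x - e < x' n"
    then show "f (x - e) + increment \<Omega> h (x - e) (x' n) = f (x' n)"
      using inc[of "x - e" "x' n"] e x by simp
  qed
  moreover have "(\<lambda>n. f (x - e) + increment \<Omega> h (x - e) (x' n)) \<longlonglongrightarrow> f (x - e) + increment \<Omega> h (x - e) x"
    using x e by (intro tendsto_intros increment_tendsto h) auto
  moreover have "f (x - e) + increment \<Omega> h (x - e) x = f x"
    using inc[of "x - e" x] e x by simp
  ultimately show "(f \<circ> x') \<longlonglongrightarrow> f x"
    by (auto simp: o_def intro: Lim_transform_eventually)
qed

text \<open>Integration by parts without Fubini: on short intervals the increment of
  \<open>f \<phi> - \<integral>(f \<phi>' + h \<phi>)\<close> is small compared with that of \<open>\<integral>(\<bar>\<phi>'\<bar> + \<bar>h\<bar>)\<close>, so the total increment is zero.\<close>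

lemma weak_derivativeI:
  assumes h: "loc_integrable \<Omega> h"
    and inc: "\<And>x y. x \<in> \<Omega> \<Longrightarrow> y \<in> \<Omega> \<Longrightarrow> x \<le> y \<Longrightarrow> f y - f x = increment \<Omega> h x y"
  shows "weak_derivative \<Omega> f h"
proof -
  have fc: "continuous_on \<Omega> f" using primitive_continuous assms .
  have "(LINT x|lebesgue_on \<Omega>. f x * deriv \<phi> x) = - (LINT x|lebesgue_on \<Omega>. h x * \<phi> x)"
    if test: "test_function \<Omega> \<phi>" for \<phi>
  proof (cases "closure {x. \<phi> x \<noteq> 0} = {}")
    case True
    then have "\<phi> x = 0" for x using closure_subset[of "{x. \<phi> x \<noteq> 0}"] by auto
    then have "\<phi> = (\<lambda>x. 0)" by auto
    then show ?thesis by simp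
  next
    case False
    let ?K = "closure {x. \<phi> x \<noteq> 0}"
    have sm: "smooth \<phi>" and K: "compact ?K" "?K \<subseteq> \<Omega>" using test by (auto simp: test_function_iff)
    obtain c d where cd: "c \<in> \<Omega>" "d \<in> \<Omega>" "c < d" "?K \<subseteq> {c<..<d}"
      using compact_subset_interior[OF K False] .
    have \<phi>0: "\<phi> x = 0" if "x \<notin> {c<..<d}" for x
      using that cd(4) closure_subset[of "{x. \<phi> x \<noteq> 0}"] by auto
    have d\<phi>0: "deriv \<phi> x = 0" if "x \<notin> ?K" for x
    proof -
      have "(\<phi> has_real_derivative 0) (at x)"
        by (rule has_field_derivative_transform_within_open[where S="- ?K" and f="\<lambda>_. 0"])
           (use that closure_subset[of "{x. \<phi> x \<noteq> 0}"] in auto)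
      then show ?thesis by (rule DERIV_imp_deriv)
    qed
    have \<phi>c: "continuous_on S \<phi>" "continuous_on S (deriv \<phi>)" for S
      using sm by (auto intro: smooth_continuous_on smooth_deriv)
    \<comment> \<open>P is the integrand whose integral has to vanish; Q dominates the error made
      when f and \<phi> are frozen on a short interval.\<close>
    define P where "P x = f x * deriv \<phi> x + 1 * (h x * \<phi> x)" for x
    define Q where "Q x = \<bar>deriv \<phi> x\<bar> + 1 * \<bar>h x\<bar>" for x
    have l\<phi>': "loc_integrable \<Omega> (deriv \<phi>)" by (intro loc_integrable_continuous \<phi>c)
    have lP1: "loc_integrable \<Omega> (\<lambda>x. f x * deriv \<phi> x)"
      by (intro loc_integrable_continuous continuous_on_mult fc \<phi>c)
    have lP2: "loc_integrable \<Omega> (\<lambda>x. h x * \<phi> x)"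
      by (intro loc_integrable_mult_continuous h \<phi>c)
    have lP: "loc_integrable \<Omega> P" unfolding P_def by (intro loc_integrable_add lP1 lP2)
    have lQ: "loc_integrable \<Omega> Q"
      unfolding Q_def by (intro loc_integrable_add loc_integrable_abs l\<phi>' h)
    \<comment> \<open>Since \<phi> vanishes at c and at d, the increment of G from c to d is minus
      the integral of P.\<close>
    define G where "G x = f x * \<phi> x - increment \<Omega> P c x" for x
    define M where "M x = increment \<Omega> Q c x" for x
    have sub: "{c..d} \<subseteq> \<Omega>" using Icc_subset cd by blast
    have small: "\<bar>G d - G c\<bar> \<le> e * (M d - M c)" if e: "e > 0" for e
    proof -
      have "uniformly_continuous_on {c..d} f" "uniformly_continuous_on {c..d} \<phi>"
        using fc sub \<phi>c by (auto intro!: compact_uniformly_continuous intro: continuous_on_subset)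
      then obtain d1 d2 where d1: "d1 > 0" "\<And>x y. x \<in> {c..d} \<Longrightarrow> y \<in> {c..d} \<Longrightarrow> \<bar>y - x\<bar> < d1 \<Longrightarrow> \<bar>f y - f x\<bar> < e"
         and d2: "d2 > 0" "\<And>x y. x \<in> {c..d} \<Longrightarrow> y \<in> {c..d} \<Longrightarrow> \<bar>y - x\<bar> < d2 \<Longrightarrow> \<bar>\<phi> y - \<phi> x\<bar> < e"
        using e unfolding uniformly_continuous_on_def dist_real_def by metis
      show ?thesis
      proof (rule small_increments_chain[where \<delta> = "min d1 d2"])
        fix x y assume xy: "c \<le> x" "x \<le> y" "y \<le> d" "y - x < min d1 d2"
        then have xyO: "x \<in> \<Omega>" "y \<in> \<Omega>" using sub by auto
        have eqM: "M y - M x = increment \<Omega> Q x y"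
          unfolding M_def using increment_add[OF lQ cd(1) xyO] xy by simp
        have eqP: "increment \<Omega> P c y - increment \<Omega> P c x = increment \<Omega> P x y"
          using increment_add[OF lP cd(1) xyO] xy by simp
        have "\<phi> y - \<phi> x = increment \<Omega> (deriv \<phi>) x y"
          using xyO xy \<phi>c smooth_DERIV[OF sm] by (intro increment_FTC) auto
        \<comment> \<open>Discrete product rule, with f taken at the left end and \<phi> at the
          right end.\<close>
        then have "f y * \<phi> y - f x * \<phi> x = f x * increment \<Omega> (deriv \<phi>) x y + \<phi> y * increment \<Omega> h x y"
          using inc[OF xyO xy(2)] by (simp add: algebra_simps flip: \<open>\<phi> y - \<phi> x = _\<close>)
        also have "\<dots> = increment \<Omega> (\<lambda>z. f x * deriv \<phi> z + \<phi> y * h z) x y"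
          using increment_linear[OF loc_integrable_cmult[OF l\<phi>', of "f x"] h xyO, of "\<phi> y"]
            increment_cmult[where c="f x" and h="deriv \<phi>" and p=x and q=y] by (simp add: algebra_simps)
        finally have "G y - G x = increment \<Omega> (\<lambda>z. f x * deriv \<phi> z + \<phi> y * h z) x y + (-1) * increment \<Omega> P x y"
          using eqP by (simp add: G_def)
        also have "\<dots> = increment \<Omega> (\<lambda>z. (f x * deriv \<phi> z + \<phi> y * h z) + (-1) * P z) x y"
          by (intro increment_linear[symmetric] lP xyO loc_integrable_add loc_integrable_cmult l\<phi>' h)
        finally have Geq: "G y - G x = increment \<Omega> (\<lambda>z. (f x * deriv \<phi> z + \<phi> y * h z) + (-1) * P z) x y" .
        have l1: "loc_integrable \<Omega> (\<lambda>z. (f x * deriv \<phi> z + \<phi> y * h z) + (-1) * P z)"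
          by (intro loc_integrable_add loc_integrable_cmult l\<phi>' h lP)
        have l2: "loc_integrable \<Omega> (\<lambda>z. e * Q z)"
          using loc_integrable_add[OF lQ lQ, of "e - 1"] by (simp add: algebra_simps)
        have "\<bar>G y - G x\<bar> \<le> increment \<Omega> (\<lambda>z. \<bar>(f x * deriv \<phi> z + \<phi> y * h z) + (-1) * P z\<bar>) x y"
          unfolding Geq by (rule increment_bound_within[OF l1 xyO order_refl xy(2) order_refl])
        also have "\<dots> \<le> increment \<Omega> (\<lambda>z. e * Q z) x y"
        proof (rule increment_mono[OF loc_integrable_abs[OF l1] l2 xyO])
          fix z assume z: "x < z" "z \<le> y"
          have "(f x * deriv \<phi> z + \<phi> y * h z) + (-1) * P z = (f x - f z) * deriv \<phi> z + (\<phi> y - \<phi> z) * h z"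
            by (simp add: P_def algebra_simps)
          also have "\<bar>\<dots>\<bar> \<le> \<bar>f x - f z\<bar> * \<bar>deriv \<phi> z\<bar> + \<bar>\<phi> y - \<phi> z\<bar> * \<bar>h z\<bar>"
            by (metis abs_mult abs_triangle_ineq)
          also have "\<dots> \<le> e * \<bar>deriv \<phi> z\<bar> + e * \<bar>h z\<bar>"
            using d1(2)[of z x] d2(2)[of z y] z xy by (intro add_mono mult_right_mono) auto
          finally show "\<bar>(f x * deriv \<phi> z + \<phi> y * h z) + (-1) * P z\<bar> \<le> e * Q z"
            by (simp add: Q_def algebra_simps)
        qed
        also have "\<dots> = e * (M y - M x)" using increment_cmult eqM by simp
        finally show "\<bar>G y - G x\<bar> \<le> e * (M y - M x)" .
      qed (use cd d1 d2 in auto)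
    qed
    have "G d - G c = 0"
    proof (rule ccontr)
      assume "G d - G c \<noteq> 0"
      then have pos: "\<bar>G d - G c\<bar> > 0" by simp
      \<comment> \<open>The summand 1 keeps K positive. With the e below, \<open>small\<close>
        bounds the supposedly nonzero increment by half of itself.\<close>
      define K where "K = \<bar>M d - M c\<bar> + 1"
      define e where "e = \<bar>G d - G c\<bar> / (2 * K)"
      have K: "K > 0" by (simp add: K_def add_nonneg_pos)
      have e: "e > 0" unfolding e_def using pos K by (intro divide_pos_pos) auto
      have "\<bar>G d - G c\<bar> \<le> e * (M d - M c)" using small[OF e] .
      also have "\<dots> \<le> e * K" using e by (intro mult_left_mono) (auto simp: K_def)
      also have "\<dots> = \<bar>G d - G c\<bar> / 2" using K by (simp add: e_def field_simps)
      finally show False using pos by simp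
    qed
    then have "increment \<Omega> P c d = 0"
      using \<phi>0[of c] \<phi>0[of d] by (simp add: G_def)
    moreover have "increment \<Omega> P c d = (LINT x|lebesgue_on \<Omega>. P x)"
    proof (intro Bochner_Integration.integral_cong refl)
      fix x
      have "P x = 0" if "x \<notin> {c<..d}"
      proof -
        have "x \<notin> ?K" using that cd(4) by auto
        moreover from this have "\<phi> x = 0" using closure_subset[of "{x. \<phi> x \<noteq> 0}"] by auto
        ultimately show ?thesis using d\<phi>0[of x] by (simp add: P_def)
      qed
      then show "indicat_real {c<..d} x * P x = P x" by (auto simp: indicator_def)
    qed
    moreover have "(LINT x|lebesgue_on \<Omega>. P x)
        = (LINT x|lebesgue_on \<Omega>. f x * deriv \<phi> x) + (LINT x|lebesgue_on \<Omega>. h x * \<phi> x)"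
      unfolding P_def mult_1
    proof (rule Bochner_Integration.integral_add)
      show "integrable (lebesgue_on \<Omega>) (\<lambda>x. f x * deriv \<phi> x)"
        using d\<phi>0 by (intro integrable_mult_continuous[OF loc_integrable_continuous[OF fc] K \<phi>c(2)]) auto
      show "integrable (lebesgue_on \<Omega>) (\<lambda>x. h x * \<phi> x)"
        using closure_subset[of "{x. \<phi> x \<noteq> 0}"]
        by (intro integrable_mult_continuous[OF h K \<phi>c(1)]) auto
    qed
    ultimately show ?thesis by simp
  qed
  then show ?thesis
    using h loc_integrable_continuous[OF fc] by (auto simp: weak_derivative_iff)
qed

lemma weak_derivative_continuous_increment:
  assumes "weak_derivative \<Omega> f h" "continuous_on \<Omega> f" "c \<in> \<Omega>" "d \<in> \<Omega>" "c \<le> d"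
  shows "f d - f c = increment \<Omega> h c d"
  using assms by (intro weak_primitive_increment) (auto simp: weak_derivative_iff)

text \<open>Cut off to one interval (c, d], the integrals of h over rays are increments, so
  \<open>AE_eq_0_from_rays\<close> applies; countably many intervals with rational ends cover
  \<Omega>.\<close>

lemma AE_eq_0_from_increments:
  assumes h: "loc_integrable \<Omega> h"
    and z: "\<And>c d. c \<in> \<Omega> \<Longrightarrow> d \<in> \<Omega> \<Longrightarrow> c \<le> d \<Longrightarrow> increment \<Omega> h c d = 0"
  shows "AE x in lebesgue_on \<Omega>. h x = 0"
proof -
  have local: "AE x in lebesgue. x \<in> {c<..d} \<longrightarrow> h x = 0" if cd: "c \<in> \<Omega>" "d \<in> \<Omega>" "c \<le> d" for c d
  proof -
    define G where "G x = indicator {c<..d} x * h x" for x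
    have conv: "integrable (lebesgue_on \<Omega>) g \<longleftrightarrow> integrable lebesgue g"
      "(LINT x|lebesgue_on \<Omega>. g x) = (LINT x|lebesgue. g x)"
      if "\<And>x. x \<notin> {c<..d} \<Longrightarrow> g x = 0" for g :: "real \<Rightarrow> real"
    proof -
      have s: "{c<..d} \<subseteq> \<Omega>" using Icc_subset[OF cd(1,2)] by auto
      have z: "\<And>x. x \<notin> \<Omega> \<Longrightarrow> g x = 0" using that s by blast
      show "integrable (lebesgue_on \<Omega>) g \<longleftrightarrow> integrable lebesgue g"
        using lebesgue_on_restrict_support(1)[OF subset_UNIV sets_\<Omega>, of g] z
        by (simp add: lebesgue_on_UNIV_eq)
      show "(LINT x|lebesgue_on \<Omega>. g x) = (LINT x|lebesgue. g x)"
        using lebesgue_on_restrict_support(2)[OF subset_UNIV sets_\<Omega>, of g] z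
        by (simp add: lebesgue_on_UNIV_eq)
    qed
    have "AE x in lebesgue. G x = 0"
    proof (rule AE_eq_0_from_rays)
      show "integrable lebesgue G"
        using integrable_increment[OF h cd(1,2)] conv(1)[of G] by (auto simp: G_def[abs_def])
      fix r
      have "(LINT x|lebesgue. indicator {r<..} x * G x) = (LINT x|lebesgue_on \<Omega>. indicator {r<..} x * G x)"
        by (rule conv(2)[symmetric]) (simp add: G_def)
      \<comment> \<open>A ray meets (c, d] in a half-open interval with right end d, which is empty
        if r lies beyond d.\<close>
      also have "\<dots> = increment \<Omega> h (min d (max r c)) d"
        by (intro Bochner_Integration.integral_cong) (use cd in \<open>auto simp: G_def indicator_def\<close>)
      also have "\<dots> = 0"
        by (rule z) (use cd Icc_subset[OF cd(1,2)] in auto)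
      finally show "(LINT x|lebesgue. indicator {r<..} x * G x) = 0" .
    qed
    then show ?thesis by eventually_elim (auto simp: G_def)
  qed
  have "AE x in lebesgue. \<forall>c\<in>\<rat>\<inter>\<Omega>. \<forall>d\<in>\<rat>\<inter>\<Omega>. c \<le> d \<longrightarrow> x \<in> {c<..d} \<longrightarrow> h x = 0"
  proof (subst AE_ball_countable)
    show "countable (\<rat> \<inter> \<Omega>)" using countable_rat by blast
    show "\<forall>c\<in>\<rat> \<inter> \<Omega>. AE x in lebesgue. \<forall>d\<in>\<rat>\<inter>\<Omega>. c \<le> d \<longrightarrow> x \<in> {c<..d} \<longrightarrow> h x = 0"
    proof
      fix c assume c: "c \<in> \<rat> \<inter> \<Omega>"
      show "AE x in lebesgue. \<forall>d\<in>\<rat>\<inter>\<Omega>. c \<le> d \<longrightarrow> x \<in> {c<..d} \<longrightarrow> h x = 0"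
      proof (subst AE_ball_countable)
        show "countable (\<rat> \<inter> \<Omega>)" using countable_rat by blast
        show "\<forall>d\<in>\<rat> \<inter> \<Omega>. AE x in lebesgue. c \<le> d \<longrightarrow> x \<in> {c<..d} \<longrightarrow> h x = 0"
        proof
          fix d assume d: "d \<in> \<rat> \<inter> \<Omega>"
          show "AE x in lebesgue. c \<le> d \<longrightarrow> x \<in> {c<..d} \<longrightarrow> h x = 0"
            using local[of c d] c d by (cases "c \<le> d") auto
        qed
      qed
    qed
  qed
  then have "AE x in lebesgue. x \<in> \<Omega> \<longrightarrow> h x = 0"
  proof eventually_elim
    case (elim x)
    show ?case
    proof
      assume x: "x \<in> \<Omega>"
      obtain e1 where e1: "e1 > 0" "x - e1 \<in> \<Omega>" using extend_left[OF x] .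
      obtain e2 where e2: "e2 > 0" "x + e2 \<in> \<Omega>" using extend_right[OF x] .
      obtain c where c: "c \<in> \<rat>" "x - e1 < c" "c < x" using Rats_dense_in_real[of "x - e1" x] e1 by auto
      obtain d where d: "d \<in> \<rat>" "x < d" "d < x + e2" using Rats_dense_in_real[of x "x + e2"] e2 by auto
      have "c \<in> \<Omega>" "d \<in> \<Omega>" using Icc_subset[OF e1(2) e2(2)] c d by auto
      then show "h x = 0" using elim c d by (meson IntI greaterThanAtMost_iff less_imp_le less_trans)
    qed
  qed
  then show ?thesis by (simp add: AE_lebesgue_on_iff)
qed

text \<open>The difference of two weak derivatives of f is a weak derivative of the constant 0, so
  all its increments vanish.\<close>

lemma weak_derivative_unique:
  assumes "weak_derivative \<Omega> f g1" "weak_derivative \<Omega> f g2"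
  shows "AE x in lebesgue_on \<Omega>. g1 x = g2 x"
proof -
  have l: "loc_integrable \<Omega> (\<lambda>x. g1 x + (-1) * g2 x)"
    using assms by (intro loc_integrable_add) (auto simp: weak_derivative_iff)
  have "AE x in lebesgue_on \<Omega>. g1 x + (-1) * g2 x = 0"
  proof (rule AE_eq_0_from_increments[OF l])
    fix c d assume cd: "c \<in> \<Omega>" "d \<in> \<Omega>" "c \<le> d"
    have "(\<lambda>x. 0::real) d - (\<lambda>x. 0) c = increment \<Omega> (\<lambda>x. g1 x + (-1) * g2 x) c d"
    proof (rule weak_primitive_increment[OF _ l _ cd])
      fix \<phi> assume t: "test_function \<Omega> \<phi>"
      have i: "integrable (lebesgue_on \<Omega>) (\<lambda>x. g x * \<phi> x)" if "loc_integrable \<Omega> g" for g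
        using t closure_subset[of "{x. \<phi> x \<noteq> 0}"]
        by (intro integrable_mult_continuous[OF that, of "closure {x. \<phi> x \<noteq> 0}"])
           (auto simp: test_function_iff intro: smooth_continuous_on)
      have "(LINT x|lebesgue_on \<Omega>. g1 x * \<phi> x) = (LINT x|lebesgue_on \<Omega>. g2 x * \<phi> x)"
        using assms t by (simp add: weak_derivative_iff)
      then have "(LINT x|lebesgue_on \<Omega>. g1 x * \<phi> x - g2 x * \<phi> x) = 0"
        using i assms by (simp add: weak_derivative_iff)
      then show "(LINT x|lebesgue_on \<Omega>. 0 * deriv \<phi> x) = - (LINT x|lebesgue_on \<Omega>. (g1 x + - 1 * g2 x) * \<phi> x)"
        by (simp add: left_diff_distrib)
    qed simp
    then show "increment \<Omega> (\<lambda>x. g1 x + (-1) * g2 x) c d = 0" by simp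
  qed
  then show ?thesis by eventually_elim simp
qed

section \<open>Weak derivatives and Sobolev functions up to null sets\<close>

lemma weak_derivative_AE_cong:
  assumes "weak_derivative \<Omega> f g" "AE x in lebesgue_on \<Omega>. f x = f2 x" "AE x in lebesgue_on \<Omega>. g x = g2 x"
  shows "weak_derivative \<Omega> f2 g2"
proof -
  have l: "loc_integrable \<Omega> k2" if "loc_integrable \<Omega> k" "AE x in lebesgue_on \<Omega>. k x = k2 x" for k k2
    unfolding loc_integrable_def
  proof (intro allI impI)
    fix K assume K: "compact K \<and> K \<subseteq> \<Omega>"
    show "integrable (lebesgue_on K) k2"
      by (rule integrable_lebesgue_on_AE_cong[of K k])
         (use that K in \<open>auto simp: loc_integrable_def sets_compact intro: AE_lebesgue_on_subset\<close>)
  qed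
  show ?thesis unfolding weak_derivative_iff
  proof (intro conjI allI impI)
    show "loc_integrable \<Omega> f2" "loc_integrable \<Omega> g2"
      using assms l by (auto simp: weak_derivative_iff)
    fix \<phi> assume t: "test_function \<Omega> \<phi>"
    have "(LINT x|lebesgue_on \<Omega>. f x * deriv \<phi> x) = (LINT x|lebesgue_on \<Omega>. f2 x * deriv \<phi> x)"
      "(LINT x|lebesgue_on \<Omega>. g x * \<phi> x) = (LINT x|lebesgue_on \<Omega>. g2 x * \<phi> x)"
      using assms by (auto intro!: LINT_lebesgue_on_AE_cong elim: eventually_mono)
    with assms(1) t show "(LINT x|lebesgue_on \<Omega>. f2 x * deriv \<phi> x) = - (LINT x|lebesgue_on \<Omega>. g2 x * \<phi> x)"
      by (simp add: weak_derivative_iff)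
  qed
qed

lemma weak_derivative_wd: "weak_derivative \<Omega> f g \<Longrightarrow> weak_derivative \<Omega> f (wd \<Omega> f)"
  using someI[of "weak_derivative \<Omega> f" g] by (simp add: wd_def)

lemma wd_AE_eq: "weak_derivative \<Omega> f g \<Longrightarrow> AE x in lebesgue_on \<Omega>. wd \<Omega> f x = g x"
  using weak_derivative_unique weak_derivative_wd by blast

lemma weak_derivative_linear:
  assumes "weak_derivative \<Omega> f f'" "weak_derivative \<Omega> g g'"
  shows "weak_derivative \<Omega> (\<lambda>x. f x + c * g x) (\<lambda>x. f' x + c * g' x)"
  unfolding weak_derivative_iff
proof (intro conjI allI impI)
  show "loc_integrable \<Omega> (\<lambda>x. f x + c * g x)" "loc_integrable \<Omega> (\<lambda>x. f' x + c * g' x)"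
    using assms by (auto simp: weak_derivative_iff intro: loc_integrable_add)
  fix \<phi> assume t: "test_function \<Omega> \<phi>"
  let ?K = "closure {x. \<phi> x \<noteq> 0}"
  have K: "compact ?K" "?K \<subseteq> \<Omega>" "smooth \<phi>" using t by (auto simp: test_function_iff)
  have "deriv \<phi> x = 0" if "x \<notin> ?K" for x
  proof -
    have "(\<phi> has_real_derivative 0) (at x)"
      by (rule has_field_derivative_transform_within_open[where S="- ?K" and f="\<lambda>_. 0"])
         (use that closure_subset[of "{x. \<phi> x \<noteq> 0}"] in auto)
    then show ?thesis by (rule DERIV_imp_deriv)
  qed
  then have i1: "integrable (lebesgue_on \<Omega>) (\<lambda>x. k x * deriv \<phi> x)" if "loc_integrable \<Omega> k" for k
    using K by (intro integrable_mult_continuous[OF that K(1,2)] smooth_continuous_on smooth_deriv) auto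
  have i2: "integrable (lebesgue_on \<Omega>) (\<lambda>x. k x * \<phi> x)" if "loc_integrable \<Omega> k" for k
    using K closure_subset[of "{x. \<phi> x \<noteq> 0}"]
    by (intro integrable_mult_continuous[OF that K(1,2)] smooth_continuous_on) auto
  show "(LINT x|lebesgue_on \<Omega>. (f x + c * g x) * deriv \<phi> x) = - (LINT x|lebesgue_on \<Omega>. (f' x + c * g' x) * \<phi> x)"
    using assms t i1 i2 by (simp add: weak_derivative_iff distrib_right mult.assoc)
qed

lemma sobolev_L2: "f \<in> sobolev m \<Omega> \<Longrightarrow> k \<le> m \<Longrightarrow> square_integrable (lebesgue_on \<Omega>) ((wd \<Omega> ^^ k) f)"
  by (simp add: sobolev_def L2_fun_iff)

text \<open>\<open>wd\<close> picks a representative by choice and is therefore linear only up to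
  null sets; the induction over the order carries an equality almost everywhere.\<close>

lemma sobolev_linear:
  assumes f: "f \<in> sobolev m \<Omega>" and g: "g \<in> sobolev m \<Omega>"
  shows "(\<lambda>x. f x + c * g x) \<in> sobolev m \<Omega>"
    and "k \<le> m \<Longrightarrow> AE x in lebesgue_on \<Omega>. (wd \<Omega> ^^ k) (\<lambda>x. f x + c * g x) x
           = (wd \<Omega> ^^ k) f x + c * (wd \<Omega> ^^ k) g x"
proof -
  let ?s = "\<lambda>x. f x + c * g x"
  let ?S = "\<lambda>k x. (wd \<Omega> ^^ k) f x + c * (wd \<Omega> ^^ k) g x"
  have w: "weak_derivative \<Omega> (?S k) (?S (Suc k))" if "k < m" for k
    using f g that by (intro weak_derivative_linear) (auto simp: sobolev_def)
  have eq: "AE x in lebesgue_on \<Omega>. (wd \<Omega> ^^ k) ?s x = ?S k x" if "k \<le> m" for k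
    using that
  proof (induction k)
    case (Suc k)
    then have "weak_derivative \<Omega> ((wd \<Omega> ^^ k) ?s) (?S (Suc k))"
      using w[of k] by (intro weak_derivative_AE_cong[OF w[of k]]) (auto elim: eventually_mono)
    from wd_AE_eq[OF this] show ?case by simp
  qed simp
  have wd: "weak_derivative \<Omega> ((wd \<Omega> ^^ k) ?s) ((wd \<Omega> ^^ Suc k) ?s)" if "k < m" for k
    using eq[of k] eq[of "Suc k"] that
    by (intro weak_derivative_AE_cong[OF w[OF that]]) (auto elim: eventually_mono)
  have "square_integrable (lebesgue_on \<Omega>) ((wd \<Omega> ^^ k) ?s)" if "k \<le> m" for k
  proof -
    have s: "square_integrable (lebesgue_on \<Omega>) (?S k)"
      using f g that by (intro square_integrable_add square_integrable_cmult sobolev_L2)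
    have e: "AE x in lebesgue_on \<Omega>. ?S k x = (wd \<Omega> ^^ k) ?s x"
      using eq[OF that] by (auto elim: eventually_mono)
    show ?thesis
      using s e by (intro square_integrable_AE_cong[OF s] borel_measurable_lebesgue_on_AE_cong[OF _ sets_\<Omega> e]) auto
  qed
  with wd show "?s \<in> sobolev m \<Omega>" by (simp add: sobolev_def L2_fun_iff)
  show "k \<le> m \<Longrightarrow> AE x in lebesgue_on \<Omega>. (wd \<Omega> ^^ k) ?s x = ?S k x" by (rule eq)
qed

section \<open>Inner product and norm of the Sobolev spaces\<close>

lemma Hinner_commute: "Hinner m \<Omega> f g = Hinner m \<Omega> g f"
  by (simp add: Hinner_def mult.commute)

lemma Hinner_linear:
  assumes f: "f \<in> sobolev m \<Omega>" and g: "g \<in> sobolev m \<Omega>" and h: "h \<in> sobolev m \<Omega>"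
  shows "Hinner m \<Omega> (\<lambda>x. f x + c * g x) h = Hinner m \<Omega> f h + c * Hinner m \<Omega> g h"
proof -
  have "(LINT x|lebesgue_on \<Omega>. (wd \<Omega> ^^ k) (\<lambda>x. f x + c * g x) x * (wd \<Omega> ^^ k) h x)
    = (LINT x|lebesgue_on \<Omega>. (wd \<Omega> ^^ k) f x * (wd \<Omega> ^^ k) h x)
      + c * (LINT x|lebesgue_on \<Omega>. (wd \<Omega> ^^ k) g x * (wd \<Omega> ^^ k) h x)" if "k \<le> m" for k
  proof -
    have "(LINT x|lebesgue_on \<Omega>. (wd \<Omega> ^^ k) (\<lambda>x. f x + c * g x) x * (wd \<Omega> ^^ k) h x)
      = (LINT x|lebesgue_on \<Omega>. (wd \<Omega> ^^ k) f x * (wd \<Omega> ^^ k) h x + c * ((wd \<Omega> ^^ k) g x * (wd \<Omega> ^^ k) h x))"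
      using sobolev_linear(2)[OF f g that, of c]
      by (intro LINT_lebesgue_on_AE_cong) (auto elim!: eventually_mono simp: algebra_simps)
    then show ?thesis
      using f g h that by (simp add: square_integrable_mult sobolev_L2)
  qed
  then show ?thesis
    by (simp add: Hinner_def sum.distrib sum_distrib_left)
qed

lemma Hinner_self_nonneg: "Hinner m \<Omega> f f \<ge> 0"
  unfolding Hinner_def by (intro sum_nonneg integral_nonneg_AE) auto

lemma Hnorm_nonneg [simp]: "Hnorm m \<Omega> f \<ge> 0"
  by (simp add: Hnorm_def Hinner_self_nonneg)

lemma Hnorm_power2: "(Hnorm m \<Omega> f)\<^sup>2 = Hinner m \<Omega> f f"
  by (simp add: Hnorm_def Hinner_self_nonneg)

lemma Hnorm_power2_sum: "(Hnorm m \<Omega> f)\<^sup>2 = (\<Sum>k\<le>m. (norm2 (lebesgue_on \<Omega>) ((wd \<Omega> ^^ k) f))\<^sup>2)"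
  unfolding Hnorm_power2 Hinner_def norm2_power2 by (simp add: power2_eq_square)

lemma norm2_le_Hnorm: "k \<le> m \<Longrightarrow> norm2 (lebesgue_on \<Omega>) ((wd \<Omega> ^^ k) f) \<le> Hnorm m \<Omega> f"
  by (rule power2_le_imp_le, subst Hnorm_power2_sum)
     (auto intro!: member_le_sum[of k "{..m}" "\<lambda>k. (norm2 (lebesgue_on \<Omega>) ((wd \<Omega> ^^ k) f))\<^sup>2"])

text \<open>Cauchy-Schwarz twice: for the integral of each order, and for the finite sum over the
  orders.\<close>

lemma Hinner_Cauchy_Schwarz:
  assumes f: "f \<in> sobolev m \<Omega>" and g: "g \<in> sobolev m \<Omega>"
  shows "\<bar>Hinner m \<Omega> f g\<bar> \<le> Hnorm m \<Omega> f * Hnorm m \<Omega> g"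
proof -
  let ?n = "\<lambda>f k. norm2 (lebesgue_on \<Omega>) ((wd \<Omega> ^^ k) f)"
  have "\<bar>Hinner m \<Omega> f g\<bar> \<le> (\<Sum>k\<le>m. \<bar>LINT x|lebesgue_on \<Omega>. (wd \<Omega> ^^ k) f x * (wd \<Omega> ^^ k) g x\<bar>)"
    unfolding Hinner_def by (rule sum_abs)
  also have "\<dots> \<le> (\<Sum>k\<le>m. ?n f k * ?n g k)"
    using f g by (intro sum_mono Cauchy_Schwarz_norm2 sobolev_L2) auto
  also have "\<dots> \<le> Hnorm m \<Omega> f * Hnorm m \<Omega> g"
  proof (rule power2_le_imp_le)
    show "(\<Sum>k\<le>m. ?n f k * ?n g k)\<^sup>2 \<le> (Hnorm m \<Omega> f * Hnorm m \<Omega> g)\<^sup>2"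
      unfolding power_mult_distrib Hnorm_power2_sum by (rule Cauchy_Schwarz_ineq_sum)
  qed simp
  finally show ?thesis .
qed

lemma Hnorm_add_le:
  assumes f: "f \<in> sobolev m \<Omega>" and g: "g \<in> sobolev m \<Omega>"
  shows "Hnorm m \<Omega> (\<lambda>x. f x + c * g x) \<le> Hnorm m \<Omega> f + \<bar>c\<bar> * Hnorm m \<Omega> g"
proof (rule power2_le_imp_le)
  have s: "(\<lambda>x. f x + c * g x) \<in> sobolev m \<Omega>" using sobolev_linear(1)[OF f g] .
  let ?s = "\<lambda>x. f x + c * g x"
  have "Hinner m \<Omega> f ?s = Hinner m \<Omega> f f + c * Hinner m \<Omega> g f"
    by (subst Hinner_commute) (rule Hinner_linear[OF f g f])
  moreover have "Hinner m \<Omega> g ?s = Hinner m \<Omega> f g + c * Hinner m \<Omega> g g"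
    by (subst Hinner_commute) (rule Hinner_linear[OF f g g])
  moreover have "Hinner m \<Omega> g f = Hinner m \<Omega> f g" by (rule Hinner_commute)
  ultimately have "(Hnorm m \<Omega> ?s)\<^sup>2 = Hinner m \<Omega> f f + 2 * c * Hinner m \<Omega> f g + c\<^sup>2 * Hinner m \<Omega> g g"
    unfolding Hnorm_power2 using Hinner_linear[OF f g s, of c] by (simp add: power2_eq_square algebra_simps)
  also have "\<dots> \<le> (Hnorm m \<Omega> f + \<bar>c\<bar> * Hnorm m \<Omega> g)\<^sup>2"
  proof -
    have "c * Hinner m \<Omega> f g \<le> \<bar>c\<bar> * (Hnorm m \<Omega> f * Hnorm m \<Omega> g)"
      using Hinner_Cauchy_Schwarz[OF f g] by (metis abs_ge_self abs_ge_zero abs_mult mult_left_mono order_trans)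
    then show ?thesis by (simp add: power2_sum power_mult_distrib Hnorm_power2 algebra_simps)
  qed
  finally show "(Hnorm m \<Omega> (\<lambda>x. f x + c * g x))\<^sup>2 \<le> (Hnorm m \<Omega> f + \<bar>c\<bar> * Hnorm m \<Omega> g)\<^sup>2" .
qed simp

end

section \<open>Primitives of square integrable functions on a bounded interval\<close>

locale bounded_interval =
  fixes a b :: real
  assumes ab: "a < b"
begin

abbreviation "\<Omega> \<equiv> {a<..<b}"
abbreviation "LL \<equiv> lebesgue_on {a<..<b}"

sublocale open_interval "{a<..<b}"
  by standard (auto simp: is_interval_1)

lemma finite_measure_LL: "finite_measure LL"
  by (intro finite_measure_lebesgue_on) auto

lemma indicator_measurable_LL [measurable]: "indicat_real {c<..d} \<in> borel_measurable LL"
  by (intro measurable_restrict_space1 borel_measurable_indicator) simp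

lemma integral_indicator_LL:
  assumes "a \<le> c" "c \<le> d" "d \<le> b"
  shows "(LINT x|LL. indicat_real {c<..d} x) = d - c"
proof -
  have "(LINT x|LL. indicat_real {c<..d} x) = measure LL ({c<..d} \<inter> {a<..<b})" by simp
  also have "\<dots> = measure lebesgue ({c<..d} \<inter> {a<..<b})"
    by (rule measure_restrict_space) auto
  also have "\<dots> = d - c"
  proof (cases "d < b")
    case True
    then have "{c<..d} \<inter> {a<..<b} = {c<..d}" using assms by auto
    then show ?thesis using assms by simp
  next
    case False
    then have "{c<..d} \<inter> {a<..<b} = {c<..<d}" using assms by auto
    then show ?thesis using assms by simp
  qed
  finally show ?thesis .
qed

lemma square_integrable_bounded:
  assumes "f \<in> borel_measurable LL" "\<And>x. x \<in> \<Omega> \<Longrightarrow> \<bar>f x\<bar> \<le> B"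
  shows "square_integrable LL f"
proof -
  have "integrable LL (\<lambda>x. (f x)\<^sup>2)"
  proof (rule finite_measure.integrable_const_bound[OF finite_measure_LL, of _ "B\<^sup>2"])
    show "AE x in LL. norm ((f x)\<^sup>2) \<le> B\<^sup>2"
      using assms(2) by (intro AE_I2) (auto simp: abs_le_square_iff[symmetric] intro: order_trans[OF _ abs_ge_self])
  qed (use assms in auto)
  then show ?thesis using assms by (simp add: square_integrable_def)
qed

lemma square_integrable_const: "square_integrable LL (\<lambda>x. c)"
  by (rule square_integrable_bounded[of _ "\<bar>c\<bar>"]) auto

lemma square_integrable_indicator: "square_integrable LL (indicat_real {c<..d})"
  by (rule square_integrable_bounded[of _ 1]) (auto simp: indicator_def)

lemma square_integrable_integrable: "square_integrable LL h \<Longrightarrow> integrable LL h"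
  using square_integrable_mult[OF square_integrable_const[of 1]] by simp

lemma integrable_indicator_times:
  fixes h :: "real \<Rightarrow> real"
  assumes h: "integrable LL h" and A: "indicat_real A \<in> borel_measurable LL"
  shows "integrable LL (\<lambda>x. indicat_real A x * h x)"
proof (rule Bochner_Integration.integrable_bound[OF h])
  show "(\<lambda>x. indicat_real A x * h x) \<in> borel_measurable LL"
    using A h by (intro borel_measurable_times) auto
qed (auto simp: indicator_def)

lemma integrable_loc_integrable:
  assumes "integrable LL h" shows "loc_integrable \<Omega> h"
  unfolding loc_integrable_def
proof (intro allI impI)
  fix K assume K: "compact K \<and> K \<subseteq> \<Omega>"
  have "indicat_real K \<in> borel_measurable LL"
    using K by (intro measurable_restrict_space1 borel_measurable_indicator) (simp add: sets_compact)
  then have "integrable LL (\<lambda>x. indicat_real K x * h x)"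
    by (rule integrable_indicator_times[OF assms])
  then have "integrable (lebesgue_on K) (\<lambda>x. indicat_real K x * h x)"
    using K by (subst (asm) lebesgue_on_restrict_support(1)[of K]) (auto simp: sets_compact)
  moreover have "integrable (lebesgue_on K) (\<lambda>x. indicat_real K x * h x) \<longleftrightarrow> integrable (lebesgue_on K) h"
    by (intro Bochner_Integration.integrable_cong) auto
  ultimately show "integrable (lebesgue_on K) h" by simp
qed

lemma square_integrable_loc_integrable: "square_integrable LL h \<Longrightarrow> loc_integrable \<Omega> h"
  by (intro integrable_loc_integrable square_integrable_integrable)

lemma integrable_increment': "integrable LL h \<Longrightarrow> integrable LL (\<lambda>x. indicat_real {c<..d} x * h x)"
  by (rule integrable_indicator_times) auto

lemma increment_add':
  assumes "integrable LL h" "c \<le> d" "d \<le> e"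
  shows "increment \<Omega> h c e = increment \<Omega> h c d + increment \<Omega> h d e"
proof -
  have "increment \<Omega> h c e = (LINT x|LL. indicator {c<..d} x * h x + indicator {d<..e} x * h x)"
    by (intro Bochner_Integration.integral_cong) (use assms in \<open>auto simp: indicator_def\<close>)
  also have "\<dots> = increment \<Omega> h c d + increment \<Omega> h d e"
    using assms by (intro Bochner_Integration.integral_add integrable_increment')
  finally show ?thesis .
qed

lemma norm2_indicator:
  assumes "a \<le> c" "c \<le> d" "d \<le> b"
  shows "norm2 LL (indicat_real {c<..d}) = sqrt (d - c)"
proof -
  have "(\<lambda>x. (indicat_real {c<..d} x)\<^sup>2) = indicat_real {c<..d}" by (auto simp: fun_eq_iff indicator_def)
  then show ?thesis unfolding norm2_def using integral_indicator_LL[OF assms] by simp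
qed

lemma norm2_const: "norm2 LL (\<lambda>x. c) = \<bar>c\<bar> * sqrt (b - a)"
proof -
  have "norm2 LL (\<lambda>x. c) = norm2 LL (\<lambda>x. c * indicat_real {a<..b} x)"
    unfolding norm2_def by (intro arg_cong[where f=sqrt] Bochner_Integration.integral_cong) (auto simp: indicator_def)
  then show ?thesis using norm2_indicator[of a b] ab by (simp add: norm2_cmult)
qed

lemma increment_le_norm2:
  assumes "square_integrable LL h" "a \<le> c" "c \<le> d" "d \<le> b"
  shows "\<bar>increment \<Omega> h c d\<bar> \<le> sqrt (d - c) * norm2 LL h"
  using Cauchy_Schwarz_norm2[OF square_integrable_indicator assms(1), of c d] norm2_indicator[OF assms(2-)] by simp

lemma norm2_mono:
  assumes f: "f \<in> borel_measurable LL" and g: "square_integrable LL g" and le: "\<And>x. x \<in> \<Omega> \<Longrightarrow> \<bar>f x\<bar> \<le> \<bar>g x\<bar>"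
  shows "square_integrable LL f" "norm2 LL f \<le> norm2 LL g"
proof -
  have sq: "(f x)\<^sup>2 \<le> (g x)\<^sup>2" if "x \<in> \<Omega>" for x using le[OF that] by (simp add: abs_le_square_iff)
  have i: "integrable LL (\<lambda>x. (f x)\<^sup>2)"
  proof (rule Bochner_Integration.integrable_bound[OF square_integrable_square[OF g]])
    show "AE x in LL. norm ((f x)\<^sup>2) \<le> norm ((g x)\<^sup>2)" using sq by (intro AE_I2) auto
  qed (use f in auto)
  then show "square_integrable LL f" using f by (simp add: square_integrable_def)
  show "norm2 LL f \<le> norm2 LL g"
    unfolding norm2_def using sq
    by (intro real_sqrt_le_mono integral_mono i square_integrable_square[OF g]) auto
qed

section \<open>Dyadic difference quotients\<close>

definition mesh :: "nat \<Rightarrow> real" where "mesh k = (b - a) / 2 ^ k"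

definition pt :: "nat \<Rightarrow> nat \<Rightarrow> real" where "pt k j = a + real j * mesh k"

definition slope :: "nat \<Rightarrow> (real \<Rightarrow> real) \<Rightarrow> nat \<Rightarrow> real" where
  "slope k F j = (F (pt k (Suc j)) - F (pt k j)) / mesh k"

text \<open>If F is a primitive of h, this is the conditional expectation of h with respect to the
  dyadic cells of level k.\<close>

definition step :: "nat \<Rightarrow> (real \<Rightarrow> real) \<Rightarrow> real \<Rightarrow> real" where
  "step k F x = (\<Sum>j<2^k. slope k F j * indicator {pt k j<..pt k (Suc j)} x)"

text \<open>The squared \<open>L\<^sup>2\<close> norm of \<open>step k F\<close>. It involves only
  finitely many values of F and so passes to pointwise limits of F.\<close>

definition energy :: "nat \<Rightarrow> (real \<Rightarrow> real) \<Rightarrow> real" where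
  "energy k F = (\<Sum>j<2^k. (F (pt k (Suc j)) - F (pt k j))\<^sup>2 / mesh k)"

lemma mesh_pos: "mesh k > 0" using ab by (simp add: mesh_def)

lemma pt_0: "pt k 0 = a" and pt_last: "pt k (2^k) = b"
  by (auto simp: pt_def mesh_def)

lemma pt_mono: "i \<le> j \<Longrightarrow> pt k i \<le> pt k j"
  using mesh_pos[of k] by (simp add: pt_def mult_right_mono)

lemma pt_bounds: "j \<le> 2^k \<Longrightarrow> a \<le> pt k j" "j \<le> 2^k \<Longrightarrow> pt k j \<le> b"
  using pt_mono[of 0 j k] pt_mono[of j "2^k" k] by (auto simp: pt_0 pt_last)

lemma pt_Suc: "pt k (Suc j) - pt k j = mesh k"
  by (simp add: pt_def algebra_simps)

lemma pt_refine: assumes "k \<le> l" shows "pt k j = pt l (j * 2^(l-k))"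
proof -
  have "mesh k = 2^(l-k) * mesh l"
    using assms by (simp add: mesh_def power_diff)
  then show ?thesis by (simp add: pt_def)
qed

lemma square_integrable_step: "square_integrable LL (step k F)"
  unfolding step_def[abs_def]
  by (intro square_integrable_sum square_integrable_cmult square_integrable_indicator)

lemma integral_step_mult:
  assumes h: "integrable LL h"
  shows "(LINT x|LL. step k F x * h x) = (\<Sum>j<2^k. slope k F j * increment \<Omega> h (pt k j) (pt k (Suc j)))"
proof -
  have "(LINT x|LL. step k F x * h x)
     = (LINT x|LL. (\<Sum>j<2^k. slope k F j * (indicator {pt k j<..pt k (Suc j)} x * h x)))"
    by (simp only: step_def sum_distrib_right mult.assoc)
  also have "\<dots> = (\<Sum>j<2^k. LINT x|LL. slope k F j * (indicator {pt k j<..pt k (Suc j)} x * h x))"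
    by (intro Bochner_Integration.integral_sum integrable_mult_right integrable_increment' h)
  finally show ?thesis by simp
qed

lemma increment_step_cell:
  assumes i: "i < 2^l"
  shows "increment \<Omega> (step l F) (pt l i) (pt l (Suc i)) = F (pt l (Suc i)) - F (pt l i)"
proof -
  have "indicator {pt l i<..pt l (Suc i)} x * step l F x = slope l F i * indicator {pt l i<..pt l (Suc i)} x" for x
  proof (cases "x \<in> {pt l i<..pt l (Suc i)}")
    case True
    have "indicat_real {pt l j<..pt l (Suc j)} x = 0" if "j \<noteq> i" for j
    proof (cases "j < i")
      case True
      then have "pt l (Suc j) \<le> pt l i" by (intro pt_mono) simp
      then show ?thesis using \<open>x \<in> {pt l i<..pt l (Suc i)}\<close> by (auto simp: indicator_def)
    next
      case False
      then have "pt l (Suc i) \<le> pt l j" using that by (intro pt_mono) simp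
      then show ?thesis using \<open>x \<in> {pt l i<..pt l (Suc i)}\<close> by (auto simp: indicator_def)
    qed
    then have "step l F x = (\<Sum>j<2^l. if j = i then slope l F i else 0)"
      unfolding step_def using True by (intro sum.cong) (auto simp: indicator_def)
    also have "\<dots> = slope l F i" using i by simp
    finally show ?thesis using True by simp
  qed simp
  then have "increment \<Omega> (step l F) (pt l i) (pt l (Suc i)) = (LINT x|LL. slope l F i * indicator {pt l i<..pt l (Suc i)} x)"
    by (simp only:)
  also have "\<dots> = slope l F i * (LINT x|LL. indicator {pt l i<..pt l (Suc i)} x)"
    by (rule integral_mult_right_zero)
  also have "(LINT x|LL. indicat_real {pt l i<..pt l (Suc i)} x) = mesh l"
    using integral_indicator_LL[of "pt l i" "pt l (Suc i)"] i pt_Suc[of l i] pt_mono[of i "Suc i" l] pt_bounds[of i l] pt_bounds[of "Suc i" l]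
    by simp
  finally show ?thesis using mesh_pos[of l] by (simp add: slope_def)
qed

lemma increment_step_level:
  assumes "i \<le> 2^l"
  shows "increment \<Omega> (step l F) a (pt l i) = F (pt l i) - F a"
  using assms
proof (induction i)
  case (Suc i)
  have "increment \<Omega> (step l F) a (pt l (Suc i)) = increment \<Omega> (step l F) a (pt l i) + increment \<Omega> (step l F) (pt l i) (pt l (Suc i))"
    using Suc.prems by (intro increment_add' square_integrable_integrable square_integrable_step pt_bounds pt_mono) auto
  then show ?case using Suc increment_step_cell[of i l F] by simp
qed (simp add: pt_0)

text \<open>Finer difference quotients reproduce the increments of F between coarser dyadic points:
  the martingale property.\<close>

lemma increment_step:
  assumes "k \<le> l" "j \<le> 2^k"
  shows "increment \<Omega> (step l F) a (pt k j) = F (pt k j) - F a"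
proof -
  have "j * 2^(l-k) \<le> 2^k * 2^(l-k)" using assms by (intro mult_right_mono) auto
  also have "\<dots> = (2::nat)^l" using assms by (simp flip: power_add)
  finally show ?thesis using increment_step_level[of "j * 2^(l-k)" l F] pt_refine[OF assms(1)] by simp
qed

lemma increment_step_pt:
  assumes "k \<le> l" "j < 2^k"
  shows "increment \<Omega> (step l F) (pt k j) (pt k (Suc j)) = F (pt k (Suc j)) - F (pt k j)"
proof -
  have "increment \<Omega> (step l F) a (pt k (Suc j)) = increment \<Omega> (step l F) a (pt k j) + increment \<Omega> (step l F) (pt k j) (pt k (Suc j))"
    using assms by (intro increment_add' square_integrable_integrable square_integrable_step pt_bounds pt_mono) auto
  then show ?thesis using increment_step[of k l j F] increment_step[of k l "Suc j" F] assms by simp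
qed

lemma integral_step_energy:
  assumes h: "integrable LL h"
    and inc: "\<And>j. j < 2^k \<Longrightarrow> increment \<Omega> h (pt k j) (pt k (Suc j)) = F (pt k (Suc j)) - F (pt k j)"
  shows "(LINT x|LL. step k F x * h x) = energy k F"
  unfolding integral_step_mult[OF h] energy_def
  by (intro sum.cong refl) (simp add: inc slope_def power2_eq_square)

lemma integral_step_step: "k \<le> l \<Longrightarrow> (LINT x|LL. step k F x * step l F x) = energy k F"
  by (intro integral_step_energy square_integrable_integrable square_integrable_step increment_step_pt)

lemma norm2_step: "(norm2 LL (step k F))\<^sup>2 = energy k F"
  unfolding norm2_power2 using integral_step_step[of k k F] by (simp add: power2_eq_square)

text \<open>Pythagoras: h and \<open>step k F\<close> have the same integral over every cell of
  level k, so their difference is orthogonal to functions constant on these cells.\<close>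

lemma norm2_diff_step:
  assumes h: "square_integrable LL h"
    and inc: "\<And>j. j < 2^k \<Longrightarrow> increment \<Omega> h (pt k j) (pt k (Suc j)) = F (pt k (Suc j)) - F (pt k j)"
  shows "(norm2 LL (\<lambda>x. h x - step k F x))\<^sup>2 = (norm2 LL h)\<^sup>2 - energy k F"
proof -
  have "(norm2 LL (\<lambda>x. h x - step k F x))\<^sup>2
    = (LINT x|LL. (h x)\<^sup>2 - 2 * (step k F x * h x) + (step k F x)\<^sup>2)"
    unfolding norm2_power2 by (simp add: power2_diff algebra_simps)
  also have "\<dots> = (norm2 LL h)\<^sup>2 - 2 * (LINT x|LL. step k F x * h x) + (norm2 LL (step k F))\<^sup>2"
    using square_integrable_square[OF h] square_integrable_square[OF square_integrable_step]
      square_integrable_mult[OF square_integrable_step h] by (simp add: norm2_power2)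
  finally show ?thesis
    using integral_step_energy[OF square_integrable_integrable[OF h] inc] norm2_step by simp
qed

lemma norm2_step_diff:
  "k \<le> l \<Longrightarrow> (norm2 LL (\<lambda>x. step l F x - step k F x))\<^sup>2 = energy l F - energy k F"
  by (subst norm2_diff_step[OF square_integrable_step]) (auto simp: increment_step_pt norm2_step)

lemma energy_mono: "k \<le> l \<Longrightarrow> energy k F \<le> energy l F"
  using norm2_step_diff[of k l F] zero_le_power2[of "norm2 LL (\<lambda>x. step l F x - step k F x)"] by linarith

lemma energy_le:
  assumes h: "square_integrable LL h" and inc: "\<And>x y. a \<le> x \<Longrightarrow> x \<le> y \<Longrightarrow> y \<le> b \<Longrightarrow> F y - F x = increment \<Omega> h x y"
  shows "energy k F \<le> (norm2 LL h)\<^sup>2"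
proof -
  have "(norm2 LL (\<lambda>x. h x - step k F x))\<^sup>2 = (norm2 LL h)\<^sup>2 - energy k F"
    by (rule norm2_diff_step[OF h]) (intro inc[symmetric] pt_bounds pt_mono; simp)
  then show ?thesis using zero_le_power2[of "norm2 LL (\<lambda>x. h x - step k F x)"] by linarith
qed

lemma dyadic_approx:
  assumes "a \<le> x" "x \<le> b"
  obtains j where "\<And>k. j k \<le> 2^k" "(\<lambda>k. pt k (j k)) \<longlonglongrightarrow> x"
proof -
  define j where "j k = nat \<lfloor>(x - a) / mesh k\<rfloor>" for k
  have nn: "(x - a) / mesh k \<ge> 0" for k using assms mesh_pos[of k] by simp
  have le: "pt k (j k) \<le> x" for k
  proof -
    have "real (j k) \<le> (x - a) / mesh k" using nn[of k] by (simp add: j_def)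
    then show ?thesis using mesh_pos[of k] by (simp add: pt_def field_simps)
  qed
  have ge: "x - mesh k \<le> pt k (j k)" for k
  proof -
    have "(x - a) / mesh k < real (j k) + 1" unfolding j_def using nn[of k] by linarith
    then show ?thesis using mesh_pos[of k] by (simp add: pt_def field_simps)
  qed
  have "j k \<le> 2^k" for k
  proof -
    have "(x - a) / mesh k \<le> 2^k" using assms ab by (simp add: mesh_def field_simps)
    then have "\<lfloor>(x - a) / mesh k\<rfloor> \<le> 2^k"
      by (metis floor_le_iff le_less_trans less_add_one of_int_numeral of_int_power)
    then show ?thesis by (simp add: j_def nat_le_iff)
  qed
  moreover have "(\<lambda>k. pt k (j k)) \<longlonglongrightarrow> x"
  proof (rule tendsto_sandwich[of "\<lambda>k. x - mesh k" _ _ "\<lambda>k. x"])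
    have "(\<lambda>k. (b - a) * (1/2)^k) \<longlonglongrightarrow> (b - a) * 0" by (intro tendsto_intros LIMSEQ_realpow_zero) auto
    moreover have "mesh = (\<lambda>k. (b - a) * (1/2)^k)" by (simp add: mesh_def fun_eq_iff power_divide)
    ultimately have "mesh \<longlonglongrightarrow> 0" by simp
    from tendsto_diff[OF tendsto_const this, of x] show "(\<lambda>k. x - mesh k) \<longlonglongrightarrow> x" by simp
  qed (use le ge in auto)
  ultimately show thesis by (rule that)
qed

lemma increment_dist:
  assumes h: "square_integrable LL h" and xy: "a \<le> x" "x \<le> b" "a \<le> y" "y \<le> b"
  shows "\<bar>increment \<Omega> h a x - increment \<Omega> h a y\<bar> \<le> sqrt \<bar>x - y\<bar> * norm2 LL h"
proof -
  have *: "\<bar>increment \<Omega> h a x - increment \<Omega> h a y\<bar> \<le> sqrt \<bar>x - y\<bar> * norm2 LL h"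
    if "a \<le> x" "x \<le> y" "y \<le> b" for x y
    using increment_add'[OF square_integrable_integrable[OF h] that(1,2)] increment_le_norm2[OF h that] that
    by simp
  show ?thesis
    using *[of x y] *[of y x] xy by (cases "x \<le> y") (auto simp: abs_minus_commute)
qed

lemma increment_continuous_on:
  assumes h: "square_integrable LL h" shows "continuous_on {a..b} (increment \<Omega> h a)"
  unfolding continuous_on_sequentially
proof (intro allI ballI impI, elim conjE)
  fix x' x assume x: "x \<in> {a..b}" "\<forall>n. x' n \<in> {a..b}" "x' \<longlonglongrightarrow> x"
  have "(\<lambda>n. sqrt \<bar>x' n - x\<bar> * norm2 LL h) \<longlonglongrightarrow> sqrt \<bar>x - x\<bar> * norm2 LL h"
    by (intro tendsto_mult tendsto_real_sqrt tendsto_rabs tendsto_diff tendsto_const x(3))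
  then have lim: "(\<lambda>n. sqrt \<bar>x' n - x\<bar> * norm2 LL h) \<longlonglongrightarrow> 0" by simp
  have "(\<lambda>n. increment \<Omega> h a (x' n) - increment \<Omega> h a x) \<longlonglongrightarrow> 0"
  proof (rule Lim_null_comparison[OF always_eventually[OF allI] lim])
    show "norm (increment \<Omega> h a (x' n) - increment \<Omega> h a x) \<le> sqrt \<bar>x' n - x\<bar> * norm2 LL h" for n
      using increment_dist[OF h, of "x' n" x] x by simp
  qed
  then show "(increment \<Omega> h a \<circ> x') \<longlonglongrightarrow> increment \<Omega> h a x"
    by (simp add: o_def LIM_zero_iff)
qed

text \<open>The dyadic difference quotients of \<open>F\<close> form a martingale, which converges in \<open>L\<^sup>2\<close> once it is bounded there.\<close>

theorem Riesz_primitive: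
  assumes F: "continuous_on {a..b} F" and B: "\<And>k. energy k F \<le> B\<^sup>2" "B \<ge> 0"
  obtains h where "square_integrable LL h" "norm2 LL h \<le> B"
    "\<And>x. a \<le> x \<Longrightarrow> x \<le> b \<Longrightarrow> F x - F a = increment \<Omega> h a x"
    "(\<lambda>k. norm2 LL (\<lambda>x. step k F x - h x)) \<longlonglongrightarrow> 0"
proof -
  have cauchy: "\<exists>N. \<forall>m\<ge>N. \<forall>n\<ge>N. norm2 LL (\<lambda>x. step m F x - step n F x) < e" if e: "e > 0" for e
  proof -
    \<comment> \<open>By \<open>norm2_step_diff\<close> the squared distance of two levels is the
      difference of their energies, and these increase and are bounded.\<close>
    have "convergent (\<lambda>k. energy k F)"
    proof -
      obtain L where "(\<lambda>k. energy k F) \<longlonglongrightarrow> L"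
        by (rule incseq_convergent[of "\<lambda>k. energy k F" "B\<^sup>2"])
           (use B(1) energy_mono in \<open>auto simp: incseq_def\<close>)
      then show ?thesis by (rule convergentI)
    qed
    then have "Cauchy (\<lambda>k. energy k F)" by (rule convergent_Cauchy)
    then obtain N where N: "\<And>m n. m \<ge> N \<Longrightarrow> n \<ge> N \<Longrightarrow> \<bar>energy m F - energy n F\<bar> < e\<^sup>2"
      using e unfolding Cauchy_def dist_real_def by (meson zero_less_power)
    have *: "norm2 LL (\<lambda>x. step m F x - step n F x) < e" if "n \<ge> N" "m \<ge> n" for m n
    proof -
      have "(norm2 LL (\<lambda>x. step m F x - step n F x))\<^sup>2 < e\<^sup>2"
        using norm2_step_diff[OF that(2), of F] N[of m n] that by simp
      then show ?thesis using e by (simp add: power2_less_imp_less)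
    qed
    have sym: "norm2 LL (\<lambda>x. step m F x - step n F x) = norm2 LL (\<lambda>x. step n F x - step m F x)" for m n
      by (simp add: norm2_def power2_commute)
    have "norm2 LL (\<lambda>x. step m F x - step n F x) < e" if "m \<ge> N" "n \<ge> N" for m n
      using *[of m n] *[of n m] sym[of m n] that by (cases "m \<le> n") auto
    then show ?thesis by blast
  qed
  obtain h where h: "square_integrable LL h" and lim: "(\<lambda>k. norm2 LL (\<lambda>x. step k F x - h x)) \<longlonglongrightarrow> 0"
    using Riesz_Fischer[of LL "\<lambda>k. step k F"] square_integrable_step cauchy by blast
  have nB: "norm2 LL h \<le> B"
  proof -
    have "norm2 LL h \<le> B + norm2 LL (\<lambda>x. step k F x - h x)" for k
    proof -
      have "norm2 LL h \<le> norm2 LL (step k F) + norm2 LL (\<lambda>x. (-1) * (step k F x - h x))"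
        using norm2_triangle[OF square_integrable_step[of k F] square_integrable_cmult[OF square_integrable_diff[OF square_integrable_step[of k F] h], of "-1"]]
        by simp
      moreover have "norm2 LL (step k F) \<le> B"
        using norm2_step[of k F] B by (auto intro: power2_le_imp_le[OF _ B(2)])
      ultimately show ?thesis by (simp only: norm2_cmult)
    qed
    moreover have "(\<lambda>k. B + norm2 LL (\<lambda>x. step k F x - h x)) \<longlonglongrightarrow> B + 0"
      by (intro tendsto_intros lim)
    ultimately show ?thesis by (intro LIMSEQ_le_const[of _ B]) auto
  qed
  \<comment> \<open>At a dyadic point of level k all levels from k on give the increment of F
    exactly, so only the limit in \<open>L\<^sup>2\<close> has to be taken; the other points follow
    by continuity.\<close>
  have dy: "F (pt k j) - F a = increment \<Omega> h a (pt k j)" if j: "j \<le> 2^k" for k j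
  proof -
    have "(\<lambda>l. increment \<Omega> (\<lambda>x. step l F x - h x) a (pt k j)) \<longlonglongrightarrow> 0"
    proof (rule Lim_null_comparison)
      show "\<forall>\<^sub>F l in sequentially. norm (increment \<Omega> (\<lambda>x. step l F x - h x) a (pt k j))
         \<le> sqrt (pt k j - a) * norm2 LL (\<lambda>x. step l F x - h x)"
        using j by (intro always_eventually allI)
          (auto intro!: increment_le_norm2 square_integrable_diff square_integrable_step h pt_bounds)
      show "(\<lambda>l. sqrt (pt k j - a) * norm2 LL (\<lambda>x. step l F x - h x)) \<longlonglongrightarrow> 0"
        by (rule tendsto_mult_right_zero[OF lim])
    qed
    moreover have "\<forall>\<^sub>F l in sequentially. increment \<Omega> (\<lambda>x. step l F x - h x) a (pt k j) = F (pt k j) - F a - increment \<Omega> h a (pt k j)"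
      unfolding eventually_sequentially
    proof (intro exI[of _ k] allI impI)
      fix l assume l: "k \<le> l"
      have "increment \<Omega> (\<lambda>x. step l F x - h x) a (pt k j) = increment \<Omega> (step l F) a (pt k j) - increment \<Omega> h a (pt k j)"
        using integrable_increment'[OF square_integrable_integrable[OF square_integrable_step[of l F]]]
          integrable_increment'[OF square_integrable_integrable[OF h]]
        by (simp add: right_diff_distrib)
      then show "increment \<Omega> (\<lambda>x. step l F x - h x) a (pt k j) = F (pt k j) - F a - increment \<Omega> h a (pt k j)"
        using increment_step[OF l j] by simp
    qed
    ultimately have "(\<lambda>l::nat. F (pt k j) - F a - increment \<Omega> h a (pt k j)) \<longlonglongrightarrow> 0"
      by (rule Lim_transform_eventually)
    then show ?thesis by (simp add: LIMSEQ_const_iff)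
  qed
  have "F x - F a = increment \<Omega> h a x" if x: "a \<le> x" "x \<le> b" for x
  proof -
    obtain j where j: "\<And>k. j k \<le> 2^k" "(\<lambda>k. pt k (j k)) \<longlonglongrightarrow> x" using dyadic_approx[OF x] by blast
    have in_ab: "pt k (j k) \<in> {a..b}" for k using pt_bounds[OF j(1)] by simp
    have 1: "(\<lambda>k. F (pt k (j k)) - F a) \<longlonglongrightarrow> F x - F a"
      using continuous_on_tendsto_compose[OF F j(2)] x in_ab by (intro tendsto_intros) auto
    have 2: "(\<lambda>k. increment \<Omega> h a (pt k (j k))) \<longlonglongrightarrow> increment \<Omega> h a x"
      using continuous_on_tendsto_compose[OF increment_continuous_on[OF h] j(2)] x in_ab by auto
    show ?thesis using LIMSEQ_unique[OF 1] 2 dy[OF j(1)] by simp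
  qed
  from that[OF h nB this lim] show thesis .
qed

text \<open>\<open>Riesz_primitive\<close> applied to the primitive of h yields a limit with the
  same increments as h, hence h itself. In effect dyadic step functions are dense in
  \<open>L\<^sup>2\<close>.\<close>

lemma step_tendsto:
  assumes h: "square_integrable LL h"
  shows "(\<lambda>k. norm2 LL (\<lambda>x. step k (increment \<Omega> h a) x - h x)) \<longlonglongrightarrow> 0"
proof -
  let ?F = "increment \<Omega> h a"
  have inc: "?F y - ?F x = increment \<Omega> h x y" if "a \<le> x" "x \<le> y" "y \<le> b" for x y
    using increment_add'[OF square_integrable_integrable[OF h] that(1,2)] by simp
  have en: "energy k ?F \<le> (norm2 LL h)\<^sup>2" for k by (rule energy_le[OF h inc])
  obtain g where g: "square_integrable LL g" "\<And>x. a \<le> x \<Longrightarrow> x \<le> b \<Longrightarrow> ?F x - ?F a = increment \<Omega> g a x"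
    "(\<lambda>k. norm2 LL (\<lambda>x. step k ?F x - g x)) \<longlonglongrightarrow> 0"
    by (rule Riesz_primitive[OF increment_continuous_on[OF h] en norm2_nonneg]) blast
  have eq: "AE x in LL. h x + (-1) * g x = 0"
  proof (rule AE_eq_0_from_increments)
    show "loc_integrable \<Omega> (\<lambda>x. h x + (-1) * g x)"
      using h g by (intro loc_integrable_add square_integrable_loc_integrable)
    fix c d assume cd: "c \<in> \<Omega>" "d \<in> \<Omega>" "c \<le> d"
    have "increment \<Omega> (\<lambda>x. h x + (-1) * g x) c d = increment \<Omega> h c d + (-1) * increment \<Omega> g c d"
      using h g cd by (intro increment_linear square_integrable_loc_integrable)
    moreover have "increment \<Omega> g c d = increment \<Omega> h c d"
      using g(2)[of c] g(2)[of d] cd increment_add'[OF square_integrable_integrable[OF g(1)], of a c d] inc[of c d] by simp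
    ultimately show "increment \<Omega> (\<lambda>x. h x + (-1) * g x) c d = 0" by simp
  qed
  have "norm2 LL (\<lambda>x. step k ?F x - h x) = norm2 LL (\<lambda>x. step k ?F x - g x)" for k
    using square_integrable_step[of k ?F] h g(1) eq
    by (intro norm2_AE_cong) (auto elim: eventually_mono)
  then show ?thesis using g(3) by simp
qed

end

section \<open>Uniform approximation, moduli of continuity and limits of derivatives\<close>

lemma tendsto_by_approximation:
  fixes X :: "nat \<Rightarrow> real"
  assumes "\<And>e. e > 0 \<Longrightarrow> \<exists>Y y. Y \<longlonglongrightarrow> y \<and> \<bar>y - x\<bar> \<le> e \<and> (\<forall>n. \<bar>X n - Y n\<bar> \<le> e)"
  shows "X \<longlonglongrightarrow> x"
proof (rule LIMSEQ_I)
  fix r :: real assume r: "r > 0"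
  then obtain Y y where Y: "Y \<longlonglongrightarrow> y" "\<bar>y - x\<bar> \<le> r/4" "\<And>n. \<bar>X n - Y n\<bar> \<le> r/4"
    using assms[of "r/4"] by auto
  obtain N where N: "\<And>n. n \<ge> N \<Longrightarrow> \<bar>Y n - y\<bar> < r/4"
    using LIMSEQ_D[OF Y(1), of "r/4"] r by auto
  have "norm (X n - x) < r" if "n \<ge> N" for n
  proof -
    have "\<bar>X n - x\<bar> \<le> \<bar>X n - Y n\<bar> + \<bar>Y n - y\<bar> + \<bar>y - x\<bar>" by linarith
    then show ?thesis using Y(2) Y(3)[of n] N[OF that] r by simp
  qed
  then show "\<exists>N. \<forall>n\<ge>N. norm (X n - x) < r" by blast
qed

lemma convergent_by_approximation:
  fixes X :: "nat \<Rightarrow> real"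
  assumes "\<And>e. e > 0 \<Longrightarrow> \<exists>Y. convergent Y \<and> (\<forall>n. \<bar>X n - Y n\<bar> \<le> e)"
  shows "convergent X"
proof -
  have "Cauchy X"
  proof (rule metric_CauchyI)
    fix r :: real assume r: "r > 0"
    then obtain Y where Y: "convergent Y" "\<And>n. \<bar>X n - Y n\<bar> \<le> r/4"
      using assms[of "r/4"] by auto
    obtain N where N: "\<And>m n. m \<ge> N \<Longrightarrow> n \<ge> N \<Longrightarrow> dist (Y m) (Y n) < r/4"
      using metric_CauchyD[OF convergent_Cauchy[OF Y(1)], of "r/4"] r by auto
    have "dist (X m) (X n) < r" if "m \<ge> N" "n \<ge> N" for m n
    proof -
      have "\<bar>X m - X n\<bar> \<le> \<bar>X m - Y m\<bar> + \<bar>Y m - Y n\<bar> + \<bar>X n - Y n\<bar>" by linarith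
      then show ?thesis using Y(2)[of m] Y(2)[of n] N[OF that] r by (simp add: dist_real_def)
    qed
    then show "\<exists>N. \<forall>m\<ge>N. \<forall>n\<ge>N. dist (X m) (X n) < r" by blast
  qed
  then show ?thesis by (simp add: Cauchy_convergent_iff)
qed

text \<open>By monotonicity one small value controls all smaller arguments. The notion is kept
  abstract because the exponents 1, 1/2 and 1/4 all occur.\<close>

definition modulus :: "(real \<Rightarrow> real) \<Rightarrow> bool" where
  "modulus \<omega> \<longleftrightarrow> (\<forall>r s. 0 \<le> r \<longrightarrow> r \<le> s \<longrightarrow> \<omega> r \<le> \<omega> s) \<and> (\<forall>e>0. \<exists>d>0. \<omega> d < e)"

lemma modulus_mono: "modulus \<omega> \<Longrightarrow> 0 \<le> r \<Longrightarrow> r \<le> s \<Longrightarrow> \<omega> r \<le> \<omega> s"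
  by (auto simp: modulus_def)

lemma modulusE:
  assumes "modulus \<omega>" "e > 0"
  obtains d where "d > 0" "\<And>r. 0 \<le> r \<Longrightarrow> r \<le> d \<Longrightarrow> \<omega> r < e"
  using assms unfolding modulus_def by (meson le_less_trans)

lemma modulus_sqrt: assumes "M \<ge> 0" shows "modulus (\<lambda>r. M * sqrt r)"
  unfolding modulus_def
proof (intro conjI allI impI)
  fix e :: real assume e: "e > 0"
  \<comment> \<open>Dividing by M + 1 also covers M = 0.\<close>
  have "sqrt ((e / (M + 1))\<^sup>2) = e / (M + 1)"
    unfolding real_sqrt_abs using e assms by simp
  moreover have "M * (e / (M + 1)) < e" using e assms by (simp add: field_simps)
  ultimately have "M * sqrt ((e / (M + 1))\<^sup>2) < e" by (simp only:)
  then show "\<exists>d>0. M * sqrt d < e"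
    using e assms by (intro exI[of _ "(e / (M + 1))\<^sup>2"]) auto
qed (use assms in \<open>auto intro: mult_left_mono\<close>)

lemma modulus_sqrt_sqrt: assumes "M \<ge> 0" shows "modulus (\<lambda>r. M * sqrt (sqrt r))"
  unfolding modulus_def
proof (intro conjI allI impI)
  fix e :: real assume e: "e > 0"
  have "sqrt (sqrt (((e / (M + 1))\<^sup>2)\<^sup>2)) = e / (M + 1)"
    unfolding real_sqrt_abs using e assms by (simp only: abs_power2 real_sqrt_abs) simp
  moreover have "M * (e / (M + 1)) < e" using e assms by (simp add: field_simps)
  ultimately have "M * sqrt (sqrt (((e / (M + 1))\<^sup>2)\<^sup>2)) < e" by (simp only:)
  then show "\<exists>d>0. M * sqrt (sqrt d) < e"
    using e assms by (intro exI[of _ "((e / (M + 1))\<^sup>2)\<^sup>2"]) auto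
qed (use assms in \<open>auto intro: mult_left_mono\<close>)

text \<open>The mean value inequality on the segment from x to y, applied to f z - z L.\<close>

lemma derivative_remainder:
  fixes f :: "real \<Rightarrow> real"
  assumes S: "convex S" "x \<in> S" "y \<in> S"
    and d: "\<And>z. z \<in> S \<Longrightarrow> (f has_real_derivative f' z) (at z within S)"
    and m: "\<And>z. z \<in> S \<Longrightarrow> \<bar>z - x\<bar> \<le> \<bar>y - x\<bar> \<Longrightarrow> \<bar>f' z - L\<bar> \<le> B"
  shows "\<bar>f y - f x - (y - x) * L\<bar> \<le> \<bar>y - x\<bar> * B"
proof -
  let ?T = "closed_segment x y"
  have sub: "?T \<subseteq> S" using S by (simp add: closed_segment_subset)
  have "norm ((f y - y * L) - (f x - x * L)) \<le> B * norm (y - x)"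
  proof (rule field_differentiable_bound[where S = ?T and f' = "\<lambda>z. f' z - L"])
    fix z assume z: "z \<in> ?T"
    then have "(f has_real_derivative f' z) (at z within ?T)"
      using d sub DERIV_subset by blast
    then show "((\<lambda>z. f z - z * L) has_field_derivative f' z - L) (at z within ?T)"
      by (auto intro!: derivative_eq_intros)
    have "\<bar>z - x\<bar> \<le> \<bar>y - x\<bar>" using z by (auto simp: closed_segment_eq_real_ivl split: if_splits)
    then show "norm (f' z - L) \<le> B" using m z sub by auto
  qed auto
  then show ?thesis by (simp add: algebra_simps)
qed

text \<open>The common modulus bounds the remainder of difference quotients uniformly in n. A
  quotient at one point close to x converges and stays within e of the derivatives at x, so these
  converge; the same remainder bound for the limit function identifies its derivative.\<close>

lemma derivative_limit:
  fixes f :: "nat \<Rightarrow> real \<Rightarrow> real"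
  assumes S: "convex S" "x \<in> S" "at x within S \<noteq> bot"
    and d: "\<And>n z. z \<in> S \<Longrightarrow> (f n has_real_derivative f' n z) (at z within S)"
    and m: "modulus \<omega>" "\<And>n z. z \<in> S \<Longrightarrow> \<bar>f' n z - f' n x\<bar> \<le> \<omega> \<bar>z - x\<bar>"
    and g: "\<And>z. z \<in> S \<Longrightarrow> (\<lambda>n. f n z) \<longlonglongrightarrow> g z"
  obtains L where "(\<lambda>n. f' n x) \<longlonglongrightarrow> L" "(g has_real_derivative L) (at x within S)"
proof -
  have rem: "\<bar>f n y - f n x - (y - x) * f' n x\<bar> \<le> \<bar>y - x\<bar> * \<omega> \<bar>y - x\<bar>" if "y \<in> S" for n y
  proof (rule derivative_remainder[OF S(1,2) that d])
    show "\<bar>f' n z - f' n x\<bar> \<le> \<omega> \<bar>y - x\<bar>" if "z \<in> S" "\<bar>z - x\<bar> \<le> \<bar>y - x\<bar>" for z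
      using m(2)[OF that(1), of n] modulus_mono[OF m(1) _ that(2)] by simp
  qed
  have "convergent (\<lambda>n. f' n x)"
  proof (rule convergent_by_approximation)
    fix e :: real assume "e > 0"
    then obtain \<delta> where \<delta>: "\<delta> > 0" "\<And>r. 0 \<le> r \<Longrightarrow> r \<le> \<delta> \<Longrightarrow> \<omega> r < e" using modulusE[OF m(1)] by blast
    obtain y where y: "y \<in> S" "y \<noteq> x" "dist y x < \<delta>"
      using S(3) \<delta>(1) by (auto simp: trivial_limit_within islimpt_approachable)
    have "convergent (\<lambda>n. (f n y - f n x) / (y - x))"
      using tendsto_divide[OF tendsto_diff[OF g[OF y(1)] g[OF S(2)]] tendsto_const, of "y - x"] y(2)
      by (auto simp: convergent_def)
    moreover have "\<bar>f' n x - (f n y - f n x) / (y - x)\<bar> \<le> e" for n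
    proof -
      have "\<bar>f n y - f n x - (y - x) * f' n x\<bar> \<le> \<bar>y - x\<bar> * e"
        using rem[OF y(1), of n] \<delta>(2)[of "\<bar>y - x\<bar>"] y(3)
        by (smt (verit) dist_real_def mult_left_mono)
      moreover have "\<bar>f n y - f n x - (y - x) * f' n x\<bar> = \<bar>y - x\<bar> * \<bar>f' n x - (f n y - f n x) / (y - x)\<bar>"
      proof -
        have "f n y - f n x - (y - x) * f' n x = - ((y - x) * (f' n x - (f n y - f n x) / (y - x)))"
          using y(2) by (simp add: field_simps)
        then show ?thesis by (simp add: abs_mult)
      qed
      ultimately show ?thesis using y(2) by simp
    qed
    ultimately show "\<exists>Y. convergent Y \<and> (\<forall>n. \<bar>f' n x - Y n\<bar> \<le> e)" by blast
  qed
  then obtain L where L: "(\<lambda>n. f' n x) \<longlonglongrightarrow> L" by (auto simp: convergent_def)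
  have remg: "\<bar>g y - g x - (y - x) * L\<bar> \<le> \<bar>y - x\<bar> * \<omega> \<bar>y - x\<bar>" if "y \<in> S" for y
  proof (rule LIMSEQ_le_const2)
    show "(\<lambda>n. \<bar>f n y - f n x - (y - x) * f' n x\<bar>) \<longlonglongrightarrow> \<bar>g y - g x - (y - x) * L\<bar>"
      by (intro tendsto_intros g that S L)
  qed (use rem[OF that] in blast)
  have "(g has_real_derivative L) (at x within S)"
    unfolding has_field_derivative_iff LIM_def tendsto_iff eventually_at
  proof (intro allI impI)
    fix e :: real assume "e > 0"
    then obtain \<delta> where \<delta>: "\<delta> > 0" "\<And>r. 0 \<le> r \<Longrightarrow> r \<le> \<delta> \<Longrightarrow> \<omega> r < e" using modulusE[OF m(1)] by blast
    have "dist ((g y - g x) / (y - x)) L < e" if "y \<in> S" "y \<noteq> x" "dist y x < \<delta>" for y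
    proof -
      have "(g y - g x) / (y - x) - L = (g y - g x - (y - x) * L) / (y - x)"
        using that(2) by (simp add: field_simps)
      then have "\<bar>(g y - g x) / (y - x) - L\<bar> = \<bar>g y - g x - (y - x) * L\<bar> / \<bar>y - x\<bar>"
        by (simp add: abs_divide)
      also have "\<dots> \<le> \<omega> \<bar>y - x\<bar>" using remg[OF that(1)] that(2) by (simp add: field_simps)
      also have "\<dots> < e" using \<delta>(2)[of "\<bar>y - x\<bar>"] that(3) by (simp add: dist_real_def)
      finally show ?thesis by (simp add: dist_real_def)
    qed
    then show "\<exists>d>0. \<forall>y\<in>S. y \<noteq> x \<and> dist y x < d \<longrightarrow> dist ((g y - g x) / (y - x)) L < e"
      using \<delta>(1) by blast
  qed
  with L show thesis by (rule that)
qed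

section \<open>Continuous representatives of functions in \<open>H\<^sup>1\<close> and
  \<open>H\<^sup>2\<close>\<close>

context bounded_interval
begin

text \<open>f is the continuous representative of an \<open>H\<^sup>1\<close> function with weak
  derivative h; the values of f count at every point, those of h up to null sets.\<close>

definition primitive :: "(real \<Rightarrow> real) \<Rightarrow> (real \<Rightarrow> real) \<Rightarrow> bool" where
  "primitive f h \<longleftrightarrow> square_integrable LL h \<and>
     (\<forall>x\<in>\<Omega>. \<forall>y\<in>\<Omega>. x \<le> y \<longrightarrow> f y - f x = increment \<Omega> h x y)"

lemma primitiveD: "primitive f h \<Longrightarrow> square_integrable LL h"
  and primitive_increment: "primitive f h \<Longrightarrow> x \<in> \<Omega> \<Longrightarrow> y \<in> \<Omega> \<Longrightarrow> x \<le> y \<Longrightarrow> f y - f x = increment \<Omega> h x y"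
  by (auto simp: primitive_def)

lemma primitive_Hoelder:
  assumes "primitive f h" "x \<in> \<Omega>" "y \<in> \<Omega>"
  shows "\<bar>f x - f y\<bar> \<le> norm2 LL h * sqrt \<bar>x - y\<bar>"
proof -
  have *: "\<bar>f y - f x\<bar> \<le> norm2 LL h * sqrt \<bar>y - x\<bar>" if "x \<in> \<Omega>" "y \<in> \<Omega>" "x \<le> y" for x y
    using increment_le_norm2[OF primitiveD[OF assms(1)], of x y] primitive_increment[OF assms(1) that] that
    by (simp add: mult.commute)
  show ?thesis using *[of x y] *[of y x] assms by (cases "x \<le> y") (auto simp: abs_minus_commute)
qed

lemma primitive_continuous_on: "primitive f h \<Longrightarrow> continuous_on \<Omega> f"
  by (rule primitive_continuous[of h]) (auto intro: square_integrable_loc_integrable primitiveD primitive_increment)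

lemma primitive_weak_derivative: "primitive f h \<Longrightarrow> weak_derivative \<Omega> f h"
  by (rule weak_derivativeI) (auto intro: square_integrable_loc_integrable primitiveD primitive_increment)

lemma primitive_square_integrable:
  assumes "primitive f h" shows "square_integrable LL f"
proof (rule square_integrable_bounded)
  show "f \<in> borel_measurable LL"
    using primitive_continuous_on[OF assms] by (rule continuous_imp_measurable_on_sets_lebesgue) simp
  let ?c = "(a + b) / 2"
  fix x assume x: "x \<in> \<Omega>"
  have "\<bar>f x - f ?c\<bar> \<le> norm2 LL h * sqrt \<bar>x - ?c\<bar>"
    using x ab by (intro primitive_Hoelder[OF assms]) auto
  also have "\<dots> \<le> norm2 LL h * sqrt (b - a)"
    using x by (intro mult_left_mono real_sqrt_le_mono) (auto simp: abs_le_iff field_simps)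
  finally show "\<bar>f x\<bar> \<le> \<bar>f ?c\<bar> + norm2 LL h * sqrt (b - a)" by linarith
qed

lemma weak_derivative_primitive:
  assumes "weak_derivative \<Omega> f h" "continuous_on \<Omega> f" "square_integrable LL h"
  shows "primitive f h"
  using assms weak_derivative_continuous_increment by (auto simp: primitive_def)

text \<open>Constant of the embedding of \<open>H\<^sup>1\<close> into bounded functions. It arises
  in \<open>primitive_sup\<close> by taking the \<open>L\<^sup>2\<close> norm over z of f x = f z +
  (f x - f z), where the difference is at most sqrt (b - a) times the norm of the
  derivative.\<close>

definition sup_const :: real where "sup_const = (1 + (b - a)) / sqrt (b - a)"

lemma sup_const_pos: "sup_const > 0" using ab by (simp add: sup_const_def add_pos_pos)

lemma primitive_sup:
  assumes p: "primitive f h" and x: "x \<in> \<Omega>" and B: "norm2 LL f \<le> B" "norm2 LL h \<le> B"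
  shows "\<bar>f x\<bar> \<le> sup_const * B"
proof -
  have f: "square_integrable LL f" using primitive_square_integrable[OF p] .
  have "sqrt (b - a) * \<bar>f x\<bar> = norm2 LL (\<lambda>z. f z + (f x - f z))"
    using norm2_const[of "f x"] by simp
  also have "\<dots> \<le> norm2 LL f + norm2 LL (\<lambda>z. f x - f z)"
    by (intro norm2_triangle square_integrable_diff f square_integrable_const)
  also have "norm2 LL (\<lambda>z. f x - f z) \<le> norm2 LL (\<lambda>z. norm2 LL h * sqrt (b - a))"
  proof (rule norm2_mono(2)[OF _ square_integrable_const])
    show "(\<lambda>z. f x - f z) \<in> borel_measurable LL" using f by auto
    show "\<bar>f x - f z\<bar> \<le> \<bar>norm2 LL h * sqrt (b - a)\<bar>" if "z \<in> \<Omega>" for z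
    proof -
      have "\<bar>f x - f z\<bar> \<le> norm2 LL h * sqrt \<bar>x - z\<bar>" by (rule primitive_Hoelder[OF p x that])
      also have "\<dots> \<le> norm2 LL h * sqrt (b - a)"
        using x that by (intro mult_left_mono real_sqrt_le_mono) auto
      finally show ?thesis by linarith
    qed
  qed
  also have "norm2 LL (\<lambda>z. norm2 LL h * sqrt (b - a)) = norm2 LL h * (b - a)"
    using ab by (simp add: norm2_const mult.assoc)
  also have "norm2 LL f + norm2 LL h * (b - a) \<le> B + B * (b - a)"
    using B ab by (intro add_mono mult_right_mono) auto
  finally have "sqrt (b - a) * \<bar>f x\<bar> \<le> B * (1 + (b - a))" by (simp add: algebra_simps)
  then show ?thesis using ab by (simp add: sup_const_def field_simps)
qed

text \<open>The classical derivative f1 has a value at every point, as pointwise limits require; the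
  iterates of \<open>wd\<close> are fixed only up to null sets.\<close>

definition H2 :: "(real \<Rightarrow> real) \<Rightarrow> (real \<Rightarrow> real) \<Rightarrow> (real \<Rightarrow> real) \<Rightarrow> bool" where
  "H2 f f1 f2 \<longleftrightarrow> (\<forall>x\<in>\<Omega>. (f has_real_derivative f1 x) (at x)) \<and> primitive f1 f2"

lemma H2_DERIV: "H2 f f1 f2 \<Longrightarrow> x \<in> \<Omega> \<Longrightarrow> (f has_real_derivative f1 x) (at x)"
  and H2_primitive1: "H2 f f1 f2 \<Longrightarrow> primitive f1 f2"
  by (auto simp: H2_def)

lemma continuous_derivative_primitive:
  assumes "\<And>x. x \<in> \<Omega> \<Longrightarrow> (f has_real_derivative f1 x) (at x)" "continuous_on \<Omega> f1" "square_integrable LL f1"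
  shows "primitive f f1"
  unfolding primitive_def using assms by (auto intro: increment_FTC)

lemma H2_primitive:
  assumes "H2 f f1 f2" shows "primitive f f1"
  by (intro continuous_derivative_primitive H2_DERIV[OF assms] primitive_continuous_on[OF H2_primitive1[OF assms]]
      primitive_square_integrable[OF H2_primitive1[OF assms]])

lemma H2_wd:
  assumes H: "H2 f f1 f2"
  shows "AE x in LL. wd \<Omega> f x = f1 x" "AE x in LL. wd \<Omega> (wd \<Omega> f) x = f2 x"
    "weak_derivative \<Omega> f (wd \<Omega> f)" "weak_derivative \<Omega> (wd \<Omega> f) (wd \<Omega> (wd \<Omega> f))"
proof -
  have w1: "weak_derivative \<Omega> f f1" using primitive_weak_derivative[OF H2_primitive[OF H]] .
  show e1: "AE x in LL. wd \<Omega> f x = f1 x" using wd_AE_eq[OF w1] .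
  have "AE x in LL. f1 x = wd \<Omega> f x" using e1 by eventually_elim simp
  then have w2: "weak_derivative \<Omega> (wd \<Omega> f) f2"
    using weak_derivative_AE_cong[OF primitive_weak_derivative[OF H2_primitive1[OF H]], of "wd \<Omega> f" f2] by simp
  show "AE x in LL. wd \<Omega> (wd \<Omega> f) x = f2 x" using wd_AE_eq[OF w2] .
  show "weak_derivative \<Omega> f (wd \<Omega> f)" "weak_derivative \<Omega> (wd \<Omega> f) (wd \<Omega> (wd \<Omega> f))"
    using weak_derivative_wd w1 w2 by auto
qed

lemma square_integrable_LL_AE_cong:
  assumes "square_integrable LL f" "AE x in LL. g x = f x"
  shows "square_integrable LL g"
proof -
  have "AE x in LL. f x = g x" using assms(2) by eventually_elim simp
  from square_integrable_AE_cong[OF assms(1) borel_measurable_lebesgue_on_AE_cong[OF square_integrable_measurable[OF assms(1)] sets_\<Omega> this] this]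
  show ?thesis .
qed

lemma all_le_2: "(\<forall>k\<le>2::nat. P k) \<longleftrightarrow> P 0 \<and> P (Suc 0) \<and> P 2"
  by (auto simp: le_Suc_eq numeral_2_eq_2)

lemma all_less_2: "(\<forall>k<2::nat. P k) \<longleftrightarrow> P 0 \<and> P (Suc 0)"
  by (auto simp: less_Suc_eq numeral_2_eq_2)

lemma H2_sobolev:
  assumes H: "H2 f f1 f2" shows "f \<in> sobolev 2 \<Omega>"
proof -
  have "square_integrable LL f" "square_integrable LL (wd \<Omega> f)" "square_integrable LL (wd \<Omega> (wd \<Omega> f))"
    using primitive_square_integrable[OF H2_primitive[OF H]] primitive_square_integrable[OF H2_primitive1[OF H]]
      primitiveD[OF H2_primitive1[OF H]] H2_wd[OF H] by (auto intro: square_integrable_LL_AE_cong)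
  then show ?thesis
    using H2_wd(3,4)[OF H] unfolding sobolev_def all_le_2 all_less_2
    by (simp add: L2_fun_iff numeral_2_eq_2)
qed

lemma sobolev_2D:
  assumes "f \<in> sobolev 2 \<Omega>"
  shows "square_integrable LL f" "square_integrable LL (wd \<Omega> f)" "square_integrable LL (wd \<Omega> (wd \<Omega> f))"
    "weak_derivative \<Omega> f (wd \<Omega> f)" "weak_derivative \<Omega> (wd \<Omega> f) (wd \<Omega> (wd \<Omega> f))"
  using assms unfolding sobolev_def all_le_2 all_less_2
  by (simp_all add: L2_fun_iff numeral_2_eq_2)

text \<open>A continuous classical derivative agrees almost everywhere with \<open>wd\<close>, so
  the second weak derivative of f is also a weak derivative of f1.\<close>

lemma sobolev_H2:
  assumes f: "f \<in> sobolev 2 \<Omega>" and d: "\<And>x. x \<in> \<Omega> \<Longrightarrow> (f has_real_derivative f1 x) (at x)"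
    and c: "continuous_on \<Omega> f1"
  shows "H2 f f1 (wd \<Omega> (wd \<Omega> f))"
proof -
  have w: "weak_derivative \<Omega> f f1"
    by (rule weak_derivativeI) (auto intro: loc_integrable_continuous c increment_FTC d)
  have "AE x in LL. wd \<Omega> f x = f1 x" using wd_AE_eq[OF w] .
  then have "weak_derivative \<Omega> f1 (wd \<Omega> (wd \<Omega> f))"
    using weak_derivative_AE_cong[OF sobolev_2D(5)[OF f], of f1] by simp
  then have "primitive f1 (wd \<Omega> (wd \<Omega> f))"
    using c sobolev_2D(3)[OF f] by (rule weak_derivative_primitive)
  with d show ?thesis by (simp add: H2_def)
qed

lemma Hinner_2:
  "Hinner 2 \<Omega> f g = (LINT x|LL. f x * g x) + (LINT x|LL. wd \<Omega> f x * wd \<Omega> g x)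
     + (LINT x|LL. wd \<Omega> (wd \<Omega> f) x * wd \<Omega> (wd \<Omega> g) x)"
  by (simp add: Hinner_def numeral_2_eq_2)

lemma H2_Hinner:
  assumes H: "H2 f f1 f2"
  shows "Hinner 2 \<Omega> f g = (LINT x|LL. f x * g x) + (LINT x|LL. f1 x * wd \<Omega> g x)
     + (LINT x|LL. f2 x * wd \<Omega> (wd \<Omega> g) x)"
proof -
  have "(LINT x|LL. wd \<Omega> f x * wd \<Omega> g x) = (LINT x|LL. f1 x * wd \<Omega> g x)"
    using H2_wd(1)[OF H] by (intro LINT_lebesgue_on_AE_cong) (auto elim: eventually_mono)
  moreover have "(LINT x|LL. wd \<Omega> (wd \<Omega> f) x * wd \<Omega> (wd \<Omega> g) x) = (LINT x|LL. f2 x * wd \<Omega> (wd \<Omega> g) x)"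
    using H2_wd(2)[OF H] by (intro LINT_lebesgue_on_AE_cong) (auto elim: eventually_mono)
  ultimately show ?thesis by (simp add: Hinner_2)
qed

lemma H2_Hnorm:
  assumes H: "H2 f f1 f2"
  shows "(Hnorm 2 \<Omega> f)\<^sup>2 = (norm2 LL f)\<^sup>2 + (norm2 LL f1)\<^sup>2 + (norm2 LL f2)\<^sup>2"
proof -
  have "(LINT x|LL. (wd \<Omega> f x)\<^sup>2) = (LINT x|LL. (f1 x)\<^sup>2)"
    using H2_wd(1)[OF H] by (intro LINT_lebesgue_on_AE_cong) (auto elim: eventually_mono)
  moreover have "(LINT x|LL. (wd \<Omega> (wd \<Omega> f) x)\<^sup>2) = (LINT x|LL. (f2 x)\<^sup>2)"
    using H2_wd(2)[OF H] by (intro LINT_lebesgue_on_AE_cong) (auto elim: eventually_mono)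
  ultimately show ?thesis by (simp add: Hnorm_power2 Hinner_2 norm2_power2 flip: power2_eq_square)
qed

lemma H2_norm2_le:
  assumes H: "H2 f f1 f2"
  shows "norm2 LL f \<le> Hnorm 2 \<Omega> f" "norm2 LL f1 \<le> Hnorm 2 \<Omega> f" "norm2 LL f2 \<le> Hnorm 2 \<Omega> f"
  by (rule power2_le_imp_le, simp add: H2_Hnorm[OF H], simp)+

lemma H2_sup:
  assumes H: "H2 f f1 f2" and R: "Hnorm 2 \<Omega> f \<le> R" and x: "x \<in> \<Omega>"
  shows "\<bar>f x\<bar> \<le> sup_const * R" "\<bar>f1 x\<bar> \<le> sup_const * R"
  using primitive_sup[OF H2_primitive[OF H] x, of R] primitive_sup[OF H2_primitive1[OF H] x, of R]
    H2_norm2_le[OF H] R by auto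

lemma H2_Hoelder:
  assumes H: "H2 f f1 f2" and R: "Hnorm 2 \<Omega> f \<le> R" and x: "x \<in> \<Omega>" "y \<in> \<Omega>"
  shows "\<bar>f x - f y\<bar> \<le> R * sqrt \<bar>x - y\<bar>" "\<bar>f1 x - f1 y\<bar> \<le> R * sqrt \<bar>x - y\<bar>"
proof -
  have "norm2 LL f1 \<le> R" "norm2 LL f2 \<le> R" using H2_norm2_le[OF H] R by auto
  then have "norm2 LL f1 * sqrt \<bar>x - y\<bar> \<le> R * sqrt \<bar>x - y\<bar>" "norm2 LL f2 * sqrt \<bar>x - y\<bar> \<le> R * sqrt \<bar>x - y\<bar>"
    by (auto intro: mult_right_mono)
  then show "\<bar>f x - f y\<bar> \<le> R * sqrt \<bar>x - y\<bar>" "\<bar>f1 x - f1 y\<bar> \<le> R * sqrt \<bar>x - y\<bar>"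
    using primitive_Hoelder[OF H2_primitive[OF H] x] primitive_Hoelder[OF H2_primitive1[OF H] x] by auto
qed

lemma at_within_\<Omega>_nontrivial: "x \<in> \<Omega> \<Longrightarrow> at x within \<Omega> \<noteq> bot"
  using at_within_open[of x \<Omega>] by simp

lemma bounded_convergence_mult:
  assumes m: "\<And>n. f n \<in> borel_measurable LL" and B: "\<And>n x. x \<in> \<Omega> \<Longrightarrow> \<bar>f n x\<bar> \<le> B"
    and l: "\<And>x. x \<in> \<Omega> \<Longrightarrow> (\<lambda>n. f n x) \<longlonglongrightarrow> g x" and p: "square_integrable LL p"
  shows "(\<lambda>n. LINT x|LL. f n x * p x) \<longlonglongrightarrow> (LINT x|LL. g x * p x)"
proof (rule integral_dominated_convergence[where w = "\<lambda>x. \<bar>B * p x\<bar>"])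
  have "g \<in> borel_measurable LL"
    by (rule borel_measurable_LIMSEQ_metric[of f]) (use m l in auto)
  then show "(\<lambda>x. g x * p x) \<in> borel_measurable LL" using p by auto
  show "\<And>n. (\<lambda>x. f n x * p x) \<in> borel_measurable LL" using m p by auto
  show "integrable LL (\<lambda>x. \<bar>B * p x\<bar>)" using square_integrable_integrable[OF p] by auto
  show "AE x in LL. (\<lambda>n. f n x * p x) \<longlonglongrightarrow> g x * p x"
    using l by (intro AE_I2 tendsto_mult) auto
  show "AE x in LL. norm (f n x * p x) \<le> \<bar>B * p x\<bar>" for n
  proof (intro AE_I2)
    fix x assume "x \<in> space LL"
    then have "\<bar>f n x\<bar> \<le> \<bar>B\<bar>" using B[of x n] by auto
    then show "norm (f n x * p x) \<le> \<bar>B * p x\<bar>" by (simp add: abs_mult mult_right_mono)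
  qed
qed

text \<open>The first derivatives have a common Hoelder bound and converge pointwise by
  \<open>derivative_limit\<close>. The second derivatives converge weakly only; their limit is
  recovered from the limit of the first ones by \<open>Riesz_primitive\<close>.\<close>

theorem H2_weak_limit:
  assumes H: "\<And>n. H2 (f n) (f1 n) (f2 n)" and R: "\<And>n. Hnorm 2 \<Omega> (f n) \<le> R"
    and lim: "\<And>x. x \<in> \<Omega> \<Longrightarrow> (\<lambda>n. f n x) \<longlonglongrightarrow> g x"
  obtains g1 g2 where "H2 g g1 g2" "\<And>x. x \<in> \<Omega> \<Longrightarrow> (\<lambda>n. f1 n x) \<longlonglongrightarrow> g1 x"
    "Hnorm 2 \<Omega> g \<le> R" "\<And>p. p \<in> sobolev 2 \<Omega> \<Longrightarrow> (\<lambda>n. Hinner 2 \<Omega> (f n) p) \<longlonglongrightarrow> Hinner 2 \<Omega> g p"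
proof -
  have R0: "R \<ge> 0" using R[of 0] Hnorm_nonneg order_trans by blast
  have "\<exists>L. (\<lambda>n. f1 n x) \<longlonglongrightarrow> L \<and> (g has_real_derivative L) (at x)" if x: "x \<in> \<Omega>" for x
  proof -
    obtain L where "(\<lambda>n. f1 n x) \<longlonglongrightarrow> L" "(g has_real_derivative L) (at x within \<Omega>)"
    proof (rule derivative_limit[OF _ x at_within_\<Omega>_nontrivial[OF x] _ modulus_sqrt[OF R0] _ lim])
      show "(f n has_real_derivative f1 n z) (at z within \<Omega>)" if "z \<in> \<Omega>" for n z
        using H2_DERIV[OF H that] by (rule has_field_derivative_at_within)
      show "\<bar>f1 n z - f1 n x\<bar> \<le> R * sqrt \<bar>z - x\<bar>" if "z \<in> \<Omega>" for n z
        by (rule H2_Hoelder(2)[OF H R that x])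
    qed auto
    then show ?thesis using at_within_open[OF x open_\<Omega>] by auto
  qed
  then obtain g1 where g1: "\<And>x. x \<in> \<Omega> \<Longrightarrow> (\<lambda>n. f1 n x) \<longlonglongrightarrow> g1 x"
    "\<And>x. x \<in> \<Omega> \<Longrightarrow> (g has_real_derivative g1 x) (at x)" by metis
  have f2: "square_integrable LL (f2 n)" "norm2 LL (f2 n) \<le> R" for n
    using primitiveD[OF H2_primitive1[OF H]] H2_norm2_le(3)[OF H, of n] R[of n] by auto
  \<comment> \<open>Up to a constant, G n is f1 n extended to the closed interval, where
    \<open>Riesz_primitive\<close> works.\<close>
  define G where "G n = increment \<Omega> (f2 n) a" for n
  have G_dist: "\<bar>G n x - G n y\<bar> \<le> sqrt \<bar>x - y\<bar> * R" if "x \<in> {a..b}" "y \<in> {a..b}" for n x y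
  proof -
    have "\<bar>G n x - G n y\<bar> \<le> sqrt \<bar>x - y\<bar> * norm2 LL (f2 n)"
      unfolding G_def using that by (intro increment_dist f2) auto
    also have "\<dots> \<le> sqrt \<bar>x - y\<bar> * R" by (intro mult_left_mono f2) auto
    finally show ?thesis .
  qed
  have G_inc: "G n y - G n x = increment \<Omega> (f2 n) x y" if "a \<le> x" "x \<le> y" "y \<le> b" for n x y
    using increment_add'[OF square_integrable_integrable[OF f2(1)] that(1,2)] by (simp add: G_def)
  have G_f1: "G n y - G n x = f1 n y - f1 n x" if "x \<in> \<Omega>" "y \<in> \<Omega>" for n x y
    using G_inc[of x y n] G_inc[of y x n] primitive_increment[OF H2_primitive1[OF H], of x y n]
      primitive_increment[OF H2_primitive1[OF H], of y x n] that by (cases "x \<le> y") auto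
  have Ga: "G n a = 0" for n by (simp add: G_def)
  have "convergent (\<lambda>n. G n x)" if x: "x \<in> {a..b}" for x
  proof (rule convergent_by_approximation)
    fix e :: real assume e: "e > 0"
    obtain d where d: "d > 0" "\<And>r. 0 \<le> r \<Longrightarrow> r \<le> d \<Longrightarrow> R * sqrt r < e/2"
      using modulusE[OF modulus_sqrt[OF R0], of "e/2"] e by auto
    \<comment> \<open>Convergence of f1 n is known only inside \<Omega>, so the ends a and x of the
      integral are replaced by nearby inner points y and z.\<close>
    define y where "y = a + min (d/2) ((b - a)/2)"
    have y: "y \<in> \<Omega>" "\<bar>y - a\<bar> \<le> d" using d ab by (auto simp: y_def min_def field_simps)
    obtain z where z: "z \<in> \<Omega>" "\<bar>z - x\<bar> \<le> d"
    proof (cases "x \<le> (a + b) / 2")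
      case True
      have "x + min (d/2) ((b - a)/4) \<in> \<Omega>" using True x ab d by (auto simp: min_def field_simps)
      then show ?thesis using d ab by (intro that) (auto simp: min_def)
    next
      case False
      have "x - min (d/2) ((b - a)/4) \<in> \<Omega>" using False x ab d by (auto simp: min_def field_simps)
      then show ?thesis using d ab by (intro that) (auto simp: min_def)
    qed
    have "convergent (\<lambda>n. f1 n z - f1 n y)"
      using tendsto_diff[OF g1(1)[OF z(1)] g1(1)[OF y(1)]] by (rule convergentI)
    moreover have "\<bar>G n x - (f1 n z - f1 n y)\<bar> \<le> e" for n
    proof -
      have "\<bar>G n x - G n z\<bar> \<le> sqrt \<bar>x - z\<bar> * R" "\<bar>G n y - G n a\<bar> \<le> sqrt \<bar>y - a\<bar> * R"
        using G_dist[of x z n] G_dist[of y a n] x y z ab by auto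
      moreover have "R * sqrt \<bar>x - z\<bar> < e/2" "R * sqrt \<bar>y - a\<bar> < e/2"
        using d(2) z y by (auto simp: abs_minus_commute)
      ultimately show ?thesis using G_f1[OF y(1) z(1), of n] Ga[of n] by (simp add: mult.commute)
    qed
    ultimately show "\<exists>Y. convergent Y \<and> (\<forall>n. \<bar>G n x - Y n\<bar> \<le> e)" by blast
  qed
  then obtain G' where G': "\<And>x. x \<in> {a..b} \<Longrightarrow> (\<lambda>n. G n x) \<longlonglongrightarrow> G' x"
    unfolding convergent_def by metis
  have G'_dist: "\<bar>G' x - G' y\<bar> \<le> sqrt \<bar>x - y\<bar> * R" if "x \<in> {a..b}" "y \<in> {a..b}" for x y
    using tendsto_rabs[OF tendsto_diff[OF G'[OF that(1)] G'[OF that(2)]]] G_dist[OF that]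
    by (intro LIMSEQ_le_const2[of _ _ "sqrt \<bar>x - y\<bar> * R"]) auto
  have G'c: "continuous_on {a..b} G'"
    unfolding continuous_on_iff dist_real_def
  proof (intro ballI allI impI)
    fix x e :: real assume x: "x \<in> {a..b}" and e: "e > 0"
    obtain d where d: "d > 0" "\<And>r. 0 \<le> r \<Longrightarrow> r \<le> d \<Longrightarrow> R * sqrt r < e"
      using modulusE[OF modulus_sqrt[OF R0] e] by auto
    have "\<bar>G' y - G' x\<bar> < e" if "y \<in> {a..b}" "\<bar>y - x\<bar> < d" for y
      using G'_dist[OF that(1) x] d(2)[of "\<bar>y - x\<bar>"] that(2) by (simp add: mult.commute)
    then show "\<exists>d>0. \<forall>y\<in>{a..b}. \<bar>y - x\<bar> < d \<longrightarrow> \<bar>G' y - G' x\<bar> < e" using d(1) by blast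
  qed
  have en: "energy k G' \<le> R\<^sup>2" for k
  proof (rule LIMSEQ_le_const2)
    show "(\<lambda>n. energy k (G n)) \<longlonglongrightarrow> energy k G'"
      unfolding energy_def using pt_bounds mesh_pos[of k]
      by (intro tendsto_sum tendsto_divide tendsto_power tendsto_diff tendsto_const G') auto
    have "energy k (G n) \<le> (norm2 LL (f2 n))\<^sup>2" for n
      by (rule energy_le[OF f2(1) G_inc])
    moreover have "(norm2 LL (f2 n))\<^sup>2 \<le> R\<^sup>2" for n using f2(2)[of n] by (intro power_mono) auto
    ultimately show "\<exists>N. \<forall>n\<ge>N. energy k (G n) \<le> R\<^sup>2" by (meson order_trans)
  qed
  obtain h where h: "square_integrable LL h" "norm2 LL h \<le> R" "\<And>x. a \<le> x \<Longrightarrow> x \<le> b \<Longrightarrow> G' x - G' a = increment \<Omega> h a x"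
    by (rule Riesz_primitive[OF G'c en R0]) blast
  have G'_inc: "G' y - G' x = increment \<Omega> h x y" if "a \<le> x" "x \<le> y" "y \<le> b" for x y
    using increment_add'[OF square_integrable_integrable[OF h(1)] that(1,2)] h(3)[of x] h(3)[of y] that by simp
  have prim: "primitive g1 h"
    unfolding primitive_def
  proof (intro conjI ballI impI h(1))
    fix x y assume xy: "x \<in> \<Omega>" "y \<in> \<Omega>" "x \<le> y"
    have "(\<lambda>n. f1 n y - f1 n x) \<longlonglongrightarrow> g1 y - g1 x" by (intro tendsto_diff g1 xy)
    moreover have "(\<lambda>n. G n y - G n x) \<longlonglongrightarrow> G' y - G' x" using xy by (intro tendsto_diff G') auto
    ultimately have "g1 y - g1 x = G' y - G' x" using G_f1[OF xy(1,2)] LIMSEQ_unique by auto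
    then show "g1 y - g1 x = increment \<Omega> h x y" using G'_inc[of x y] xy by simp
  qed
  have Hg: "H2 g g1 h" using g1(2) prim by (simp add: H2_def)
  \<comment> \<open>Pairing with a dyadic step function involves finitely many increments of G n,
    which converge; \<open>step_tendsto\<close> gives density.\<close>
  have weak2: "(\<lambda>n. LINT x|LL. f2 n x * p x) \<longlonglongrightarrow> (LINT x|LL. h x * p x)" if p: "square_integrable LL p" for p
  proof (rule tendsto_by_approximation)
    fix e :: real assume e: "e > 0"
    let ?s = "\<lambda>k. step k (increment \<Omega> p a)"
    have "(\<lambda>k. R * norm2 LL (\<lambda>x. ?s k x - p x)) \<longlonglongrightarrow> 0"
      by (rule tendsto_mult_right_zero[OF step_tendsto[OF p]])
    from order_tendstoD(2)[OF this e] obtain k where k: "R * norm2 LL (\<lambda>x. ?s k x - p x) < e"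
      by (meson eventually_happens sequentially_bot)
    have near: "\<bar>(LINT x|LL. f x * p x) - (LINT x|LL. ?s k x * f x)\<bar> \<le> e"
      if f: "square_integrable LL f" "norm2 LL f \<le> R" for f
    proof -
      have "\<bar>(LINT x|LL. ?s k x * f x) - (LINT x|LL. f x * p x)\<bar> = \<bar>LINT x|LL. f x * (?s k x - p x)\<bar>"
        using square_integrable_mult[OF square_integrable_step f(1)] square_integrable_mult[OF f(1) p]
        by (subst Bochner_Integration.integral_diff[symmetric]) (auto simp: algebra_simps)
      also have "\<dots> \<le> norm2 LL f * norm2 LL (\<lambda>x. ?s k x - p x)"
        by (intro Cauchy_Schwarz_norm2 f square_integrable_diff square_integrable_step p)
      also have "\<dots> \<le> R * norm2 LL (\<lambda>x. ?s k x - p x)" by (intro mult_right_mono f) auto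
      finally show ?thesis using k by linarith
    qed
    have "(\<lambda>n. LINT x|LL. ?s k x * f2 n x) \<longlonglongrightarrow> (LINT x|LL. ?s k x * h x)"
      unfolding integral_step_mult[OF square_integrable_integrable[OF f2(1)]] integral_step_mult[OF square_integrable_integrable[OF h(1)]]
    proof (intro tendsto_sum tendsto_mult tendsto_const)
      fix j :: nat assume "j \<in> {..<2^k}"
      then have "a \<le> pt k j" "pt k j \<le> pt k (Suc j)" "pt k (Suc j) \<le> b"
        using pt_bounds pt_mono by auto
      then show "(\<lambda>n. increment \<Omega> (f2 n) (pt k j) (pt k (Suc j))) \<longlonglongrightarrow> increment \<Omega> h (pt k j) (pt k (Suc j))"
        using tendsto_diff[OF G'[of "pt k (Suc j)"] G'[of "pt k j"]] by (simp add: G_inc G'_inc)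
    qed
    then show "\<exists>Y y. Y \<longlonglongrightarrow> y \<and> \<bar>y - (LINT x|LL. h x * p x)\<bar> \<le> e \<and> (\<forall>n. \<bar>(LINT x|LL. f2 n x * p x) - Y n\<bar> \<le> e)"
      using near[OF h(1,2)] near[OF f2]
      by (intro exI[of _ "\<lambda>n. LINT x|LL. ?s k x * f2 n x"] exI[of _ "LINT x|LL. ?s k x * h x"] conjI allI)
         (simp_all add: abs_minus_commute)
  qed
  have weak: "(\<lambda>n. Hinner 2 \<Omega> (f n) p) \<longlonglongrightarrow> Hinner 2 \<Omega> g p" if p: "p \<in> sobolev 2 \<Omega>" for p
    unfolding H2_Hinner[OF H] H2_Hinner[OF Hg]
    by (intro tendsto_add weak2 bounded_convergence_mult[where B = "sup_const * R"] sobolev_2D[OF p]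
        H2_sup[OF H R] lim g1 square_integrable_measurable primitive_square_integrable[OF H2_primitive[OF H]]
        primitive_square_integrable[OF H2_primitive1[OF H]])
  \<comment> \<open>Lower semicontinuity of the norm, by testing the weak convergence with g
    itself.\<close>
  have "Hnorm 2 \<Omega> g \<le> R"
  proof -
    have gs: "g \<in> sobolev 2 \<Omega>" using H2_sobolev[OF Hg] .
    have "Hinner 2 \<Omega> (f n) g \<le> R * Hnorm 2 \<Omega> g" for n
      using Hinner_Cauchy_Schwarz[OF H2_sobolev[OF H] gs, of n] mult_right_mono[OF R[of n] Hnorm_nonneg[of 2 g]]
      by linarith
    then have "Hinner 2 \<Omega> g g \<le> R * Hnorm 2 \<Omega> g"
      using LIMSEQ_le_const2[OF weak[OF gs]] by blast
    then have "Hnorm 2 \<Omega> g * Hnorm 2 \<Omega> g \<le> R * Hnorm 2 \<Omega> g"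
      by (simp add: power2_eq_square flip: Hnorm_power2)
    then show ?thesis using R0 Hnorm_nonneg[of 2 g] by (cases "Hnorm 2 \<Omega> g = 0") auto
  qed
  then show thesis using that Hg g1(1) weak by blast
qed

end

section \<open>Bochner measurability with values in a Sobolev space\<close>

lemma borel_measurable_AE_LIMSEQ:
  fixes X :: "nat \<Rightarrow> real \<Rightarrow> real"
  assumes X: "\<And>n. X n \<in> borel_measurable (lebesgue_on S)" and S: "S \<in> sets lebesgue"
    and lim: "AE t in lebesgue_on S. (\<lambda>n. X n t) \<longlonglongrightarrow> Y t"
  shows "Y \<in> borel_measurable (lebesgue_on S)"
proof (rule borel_measurable_lebesgue_on_AE_cong[OF _ S])
  show "(\<lambda>t. lim (\<lambda>n. X n t)) \<in> borel_measurable (lebesgue_on S)"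
    by (rule borel_measurable_lim_metric) (rule X)
  show "AE t in lebesgue_on S. lim (\<lambda>n. X n t) = Y t"
    using lim by eventually_elim (rule limI)
qed

text \<open>The pair (s t, r t) takes finitely many values, each on a measurable set, so a function
  of it is a finite combination of indicators.\<close>

lemma H_simple_measurable2:
  fixes F :: "(real \<Rightarrow> real) \<Rightarrow> (real \<Rightarrow> real) \<Rightarrow> real"
  assumes s: "H_simple m \<Omega> s" and r: "H_simple m' \<Omega>' r"
  shows "(\<lambda>t. F (s t) (r t)) \<in> borel_measurable (lebesgue_on {0<..})"
proof -
  let ?I = "\<lambda>h k t. F h k * (indicat_real {t\<in>{0<..}. s t = h} t * indicat_real {t\<in>{0<..}. r t = k} t)"
  have fin: "finite (s ` {0<..})" "finite (r ` {0<..})" using s r by (auto simp: H_simple_def)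
  have "(\<lambda>t. \<Sum>h\<in>s ` {0<..}. \<Sum>k\<in>r ` {0<..}. ?I h k t) \<in> borel_measurable (lebesgue_on {0<..})"
  proof (intro borel_measurable_sum borel_measurable_times borel_measurable_const
      borel_measurable_indicator)
    fix h k assume "h \<in> s ` {0<..}" "k \<in> r ` {0<..}"
    then have "{t\<in>{0<..}. s t = h} \<in> sets lebesgue" "{t\<in>{0<..}. r t = k} \<in> sets lebesgue"
      using s r by (auto simp: H_simple_def)
    then show "{t\<in>{0<..}. s t = h} \<in> sets (lebesgue_on {0<..})" "{t\<in>{0<..}. r t = k} \<in> sets (lebesgue_on {0<..})"
      by (auto simp: sets_restrict_space_iff)
  qed
  moreover have "(\<Sum>h\<in>s ` {0<..}. \<Sum>k\<in>r ` {0<..}. ?I h k t) = F (s t) (r t)" if t: "t > 0" for t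
  proof -
    have "(\<Sum>h\<in>s ` {0<..}. \<Sum>k\<in>r ` {0<..}. ?I h k t) = (\<Sum>h\<in>s ` {0<..}. if h = s t then F (s t) (r t) else 0)"
    proof (intro sum.cong refl)
      fix h assume "h \<in> s ` {0<..}"
      have "(\<Sum>k\<in>r ` {0<..}. ?I h k t) = (\<Sum>k\<in>r ` {0<..}. if k = r t then F h (r t) * indicat_real {t\<in>{0<..}. s t = h} t else 0)"
        using t by (intro sum.cong) (auto simp: indicator_def)
      also have "\<dots> = F h (r t) * indicat_real {t\<in>{0<..}. s t = h} t"
        using fin t by (subst sum.delta) auto
      finally show "(\<Sum>k\<in>r ` {0<..}. ?I h k t) = (if h = s t then F (s t) (r t) else 0)"
        using t by (auto simp: indicator_def)
    qed
    also have "\<dots> = F (s t) (r t)" using fin t by (subst sum.delta) auto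
    finally show ?thesis .
  qed
  ultimately show ?thesis
    by (subst measurable_cong[where g = "\<lambda>t. \<Sum>h\<in>s ` {0<..}. \<Sum>k\<in>r ` {0<..}. ?I h k t"]) auto
qed

lemma H_simple_sobolev: "H_simple m \<Omega> s \<Longrightarrow> t > 0 \<Longrightarrow> s t \<in> sobolev m \<Omega>"
  by (auto simp: H_simple_def)

lemma H_simple_const: "f \<in> sobolev m \<Omega> \<Longrightarrow> H_simple m \<Omega> (\<lambda>t. f)"
  unfolding H_simple_def by (auto simp: image_constant_conv)

section \<open>Measurability of inner products and norms\<close>

context open_interval
begin

lemma sobolev_diff:
  assumes "f \<in> sobolev m \<Omega>" "g \<in> sobolev m \<Omega>" shows "(\<lambda>x. f x - g x) \<in> sobolev m \<Omega>"
  using sobolev_linear(1)[OF assms, of "-1"] by simp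

lemma Hinner_diff:
  assumes "f \<in> sobolev m \<Omega>" "g \<in> sobolev m \<Omega>" "h \<in> sobolev m \<Omega>"
  shows "Hinner m \<Omega> (\<lambda>x. f x - g x) h = Hinner m \<Omega> f h - Hinner m \<Omega> g h"
  using Hinner_linear[OF assms, of "-1"] by simp

lemma Hnorm_triangle:
  assumes "f \<in> sobolev m \<Omega>" "g \<in> sobolev m \<Omega>"
  shows "Hnorm m \<Omega> f \<le> Hnorm m \<Omega> (\<lambda>x. f x - g x) + Hnorm m \<Omega> g"
  using Hnorm_add_le[OF sobolev_diff[OF assms] assms(2), of 1] by simp

text \<open>For almost every t both arguments are limits of simple functions in the norm of
  \<open>H\<^sup>m\<close>, and the inner product is jointly continuous there.\<close>

lemma Hinner_measurable:
  assumes w: "H_measurable m \<Omega> w" and p: "H_measurable m \<Omega> p"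
  shows "(\<lambda>t. Hinner m \<Omega> (w t) (p t)) \<in> borel_measurable (lebesgue_on {0<..})"
proof -
  obtain s where s: "\<And>n. H_simple m \<Omega> (s n)"
    "AE t in lebesgue_on {0<..}. (\<lambda>n. Hnorm m \<Omega> (\<lambda>x. s n t x - w t x)) \<longlonglongrightarrow> 0"
    using w unfolding H_measurable_def by blast
  obtain r where r: "\<And>n. H_simple m \<Omega> (r n)"
    "AE t in lebesgue_on {0<..}. (\<lambda>n. Hnorm m \<Omega> (\<lambda>x. r n t x - p t x)) \<longlonglongrightarrow> 0"
    using p unfolding H_measurable_def by blast
  have ws: "AE t in lebesgue_on {0<..}. w t \<in> sobolev m \<Omega>" "AE t in lebesgue_on {0<..}. p t \<in> sobolev m \<Omega>"
    using w p by (auto simp: H_measurable_def)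
  have pos: "AE t in lebesgue_on {0<..}. t > (0::real)" by (rule AE_I2) simp
  show ?thesis
  proof (rule borel_measurable_AE_LIMSEQ[where X = "\<lambda>n t. Hinner m \<Omega> (s n t) (r n t)"])
    show "(\<lambda>t. Hinner m \<Omega> (s n t) (r n t)) \<in> borel_measurable (lebesgue_on {0<..})" for n
      by (rule H_simple_measurable2[OF s(1) r(1)])
    show "AE t in lebesgue_on {0<..}. (\<lambda>n. Hinner m \<Omega> (s n t) (r n t)) \<longlonglongrightarrow> Hinner m \<Omega> (w t) (p t)"
      using ws s(2) r(2) pos
    proof eventually_elim
      case (elim t)
      let ?a = "\<lambda>n. Hnorm m \<Omega> (\<lambda>x. s n t x - w t x)"
      let ?b = "\<lambda>n. Hnorm m \<Omega> (\<lambda>x. r n t x - p t x)"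
      have st: "s n t \<in> sobolev m \<Omega>" "r n t \<in> sobolev m \<Omega>" for n
        using H_simple_sobolev s(1) r(1) elim(5) by auto
      have bound: "norm (Hinner m \<Omega> (s n t) (r n t) - Hinner m \<Omega> (w t) (p t))
          \<le> ?a n * (?b n + Hnorm m \<Omega> (p t)) + Hnorm m \<Omega> (w t) * ?b n" for n
      proof -
        have eq: "Hinner m \<Omega> (s n t) (r n t) - Hinner m \<Omega> (w t) (p t)
          = Hinner m \<Omega> (\<lambda>x. s n t x - w t x) (r n t) + Hinner m \<Omega> (\<lambda>x. r n t x - p t x) (w t)"
          using Hinner_diff[OF st(1) elim(1) st(2)] Hinner_diff[OF st(2) elim(2) elim(1)]
          by (simp add: Hinner_commute)
        have "\<bar>Hinner m \<Omega> (s n t) (r n t) - Hinner m \<Omega> (w t) (p t)\<bar>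
          \<le> \<bar>Hinner m \<Omega> (\<lambda>x. s n t x - w t x) (r n t)\<bar> + \<bar>Hinner m \<Omega> (\<lambda>x. r n t x - p t x) (w t)\<bar>"
          unfolding eq by (rule abs_triangle_ineq)
        also have "\<dots> \<le> ?a n * Hnorm m \<Omega> (r n t) + ?b n * Hnorm m \<Omega> (w t)"
          using Hinner_Cauchy_Schwarz[OF sobolev_diff[OF st(1) elim(1)] st(2)]
            Hinner_Cauchy_Schwarz[OF sobolev_diff[OF st(2) elim(2)] elim(1)] by (rule add_mono)
        also have "\<dots> \<le> ?a n * (?b n + Hnorm m \<Omega> (p t)) + Hnorm m \<Omega> (w t) * ?b n"
          using mult_left_mono[OF Hnorm_triangle[OF st(2)[of n] elim(2)] Hnorm_nonneg[of m "\<lambda>x. s n t x - w t x"]]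
          by (simp add: mult.commute[of "Hnorm m \<Omega> (w t)"])
        finally show ?thesis by simp
      qed
      have "(\<lambda>n. ?a n * (?b n + Hnorm m \<Omega> (p t)) + Hnorm m \<Omega> (w t) * ?b n) \<longlonglongrightarrow> 0 * (0 + Hnorm m \<Omega> (p t)) + Hnorm m \<Omega> (w t) * 0"
        by (intro tendsto_intros elim)
      then have "(\<lambda>n. ?a n * (?b n + Hnorm m \<Omega> (p t)) + Hnorm m \<Omega> (w t) * ?b n) \<longlonglongrightarrow> 0" by simp
      from Lim_null_comparison[OF always_eventually[OF allI[OF bound]] this]
      show ?case by (simp add: LIM_zero_iff)
    qed
  qed simp
qed

lemma Hnorm_measurable:
  "H_measurable m \<Omega> w \<Longrightarrow> (\<lambda>t. Hnorm m \<Omega> (w t)) \<in> borel_measurable (lebesgue_on {0<..})"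
  unfolding Hnorm_def using Hinner_measurable by auto

lemma H_measurable_const: "f \<in> sobolev m \<Omega> \<Longrightarrow> H_measurable m \<Omega> (\<lambda>t. f)"
  unfolding H_measurable_def
  using sobolev_diff[of f m f] Hinner_diff[of f m f "\<lambda>x. 0"]
proof (intro conjI exI[of _ "\<lambda>n t. f"] allI)
  assume f: "f \<in> sobolev m \<Omega>"
  have "Hnorm m \<Omega> (\<lambda>x. f x - f x) = 0"
    using Hnorm_power2[of m "\<lambda>x. f x - f x"] Hinner_diff[OF f f sobolev_diff[OF f f]] by simp
  then show "AE t in lebesgue_on {0<..}. (\<lambda>n. Hnorm m \<Omega> (\<lambda>x. f x - f x)) \<longlonglongrightarrow> 0" by simp
qed (auto intro: H_simple_const)

end

text \<open>Rounds down to a multiple of 1 / k and sends large arguments to 0, which leaves finitely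
  many values. The threshold grows like \<open>2^k\<close> times k because difference quotients of
  level k are bounded by a multiple of \<open>2^k\<close>.\<close>

definition round_to :: "nat \<Rightarrow> real \<Rightarrow> real" where
  "round_to k y = (if \<bar>y\<bar> \<le> real k * 2^k then of_int \<lfloor>real k * y\<rfloor> / real k else 0)"

lemma round_to_measurable [measurable]: "round_to k \<in> borel_measurable borel"
  unfolding round_to_def[abs_def] by measurable

lemma finite_range_round_to: "finite (range (round_to k))"
proof -
  let ?N = "\<lceil>real k * (real k * 2^k)\<rceil> + 1"
  have "range (round_to k) \<subseteq> insert 0 ((\<lambda>i. of_int i / real k) ` {- ?N..?N})"
  proof (rule image_subsetI)
    fix y :: real
    have "\<lfloor>real k * y\<rfloor> \<in> {- ?N..?N}" if "\<bar>y\<bar> \<le> real k * 2^k"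
    proof -
      have "\<bar>real k * y\<bar> \<le> real k * (real k * 2^k)"
        using that by (simp add: abs_mult mult_left_mono)
      then show ?thesis by (auto; linarith)
    qed
    then show "round_to k y \<in> insert 0 ((\<lambda>i. of_int i / real k) ` {- ?N..?N})"
      by (auto simp: round_to_def)
  qed
  then show ?thesis by (rule finite_subset) auto
qed

lemma round_to_error:
  assumes "k > 0" "\<bar>y\<bar> \<le> real k * 2^k"
  shows "\<bar>round_to k y - y\<bar> \<le> 1 / real k"
proof -
  have "\<bar>of_int \<lfloor>real k * y\<rfloor> - real k * y\<bar> \<le> 1" by linarith
  then have "\<bar>of_int \<lfloor>real k * y\<rfloor> - real k * y\<bar> / real k \<le> 1 / real k"
    by (rule divide_right_mono) simp
  moreover have "round_to k y - y = (of_int \<lfloor>real k * y\<rfloor> - real k * y) / real k"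
    using assms by (simp add: round_to_def field_simps)
  ultimately show ?thesis by (simp add: abs_divide)
qed

context bounded_interval
begin

definition mid :: real where "mid = (a + b) / 2"

lemma mid_in: "mid \<in> \<Omega>" using ab by (auto simp: mid_def)

text \<open>Integrate h twice; the two constants of integration are fixed by the value and the slope
  at the midpoint.\<close>

lemma H2_exists:
  assumes h: "square_integrable LL h"
  obtains f f1 where "H2 f f1 h" "f mid = \<alpha>" "f1 mid = \<beta>"
proof -
  define f1 where "f1 x = \<beta> + (increment \<Omega> h a x - increment \<Omega> h a mid)" for x
  have c: "continuous_on {a..b} f1"
    unfolding f1_def by (intro continuous_intros increment_continuous_on h)
  have "isCont f1 x" if "x \<in> \<Omega>" for x
    using continuous_on_interior[OF c, of x] that by simp
  then obtain F where F: "\<And>x. x \<in> \<Omega> \<Longrightarrow> (F has_real_derivative f1 x) (at x)"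
    using einterval_antiderivative[of "ereal a" "ereal b" f1] ab
    by (auto simp: has_real_derivative_iff_has_vector_derivative)
  show thesis
  proof (rule that[of "\<lambda>x. F x - F mid + \<alpha>" f1])
    have "primitive f1 h"
      unfolding primitive_def
    proof (intro conjI ballI impI h)
      fix x y assume "x \<in> \<Omega>" "y \<in> \<Omega>" "x \<le> y"
      then show "f1 y - f1 x = increment \<Omega> h x y"
        using increment_add'[OF square_integrable_integrable[OF h], of a x y] by (simp add: f1_def)
    qed
    then show "H2 (\<lambda>x. F x - F mid + \<alpha>) f1 h"
      unfolding H2_def by (auto intro!: derivative_eq_intros F)
  qed (auto simp: f1_def)
qed

lemma norm2_le_const:
  assumes "f \<in> borel_measurable LL" "\<And>x. x \<in> \<Omega> \<Longrightarrow> \<bar>f x\<bar> \<le> B"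
  shows "norm2 LL f \<le> B * sqrt (b - a)"
proof -
  have "B \<ge> 0" using assms(2)[OF mid_in] by linarith
  then show ?thesis
    using norm2_mono(2)[OF assms(1) square_integrable_const[of B]] assms(2) by (simp add: norm2_const)
qed

lemma primitive_norm2_le:
  assumes p: "primitive f h"
  shows "norm2 LL f \<le> (\<bar>f mid\<bar> + norm2 LL h * sqrt (b - a)) * sqrt (b - a)"
proof (rule norm2_le_const)
  show "f \<in> borel_measurable LL" using primitive_square_integrable[OF p] by auto
  fix x assume x: "x \<in> \<Omega>"
  have "\<bar>f x - f mid\<bar> \<le> norm2 LL h * sqrt \<bar>x - mid\<bar>"
    by (rule primitive_Hoelder[OF p x mid_in])
  also have "\<dots> \<le> norm2 LL h * sqrt (b - a)"
    using x mid_in by (intro mult_left_mono real_sqrt_le_mono) auto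
  finally show "\<bar>f x\<bar> \<le> \<bar>f mid\<bar> + norm2 LL h * sqrt (b - a)" by linarith
qed

text \<open>The value at the midpoint and the norm of the derivative control a function; this is
  used first for f1 n and then for f n.\<close>

lemma H2_Hnorm_tendsto_0:
  assumes H: "\<And>n. H2 (f n) (f1 n) (f2 n)"
    and l: "(\<lambda>n. f n mid) \<longlonglongrightarrow> 0" "(\<lambda>n. f1 n mid) \<longlonglongrightarrow> 0" "(\<lambda>n. norm2 LL (f2 n)) \<longlonglongrightarrow> 0"
  shows "(\<lambda>n. Hnorm 2 \<Omega> (f n)) \<longlonglongrightarrow> 0"
proof -
  have squeeze: "X \<longlonglongrightarrow> 0" if "\<And>n. 0 \<le> X n" "\<And>n. X n \<le> Y n" "Y \<longlonglongrightarrow> 0" for X Y :: "nat \<Rightarrow> real"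
    using that by (intro tendsto_sandwich[of "\<lambda>n. 0" X _ Y]) auto
  have "(\<lambda>n. (\<bar>f1 n mid\<bar> + norm2 LL (f2 n) * sqrt (b - a)) * sqrt (b - a)) \<longlonglongrightarrow> (\<bar>0\<bar> + 0 * sqrt (b - a)) * sqrt (b - a)"
    by (intro tendsto_intros l)
  then have l1: "(\<lambda>n. norm2 LL (f1 n)) \<longlonglongrightarrow> 0"
    by (intro squeeze[OF _ primitive_norm2_le[OF H2_primitive1[OF H]]]) auto
  have "(\<lambda>n. (\<bar>f n mid\<bar> + norm2 LL (f1 n) * sqrt (b - a)) * sqrt (b - a)) \<longlonglongrightarrow> (\<bar>0\<bar> + 0 * sqrt (b - a)) * sqrt (b - a)"
    by (intro tendsto_intros l l1)
  then have l0: "(\<lambda>n. norm2 LL (f n)) \<longlonglongrightarrow> 0"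
    by (intro squeeze[OF _ primitive_norm2_le[OF H2_primitive[OF H]]]) auto
  have "(\<lambda>n. (norm2 LL (f n))\<^sup>2 + (norm2 LL (f1 n))\<^sup>2 + (norm2 LL (f2 n))\<^sup>2) \<longlonglongrightarrow> 0\<^sup>2 + 0\<^sup>2 + 0\<^sup>2"
    by (intro tendsto_intros l0 l1 l(3))
  then have "(\<lambda>n. sqrt ((Hnorm 2 \<Omega> (f n))\<^sup>2)) \<longlonglongrightarrow> sqrt 0"
    unfolding H2_Hnorm[OF H] by (intro tendsto_real_sqrt) simp
  then show ?thesis by simp
qed

lemma primitive_diff:
  assumes "primitive f f'" "primitive g g'"
  shows "primitive (\<lambda>x. f x - g x) (\<lambda>x. f' x - g' x)"
  unfolding primitive_def
proof (intro conjI ballI impI)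
  show "square_integrable LL (\<lambda>x. f' x - g' x)" using assms by (intro square_integrable_diff primitiveD)
  fix x y assume xy: "x \<in> \<Omega>" "y \<in> \<Omega>" "x \<le> y"
  have "increment \<Omega> (\<lambda>x. f' x + (-1) * g' x) x y = increment \<Omega> f' x y + (-1) * increment \<Omega> g' x y"
    using assms xy by (intro increment_linear square_integrable_loc_integrable primitiveD)
  then show "f y - g y - (f x - g x) = increment \<Omega> (\<lambda>x. f' x - g' x) x y"
    using primitive_increment[OF assms(1) xy] primitive_increment[OF assms(2) xy] by simp
qed

lemma H2_diff:
  assumes "H2 f f1 f2" "H2 g g1 g2"
  shows "H2 (\<lambda>x. f x - g x) (\<lambda>x. f1 x - g1 x) (\<lambda>x. f2 x - g2 x)"
  using primitive_diff[OF H2_primitive1[OF assms(1)] H2_primitive1[OF assms(2)]] assms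
  unfolding H2_def by (auto intro!: derivative_eq_intros)

definition cells :: "nat \<Rightarrow> (nat \<Rightarrow> real) \<Rightarrow> real \<Rightarrow> real" where
  "cells k \<sigma> x = (\<Sum>j<2^k. \<sigma> j * indicator {pt k j<..pt k (Suc j)} x)"

lemma square_integrable_cells: "square_integrable LL (cells k \<sigma>)"
  unfolding cells_def[abs_def]
  by (intro square_integrable_sum square_integrable_cmult square_integrable_indicator)

lemma cells_le:
  assumes "\<And>j. j < 2^k \<Longrightarrow> \<bar>\<sigma> j\<bar> \<le> e" "e \<ge> 0"
  shows "\<bar>cells k \<sigma> x\<bar> \<le> e"
proof (cases "\<exists>i<2^k. x \<in> {pt k i<..pt k (Suc i)}")
  case True
  then obtain i where i: "i < 2^k" "x \<in> {pt k i<..pt k (Suc i)}" by blast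
  have "indicat_real {pt k j<..pt k (Suc j)} x = 0" if "j \<noteq> i" for j
  proof (cases "j < i")
    case True
    then have "pt k (Suc j) \<le> pt k i" by (intro pt_mono) simp
    then show ?thesis using i(2) by (auto simp: indicator_def)
  next
    case False
    then have "pt k (Suc i) \<le> pt k j" using that by (intro pt_mono) simp
    then show ?thesis using i(2) by (auto simp: indicator_def)
  qed
  then have "cells k \<sigma> x = (\<Sum>j<2^k. if j = i then \<sigma> i else 0)"
    unfolding cells_def using i(2) by (intro sum.cong) (auto simp: indicator_def)
  then show ?thesis using i(1) assms(1)[OF i(1)] by simp
next
  case False
  then have "cells k \<sigma> x = 0" unfolding cells_def by (intro sum.neutral) (auto simp: indicator_def)
  then show ?thesis using assms(2) by simp
qed

text \<open>Entry 0 is the value at the midpoint, entry 1 the slope there, and entry j + 2 the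
  constant second derivative on cell j. A fixed choice makes the result depend on d alone, so
  finitely many data give finitely many functions.\<close>

definition from_data :: "nat \<Rightarrow> (nat \<Rightarrow> real) \<Rightarrow> real \<Rightarrow> real" where
  "from_data k d = (SOME f. \<exists>f1. H2 f f1 (cells k (\<lambda>j. d (j + 2))) \<and> f mid = d 0 \<and> f1 mid = d 1)"

lemma from_data:
  obtains f1 where "H2 (from_data k d) f1 (cells k (\<lambda>j. d (j + 2)))" "from_data k d mid = d 0" "f1 mid = d 1"
proof -
  have "\<exists>f f1. H2 f f1 (cells k (\<lambda>j. d (j + 2))) \<and> f mid = d 0 \<and> f1 mid = d 1"
    using H2_exists[OF square_integrable_cells] by metis
  from someI_ex[OF this] show thesis using that unfolding from_data_def by blast
qed

text \<open>Pettis' theorem for functions with values in \<open>H\<^sup>2\<close>: the difference quotients of \<open>w t\<close> determine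
  the dyadic averages of its second derivative, and rounding these yields simple functions.\<close>

theorem H_measurable_2I:
  assumes H: "AE t in lebesgue_on {0<..}. \<exists>f1 f2. H2 (w t) f1 f2"
    and m: "\<And>x. x \<in> \<Omega> \<Longrightarrow> (\<lambda>t. w t x) \<in> borel_measurable (lebesgue_on {0<..})"
  shows "H_measurable 2 \<Omega> w"
proof -
  let ?T = "lebesgue_on {0::real<..}"
  \<comment> \<open>These increments tend to 0 and keep y + \<delta> y n inside \<Omega>, so the
    derivative at y is a limit of measurable quotients.\<close>
  define \<delta> where "\<delta> y n = (b - y) / real (n + 2)" for y n
  have \<delta>: "y + \<delta> y n \<in> \<Omega>" "\<delta> y n > 0" if "y \<in> \<Omega>" for y n
  proof -
    have "\<delta> y n \<le> (b - y) / 2" unfolding \<delta>_def using that by (intro divide_left_mono) auto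
    moreover show "\<delta> y n > 0" unfolding \<delta>_def using that by simp
    ultimately show "y + \<delta> y n \<in> \<Omega>" using that by auto
  qed
  have inv0: "(\<lambda>n. c / real (n + 2)) \<longlonglongrightarrow> 0" for c :: real
    using LIMSEQ_ignore_initial_segment[OF lim_const_over_n[of c], of 2] by simp
  define Dw where "Dw y t = lim (\<lambda>n. (w t (y + \<delta> y n) - w t y) / \<delta> y n)" for y t
  \<comment> \<open>The dyadic points include a and b, where w t need not have a derivative; they
    are approached from inside.\<close>
  define \<xi> where "\<xi> p n = p + (mid - p) / real (n + 2)" for p n
  have \<xi>: "\<xi> p n \<in> \<Omega>" if "a \<le> p" "p \<le> b" for p n
  proof -
    define r where "r = 1 / real (n + 2)"
    have l: "0 < r" "r < 1" by (auto simp: r_def)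
    have e: "\<xi> p n = (1 - r) * p + r * mid" by (simp add: \<xi>_def r_def algebra_simps diff_divide_distrib)
    have "(1 - r) * a + r * a < (1 - r) * p + r * mid"
      using l mid_in that by (intro add_le_less_mono mult_left_mono mult_strict_left_mono) auto
    moreover have "(1 - r) * p + r * mid < (1 - r) * b + r * b"
      using l mid_in that by (intro add_le_less_mono mult_left_mono mult_strict_left_mono) auto
    ultimately show ?thesis unfolding e by (simp add: algebra_simps)
  qed
  have \<xi>_lim: "\<xi> p \<longlonglongrightarrow> p" for p
    using tendsto_add[OF tendsto_const inv0[of "mid - p"], of p] by (simp add: \<xi>_def[abs_def])
  define Pw where "Pw p t = lim (\<lambda>n. Dw (\<xi> p n) t)" for p t
  have Dwm: "Dw y \<in> borel_measurable ?T" if "y \<in> \<Omega>" for y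
    unfolding Dw_def[abs_def]
  proof (rule borel_measurable_lim_metric)
    show "(\<lambda>t. (w t (y + \<delta> y n) - w t y) / \<delta> y n) \<in> borel_measurable ?T" for n
      using m[OF that] m[OF \<delta>(1)[OF that]] by (intro borel_measurable_divide borel_measurable_diff) auto
  qed
  have Pwm: "Pw p \<in> borel_measurable ?T" if "a \<le> p" "p \<le> b" for p
    unfolding Pw_def[abs_def] by (rule borel_measurable_lim_metric) (intro Dwm \<xi> that)
  \<comment> \<open>The layout of \<open>from_data\<close>: for i at least 2 the cell has number i -
    2, and its ends are the points i - 2 and i - 1.\<close>
  define coef where "coef k i t = (if i = 0 then w t mid else if i = 1 then Dw mid t
      else (Pw (pt k (i - 1)) t - Pw (pt k (i - 2)) t) / mesh k)" for k i t
  have coefm: "coef k i \<in> borel_measurable ?T" if "i < 2^k + 2" for k i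
  proof -
    consider "i = 0" | "i = 1" | "i \<ge> 2" by linarith
    then show ?thesis
    proof cases
      case 1 then show ?thesis using m[OF mid_in] by (simp add: coef_def[abs_def])
    next
      case 2 then show ?thesis using Dwm[OF mid_in] by (simp add: coef_def[abs_def])
    next
      case 3
      have "Pw (pt k (i - 1)) \<in> borel_measurable ?T" "Pw (pt k (i - 2)) \<in> borel_measurable ?T"
        using that 3 by (intro Pwm pt_bounds; simp)+
      then have "(\<lambda>t. (Pw (pt k (i - 1)) t - Pw (pt k (i - 2)) t) / mesh k) \<in> borel_measurable ?T"
        by (intro borel_measurable_divide borel_measurable_diff) auto
      then show ?thesis using 3 by (simp add: coef_def[abs_def])
    qed
  qed
  \<comment> \<open>Zero beyond the entries in use, so that only finitely many sequences of data
    occur.\<close>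
  define data where "data k t i = (if i < 2^k + 2 then round_to k (coef k i t) else 0)" for k t i
  define s where "s k t = from_data k (data k t)" for k t
  have simple: "H_simple 2 \<Omega> (s k)" for k
  proof -
    define X :: "(nat \<Rightarrow> real) set" where "X = {d. (\<forall>i. (i \<in> {..<2^k + 2} \<longrightarrow> d i \<in> range (round_to k)) \<and> (i \<notin> {..<2^k + 2} \<longrightarrow> d i = (0::real)))}"
    have X: "finite X" unfolding X_def
      by (rule finite_set_of_finite_funs) (auto simp: finite_range_round_to)
    have dX: "data k t \<in> X" for t by (auto simp: X_def data_def)
    have fin: "finite (s k ` {0<..})"
      by (rule finite_subset[of _ "from_data k ` X"]) (use dX X in \<open>auto simp: s_def\<close>)
    have dm: "{t\<in>{0<..}. data k t = d} \<in> sets lebesgue" if "d \<in> X" for d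
    proof -
      have "{t\<in>{0<..}. data k t = d} = (\<Inter>i\<in>{..<2^k+2}. {t\<in>{0<..}. round_to k (coef k i t) = d i})"
        using that by (fastforce simp: data_def fun_eq_iff X_def)
      also have "\<dots> \<in> sets lebesgue"
      proof (intro sets.finite_INT)
        fix i assume "i \<in> {..<(2::nat)^k + 2}"
        then have "(\<lambda>t. round_to k (coef k i t)) \<in> borel_measurable ?T"
          by (intro measurable_compose[OF coefm round_to_measurable]) simp
        from measurable_sets[OF this, of "{d i}"]
        have "(\<lambda>t. round_to k (coef k i t)) -` {d i} \<inter> {0<..} \<in> sets ?T" by simp
        moreover have "(\<lambda>t. round_to k (coef k i t)) -` {d i} \<inter> {0<..} = {t\<in>{0<..}. round_to k (coef k i t) = d i}"
          by auto
        ultimately show "{t\<in>{0<..}. round_to k (coef k i t) = d i} \<in> sets lebesgue"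
          by (simp add: sets_restrict_space_iff)
      qed auto
      finally show ?thesis .
    qed
    have "{t\<in>{0<..}. s k t = h} \<in> sets lebesgue" for h
    proof -
      have "{t\<in>{0<..}. s k t = h} = (\<Union>d\<in>{d\<in>X. from_data k d = h}. {t\<in>{0<..}. data k t = d})"
        using dX by (auto simp: s_def)
      also have "\<dots> \<in> sets lebesgue" using X dm by (intro sets.finite_UN) auto
      finally show ?thesis .
    qed
    moreover have "s k t \<in> sobolev 2 \<Omega>" for t
      unfolding s_def by (metis from_data H2_sobolev)
    ultimately show ?thesis using fin by (auto simp: H_simple_def)
  qed
  have "AE t in ?T. w t \<in> sobolev 2 \<Omega>" using H by eventually_elim (auto intro: H2_sobolev)
  moreover have "AE t in ?T. (\<lambda>k. Hnorm 2 \<Omega> (\<lambda>x. s k t x - w t x)) \<longlonglongrightarrow> 0"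
    using H
  proof eventually_elim
    case (elim t)
    then obtain f1 f2 where H: "H2 (w t) f1 f2" by blast
    note p = H2_primitive1[OF H]
    note f2 = primitiveD[OF p]
    have Dw: "Dw y t = f1 y" if y: "y \<in> \<Omega>" for y
      unfolding Dw_def
    proof (rule limI)
      have "((\<lambda>h. (w t (y + h) - w t y) / h) \<longlongrightarrow> f1 y) (at 0)"
        using H2_DERIV[OF H y] by (simp add: DERIV_def)
      moreover have "filterlim (\<delta> y) (at 0) sequentially"
        using \<delta>(2)[OF y] inv0[of "b - y"] by (auto simp: filterlim_at \<delta>_def[abs_def] intro!: always_eventually)
      ultimately show "(\<lambda>n. (w t (y + \<delta> y n) - w t y) / \<delta> y n) \<longlonglongrightarrow> f1 y"
        by (rule filterlim_compose)
    qed
    let ?F = "increment \<Omega> f2 a"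
    have f1F: "f1 y = f1 mid + (?F y - ?F mid)" if y: "y \<in> \<Omega>" for y
    proof (cases "mid \<le> y")
      case True
      then show ?thesis using primitive_increment[OF p mid_in y True]
          increment_add'[OF square_integrable_integrable[OF f2], of a mid y] mid_in by simp
    next
      case False
      then show ?thesis using primitive_increment[OF p y mid_in]
          increment_add'[OF square_integrable_integrable[OF f2], of a y mid] y by simp
    qed
    have Pw: "Pw p t = f1 mid + (?F p - ?F mid)" if p: "a \<le> p" "p \<le> b" for p
      unfolding Pw_def
    proof (rule limI)
      have "\<forall>n. \<xi> p n \<in> {a..b}" using \<xi>[OF p] by (meson atLeastAtMost_iff greaterThanLessThan_iff less_imp_le)
      then have "(\<lambda>n. ?F (\<xi> p n)) \<longlonglongrightarrow> ?F p"
        using continuous_on_tendsto_compose[OF increment_continuous_on[OF f2] \<xi>_lim] p by auto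
      then have "(\<lambda>n. f1 mid + (?F (\<xi> p n) - ?F mid)) \<longlonglongrightarrow> f1 mid + (?F p - ?F mid)"
        by (intro tendsto_intros)
      then show "(\<lambda>n. Dw (\<xi> p n) t) \<longlonglongrightarrow> f1 mid + (?F p - ?F mid)"
        using \<xi>[OF p] by (simp add: Dw f1F)
    qed
    have slope: "coef k (j + 2) t = slope k ?F j" if "j < 2^k" for k j
      using Pw[of "pt k (Suc j)"] Pw[of "pt k j"] pt_bounds[of j k] pt_bounds[of "Suc j" k] that
      by (simp add: coef_def slope_def)
    \<comment> \<open>Bounds the value and the slope at the midpoint, and also the difference
      quotients of level k divided by \<open>2^k\<close>.\<close>
    define M where "M = \<bar>w t mid\<bar> + \<bar>f1 mid\<bar> + norm2 LL f2 * sqrt (b - a) / (b - a)"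
    obtain K where K: "real K \<ge> M" using real_arch_simple by blast
    have coef_bound: "\<bar>coef k i t\<bar> \<le> real k * 2^k" if k: "k \<ge> K" "i < 2^k + 2" for k i
    proof -
      have M: "M \<le> real k" using K k by linarith
      have n0: "0 \<le> norm2 LL f2 * sqrt (b - a) / (b - a)" using ab by simp
      have "real k * 1 \<le> real k * 2^k" by (intro mult_left_mono) auto
      then have Mk: "M \<le> real k * 2^k" using M by linarith
      consider "i = 0" | "i = 1" | j where "i = j + 2" by (metis One_nat_def add_2_eq_Suc' less_2_cases not_less nat_le_iff_add add.commute)
      then show ?thesis
      proof cases
        case 1 then show ?thesis using Mk n0 by (simp add: coef_def M_def)
      next
        case 2 then show ?thesis using Mk n0 Dw[OF mid_in] by (simp add: coef_def M_def)
      next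
        case 3
        then have j: "j < 2^k" using k by simp
        have "\<bar>?F (pt k (Suc j)) - ?F (pt k j)\<bar> \<le> sqrt \<bar>pt k (Suc j) - pt k j\<bar> * norm2 LL f2"
          using j by (intro increment_dist[OF f2] pt_bounds) auto
        also have "\<dots> \<le> sqrt (b - a) * norm2 LL f2"
        proof (intro mult_right_mono real_sqrt_le_mono)
          show "\<bar>pt k (Suc j) - pt k j\<bar> \<le> b - a"
            using pt_bounds[of j k] pt_bounds[of "Suc j" k] j by (auto simp: abs_le_iff)
        qed simp
        finally have "\<bar>slope k ?F j\<bar> \<le> sqrt (b - a) * norm2 LL f2 / mesh k"
          using mesh_pos[of k] by (simp add: slope_def abs_divide divide_right_mono)
        also have "\<dots> = (norm2 LL f2 * sqrt (b - a) / (b - a)) * 2^k"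
          using ab by (simp add: mesh_def field_simps)
        also have "\<dots> \<le> real k * 2^k"
          using M by (intro mult_right_mono) (auto simp: M_def)
        finally show ?thesis using slope[OF j] 3 by simp
      qed
    qed
    have data_err: "\<bar>data k t i - coef k i t\<bar> \<le> 1 / real k" if "k \<ge> Suc K" "i < 2^k + 2" for k i
      using round_to_error[of k "coef k i t"] coef_bound[of k i] that by (simp add: data_def)
    have "\<exists>g. H2 (s k t) g (cells k (\<lambda>j. data k t (j + 2))) \<and> s k t mid = data k t 0 \<and> g mid = data k t 1" for k
      unfolding s_def by (metis from_data)
    then obtain g where g: "\<And>k. H2 (s k t) (g k) (cells k (\<lambda>j. data k t (j + 2)))"
        "\<And>k. s k t mid = data k t 0" "\<And>k. g k mid = data k t 1"
      by metis
    \<comment> \<open>From level K on, all coefficients lie below the threshold of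
      \<open>round_to\<close>; the successor keeps the divisor in 1 / k positive.\<close>
    let ?k = "\<lambda>n. n + Suc K"
    have one_over: "(\<lambda>n. 1 / real (?k n)) \<longlonglongrightarrow> 0"
      using LIMSEQ_ignore_initial_segment[OF lim_const_over_n[of 1], of "Suc K"] by simp
    have "(\<lambda>n. Hnorm 2 \<Omega> (\<lambda>x. s (?k n) t x - w t x)) \<longlonglongrightarrow> 0"
    proof (rule H2_Hnorm_tendsto_0[OF H2_diff[OF g(1) H]])
      show "(\<lambda>n. s (?k n) t mid - w t mid) \<longlonglongrightarrow> 0"
        by (rule Lim_null_comparison[OF always_eventually[OF allI] one_over])
           (use data_err[of "?k _" 0] in \<open>simp add: g(2) coef_def\<close>)
      show "(\<lambda>n. g (?k n) mid - f1 mid) \<longlonglongrightarrow> 0"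
        by (rule Lim_null_comparison[OF always_eventually[OF allI] one_over])
           (use data_err[of "?k _" 1] Dw[OF mid_in] in \<open>simp add: g(3) coef_def\<close>)
      have bound: "norm2 LL (\<lambda>x. cells k (\<lambda>j. data k t (j + 2)) x - f2 x)
          \<le> 1 / real k * sqrt (b - a) + norm2 LL (\<lambda>x. step k ?F x - f2 x)" if k: "k \<ge> Suc K" for k
      proof -
        have eq: "cells k (\<lambda>j. data k t (j + 2)) x - step k ?F x = cells k (\<lambda>j. data k t (j + 2) - slope k ?F j) x" for x
          unfolding cells_def step_def by (simp only: left_diff_distrib sum_subtractf)
        have "norm2 LL (\<lambda>x. cells k (\<lambda>j. data k t (j + 2)) x - step k ?F x) \<le> 1 / real k * sqrt (b - a)"
        proof (rule norm2_le_const)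
          show "(\<lambda>x. cells k (\<lambda>j. data k t (j + 2)) x - step k ?F x) \<in> borel_measurable LL"
            using square_integrable_diff[OF square_integrable_cells square_integrable_step] by auto
          show "\<bar>cells k (\<lambda>j. data k t (j + 2)) x - step k ?F x\<bar> \<le> 1 / real k" for x
            unfolding eq
          proof (rule cells_le)
            show "\<bar>data k t (j + 2) - slope k ?F j\<bar> \<le> 1 / real k" if "j < 2^k" for j
              using data_err[OF k, of "j + 2"] slope[OF that] that by simp
          qed simp
        qed
        then show ?thesis
          using norm2_diff_triangle[OF square_integrable_cells[of k "\<lambda>j. data k t (j + 2)"] square_integrable_step[of k ?F] f2]
          by linarith
      qed
      show "(\<lambda>n. norm2 LL (\<lambda>x. cells (?k n) (\<lambda>j. data (?k n) t (j + 2)) x - f2 x)) \<longlonglongrightarrow> 0"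
      proof (rule tendsto_sandwich[OF _ _ tendsto_const])
        show "\<forall>\<^sub>F n in sequentially. 0 \<le> norm2 LL (\<lambda>x. cells (?k n) (\<lambda>j. data (?k n) t (j + 2)) x - f2 x)" by simp
        show "\<forall>\<^sub>F n in sequentially. norm2 LL (\<lambda>x. cells (?k n) (\<lambda>j. data (?k n) t (j + 2)) x - f2 x)
            \<le> 1 / real (?k n) * sqrt (b - a) + norm2 LL (\<lambda>x. step (?k n) ?F x - f2 x)"
          by (intro always_eventually allI bound) simp
        have "(\<lambda>n. 1 / real (?k n) * sqrt (b - a) + norm2 LL (\<lambda>x. step (?k n) ?F x - f2 x)) \<longlonglongrightarrow> 0 * sqrt (b - a) + 0"
          by (intro tendsto_add tendsto_mult one_over tendsto_const LIMSEQ_ignore_initial_segment[OF step_tendsto[OF f2]])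
        then show "(\<lambda>n. 1 / real (?k n) * sqrt (b - a) + norm2 LL (\<lambda>x. step (?k n) ?F x - f2 x)) \<longlonglongrightarrow> 0" by simp
      qed
    qed
    then show ?case by (rule LIMSEQ_offset)
  qed
  ultimately show ?thesis unfolding H_measurable_def using simple by blast
qed

end

section \<open>Weak convergence from pointwise convergence\<close>

abbreviation "TT \<equiv> lebesgue_on {0::real<..}"

lemma open_interval_pos: "open_interval {0::real<..}"
  by standard (auto simp: is_interval_1)

text \<open>The factors A n are bounded in \<open>L\<^sup>2\<close> only, which gives no common
  majorant. Where A n is at most k F one exists, of size \<open>k * F\<^sup>2\<close> plus A' F;
  elsewhere F is below A n / k and the contribution is of order B / k.\<close>

lemma integral_truncation_tendsto:
  fixes G A :: "nat \<Rightarrow> 'a \<Rightarrow> real"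
  assumes meas: "\<And>n. G n \<in> borel_measurable M" "g \<in> borel_measurable M"
    "\<And>n. square_integrable M (A n)" "square_integrable M A'" "square_integrable M F"
    and nn: "\<And>n x. A n x \<ge> 0" "\<And>x. A' x \<ge> 0" "\<And>x. F x \<ge> 0"
    and le: "\<And>n. AE x in M. \<bar>G n x\<bar> \<le> A n x * F x" "AE x in M. \<bar>g x\<bar> \<le> A' x * F x"
    and B: "\<And>n. (LINT x|M. (A n x)\<^sup>2) \<le> B" "(LINT x|M. (A' x)\<^sup>2) \<le> B"
    and lim: "AE x in M. \<forall>R. (\<lambda>n. if A n x \<le> R then G n x - g x else 0) \<longlonglongrightarrow> 0"
  shows "(\<lambda>n. LINT x|M. G n x) \<longlonglongrightarrow> (LINT x|M. g x)"
proof (rule tendsto_by_approximation)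
  fix e :: real assume e: "e > 0"
  have [measurable]: "\<And>n. G n \<in> borel_measurable M" "g \<in> borel_measurable M"
    "\<And>n. A n \<in> borel_measurable M" "A' \<in> borel_measurable M" "F \<in> borel_measurable M"
    using meas by auto
  have "0 \<le> (LINT x|M. (A' x)\<^sup>2)" by simp
  then have B0: "B \<ge> 0" using B(2) by linarith
  \<comment> \<open>Makes the final error 2 B / k at most e; the summand 1 covers B = 0.\<close>
  define k where "k = (2 * B + 1) / e"
  have k: "k > 0" using e B0 by (simp add: k_def)
  have iG: "integrable M (G n)" for n
    by (rule Bochner_Integration.integrable_bound[OF square_integrable_mult[OF meas(3)[of n] meas(5)]])
       (use le(1)[of n] in \<open>auto elim!: eventually_mono\<close>)
  have ig: "integrable M g"
    by (rule Bochner_Integration.integrable_bound[OF square_integrable_mult[OF meas(4,5)]])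
       (use le(2) in \<open>auto elim!: eventually_mono\<close>)
  define H where "H n x = (if A n x \<le> k * F x then G n x - g x else 0)" for n x
  have [measurable]: "H n \<in> borel_measurable M" for n unfolding H_def[abs_def] by measurable
  have iH: "integrable M (H n)" for n
  proof (rule Bochner_Integration.integrable_bound)
    show "integrable M (\<lambda>x. G n x - g x)" using iG ig by simp
  qed (auto simp: H_def)
  have limH: "(\<lambda>n. LINT x|M. H n x) \<longlonglongrightarrow> (LINT x|M. 0)"
  proof (rule integral_dominated_convergence)
    show "integrable M (\<lambda>x. k * (F x)\<^sup>2 + A' x * F x)"
      using square_integrable_square[OF meas(5)] square_integrable_mult[OF meas(4,5)] by simp
    show "AE x in M. (\<lambda>n. H n x) \<longlonglongrightarrow> 0"
      using lim unfolding H_def by eventually_elim auto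
    show "AE x in M. norm (H n x) \<le> k * (F x)\<^sup>2 + A' x * F x" for n
      using le(1)[of n] le(2)
    proof eventually_elim
      case (elim x)
      have pos: "0 \<le> A' x * F x" "0 \<le> k * (F x)\<^sup>2" using nn k by auto
      show ?case
      proof (cases "A n x \<le> k * F x")
        case True
        then have "A n x * F x \<le> k * (F x)\<^sup>2"
          using mult_right_mono[OF True nn(3)[of x]] by (simp add: power2_eq_square mult.assoc)
        then show ?thesis using elim True by (simp add: H_def)
      qed (use pos in \<open>simp add: H_def\<close>)
    qed
  qed auto
  have err: "\<bar>(LINT x|M. G n x) - ((LINT x|M. H n x) + (LINT x|M. g x))\<bar> \<le> e" for n
  proof -
    have "(LINT x|M. G n x) - ((LINT x|M. H n x) + (LINT x|M. g x)) = (LINT x|M. G n x - g x - H n x)"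
      using iG ig iH by simp
    also have "\<bar>\<dots>\<bar> \<le> (LINT x|M. \<bar>G n x - g x - H n x\<bar>)" by (rule integral_abs_bound)
    also have "\<dots> \<le> (LINT x|M. (3/2 * (A n x)\<^sup>2 + 1/2 * (A' x)\<^sup>2) / k)"
    proof (rule integral_mono_AE)
      show "integrable M (\<lambda>x. \<bar>G n x - g x - H n x\<bar>)" using iG ig iH by simp
      show "integrable M (\<lambda>x. (3/2 * (A n x)\<^sup>2 + 1/2 * (A' x)\<^sup>2) / k)"
        using square_integrable_square[OF meas(3)] square_integrable_square[OF meas(4)] by simp
      show "AE x in M. \<bar>G n x - g x - H n x\<bar> \<le> (3/2 * (A n x)\<^sup>2 + 1/2 * (A' x)\<^sup>2) / k"
        using le(1)[of n] le(2)
      proof eventually_elim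
        case (elim x)
        have rhs: "0 \<le> (3/2 * (A n x)\<^sup>2 + 1/2 * (A' x)\<^sup>2) / k" using k by simp
        show ?case
        proof (cases "A n x \<le> k * F x")
          case True then show ?thesis using rhs by (simp add: H_def)
        next
          case False
          have Fk: "F x \<le> A n x / k" using False k by (simp add: field_simps)
          have 1: "A n x * F x \<le> A n x * (A n x / k)" "A' x * F x \<le> A' x * (A n x / k)"
            by (rule mult_left_mono[OF Fk nn(1)], rule mult_left_mono[OF Fk nn(2)])
          have "2 * (A' x * A n x) \<le> (A n x)\<^sup>2 + (A' x)\<^sup>2"
            using zero_le_power2[of "A n x - A' x"] by (simp add: power2_diff mult.commute)
          then have "A' x * A n x / k \<le> (1/2 * (A n x)\<^sup>2 + 1/2 * (A' x)\<^sup>2) / k"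
            using k by (intro divide_right_mono) auto
          moreover have "A n x * F x + A' x * F x \<le> (A n x)\<^sup>2 / k + A' x * A n x / k"
            using 1 by (simp add: power2_eq_square)
          moreover have "(A n x)\<^sup>2 / k + (1/2 * (A n x)\<^sup>2 + 1/2 * (A' x)\<^sup>2) / k = (3/2 * (A n x)\<^sup>2 + 1/2 * (A' x)\<^sup>2) / k"
            by (simp add: add_divide_distrib)
          moreover have "\<bar>G n x - g x\<bar> \<le> A n x * F x + A' x * F x" using elim by linarith
          ultimately show ?thesis using False by (simp add: H_def)
        qed
      qed
    qed
    also have "\<dots> = (3/2 * (LINT x|M. (A n x)\<^sup>2) + 1/2 * (LINT x|M. (A' x)\<^sup>2)) / k"
      using square_integrable_square[OF meas(3)] square_integrable_square[OF meas(4)] by simp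
    also have "\<dots> \<le> (3/2 * B + 1/2 * B) / k"
      using B k by (intro divide_right_mono add_mono mult_left_mono) auto
    also have "\<dots> \<le> e" using e B0 by (simp add: k_def field_simps)
    finally show ?thesis .
  qed
  show "\<exists>Y y. Y \<longlonglongrightarrow> y \<and> \<bar>y - (LINT x|M. g x)\<bar> \<le> e \<and> (\<forall>n. \<bar>(LINT x|M. G n x) - Y n\<bar> \<le> e)"
  proof (intro exI conjI allI)
    show "(\<lambda>n. (LINT x|M. H n x) + (LINT x|M. g x)) \<longlonglongrightarrow> (LINT x|M. g x)"
      using tendsto_add[OF limH tendsto_const, of "LINT x|M. g x"] by simp
  qed (use err e in auto)
qed

section \<open>Weak-star and weak limits of functions of time\<close>

context bounded_interval
begin

text \<open>At each t \<open>H2_weak_limit\<close> gives weak convergence in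
  \<open>H\<^sup>2\<close>; the integrals over t follow with R times the norm of the test function
  as majorant.\<close>

lemma weak_star_Linf_H_2I:
  assumes H: "\<And>n t. t > 0 \<Longrightarrow> \<exists>f1 f2. H2 (w n t) f1 f2" and R: "\<And>n t. t > 0 \<Longrightarrow> Hnorm 2 \<Omega> (w n t) \<le> R"
    and m: "\<And>n x. x \<in> \<Omega> \<Longrightarrow> (\<lambda>t. w n t x) \<in> borel_measurable TT"
    and lim: "\<And>t x. t > 0 \<Longrightarrow> x \<in> \<Omega> \<Longrightarrow> (\<lambda>n. w n t x) \<longlonglongrightarrow> z t x"
  shows "weak_star_Linf_H 2 \<Omega> w z"
proof -
  have pos: "AE t in TT. t > 0" by (rule AE_I2) simp
  have Z: "(\<exists>g1 g2. H2 (z t) g1 g2) \<and> Hnorm 2 \<Omega> (z t) \<le> R \<and>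
      (\<forall>p\<in>sobolev 2 \<Omega>. (\<lambda>n. Hinner 2 \<Omega> (w n t) p) \<longlonglongrightarrow> Hinner 2 \<Omega> (z t) p)" if t: "t > 0" for t
  proof -
    have "\<forall>n. \<exists>f1 f2. H2 (w n t) f1 f2" using H[OF t] by blast
    then obtain f1 f2 where f: "\<And>n. H2 (w n t) (f1 n) (f2 n)" by metis
    show ?thesis
      by (rule H2_weak_limit[OF f R[OF t] lim[OF t]]) blast+
  qed
  have wm: "H_measurable 2 \<Omega> (w n)" for n
    using pos H by (intro H_measurable_2I m) (auto elim: eventually_mono)
  have zm: "H_measurable 2 \<Omega> z"
  proof (rule H_measurable_2I)
    show "AE t in TT. \<exists>f1 f2. H2 (z t) f1 f2" using pos by eventually_elim (use Z in blast)
    fix x assume x: "x \<in> \<Omega>"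
    show "(\<lambda>t. z t x) \<in> borel_measurable TT"
      by (rule borel_measurable_LIMSEQ_real[where u = "\<lambda>n t. w n t x"]) (use lim x m in auto)
  qed
  have wL: "w n \<in> Linf_H 2 \<Omega>" for n
    unfolding Linf_H_def using wm R pos by (auto intro!: exI[of _ R] elim!: eventually_mono)
  have zL: "z \<in> Linf_H 2 \<Omega>"
    unfolding Linf_H_def using zm Z pos by (auto intro!: exI[of _ R] elim!: eventually_mono)
  have "(\<lambda>n. LINT t|TT. Hinner 2 \<Omega> (w n t) (p t)) \<longlonglongrightarrow> (LINT t|TT. Hinner 2 \<Omega> (z t) (p t))"
    if p: "p \<in> Lp_H 1 2 \<Omega>" for p
  proof (rule integral_dominated_convergence[where w = "\<lambda>t. R * Hnorm 2 \<Omega> (p t)"])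
    have pm: "H_measurable 2 \<Omega> p" and ip: "integrable TT (\<lambda>t. Hnorm 2 \<Omega> (p t))"
      using p by (auto simp: Lp_H_def)
    have ps: "AE t in TT. p t \<in> sobolev 2 \<Omega>" using pm by (simp add: H_measurable_def)
    show "(\<lambda>t. Hinner 2 \<Omega> (z t) (p t)) \<in> borel_measurable TT"
      "\<And>n. (\<lambda>t. Hinner 2 \<Omega> (w n t) (p t)) \<in> borel_measurable TT"
      using Hinner_measurable pm zm wm by auto
    show "integrable TT (\<lambda>t. R * Hnorm 2 \<Omega> (p t))" using ip by simp
    show "AE t in TT. (\<lambda>n. Hinner 2 \<Omega> (w n t) (p t)) \<longlonglongrightarrow> Hinner 2 \<Omega> (z t) (p t)"
      using ps pos by eventually_elim (use Z in blast)
    show "AE t in TT. norm (Hinner 2 \<Omega> (w n t) (p t)) \<le> R * Hnorm 2 \<Omega> (p t)" for n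
      using ps pos
    proof eventually_elim
      case (elim t)
      have "w n t \<in> sobolev 2 \<Omega>" using H[OF elim(2)] H2_sobolev by blast
      then show ?case
        using Hinner_Cauchy_Schwarz[OF _ elim(1), of "w n t"] mult_right_mono[OF R[OF elim(2)] Hnorm_nonneg[of 2 "p t"], of n]
        by fastforce
    qed
  qed
  with wL zL show ?thesis by (simp add: weak_star_Linf_H_def)
qed

text \<open>At a fixed t the norms may be unbounded in n. Fatou's lemma makes their lower limit
  finite for almost every t, which places z t in \<open>H\<^sup>2\<close>; the pairings converge
  after truncation at large norms.\<close>

lemma weak_L2_H_2I:
  assumes H: "\<And>n t. t > 0 \<Longrightarrow> \<exists>f1 f2. H2 (q n t) f1 f2"
    and m: "\<And>n x. x \<in> \<Omega> \<Longrightarrow> (\<lambda>t. q n t x) \<in> borel_measurable TT"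
    and D: "\<And>n. integrable TT (D n)" "\<And>n. (LINT t|TT. D n t) \<le> B" "\<And>n t. t > 0 \<Longrightarrow> (Hnorm 2 \<Omega> (q n t))\<^sup>2 \<le> D n t"
    and lim: "\<And>t x. t > 0 \<Longrightarrow> x \<in> \<Omega> \<Longrightarrow> (\<lambda>n. q n t x) \<longlonglongrightarrow> z t x"
  shows "weak_L2_H 2 \<Omega> q z"
proof -
  have pos: "AE t in TT. t > 0" by (rule AE_I2) simp
  have qm: "H_measurable 2 \<Omega> (q n)" for n
    using pos H by (intro H_measurable_2I m) (auto elim: eventually_mono)
  have Am [measurable]: "(\<lambda>t. Hnorm 2 \<Omega> (q n t)) \<in> borel_measurable TT" for n
    using Hnorm_measurable qm by blast
  have iA: "integrable TT (\<lambda>t. (Hnorm 2 \<Omega> (q n t))\<^sup>2)" for n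
    by (rule Bochner_Integration.integrable_bound[OF D(1)[of n]])
       (use pos D(3)[of _ n] in \<open>auto elim!: eventually_mono intro: order_trans[OF _ abs_ge_self]\<close>)
  have sA: "square_integrable TT (\<lambda>t. Hnorm 2 \<Omega> (q n t))" for n
    using iA by (simp add: square_integrable_def)
  have BA: "(LINT t|TT. (Hnorm 2 \<Omega> (q n t))\<^sup>2) \<le> B" for n
  proof -
    have "(LINT t|TT. (Hnorm 2 \<Omega> (q n t))\<^sup>2) \<le> (LINT t|TT. D n t)"
      using D(3) by (intro integral_mono iA D(1)) auto
    then show ?thesis using D(2)[of n] by linarith
  qed
  have "0 \<le> (LINT t|TT. (Hnorm 2 \<Omega> (q 0 t))\<^sup>2)" by simp
  then have B0: "B \<ge> 0" using BA[of 0] by linarith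
  let ?L = "\<lambda>t. liminf (\<lambda>n. ennreal ((Hnorm 2 \<Omega> (q n t))\<^sup>2))"
  have "(\<integral>\<^sup>+t. ?L t \<partial>TT) \<le> liminf (\<lambda>n. \<integral>\<^sup>+t. ennreal ((Hnorm 2 \<Omega> (q n t))\<^sup>2) \<partial>TT)"
    by (rule nn_integral_liminf) measurable
  also have "\<dots> \<le> ennreal B"
  proof (rule Liminf_le)
    show "\<forall>\<^sub>F n in sequentially. (\<integral>\<^sup>+t. ennreal ((Hnorm 2 \<Omega> (q n t))\<^sup>2) \<partial>TT) \<le> ennreal B"
      using BA by (intro always_eventually allI) (simp add: nn_integral_eq_integral[OF iA] ennreal_leI)
  qed simp
  finally have Lint: "(\<integral>\<^sup>+t. ?L t \<partial>TT) \<le> ennreal B" .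
  have "(\<integral>\<^sup>+t. ?L t \<partial>TT) < \<infinity>" using le_less_trans[OF Lint ennreal_less_top] by simp
  then have fin: "AE t in TT. ?L t \<noteq> \<infinity>" by (intro nn_integral_PInf_AE) auto
  \<comment> \<open>A lower limit below y leaves infinitely many indices with squared norm below y.
    \<open>H2_weak_limit\<close> applies along them, and the pointwise limit is still z t.\<close>
  have sub: "(\<exists>g1 g2. H2 (z t) g1 g2) \<and> Hnorm 2 \<Omega> (z t) \<le> sqrt y"
    if t: "t > 0" and y: "?L t < ennreal y" "y \<ge> 0" for t y
  proof -
    have "infinite {n. ennreal ((Hnorm 2 \<Omega> (q n t))\<^sup>2) < ennreal y}"
    proof
      assume "finite {n. ennreal ((Hnorm 2 \<Omega> (q n t))\<^sup>2) < ennreal y}"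
      then have "\<forall>\<^sub>F n in sequentially. ennreal y \<le> ennreal ((Hnorm 2 \<Omega> (q n t))\<^sup>2)"
        by (simp only: cofinite_eq_sequentially[symmetric] eventually_cofinite not_le)
      then have "ennreal y \<le> ?L t" by (rule Liminf_bounded)
      then show False using y by simp
    qed
    from infinite_enumerate[OF this] obtain r :: "nat \<Rightarrow> nat"
      where r: "strict_mono r" "\<And>k. ennreal ((Hnorm 2 \<Omega> (q (r k) t))\<^sup>2) < ennreal y"
      by blast
    have R: "Hnorm 2 \<Omega> (q (r k) t) \<le> sqrt y" for k
      using r(2)[of k] y(2) by (intro real_le_rsqrt) (simp add: ennreal_less_iff)
    have "\<forall>n. \<exists>f1 f2. H2 (q (r n) t) f1 f2" using H[OF t] by blast
    then obtain f1 f2 where f: "\<And>n. H2 (q (r n) t) (f1 n) (f2 n)" by metis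
    have l: "(\<lambda>n. q (r n) t x) \<longlonglongrightarrow> z t x" if "x \<in> \<Omega>" for x
      using LIMSEQ_subseq_LIMSEQ[OF lim[OF t that] r(1)] by (simp add: o_def)
    show ?thesis by (rule H2_weak_limit[OF f R l]) blast+
  qed
  have zH: "AE t in TT. \<exists>g1 g2. H2 (z t) g1 g2"
    using fin pos
  proof eventually_elim
    case (elim t)
    then obtain y where "?L t = ennreal y" "y \<ge> 0" by (metis ennreal_cases infinity_ennreal_def)
    then show ?case using sub[OF elim(2), of "y + 1"] by (simp add: ennreal_less_iff)
  qed
  have zL: "AE t in TT. ennreal ((Hnorm 2 \<Omega> (z t))\<^sup>2) \<le> ?L t"
    using pos
  proof eventually_elim
    case (elim t)
    show ?case
    proof (rule ccontr)
      assume "\<not> ?thesis"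
      then have less: "?L t < ennreal ((Hnorm 2 \<Omega> (z t))\<^sup>2)" by simp
      then obtain y where y: "?L t = ennreal y" "y \<ge> 0"
        by (cases "?L t" rule: ennreal_cases) auto
      then have lt: "y < (Hnorm 2 \<Omega> (z t))\<^sup>2" using less by (simp add: ennreal_less_iff)
      \<comment> \<open>Strictly between the lower limit and the supposedly larger squared norm of z
        t.\<close>
      define y' where "y' = (y + (Hnorm 2 \<Omega> (z t))\<^sup>2) / 2"
      have y': "y < y'" "y' < (Hnorm 2 \<Omega> (z t))\<^sup>2" using lt by (auto simp: y'_def)
      have "Hnorm 2 \<Omega> (z t) \<le> sqrt y'"
        using sub[OF elim, of y'] y y' by (simp add: ennreal_less_iff)
      then have "(Hnorm 2 \<Omega> (z t))\<^sup>2 \<le> (sqrt y')\<^sup>2" by (intro power_mono) auto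
      then show False using y y' by simp
    qed
  qed
  have zm: "H_measurable 2 \<Omega> z"
  proof (rule H_measurable_2I[OF zH])
    fix x assume x: "x \<in> \<Omega>"
    show "(\<lambda>t. z t x) \<in> borel_measurable TT"
      by (rule borel_measurable_LIMSEQ_real[where u = "\<lambda>n t. q n t x"]) (use lim x m in auto)
  qed
  have zAm [measurable]: "(\<lambda>t. Hnorm 2 \<Omega> (z t)) \<in> borel_measurable TT"
    using Hnorm_measurable zm by blast
  have zint: "(\<integral>\<^sup>+t. ennreal ((Hnorm 2 \<Omega> (z t))\<^sup>2) \<partial>TT) \<le> ennreal B"
    using nn_integral_mono_AE[OF zL] Lint by (rule order_trans)
  have iz: "integrable TT (\<lambda>t. (Hnorm 2 \<Omega> (z t))\<^sup>2)"
    by (rule integrableI_bounded) (use zint in \<open>auto intro: le_less_trans[OF _ ennreal_less_top]\<close>)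
  have Bz: "(LINT t|TT. (Hnorm 2 \<Omega> (z t))\<^sup>2) \<le> B"
    using zint B0 nn_integral_eq_integral[OF iz] by simp
  have "(\<lambda>n. LINT t|TT. Hinner 2 \<Omega> (q n t) (p t)) \<longlonglongrightarrow> (LINT t|TT. Hinner 2 \<Omega> (z t) (p t))"
    if p: "p \<in> Lp_H 2 2 \<Omega>" for p
  proof (rule integral_truncation_tendsto[where A = "\<lambda>n t. Hnorm 2 \<Omega> (q n t)" and A' = "\<lambda>t. Hnorm 2 \<Omega> (z t)"
        and F = "\<lambda>t. Hnorm 2 \<Omega> (p t)" and B = B])
    have pm: "H_measurable 2 \<Omega> p" and ip: "integrable TT (\<lambda>t. (Hnorm 2 \<Omega> (p t))\<^sup>2)"
      using p by (auto simp: Lp_H_def)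
    have ps: "AE t in TT. p t \<in> sobolev 2 \<Omega>" using pm by (simp add: H_measurable_def)
    show "(\<lambda>t. Hinner 2 \<Omega> (z t) (p t)) \<in> borel_measurable TT"
      "\<And>n. (\<lambda>t. Hinner 2 \<Omega> (q n t) (p t)) \<in> borel_measurable TT"
      using Hinner_measurable pm zm qm by auto
    show "square_integrable TT (\<lambda>t. Hnorm 2 \<Omega> (z t))" "square_integrable TT (\<lambda>t. Hnorm 2 \<Omega> (p t))"
      using iz ip Hnorm_measurable[OF pm] by (auto simp: square_integrable_def)
    show "AE t in TT. \<bar>Hinner 2 \<Omega> (q n t) (p t)\<bar> \<le> Hnorm 2 \<Omega> (q n t) * Hnorm 2 \<Omega> (p t)" for n
      using ps pos by eventually_elim (use H H2_sobolev in \<open>blast intro: Hinner_Cauchy_Schwarz\<close>)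
    show "AE t in TT. \<bar>Hinner 2 \<Omega> (z t) (p t)\<bar> \<le> Hnorm 2 \<Omega> (z t) * Hnorm 2 \<Omega> (p t)"
      using ps zH by eventually_elim (use H2_sobolev in \<open>blast intro: Hinner_Cauchy_Schwarz\<close>)
    show "AE t in TT. \<forall>R. (\<lambda>n. if Hnorm 2 \<Omega> (q n t) \<le> R
        then Hinner 2 \<Omega> (q n t) (p t) - Hinner 2 \<Omega> (z t) (p t) else 0) \<longlonglongrightarrow> 0"
      using ps zH pos
    proof eventually_elim
      case (elim t)
      show ?case
      proof
        fix R
        \<comment> \<open>Members of large norm are replaced by z t. The new sequence is bounded and
          still tends to z t pointwise, and its pairing minus that of z t is exactly the truncated
          term.\<close>
        define f where "f n = (if Hnorm 2 \<Omega> (q n t) \<le> R then q n t else z t)" for n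
        have "\<forall>n. \<exists>f1 f2. H2 (f n) f1 f2" using H[OF elim(3)] elim(2) by (simp add: f_def)
        then obtain f1 f2 where f: "\<And>n. H2 (f n) (f1 n) (f2 n)" by metis
        have R: "Hnorm 2 \<Omega> (f n) \<le> max R (Hnorm 2 \<Omega> (z t))" for n by (auto simp: f_def le_max_iff_disj)
        have l: "(\<lambda>n. f n x) \<longlonglongrightarrow> z t x" if x: "x \<in> \<Omega>" for x
        proof (rule LIMSEQ_I)
          fix e :: real assume "e > 0"
          then obtain N where "\<And>n. n \<ge> N \<Longrightarrow> norm (q n t x - z t x) < e"
            using LIMSEQ_D[OF lim[OF elim(3) x]] by blast
          then show "\<exists>N. \<forall>n\<ge>N. norm (f n x - z t x) < e"
            using \<open>e > 0\<close> by (intro exI[of _ N]) (auto simp: f_def)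
        qed
        have "(\<lambda>n. Hinner 2 \<Omega> (f n) (p t)) \<longlonglongrightarrow> Hinner 2 \<Omega> (z t) (p t)"
          by (rule H2_weak_limit[OF f R l]) (use elim(1) in blast)+
        then have "(\<lambda>n. Hinner 2 \<Omega> (f n) (p t) - Hinner 2 \<Omega> (z t) (p t)) \<longlonglongrightarrow> 0"
          by (simp add: LIM_zero_iff)
        moreover have "Hinner 2 \<Omega> (f n) (p t) - Hinner 2 \<Omega> (z t) (p t) = (if Hnorm 2 \<Omega> (q n t) \<le> R
            then Hinner 2 \<Omega> (q n t) (p t) - Hinner 2 \<Omega> (z t) (p t) else 0)" for n
          by (simp add: f_def)
        ultimately show "(\<lambda>n. if Hnorm 2 \<Omega> (q n t) \<le> R
            then Hinner 2 \<Omega> (q n t) (p t) - Hinner 2 \<Omega> (z t) (p t) else 0) \<longlonglongrightarrow> 0" by simp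
      qed
    qed
  qed (use sA BA Bz in auto)
  then show ?thesis
    using qm iA zm iz by (simp add: weak_L2_H_def Lp_H_def)
qed

end

section \<open>Hoelder bounds in time and interpolation in space\<close>

lemma norm2_TT_indicator:
  assumes "0 \<le> s" "s \<le> t"
  shows "norm2 TT (indicat_real {s<..t}) = sqrt (t - s)" "square_integrable TT (indicat_real {s<..t})"
proof -
  have sq: "(\<lambda>x. (indicat_real {s<..t} x)\<^sup>2) = indicat_real {s<..t}" by (auto simp: fun_eq_iff indicator_def)
  have sub: "{s<..t} \<inter> {0<..} = {s<..t}" using assms by auto
  have "(LINT x|TT. indicat_real {s<..t} x) = measure TT ({s<..t} \<inter> {0<..})" by simp
  also have "\<dots> = measure lebesgue {s<..t}"
    unfolding sub by (rule measure_restrict_space) (use sub in auto)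
  finally have "(LINT x|TT. indicat_real {s<..t} x) = t - s" using assms by simp
  then show "norm2 TT (indicat_real {s<..t}) = sqrt (t - s)" by (simp add: norm2_def sq)
  have "integrable TT (indicat_real {s<..t})"
  proof (subst lebesgue_on_restrict_support(1)[of "{s<..t}"])
    show "integrable (lebesgue_on {s<..t}) (indicat_real {s<..t})"
      by (rule finite_measure.integrable_const_bound[of _ _ 1])
         (auto intro!: finite_measure_lebesgue_on borel_measurable_indicator bounded_set_imp_lmeasurable
            bounded_subset[OF compact_imp_bounded[OF compact_Icc[of s t]]] simp: sets_restrict_space_iff)
  qed (use assms in auto)
  then show "square_integrable TT (indicat_real {s<..t})"
    unfolding square_integrable_def sq by auto
qed

text \<open>Cauchy-Schwarz against the indicator of (s, t], which is the source of the exponent 1/2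
  in time.\<close>

lemma integral_sqrt_le:
  assumes D: "integrable TT D" "\<And>t. t > 0 \<Longrightarrow> D t \<ge> 0" "(LINT t|TT. D t) \<le> B" and st: "0 \<le> s" "s \<le> t"
  shows "(LINT r|TT. indicator {s<..t} r * sqrt (D r)) \<le> sqrt B * sqrt (t - s)"
    "integrable TT (\<lambda>r. indicator {s<..t} r * sqrt (D r))"
proof -
  have "(LINT r|TT. (sqrt (D r))\<^sup>2) = (LINT r|TT. D r)"
    using D(2) by (intro Bochner_Integration.integral_cong) auto
  then have n: "norm2 TT (\<lambda>r. sqrt (D r)) \<le> sqrt B" using D(3) by (simp add: norm2_def)
  have "integrable TT (\<lambda>r. (sqrt (D r))\<^sup>2)"
    by (rule Bochner_Integration.integrable_cong[THEN iffD1, OF refl _ D(1)]) (use D(2) in auto)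
  then have sq: "square_integrable TT (\<lambda>r. sqrt (D r))" using D(1) by (auto simp: square_integrable_def)
  show "integrable TT (\<lambda>r. indicator {s<..t} r * sqrt (D r))"
    by (rule square_integrable_mult[OF norm2_TT_indicator(2)[OF st] sq])
  have "(LINT r|TT. indicator {s<..t} r * sqrt (D r)) \<le> sqrt (t - s) * norm2 TT (\<lambda>r. sqrt (D r))"
    using Cauchy_Schwarz_norm2[OF norm2_TT_indicator(2)[OF st] sq] norm2_TT_indicator(1)[OF st] by simp
  also have "\<dots> \<le> sqrt (t - s) * sqrt B" using n st by (intro mult_left_mono) auto
  finally show "(LINT r|TT. indicator {s<..t} r * sqrt (D r)) \<le> sqrt B * sqrt (t - s)" by (simp add: mult.commute)
qed

context bounded_interval
begin

text \<open>Pair with \<psi> = w t - w s itself. The increment of the pairing from s to t is the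
  squared norm of \<psi>; as an integral of the pairing of z with \<psi> it is at most the norm of
  \<psi> times the claimed bound.\<close>

lemma weak_time_derivative_Hoelder:
  assumes w: "weak_time_derivative \<Omega> w z" and w2: "\<And>t. t > 0 \<Longrightarrow> square_integrable LL (w t)"
    and wc: "\<And>\<psi>. square_integrable LL \<psi> \<Longrightarrow> continuous_on {0<..} (\<lambda>t. LINT x|LL. w t x * \<psi> x)"
    and D: "integrable TT D" "\<And>t. t > 0 \<Longrightarrow> (Hnorm 0 \<Omega> (z t))\<^sup>2 \<le> D t" "(LINT t|TT. D t) \<le> B"
    and st: "0 < s" "s \<le> t"
  shows "norm2 LL (\<lambda>x. w t x - w s x) \<le> sqrt B * sqrt (t - s)"
proof -
  interpret P: open_interval "{0::real<..}" by (rule open_interval_pos)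
  define \<psi> where "\<psi> x = w t x - w s x" for x
  have \<psi>: "square_integrable LL \<psi>"
    unfolding \<psi>_def using st by (intro square_integrable_diff w2) auto
  define G where "G r = (LINT x|LL. w r x * \<psi> x)" for r
  define G' where "G' r = (LINT x|LL. z r x * \<psi> x)" for r
  have zm: "H_measurable 0 \<Omega> z" using w by (simp add: weak_time_derivative_def)
  have D0: "D r \<ge> 0" if "r > 0" for r using D(2)[OF that] zero_le_power2 order_trans by blast
  have "\<psi> \<in> sobolev 0 \<Omega>" using \<psi> by (simp add: sobolev_def L2_fun_iff)
  from Hinner_measurable[OF zm H_measurable_const[OF this]]
  have G'm: "G' \<in> borel_measurable TT" by (simp add: Hinner_def G'_def[abs_def])
  have zs: "AE r in TT. z r \<in> sobolev 0 \<Omega>" using zm by (simp add: H_measurable_def)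
  have H0: "Hnorm 0 \<Omega> f = norm2 LL f" for f
    by (simp add: Hnorm_def Hinner_def norm2_def power2_eq_square)
  have G'le: "AE r in TT. \<bar>G' r\<bar> \<le> Hnorm 0 \<Omega> (z r) * norm2 LL \<psi>"
    using zs
  proof eventually_elim
    case (elim r)
    then have "square_integrable LL (z r)" by (simp add: sobolev_def L2_fun_iff)
    from Cauchy_Schwarz_norm2[OF this \<psi>] show ?case by (simp add: G'_def H0)
  qed
  have lG': "loc_integrable {0<..} G'"
    unfolding loc_integrable_def
  proof (intro allI impI)
    fix K :: "real set" assume K: "compact K \<and> K \<subseteq> {0<..}"
    then have Ks: "K \<in> sets lebesgue" using P.sets_compact by blast
    show "integrable (lebesgue_on K) G'"
    proof (rule Bochner_Integration.integrable_bound)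
      show "integrable (lebesgue_on K) (\<lambda>r. Hnorm 0 \<Omega> (z r) * norm2 LL \<psi>)"
        using w K by (simp add: weak_time_derivative_def)
      show "G' \<in> borel_measurable (lebesgue_on K)"
        using measurable_restrict_mono[OF G'm] K by blast
      show "AE r in lebesgue_on K. norm (G' r) \<le> norm (Hnorm 0 \<Omega> (z r) * norm2 LL \<psi>)"
        using AE_lebesgue_on_subset[OF G'le, of K] K Ks by (auto elim: eventually_mono)
    qed
  qed
  have "G t - G s = increment {0<..} G' s t"
  proof (rule P.weak_primitive_increment[OF _ lG'])
    show "continuous_on {0<..} G" unfolding G_def by (rule wc[OF \<psi>])
    fix \<phi> assume "test_function {0<..} \<phi>"
    then show "(LINT r|TT. G r * deriv \<phi> r) = - (LINT r|TT. G' r * \<phi> r)"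
      using w \<psi> by (simp add: weak_time_derivative_def L2_fun_iff G_def G'_def mult.commute)
  qed (use st in auto)
  also have "\<dots> \<le> (LINT r|TT. norm2 LL \<psi> * (indicator {s<..t} r * sqrt (D r)))"
  proof (rule integral_mono_AE)
    show "integrable TT (\<lambda>r. indicator {s<..t} r * G' r)"
      using st by (intro P.integrable_increment lG') auto
    show "integrable TT (\<lambda>r. norm2 LL \<psi> * (indicator {s<..t} r * sqrt (D r)))"
      using integral_sqrt_le(2)[OF D(1) D0 D(3), of s t] st by simp
    have "AE r in TT. r > 0" by (rule AE_I2) simp
    then show "AE r in TT. indicator {s<..t} r * G' r \<le> norm2 LL \<psi> * (indicator {s<..t} r * sqrt (D r))"
      using G'le
    proof eventually_elim
      case (elim r)
      have "Hnorm 0 \<Omega> (z r) \<le> sqrt (D r)" using D(2)[OF elim(1)] by (rule real_le_rsqrt)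
      then have "Hnorm 0 \<Omega> (z r) * norm2 LL \<psi> \<le> sqrt (D r) * norm2 LL \<psi>" by (rule mult_right_mono) simp
      then show ?case using elim(2) by (auto simp: indicator_def mult.commute)
    qed
  qed
  also have "\<dots> = norm2 LL \<psi> * (LINT r|TT. indicator {s<..t} r * sqrt (D r))" by simp
  also have "\<dots> \<le> norm2 LL \<psi> * (sqrt B * sqrt (t - s))"
    using integral_sqrt_le(1)[OF D(1) D0 D(3), of s t] st by (intro mult_left_mono) auto
  finally have "G t - G s \<le> norm2 LL \<psi> * (sqrt B * sqrt (t - s))" .
  moreover have "G t - G s = norm2 LL \<psi> * norm2 LL \<psi>"
  proof -
    have "G t - G s = (LINT x|LL. w t x * \<psi> x - w s x * \<psi> x)"
      unfolding G_def using st by (subst Bochner_Integration.integral_diff) (auto intro!: square_integrable_mult w2 \<psi>)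
    also have "\<dots> = (LINT x|LL. (\<psi> x)\<^sup>2)" by (simp add: \<psi>_def power2_eq_square left_diff_distrib)
    also have "\<dots> = (norm2 LL \<psi>)\<^sup>2" by (simp only: norm2_power2)
    finally show ?thesis by (simp add: power2_eq_square)
  qed
  moreover have "0 \<le> sqrt B * sqrt (t - s)"
  proof -
    have "0 \<le> (LINT t|TT. D t)" by (rule integral_nonneg_AE, rule AE_I2) (simp add: D0)
    then show ?thesis using D(3) st by simp
  qed
  ultimately have "norm2 LL \<psi> \<le> sqrt B * sqrt (t - s)"
    using norm2_nonneg[of LL \<psi>] by (cases "norm2 LL \<psi> = 0") auto
  then show ?thesis by (simp add: \<psi>_def[abs_def])
qed

text \<open>Averaging over an interval of length l containing x bounds f x by its mean square there
  plus the oscillation. The free length l is later balanced against the size of f.\<close>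

lemma primitive_interpolation:
  assumes p: "primitive f h" and h: "norm2 LL h \<le> R" and x: "x \<in> \<Omega>" and l: "0 < l" "l \<le> (b - a) / 2"
  shows "\<bar>f x\<bar> \<le> norm2 LL f / sqrt l + R * sqrt l"
proof -
  \<comment> \<open>The interval extends from x towards the farther end of \<Omega>, where there is
    room for half the length of \<Omega>.\<close>
  obtain c where c: "a \<le> c" "c + l \<le> b" "c \<le> x" "x \<le> c + l"
  proof (cases "x \<le> mid")
    case True
    show ?thesis by (rule that[of x]) (use True l x in \<open>auto simp: mid_def field_simps\<close>)
  next
    case False
    show ?thesis by (rule that[of "x - l"]) (use False l x in \<open>auto simp: mid_def field_simps\<close>)
  qed
  have R0: "R \<ge> 0" using order_trans[OF norm2_nonneg h] .
  let ?i = "indicat_real {c<..c + l}"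
  have i: "square_integrable LL ?i" "norm2 LL ?i = sqrt l"
    using square_integrable_indicator norm2_indicator[of c "c + l"] c l by auto
  have f: "square_integrable LL f" using primitive_square_integrable[OF p] .
  have im: "(\<lambda>z. ?i z * g z) \<in> borel_measurable LL" if "g \<in> borel_measurable LL" for g
    using that by (intro borel_measurable_times indicator_measurable_LL)
  have if1: "square_integrable LL (\<lambda>z. ?i z * f z)" "norm2 LL (\<lambda>z. ?i z * f z) \<le> norm2 LL f"
    by (rule norm2_mono[OF im f]; use f in \<open>auto simp: indicator_def\<close>)+
  have near: "\<bar>?i z * (f x - f z)\<bar> \<le> \<bar>(R * sqrt l) * ?i z\<bar>" if z: "z \<in> \<Omega>" for z
  proof (cases "z \<in> {c<..c+l}")
    case True
    have "\<bar>f x - f z\<bar> \<le> norm2 LL h * sqrt \<bar>x - z\<bar>" by (rule primitive_Hoelder[OF p x z])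
    also have "\<dots> \<le> R * sqrt l"
      using True c h order_trans[OF norm2_nonneg h] by (intro mult_mono real_sqrt_le_mono) auto
    finally show ?thesis using True by (simp add: indicator_def)
  qed (use R0 l in \<open>auto simp: indicator_def\<close>)
  have if2: "square_integrable LL (\<lambda>z. ?i z * (f x - f z))" "norm2 LL (\<lambda>z. ?i z * (f x - f z)) \<le> norm2 LL (\<lambda>z. (R * sqrt l) * ?i z)"
    by (rule norm2_mono[OF im square_integrable_cmult[OF i(1)] near]; use f in auto)+
  have "\<bar>f x\<bar> * sqrt l = norm2 LL (\<lambda>z. f x * ?i z)" by (simp add: norm2_cmult i(2))
  also have "\<dots> = norm2 LL (\<lambda>z. ?i z * f z + ?i z * (f x - f z))" by (simp add: algebra_simps)
  also have "\<dots> \<le> norm2 LL (\<lambda>z. ?i z * f z) + norm2 LL (\<lambda>z. ?i z * (f x - f z))"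
    by (rule norm2_triangle[OF if1(1) if2(1)])
  also have "\<dots> \<le> norm2 LL f + (R * sqrt l) * sqrt l"
    using if1(2) if2(2) R0 l by (simp add: norm2_cmult i(2) abs_mult)
  finally show ?thesis using l by (simp add: field_simps)
qed

end

section \<open>Uniform bounds for the relaxed system\<close>

lemma sqrt_sqrt_mult: "d \<ge> 0 \<Longrightarrow> sqrt (sqrt d) * sqrt (sqrt d) = sqrt d"
  by simp

lemma C1_cylinderD:
  assumes w: "C1_cylinder \<Omega> w" and t: "t \<ge> 0"
  shows "x \<in> \<Omega> \<Longrightarrow> (w t has_real_derivative Dx w t x) (at x)"
    "x \<in> \<Omega> \<Longrightarrow> ((\<lambda>s. w s x) has_real_derivative Dt w t x) (at t within {0..})"
    "continuous_on \<Omega> (w t)" "continuous_on \<Omega> (Dx w t)" "continuous_on \<Omega> (Dt w t)"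
    "x \<in> \<Omega> \<Longrightarrow> continuous_on {0..} (\<lambda>s. w s x)" "x \<in> \<Omega> \<Longrightarrow> continuous_on {0..} (\<lambda>s. Dt w s x)"
    "x \<in> \<Omega> \<Longrightarrow> continuous_on {0..} (\<lambda>s. Dx w s x)"
proof -
  show "(w t has_real_derivative Dx w t x) (at x)" if "x \<in> \<Omega>"
    using w t that unfolding C1_cylinder_def Dx_def by (simp add: DERIV_deriv_iff_real_differentiable)
  show "((\<lambda>s. w s x) has_real_derivative Dt w t x) (at t within {0..})" if "x \<in> \<Omega>"
    using w t that unfolding C1_cylinder_def Dt_def
    by (simp add: has_real_derivative_iff_has_vector_derivative vector_derivative_works[symmetric])
  have slice1: "continuous_on \<Omega> (f t)" if "continuous_on ({0..} \<times> \<Omega>) (\<lambda>(t, x). f t x)" for f :: "real \<Rightarrow> real \<Rightarrow> real"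
  proof -
    have "continuous_on \<Omega> (\<lambda>x. case (t, x) of (t, x) \<Rightarrow> f t x)"
      by (rule continuous_on_compose2[OF that]) (use t in \<open>auto intro!: continuous_intros\<close>)
    then show ?thesis by simp
  qed
  have slice2: "continuous_on {0..} (\<lambda>s. f s x)" if "continuous_on ({0..} \<times> \<Omega>) (\<lambda>(t, x). f t x)" "x \<in> \<Omega>"
    for f :: "real \<Rightarrow> real \<Rightarrow> real" and x
  proof -
    have "continuous_on {0..} (\<lambda>s. case (s, x) of (t, x) \<Rightarrow> f t x)"
      by (rule continuous_on_compose2[OF that(1)]) (use that(2) in \<open>auto intro!: continuous_intros\<close>)
    then show ?thesis by simp
  qed
  show "continuous_on \<Omega> (w t)" "continuous_on \<Omega> (Dx w t)" "continuous_on \<Omega> (Dt w t)"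
    using w slice1 unfolding C1_cylinder_def by blast+
  show "x \<in> \<Omega> \<Longrightarrow> continuous_on {0..} (\<lambda>s. w s x)" "x \<in> \<Omega> \<Longrightarrow> continuous_on {0..} (\<lambda>s. Dt w s x)"
    "x \<in> \<Omega> \<Longrightarrow> continuous_on {0..} (\<lambda>s. Dx w s x)"
    using w slice2 unfolding C1_cylinder_def by blast+
qed

lemma C1_cylinder_DERIV_time:
  assumes "C1_cylinder \<Omega> w" "t > 0" "x \<in> \<Omega>"
  shows "((\<lambda>s. w s x) has_real_derivative Dt w t x) (at t)"
proof -
  have "((\<lambda>s. w s x) has_real_derivative Dt w t x) (at t within {0..})"
    using assms by (intro C1_cylinderD(2)) auto
  moreover have "at t within {0..} = at t" using assms(2) by (intro at_within_interior) auto
  ultimately show ?thesis by simp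
qed

text \<open>Weak time derivatives give estimates at positive times only. Shifting both times by 1 /
  (n + 1) and letting n grow includes time 0.\<close>

lemma time_modulus_extend:
  fixes f :: "real \<Rightarrow> real"
  assumes f: "continuous_on {0..} f" and \<omega>: "continuous_on {0..} \<omega>"
    and le: "\<And>s t. 0 < s \<Longrightarrow> s \<le> t \<Longrightarrow> \<bar>f t - f s\<bar> \<le> \<omega> (t - s)"
    and st: "s \<ge> 0" "t \<ge> 0"
  shows "\<bar>f t - f s\<bar> \<le> \<omega> \<bar>t - s\<bar>"
proof -
  have *: "\<bar>f t - f s\<bar> \<le> \<omega> (t - s)" if st: "0 \<le> s" "s \<le> t" for s t
  proof (rule LIMSEQ_le_const2)
    have inv: "(\<lambda>n. r + inverse (real (Suc n))) \<longlonglongrightarrow> r" for r :: real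
      using tendsto_add[OF tendsto_const LIMSEQ_inverse_real_of_nat, of r] by simp
    have "(\<lambda>n. f (r + inverse (real (Suc n)))) \<longlonglongrightarrow> f r" if "r \<ge> 0" for r
      using continuous_on_tendsto_compose[OF f inv] that by simp
    then show "(\<lambda>n. \<bar>f (t + inverse (real (Suc n))) - f (s + inverse (real (Suc n)))\<bar>) \<longlonglongrightarrow> \<bar>f t - f s\<bar>"
      using st by (intro tendsto_rabs tendsto_diff) auto
    show "\<exists>N. \<forall>n\<ge>N. \<bar>f (t + inverse (real (Suc n))) - f (s + inverse (real (Suc n)))\<bar> \<le> \<omega> (t - s)"
    proof (intro exI allI impI)
      fix n :: nat
      show "\<bar>f (t + inverse (real (Suc n))) - f (s + inverse (real (Suc n)))\<bar> \<le> \<omega> (t - s)"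
        using le[of "s + inverse (real (Suc n))" "t + inverse (real (Suc n))"] st
        by (simp add: add_nonneg_pos)
    qed
  qed
  show ?thesis using *[of s t] *[of t s] st by (cases "s \<le> t") (auto simp: abs_minus_commute)
qed

context bounded_interval
begin

lemma sobolev_1_primitive:
  assumes f: "f \<in> sobolev 1 \<Omega>" and c: "continuous_on \<Omega> f"
  shows "primitive f (wd \<Omega> f)" "norm2 LL f \<le> Hnorm 1 \<Omega> f" "norm2 LL (wd \<Omega> f) \<le> Hnorm 1 \<Omega> f"
proof -
  have "weak_derivative \<Omega> f (wd \<Omega> f)" using f by (simp add: sobolev_def)
  moreover have "square_integrable LL (wd \<Omega> f)" using sobolev_L2[OF f, of 1] by simp
  ultimately show "primitive f (wd \<Omega> f)" using c by (intro weak_derivative_primitive)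
  show "norm2 LL f \<le> Hnorm 1 \<Omega> f" "norm2 LL (wd \<Omega> f) \<le> Hnorm 1 \<Omega> f"
    using norm2_le_Hnorm[of 0 1 f] norm2_le_Hnorm[of 1 1 f] by auto
qed

lemma sobolev_1_bounds:
  assumes f: "f \<in> sobolev 1 \<Omega>" and c: "continuous_on \<Omega> f" and R: "Hnorm 1 \<Omega> f \<le> R" and x: "x \<in> \<Omega>"
  shows "\<bar>f x\<bar> \<le> sup_const * R" "y \<in> \<Omega> \<Longrightarrow> \<bar>f x - f y\<bar> \<le> R * sqrt \<bar>x - y\<bar>"
proof -
  note p = sobolev_1_primitive[OF f c]
  show "\<bar>f x\<bar> \<le> sup_const * R" using p R by (intro primitive_sup[OF p(1) x]) auto
  assume y: "y \<in> \<Omega>"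
  have "\<bar>f x - f y\<bar> \<le> norm2 LL (wd \<Omega> f) * sqrt \<bar>x - y\<bar>" by (rule primitive_Hoelder[OF p(1) x y])
  also have "\<dots> \<le> R * sqrt \<bar>x - y\<bar>" using p(3) R by (intro mult_right_mono) auto
  finally show "\<bar>f x - f y\<bar> \<le> R * sqrt \<bar>x - y\<bar>" .
qed

lemma H2_of_cylinder:
  assumes "C1_cylinder \<Omega> w" "t \<ge> 0" "w t \<in> sobolev 2 \<Omega>"
  shows "H2 (w t) (Dx w t) (wd \<Omega> (wd \<Omega> (w t)))"
  using assms by (intro sobolev_H2 C1_cylinderD)

text \<open>The uniform bounds for \<open>v\<close>, \<open>u\<close>, \<open>\<theta>\<close> and those for \<open>q\<close>, \<open>S\<close>; the spatial derivatives of the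
  latter are controlled in the mean over time only, by an integrable \<open>D\<close>.\<close>

definition regular :: "real \<Rightarrow> (real \<Rightarrow> real \<Rightarrow> real) \<Rightarrow> bool" where
  "regular M w \<longleftrightarrow> C1_cylinder \<Omega> w \<and>
     (\<forall>t\<ge>0. (\<exists>f2. H2 (w t) (Dx w t) f2) \<and> Hnorm 2 \<Omega> (w t) \<le> M) \<and>
     (\<forall>t\<ge>0. \<forall>x\<in>\<Omega>. \<bar>w t x\<bar> \<le> M \<and> \<bar>Dt w t x\<bar> \<le> M \<and> \<bar>Dx w t x\<bar> \<le> M) \<and>
     (\<forall>t\<ge>0. \<forall>x\<in>\<Omega>. \<forall>y\<in>\<Omega>. \<bar>w t x - w t y\<bar> \<le> M * sqrt \<bar>x - y\<bar> \<and>
        \<bar>Dx w t x - Dx w t y\<bar> \<le> M * sqrt \<bar>x - y\<bar> \<and> \<bar>Dt w t x - Dt w t y\<bar> \<le> M * sqrt \<bar>x - y\<bar>) \<and>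
     (\<forall>t\<ge>0. \<forall>s\<ge>0. \<forall>x\<in>\<Omega>. \<bar>Dt w t x - Dt w s x\<bar> \<le> M * sqrt (sqrt \<bar>t - s\<bar>))"

definition flux :: "real \<Rightarrow> (real \<Rightarrow> real) \<Rightarrow> (real \<Rightarrow> real \<Rightarrow> real) \<Rightarrow> bool" where
  "flux M D q \<longleftrightarrow> C1_cylinder \<Omega> q \<and>
     (\<forall>t\<ge>0. (\<exists>f2. H2 (q t) (Dx q t) f2)) \<and> (\<forall>t>0. (Hnorm 2 \<Omega> (q t))\<^sup>2 \<le> D t) \<and>
     (\<forall>t\<ge>0. \<forall>x\<in>\<Omega>. \<bar>q t x\<bar> \<le> M) \<and>
     (\<forall>t\<ge>0. \<forall>x\<in>\<Omega>. \<forall>y\<in>\<Omega>. \<bar>q t x - q t y\<bar> \<le> M * sqrt \<bar>x - y\<bar>) \<and>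
     (\<forall>t\<ge>0. \<forall>s\<ge>0. \<forall>x\<in>\<Omega>. \<bar>q t x - q s x\<bar> \<le> M * sqrt \<bar>t - s\<bar>)"

text \<open>In this order the summands bound the norm and the oscillation in space, the suprema, and
  the oscillation of w_t in time for small and for large time differences.\<close>

definition regular_const :: "real \<Rightarrow> real" where
  "regular_const R = R + sup_const * R + 3 * R + 2 * (sup_const * R) / sqrt ((b - a) / 2)"

lemma regular_const_ge:
  assumes "R \<ge> 0"
  shows "R \<le> regular_const R" "sup_const * R \<le> regular_const R" "3 * R \<le> regular_const R"
    "2 * (sup_const * R) / sqrt ((b - a) / 2) \<le> regular_const R" "0 \<le> regular_const R"
proof -
  have "0 \<le> sup_const * R" "0 \<le> 2 * (sup_const * R) / sqrt ((b - a) / 2)"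
    using assms sup_const_pos ab by auto
  then show "R \<le> regular_const R" "sup_const * R \<le> regular_const R" "3 * R \<le> regular_const R"
    "2 * (sup_const * R) / sqrt ((b - a) / 2) \<le> regular_const R" "0 \<le> regular_const R"
    unfolding regular_const_def using assms by linarith+
qed

text \<open>A weak time derivative fixes pairings for almost every time only; continuity of the
  pairings lets \<open>weak_time_derivative_Hoelder\<close> speak about every positive time.\<close>

lemma continuous_integral_bounded:
  fixes f :: "real \<Rightarrow> real \<Rightarrow> real"
  assumes c: "continuous_on ({0..} \<times> \<Omega>) (\<lambda>(t, x). f t x)"
    and B: "\<And>t x. t \<ge> 0 \<Longrightarrow> x \<in> \<Omega> \<Longrightarrow> \<bar>f t x\<bar> \<le> B" and \<psi>: "square_integrable LL \<psi>"
  shows "continuous_on {0<..} (\<lambda>t. LINT x|LL. f t x * \<psi> x)"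
  unfolding continuous_on_sequentially
proof (intro allI ballI impI, elim conjE)
  fix t' :: "nat \<Rightarrow> real" and t assume t: "t \<in> {0<..}" "\<forall>n. t' n \<in> {0<..}" "t' \<longlonglongrightarrow> t"
  have "(\<lambda>n. LINT x|LL. f (t' n) x * \<psi> x) \<longlonglongrightarrow> (LINT x|LL. f t x * \<psi> x)"
  proof (rule bounded_convergence_mult[OF _ _ _ \<psi>])
    fix n
    have "continuous_on \<Omega> (f (t' n))"
    proof -
      have "t' n \<ge> 0" using t(2) by (simp add: less_imp_le)
      have "continuous_on \<Omega> (\<lambda>x. case (t' n, x) of (t, x) \<Rightarrow> f t x)"
        by (rule continuous_on_compose2[OF c]) (use \<open>t' n \<ge> 0\<close> in \<open>auto intro!: continuous_intros\<close>)
      then show ?thesis by simp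
    qed
    then show "f (t' n) \<in> borel_measurable LL"
      by (rule continuous_imp_measurable_on_sets_lebesgue) simp
    show "\<bar>f (t' n) x\<bar> \<le> B" if "x \<in> \<Omega>" for x using B t(2) that by (simp add: less_imp_le)
  next
    fix x assume x: "x \<in> \<Omega>"
    have "(\<lambda>n. (t' n, x)) \<longlonglongrightarrow> (t, x)" using t(3) by (intro tendsto_intros)
    from continuous_on_tendsto_compose[OF c this] show "(\<lambda>n. f (t' n) x) \<longlonglongrightarrow> f t x"
      using t x by (simp add: less_imp_le)
  qed
  then show "((\<lambda>t. LINT x|LL. f t x * \<psi> x) \<circ> t') \<longlonglongrightarrow> (LINT x|LL. f t x * \<psi> x)" by (simp add: o_def)
qed

text \<open>Over a time difference d, w_t moves by at most R sqrt d in \<open>L\<^sup>2\<close>,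
  while its space derivative is bounded in \<open>L\<^sup>2\<close>.
  \<open>primitive_interpolation\<close> with l = sqrt d turns this into a pointwise bound of order
  d to the power 1/4.\<close>

lemma regularI:
  assumes w: "C1_cylinder \<Omega> w" and R0: "R \<ge> 0"
    and s2: "\<And>t. t \<ge> 0 \<Longrightarrow> w t \<in> sobolev 2 \<Omega>" "\<And>t. t \<ge> 0 \<Longrightarrow> Hnorm 2 \<Omega> (w t) \<le> R"
    and s1: "\<And>t. t \<ge> 0 \<Longrightarrow> Dt w t \<in> sobolev 1 \<Omega>" "\<And>t. t \<ge> 0 \<Longrightarrow> Hnorm 1 \<Omega> (Dt w t) \<le> R"
    and wtt: "weak_time_derivative \<Omega> (Dt w) z" "\<And>t. t > 0 \<Longrightarrow> (Hnorm 0 \<Omega> (z t))\<^sup>2 \<le> D t"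
    and D: "integrable TT D" "(LINT t|TT. D t) \<le> R\<^sup>2"
  shows "regular (regular_const R) w"
proof -
  let ?M = "regular_const R"
  note M = regular_const_ge[OF R0]
  have H: "H2 (w t) (Dx w t) (wd \<Omega> (wd \<Omega> (w t)))" if "t \<ge> 0" for t
    using H2_of_cylinder w that s2(1) by blast
  note b1 = sobolev_1_bounds[OF s1(1) C1_cylinderD(5)[OF w] s1(2)]
  have hoelder: "K * sqrt r \<le> ?M * sqrt r" if "K \<le> ?M" "r \<ge> 0" for K r
    using that by (intro mult_right_mono) auto
  have time: "\<bar>Dt w t x - Dt w s x\<bar> \<le> ?M * sqrt (sqrt (t - s))" if st: "0 < s" "s \<le> t" and x: "x \<in> \<Omega>" for s t x
  proof (cases "s = t")
    case False
    define d where "d = t - s"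
    have d: "d > 0" using False st by (simp add: d_def)
    have t0: "0 \<le> t" "0 \<le> s" using st by auto
    note pt' = sobolev_1_primitive[OF s1(1)[OF t0(1)] C1_cylinderD(5)[OF w t0(1)]]
      and ps' = sobolev_1_primitive[OF s1(1)[OF t0(2)] C1_cylinderD(5)[OF w t0(2)]]
    note p = primitive_diff[OF pt'(1) ps'(1)]
    have n: "norm2 LL (\<lambda>x. Dt w t x - Dt w s x) \<le> R * sqrt d"
    proof -
      have "norm2 LL (\<lambda>x. Dt w t x - Dt w s x) \<le> sqrt (R\<^sup>2) * sqrt (t - s)"
      proof (rule weak_time_derivative_Hoelder[OF wtt(1) _ _ D(1) wtt(2) D(2) st])
        show "square_integrable LL (Dt w r)" if "r > 0" for r
          using sobolev_1_primitive[OF s1(1) C1_cylinderD(5)[OF w], of r] that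
          by (intro primitive_square_integrable) auto
        show "continuous_on {0<..} (\<lambda>t. LINT x|LL. Dt w t x * \<psi> x)" if "square_integrable LL \<psi>" for \<psi>
        proof (rule continuous_integral_bounded[OF _ _ that])
          show "continuous_on ({0..} \<times> \<Omega>) (\<lambda>(t, x). Dt w t x)" using w by (simp add: C1_cylinder_def)
          show "\<bar>Dt w t x\<bar> \<le> sup_const * R" if "t \<ge> 0" "x \<in> \<Omega>" for t x using b1(1) that by blast
        qed
      qed auto
      then show ?thesis using R0 by (simp add: d_def)
    qed
    have n2: "norm2 LL (\<lambda>x. wd \<Omega> (Dt w t) x - wd \<Omega> (Dt w s) x) \<le> 2 * R"
    proof -
      have "norm2 LL (\<lambda>x. wd \<Omega> (Dt w t) x + (-1) * wd \<Omega> (Dt w s) x) \<le> norm2 LL (wd \<Omega> (Dt w t)) + norm2 LL (\<lambda>x. (-1) * wd \<Omega> (Dt w s) x)"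
        using pt'(1) ps'(1) by (intro norm2_triangle square_integrable_cmult primitiveD)
      also have "\<dots> \<le> R + R"
        unfolding norm2_cmult using pt'(3) ps'(3) s1(2)[OF t0(1)] s1(2)[OF t0(2)] by simp
      finally show ?thesis by simp
    qed
    have sd: "sqrt (sqrt d) > 0" using d by simp
    show ?thesis
    proof (cases "sqrt d \<le> (b - a) / 2")
      case True
      have "\<bar>Dt w t x - Dt w s x\<bar> \<le> norm2 LL (\<lambda>x. Dt w t x - Dt w s x) / sqrt (sqrt d) + 2 * R * sqrt (sqrt d)"
        using d True by (intro primitive_interpolation[OF p n2 x]) auto
      also have "\<dots> \<le> R * sqrt d / sqrt (sqrt d) + 2 * R * sqrt (sqrt d)"
        using n sd by (intro add_mono divide_right_mono) auto
      also have "R * sqrt d / sqrt (sqrt d) = R * sqrt (sqrt d)"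
        using sd sqrt_sqrt_mult[of d] d by (simp add: field_simps)
      also have "R * sqrt (sqrt d) + 2 * R * sqrt (sqrt d) = 3 * R * sqrt (sqrt d)" by simp
      also have "\<dots> \<le> ?M * sqrt (sqrt d)" using M(3) sd by (intro mult_right_mono) auto
      finally show ?thesis by (simp add: d_def)
    next
      case False
      \<comment> \<open>An interval of length sqrt d need not fit into \<Omega> here; for such large
        d the supremum bound suffices.\<close>
      have "\<bar>Dt w t x - Dt w s x\<bar> \<le> 2 * (sup_const * R)"
        using b1(1)[OF t0(1) t0(1) t0(1) x] b1(1)[OF t0(2) t0(2) t0(2) x] by linarith
      also have "\<dots> = 2 * (sup_const * R) / sqrt ((b - a) / 2) * sqrt ((b - a) / 2)" using ab by simp
      also have "\<dots> \<le> 2 * (sup_const * R) / sqrt ((b - a) / 2) * sqrt (sqrt d)"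
        using False R0 sup_const_pos ab by (intro mult_left_mono real_sqrt_le_mono) auto
      also have "\<dots> \<le> ?M * sqrt (sqrt d)" using M(4) sd by (intro mult_right_mono) auto
      finally show ?thesis by (simp add: d_def)
    qed
  qed simp
  have time': "\<bar>Dt w t x - Dt w s x\<bar> \<le> ?M * sqrt (sqrt \<bar>t - s\<bar>)" if "t \<ge> 0" "s \<ge> 0" "x \<in> \<Omega>" for s t x
    by (rule time_modulus_extend[OF C1_cylinderD(7)[OF w order_refl that(3)] _ time[OF _ _ that(3)]])
       (use that in \<open>auto intro!: continuous_intros\<close>)
  show ?thesis
    unfolding regular_def
  proof (intro conjI allI impI ballI)
    fix t :: real assume t: "t \<ge> 0"
    show "\<exists>f2. H2 (w t) (Dx w t) f2" using H t by blast
    show "Hnorm 2 \<Omega> (w t) \<le> ?M" using s2(2)[OF t] M(1) by linarith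
    fix x assume x: "x \<in> \<Omega>"
    show "\<bar>w t x\<bar> \<le> ?M" "\<bar>Dx w t x\<bar> \<le> ?M" using H2_sup[OF H[OF t] s2(2)[OF t] x] M(2) by auto
    show "\<bar>Dt w t x\<bar> \<le> ?M" using b1(1)[OF t t t x] M(2) by linarith
    fix y assume y: "y \<in> \<Omega>"
    show "\<bar>w t x - w t y\<bar> \<le> ?M * sqrt \<bar>x - y\<bar>" "\<bar>Dx w t x - Dx w t y\<bar> \<le> ?M * sqrt \<bar>x - y\<bar>"
      using H2_Hoelder[OF H[OF t] s2(2)[OF t] x y] hoelder[OF M(1), of "\<bar>x - y\<bar>"] by auto
    show "\<bar>Dt w t x - Dt w t y\<bar> \<le> ?M * sqrt \<bar>x - y\<bar>"
      using b1(2)[OF t t t x y] hoelder[OF M(1), of "\<bar>x - y\<bar>"] by auto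
  qed (use w time' in auto)
qed

text \<open>\<open>sqrt (R\<^sup>2 + 1)\<close> bounds the \<open>H\<^sup>2\<close> norm at a
  suitable time in every unit interval. Each factor 2 counts the bound at that time and the change
  on the way to the given time.\<close>

definition flux_const :: "real \<Rightarrow> real" where
  "flux_const R = 2 * sqrt (R\<^sup>2 + 1) + 2 * (sup_const * sqrt (R\<^sup>2 + 1))"

text \<open>The norm of q t is controlled in the mean over time only. Within one unit of time after
  t there is an s at which D s is at most \<open>R\<^sup>2 + 1\<close>; the bounds hold at s, and
  the integral of q_t carries them back to t.\<close>

lemma fluxI:
  assumes w: "C1_cylinder \<Omega> q" and R0: "R \<ge> 0"
    and s2: "\<And>t. t \<ge> 0 \<Longrightarrow> q t \<in> sobolev 2 \<Omega>" "\<And>t. t > 0 \<Longrightarrow> (Hnorm 2 \<Omega> (q t))\<^sup>2 \<le> D t"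
    and s1: "\<And>t. t \<ge> 0 \<Longrightarrow> Dt q t \<in> sobolev 1 \<Omega>" "\<And>t. t > 0 \<Longrightarrow> (Hnorm 1 \<Omega> (Dt q t))\<^sup>2 \<le> D t"
    and D: "integrable TT D" "(LINT t|TT. D t) \<le> R\<^sup>2"
  shows "flux (flux_const R) D q"
proof -
  interpret P: open_interval "{0::real<..}" by (rule open_interval_pos)
  let ?M = "flux_const R"
  let ?S = "sqrt (R\<^sup>2 + 1)"
  have RS: "R \<le> ?S" by (rule real_le_rsqrt) simp
  have S0: "?S > 0" by (simp add: add_nonneg_pos)
  have KS0: "sup_const * ?S > 0" using S0 sup_const_pos by simp
  have M: "2 * ?S \<le> ?M" "2 * (sup_const * ?S) \<le> ?M" using S0 KS0 by (auto simp: flux_const_def)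
  have D0: "D t \<ge> 0" if "t > 0" for t using s2(2)[OF that] zero_le_power2 order_trans by blast
  have H: "H2 (q t) (Dx q t) (wd \<Omega> (wd \<Omega> (q t)))" if "t \<ge> 0" for t
    using H2_of_cylinder w that s2(1) by blast
  have d1: "Hnorm 1 \<Omega> (Dt q t) \<le> sqrt (D t)" if "t > 0" for t by (rule real_le_rsqrt[OF s1(2)[OF that]])
  \<comment> \<open>Stated for a general function of time, because it is used both for q at a point
    and for its difference between two points.\<close>
  have incr: "\<bar>p t - p s\<bar> \<le> K * (R * sqrt (t - s))"
    if st: "0 < s" "s \<le> t" and p: "\<And>r. r > 0 \<Longrightarrow> (p has_real_derivative p' r) (at r)" "continuous_on {0<..} p'"
      and K: "\<And>r. r > 0 \<Longrightarrow> \<bar>p' r\<bar> \<le> K * sqrt (D r)" "K \<ge> 0" for p p' :: "real \<Rightarrow> real" and s t K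
  proof -
    have "p t - p s = increment {0<..} p' s t" using st p by (intro P.increment_FTC) auto
    also have "\<bar>\<dots>\<bar> \<le> (LINT r|TT. \<bar>indicator {s<..t} r * p' r\<bar>)" by (rule integral_abs_bound)
    also have "\<dots> \<le> (LINT r|TT. K * (indicator {s<..t} r * sqrt (D r)))"
    proof (rule integral_mono)
      show "integrable TT (\<lambda>r. \<bar>indicator {s<..t} r * p' r\<bar>)"
        using st p(2) by (intro integrable_abs P.integrable_increment P.loc_integrable_continuous) auto
      show "integrable TT (\<lambda>r. K * (indicator {s<..t} r * sqrt (D r)))"
        using integral_sqrt_le(2)[OF D(1) D0 D(2), of s t] st by simp
      show "\<bar>indicator {s<..t} r * p' r\<bar> \<le> K * (indicator {s<..t} r * sqrt (D r))" if "r \<in> space TT" for r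
        using K(1)[of r] that by (auto simp: indicator_def)
    qed
    also have "\<dots> = K * (LINT r|TT. indicator {s<..t} r * sqrt (D r))" by simp
    also have "\<dots> \<le> K * (sqrt (R\<^sup>2) * sqrt (t - s))"
      using integral_sqrt_le(1)[OF D(1) D0 D(2), of s t] st K(2) by (intro mult_left_mono) auto
    finally show ?thesis using R0 by simp
  qed
  have cDt: "continuous_on {0<..} (\<lambda>s. Dt q s x)" if "x \<in> \<Omega>" for x
    using C1_cylinderD(7)[OF w order_refl that] by (rule continuous_on_subset) auto
  have time: "\<bar>q t x - q s x\<bar> \<le> (sup_const * ?S) * sqrt (t - s)" if st: "0 < s" "s \<le> t" and x: "x \<in> \<Omega>" for s t x
  proof -
    have "\<bar>q t x - q s x\<bar> \<le> sup_const * (R * sqrt (t - s))"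
    proof (rule incr[OF st C1_cylinder_DERIV_time[OF w _ x] cDt[OF x]])
      show "\<bar>Dt q r x\<bar> \<le> sup_const * sqrt (D r)" if "r > 0" for r
        using sobolev_1_bounds(1)[OF s1(1) C1_cylinderD(5)[OF w] d1[OF that] x] that by auto
    qed (use sup_const_pos in auto)
    also have "\<dots> \<le> sup_const * (?S * sqrt (t - s))"
      using RS st sup_const_pos by (intro mult_left_mono mult_right_mono) auto
    finally show ?thesis by (simp add: mult.assoc)
  qed
  have space_diff: "\<bar>(q t x - q t y) - (q s x - q s y)\<bar> \<le> sqrt \<bar>x - y\<bar> * (R * sqrt (t - s))"
    if st: "0 < s" "s \<le> t" and x: "x \<in> \<Omega>" "y \<in> \<Omega>" for s t x y
  proof (rule incr[OF st, where p' = "\<lambda>r. Dt q r x - Dt q r y"])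
    show "((\<lambda>r. q r x - q r y) has_real_derivative Dt q r x - Dt q r y) (at r)" if "r > 0" for r
      by (intro DERIV_diff C1_cylinder_DERIV_time[OF w that] x)
    show "continuous_on {0<..} (\<lambda>r. Dt q r x - Dt q r y)" by (intro continuous_intros cDt x)
    show "\<bar>Dt q r x - Dt q r y\<bar> \<le> sqrt \<bar>x - y\<bar> * sqrt (D r)" if "r > 0" for r
      using sobolev_1_bounds(2)[OF s1(1) C1_cylinderD(5)[OF w] d1[OF that] x] that by (auto simp: mult.commute)
  qed simp
  \<comment> \<open>Otherwise D would exceed \<open>R\<^sup>2 + 1\<close> on an interval of length
    1, against the bound on its integral.\<close>
  have good: "\<exists>s. t < s \<and> s \<le> t + 1 \<and> D s \<le> R\<^sup>2 + 1" if t: "t \<ge> 0" for t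
  proof (rule ccontr)
    assume "\<not> ?thesis"
    then have big: "D s > R\<^sup>2 + 1" if "t < s" "s \<le> t + 1" for s using that by force
    have i: "integrable TT (indicat_real {t<..t+1})"
    proof -
      have "(\<lambda>s. (indicat_real {t<..t+1} s)\<^sup>2) = indicat_real {t<..t+1}"
        by (auto simp: fun_eq_iff indicator_def)
      then show ?thesis
        using square_integrable_square[OF norm2_TT_indicator(2)[of t "t+1"]] t by simp
    qed
    have "(LINT s|TT. indicat_real {t<..t+1} s) = (norm2 TT (indicat_real {t<..t+1}))\<^sup>2"
      unfolding norm2_power2 by (intro Bochner_Integration.integral_cong) (auto simp: indicator_def)
    then have "(LINT s|TT. indicat_real {t<..t+1} s) = 1" using norm2_TT_indicator(1)[of t "t+1"] t by simp
    then have "R\<^sup>2 + 1 = (LINT s|TT. (R\<^sup>2 + 1) * indicat_real {t<..t+1} s)" by simp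
    also have "\<dots> \<le> (LINT s|TT. D s)"
    proof (rule integral_mono[OF integrable_mult_right[OF i] D(1)])
      fix s assume "s \<in> space TT"
      then show "(R\<^sup>2 + 1) * indicat_real {t<..t+1} s \<le> D s"
        using D0[of s] big[of s] by (auto simp: indicator_def)
    qed
    finally show False using D(2) by simp
  qed
  have bound_pos: "\<bar>q t x\<bar> \<le> ?M \<and> (\<forall>y\<in>\<Omega>. \<bar>q t x - q t y\<bar> \<le> ?M * sqrt \<bar>x - y\<bar>)" if t: "t > 0" and x: "x \<in> \<Omega>" for t x
  proof -
    obtain s where s: "t < s" "s \<le> t + 1" "D s \<le> R\<^sup>2 + 1" using good[of t] t by auto
    have s0: "s > 0" using s t by simp
    have hs: "Hnorm 2 \<Omega> (q s) \<le> ?S"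
      using s2(2)[OF s0] s(3) by (intro real_le_rsqrt) linarith
    have sq1: "sqrt (s - t) \<le> 1" using s by simp
    have "\<bar>q s x - q t x\<bar> \<le> (sup_const * ?S) * sqrt (s - t)" using time[OF t _ x, of s] s by simp
    also have "\<dots> \<le> (sup_const * ?S) * 1" using sq1 KS0 by (intro mult_left_mono) auto
    finally have "\<bar>q t x\<bar> \<le> 2 * (sup_const * ?S)"
      using H2_sup(1)[OF H hs x] s0 by auto
    moreover have "\<bar>q t x - q t y\<bar> \<le> ?M * sqrt \<bar>x - y\<bar>" if y: "y \<in> \<Omega>" for y
    proof -
      have "\<bar>(q s x - q s y) - (q t x - q t y)\<bar> \<le> sqrt \<bar>x - y\<bar> * (R * sqrt (s - t))"
        using space_diff[OF t _ x y, of s] s by simp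
      also have "\<dots> \<le> sqrt \<bar>x - y\<bar> * (?S * 1)"
        using sq1 RS R0 S0 s by (intro mult_left_mono mult_mono) auto
      finally have 1: "\<bar>(q s x - q s y) - (q t x - q t y)\<bar> \<le> ?S * sqrt \<bar>x - y\<bar>" by (simp add: mult.commute)
      have 2: "\<bar>q s x - q s y\<bar> \<le> ?S * sqrt \<bar>x - y\<bar>"
        using H2_Hoelder(1)[OF H hs x y] s0 by auto
      have "\<bar>q t x - q t y\<bar> \<le> (2 * ?S) * sqrt \<bar>x - y\<bar>" using 1 2 by linarith
      also have "\<dots> \<le> ?M * sqrt \<bar>x - y\<bar>" using M(1) by (intro mult_right_mono) auto
      finally show ?thesis .
    qed
    ultimately show ?thesis using M(2) by auto
  qed
  have time': "\<bar>q t x - q s x\<bar> \<le> ?M * sqrt \<bar>t - s\<bar>" if "t \<ge> 0" "s \<ge> 0" "x \<in> \<Omega>" for s t x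
  proof -
    have "\<bar>q t x - q s x\<bar> \<le> (sup_const * ?S) * sqrt \<bar>t - s\<bar>"
      by (rule time_modulus_extend[OF C1_cylinderD(6)[OF w order_refl that(3)] _ time[OF _ _ that(3)]])
         (use that in \<open>auto intro!: continuous_intros\<close>)
    also have "\<dots> \<le> ?M * sqrt \<bar>t - s\<bar>" using M(2) KS0 by (intro mult_right_mono) auto
    finally show ?thesis .
  qed
  have at0: "(\<lambda>n. q (t + inverse (real (Suc n))) x) \<longlonglongrightarrow> q t x" if "t \<ge> 0" "x \<in> \<Omega>" for t x
    using continuous_on_tendsto_compose[OF C1_cylinderD(6)[OF w order_refl that(2)]
        tendsto_add[OF tendsto_const LIMSEQ_inverse_real_of_nat, of t]] that(1) by simp
  have bound: "\<bar>q t x\<bar> \<le> ?M" if "t \<ge> 0" "x \<in> \<Omega>" for t x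
  proof (rule LIMSEQ_le_const2[OF tendsto_rabs[OF at0[OF that]]])
    show "\<exists>N. \<forall>n\<ge>N. \<bar>q (t + inverse (real (Suc n))) x\<bar> \<le> ?M"
    proof (intro exI allI impI)
      fix n :: nat
      have "t + inverse (real (Suc n)) > 0" using that by (intro add_nonneg_pos) auto
      then show "\<bar>q (t + inverse (real (Suc n))) x\<bar> \<le> ?M" using bound_pos that(2) by blast
    qed
  qed
  have bound_space: "\<bar>q t x - q t y\<bar> \<le> ?M * sqrt \<bar>x - y\<bar>" if "t \<ge> 0" "x \<in> \<Omega>" "y \<in> \<Omega>" for t x y
  proof (rule LIMSEQ_le_const2[OF tendsto_rabs[OF tendsto_diff[OF at0[OF that(1,2)] at0[OF that(1,3)]]]])
    show "\<exists>N. \<forall>n\<ge>N. \<bar>q (t + inverse (real (Suc n))) x - q (t + inverse (real (Suc n))) y\<bar> \<le> ?M * sqrt \<bar>x - y\<bar>"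
    proof (intro exI allI impI)
      fix n :: nat
      have "t + inverse (real (Suc n)) > 0" using that by (intro add_nonneg_pos) auto
      then show "\<bar>q (t + inverse (real (Suc n))) x - q (t + inverse (real (Suc n))) y\<bar> \<le> ?M * sqrt \<bar>x - y\<bar>"
        using bound_pos that(2,3) by blast
    qed
  qed
  show ?thesis
    unfolding flux_def using w H s2(2) bound bound_space time' by blast
qed


lemma const_sobolev_2: "(\<lambda>x. c) \<in> sobolev 2 \<Omega>"
proof -
  have "H2 (\<lambda>x. c) (\<lambda>x. 0) (\<lambda>x. 0)" by (auto simp: H2_def primitive_def)
  then show ?thesis by (rule H2_sobolev)
qed

lemma Hnorms_power2: "(Hnorms m \<Omega> fs)\<^sup>2 = (\<Sum>f\<leftarrow>fs. (Hnorm m \<Omega> f)\<^sup>2)"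
  unfolding Hnorms_def by (intro real_sqrt_pow2 sum_list_nonneg) auto

lemma sobolev_2_scaled:
  assumes "(\<lambda>x. c * f x) \<in> sobolev 2 \<Omega>" "c \<noteq> 0"
  shows "f \<in> sobolev 2 \<Omega>"
  using sobolev_linear(1)[OF const_sobolev_2[of 0] assms(1), of "1 / c"] assms(2) by simp

lemma sobolev_1_scaled:
  assumes "(\<lambda>x. c * f x) \<in> sobolev 1 \<Omega>" "c \<noteq> 0"
  shows "f \<in> sobolev 1 \<Omega>"
proof -
  have "(\<lambda>x. c * f x + (1 / c - 1) * (c * f x)) \<in> sobolev 1 \<Omega>"
    using assms(1) by (intro sobolev_linear(1))
  moreover have "(\<lambda>x. c * f x + (1 / c - 1) * (c * f x)) = f"
    using assms(2) by (auto simp: fun_eq_iff field_simps)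
  ultimately show ?thesis by simp
qed

text \<open>The norm of the constant 1 enters R because the energy measures v - 1 and \<theta> - 1.
  The pointwise part of the energy sees q and S with the weight sqrt \<tau>, so it yields their
  membership in the Sobolev spaces by rescaling, while their uniform bounds come from the integral
  of D.\<close>

lemma energy_estimate_bounds:
  assumes E: "relaxed_fluid.energy_estimate \<Omega> \<tau> B' v u \<theta> q S" and B: "B' \<le> B" and \<tau>: "\<tau> > 0"
    and C1: "C1_cylinder \<Omega> v" "C1_cylinder \<Omega> u" "C1_cylinder \<Omega> \<theta>" "C1_cylinder \<Omega> q" "C1_cylinder \<Omega> S"
    and R: "R = sqrt B + Hnorm 2 \<Omega> (\<lambda>x. 1)"
  obtains D where "integrable TT D" "(LINT t|TT. D t) \<le> B"
    "regular (regular_const R) v" "regular (regular_const R) u" "regular (regular_const R) \<theta>"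
    "flux (flux_const R) D q" "flux (flux_const R) D S"
    "\<And>t x. t \<ge> 0 \<Longrightarrow> x \<in> \<Omega> \<Longrightarrow> \<bar>sqrt \<tau> * Dt q t x\<bar> \<le> sup_const * R"
    "\<And>t x. t \<ge> 0 \<Longrightarrow> x \<in> \<Omega> \<Longrightarrow> \<bar>sqrt \<tau> * Dt S t x\<bar> \<le> sup_const * R"
proof -
  obtain vtt utt \<theta>tt qtt Stt where
    wt: "weak_time_derivative \<Omega> (Dt v) vtt" "weak_time_derivative \<Omega> (Dt u) utt"
      "weak_time_derivative \<Omega> (Dt \<theta>) \<theta>tt"
    and est: "let W = (\<lambda>t. weighted \<tau> (\<lambda>x. (v t x - 1, u t x, \<theta> t x - 1, q t x, S t x)));
             Wt = (\<lambda>t. weighted \<tau> (\<lambda>x. (Dt v t x, Dt u t x, Dt \<theta> t x, Dt q t x, Dt S t x)));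
             Wtt = (\<lambda>t. weighted \<tau> (\<lambda>x. (vtt t x, utt t x, \<theta>tt t x, qtt t x, Stt t x)));
             D = (\<lambda>t. relaxed_fluid.D12 \<Omega> v vtt t + relaxed_fluid.D12 \<Omega> u utt t + relaxed_fluid.D12 \<Omega> \<theta> \<theta>tt t
                    + (Hnorms 2 \<Omega> [q t, S t])\<^sup>2 + (Hnorms 1 \<Omega> [Dt q t, Dt S t])\<^sup>2
                    + \<tau>\<^sup>2 * (Hnorms 0 \<Omega> [qtt t, Stt t])\<^sup>2)
         in (\<forall>t\<ge>0. set (W t) \<subseteq> sobolev 2 \<Omega> \<and> set (Wt t) \<subseteq> sobolev 1 \<Omega> \<and>
                    set (Wtt t) \<subseteq> sobolev 0 \<Omega>) \<and>
            integrable TT D \<and>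
            (\<forall>t\<ge>0. (Hnorms 2 \<Omega> (W t))\<^sup>2 + (Hnorms 1 \<Omega> (Wt t))\<^sup>2 + \<tau>\<^sup>2 * (Hnorms 0 \<Omega> (Wtt t))\<^sup>2
                    + (LINT s|TT. D s) \<le> B')"
    using E unfolding relaxed_fluid.energy_estimate_def by blast
  define D where "D t = relaxed_fluid.D12 \<Omega> v vtt t + relaxed_fluid.D12 \<Omega> u utt t + relaxed_fluid.D12 \<Omega> \<theta> \<theta>tt t
                    + (Hnorms 2 \<Omega> [q t, S t])\<^sup>2 + (Hnorms 1 \<Omega> [Dt q t, Dt S t])\<^sup>2
                    + \<tau>\<^sup>2 * (Hnorms 0 \<Omega> [qtt t, Stt t])\<^sup>2" for t
  note est = est[unfolded Let_def, folded D_def]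
  let ?n = "\<lambda>m f. (Hnorm m \<Omega> f)\<^sup>2"
  have mem: "(\<lambda>x. v t x - 1) \<in> sobolev 2 \<Omega>" "u t \<in> sobolev 2 \<Omega>" "(\<lambda>x. \<theta> t x - 1) \<in> sobolev 2 \<Omega>"
    "(\<lambda>x. sqrt \<tau> * q t x) \<in> sobolev 2 \<Omega>" "(\<lambda>x. sqrt \<tau> * S t x) \<in> sobolev 2 \<Omega>"
    "Dt v t \<in> sobolev 1 \<Omega>" "Dt u t \<in> sobolev 1 \<Omega>" "Dt \<theta> t \<in> sobolev 1 \<Omega>"
    "(\<lambda>x. sqrt \<tau> * Dt q t x) \<in> sobolev 1 \<Omega>" "(\<lambda>x. sqrt \<tau> * Dt S t x) \<in> sobolev 1 \<Omega>" if "t \<ge> 0" for t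
    using est that by (simp_all add: weighted_def)
  have iD: "integrable TT D" using est by (simp add: D_def[abs_def])
  have DS: "D t = (?n 0 (wd \<Omega> (v t)) + ?n 0 (Dt v t) + ?n 0 (wd \<Omega> (wd \<Omega> (v t))) + ?n 0 (wd \<Omega> (Dt v t)) + ?n 0 (vtt t))
     + (?n 0 (wd \<Omega> (u t)) + ?n 0 (Dt u t) + ?n 0 (wd \<Omega> (wd \<Omega> (u t))) + ?n 0 (wd \<Omega> (Dt u t)) + ?n 0 (utt t))
     + (?n 0 (wd \<Omega> (\<theta> t)) + ?n 0 (Dt \<theta> t) + ?n 0 (wd \<Omega> (wd \<Omega> (\<theta> t))) + ?n 0 (wd \<Omega> (Dt \<theta> t)) + ?n 0 (\<theta>tt t))
     + (?n 2 (q t) + ?n 2 (S t)) + (?n 1 (Dt q t) + ?n 1 (Dt S t)) + \<tau>\<^sup>2 * (?n 0 (qtt t) + ?n 0 (Stt t))" for t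
    by (simp add: D_def relaxed_fluid.D12_def Hnorms_power2)
  have nn: "0 \<le> ?n m f" for m f by simp
  have tnn: "0 \<le> \<tau>\<^sup>2 * (?n 0 (qtt t) + ?n 0 (Stt t))" for t by simp
  have Dge: "?n 0 (vtt t) \<le> D t" "?n 0 (utt t) \<le> D t" "?n 0 (\<theta>tt t) \<le> D t" "?n 2 (q t) \<le> D t" "?n 2 (S t) \<le> D t"
    "?n 1 (Dt q t) \<le> D t" "?n 1 (Dt S t) \<le> D t" for t
    unfolding DS by (insert tnn[of t], simp_all add: add_nonneg_nonneg add_increasing add_increasing2)
  have D0: "0 \<le> D t" for t using Dge(1)[of t] nn order_trans by blast
  have intD0: "0 \<le> (LINT s|TT. D s)" by (rule integral_nonneg_AE, rule AE_I2, rule D0)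
  have total: "(?n 2 (\<lambda>x. v t x - 1) + ?n 2 (u t) + ?n 2 (\<lambda>x. \<theta> t x - 1) + ?n 2 (\<lambda>x. sqrt \<tau> * q t x) + ?n 2 (\<lambda>x. sqrt \<tau> * S t x))
     + (?n 1 (Dt v t) + ?n 1 (Dt u t) + ?n 1 (Dt \<theta> t) + ?n 1 (\<lambda>x. sqrt \<tau> * Dt q t x) + ?n 1 (\<lambda>x. sqrt \<tau> * Dt S t x))
     + (LINT s|TT. D s) \<le> B" if t: "t \<ge> 0" for t
  proof -
    have "(Hnorms 2 \<Omega> (weighted \<tau> (\<lambda>x. (v t x - 1, u t x, \<theta> t x - 1, q t x, S t x))))\<^sup>2
      + (Hnorms 1 \<Omega> (weighted \<tau> (\<lambda>x. (Dt v t x, Dt u t x, Dt \<theta> t x, Dt q t x, Dt S t x))))\<^sup>2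
      + \<tau>\<^sup>2 * (Hnorms 0 \<Omega> (weighted \<tau> (\<lambda>x. (vtt t x, utt t x, \<theta>tt t x, qtt t x, Stt t x))))\<^sup>2
      + (LINT s|TT. D s) \<le> B'"
      using est t by (simp add: D_def[abs_def])
    moreover have "0 \<le> \<tau>\<^sup>2 * (Hnorms 0 \<Omega> (weighted \<tau> (\<lambda>x. (vtt t x, utt t x, \<theta>tt t x, qtt t x, Stt t x))))\<^sup>2" by simp
    ultimately have "(Hnorms 2 \<Omega> (weighted \<tau> (\<lambda>x. (v t x - 1, u t x, \<theta> t x - 1, q t x, S t x))))\<^sup>2
      + (Hnorms 1 \<Omega> (weighted \<tau> (\<lambda>x. (Dt v t x, Dt u t x, Dt \<theta> t x, Dt q t x, Dt S t x))))\<^sup>2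
      + (LINT s|TT. D s) \<le> B" using B by linarith
    then show ?thesis by (simp add: weighted_def Hnorms_power2 add.assoc)
  qed
  have le: "?n 2 (\<lambda>x. v t x - 1) \<le> B" "?n 2 (u t) \<le> B" "?n 2 (\<lambda>x. \<theta> t x - 1) \<le> B"
     "?n 1 (Dt v t) \<le> B" "?n 1 (Dt u t) \<le> B" "?n 1 (Dt \<theta> t) \<le> B"
     "?n 1 (\<lambda>x. sqrt \<tau> * Dt q t x) \<le> B" "?n 1 (\<lambda>x. sqrt \<tau> * Dt S t x) \<le> B" "(LINT s|TT. D s) \<le> B" if t: "t \<ge> 0" for t
    by (rule order_trans[OF _ total[OF t]], insert intD0, simp add: add_increasing add_increasing2)+
  have B0: "B \<ge> 0" using le(9)[of 0] intD0 by simp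
  have N1: "0 \<le> Hnorm 2 \<Omega> (\<lambda>x. 1)" by simp
  have RB: "sqrt B \<le> R" "0 \<le> R" using R B0 by auto
  have BR: "B \<le> R\<^sup>2"
  proof -
    have "(sqrt B)\<^sup>2 \<le> R\<^sup>2" using RB B0 by (intro power_mono) auto
    then show ?thesis using B0 by simp
  qed
  have root: "Hnorm m \<Omega> f \<le> R" if "?n m f \<le> B" for m f
    using real_le_rsqrt[OF that] RB(1) by linarith
  have DR: "(LINT t|TT. D t) \<le> R\<^sup>2" using le(9)[of 0] BR by simp
  have shift: "f \<in> sobolev 2 \<Omega>" "Hnorm 2 \<Omega> f \<le> R"
    if "(\<lambda>x. f x - 1) \<in> sobolev 2 \<Omega>" "?n 2 (\<lambda>x. f x - 1) \<le> B" for f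
  proof -
    have eq: "(\<lambda>x. (f x - 1) + 1 * 1) = f" by auto
    show "f \<in> sobolev 2 \<Omega>" using sobolev_linear(1)[OF that(1) const_sobolev_2[of 1], of 1] unfolding eq .
    have "Hnorm 2 \<Omega> f \<le> Hnorm 2 \<Omega> (\<lambda>x. f x - 1) + \<bar>1\<bar> * Hnorm 2 \<Omega> (\<lambda>x. 1)"
      using Hnorm_add_le[OF that(1) const_sobolev_2[of 1], of 1] unfolding eq .
    also have "Hnorm 2 \<Omega> (\<lambda>x. f x - 1) \<le> sqrt B" by (rule real_le_rsqrt[OF that(2)])
    finally show "Hnorm 2 \<Omega> f \<le> R" using R by simp
  qed
  have \<tau>': "sqrt \<tau> \<noteq> 0" using \<tau> by simp
  have rv: "regular (regular_const R) v"
    by (rule regularI[OF C1(1) RB(2) _ _ _ _ wt(1) _ iD DR])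
       (use mem le Dge root shift in auto)
  have ru: "regular (regular_const R) u"
    by (rule regularI[OF C1(2) RB(2) _ _ _ _ wt(2) _ iD DR])
       (use mem le Dge root in auto)
  have r\<theta>: "regular (regular_const R) \<theta>"
    by (rule regularI[OF C1(3) RB(2) _ _ _ _ wt(3) _ iD DR])
       (use mem le Dge root shift in auto)
  have fq: "flux (flux_const R) D q"
    by (rule fluxI[OF C1(4) RB(2) _ _ _ _ iD DR])
       (use mem Dge sobolev_2_scaled[OF _ \<tau>'] sobolev_1_scaled[OF _ \<tau>'] in auto)
  have fS: "flux (flux_const R) D S"
    by (rule fluxI[OF C1(5) RB(2) _ _ _ _ iD DR])
       (use mem Dge sobolev_2_scaled[OF _ \<tau>'] sobolev_1_scaled[OF _ \<tau>'] in auto)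
  have weighted_bound: "\<bar>sqrt \<tau> * Dt f t x\<bar> \<le> sup_const * R"
    if "t \<ge> 0" "x \<in> \<Omega>" "(\<lambda>x. sqrt \<tau> * Dt f t x) \<in> sobolev 1 \<Omega>" "?n 1 (\<lambda>x. sqrt \<tau> * Dt f t x) \<le> B" "C1_cylinder \<Omega> f" for f t x
    using that C1_cylinderD(5)[OF that(5,1)]
    by (intro sobolev_1_bounds(1)[OF that(3) _ root[OF that(4)] that(2)] continuous_intros)
  show thesis
    by (rule that[OF iD _ rv ru r\<theta> fq fS]) (use le(9)[of 0] weighted_bound mem le C1 in auto)
qed

section \<open>Pointwise limits of regular sequences\<close>

lemma at_within_nonneg:
  assumes "t \<ge> 0" shows "at t within {0::real..} \<noteq> bot"
proof
  assume "at t within {0..} = bot"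
  moreover have "at_right t \<le> at t within {0..}" using assms by (intro at_le) auto
  ultimately have "at_right t \<le> bot" by simp
  then show False using bot_unique trivial_limit_at_right_real by metis
qed

text \<open>At time 0 the derivative is one-sided; it is unique because 0 is a limit point of the
  closed half-line.\<close>

lemma Dt_eqI:
  assumes "t \<ge> 0" "((\<lambda>s. w s x) has_real_derivative L) (at t within {0..})"
  shows "Dt w t x = L"
  unfolding Dt_def using assms
  by (intro vector_derivative_within at_within_nonneg) (auto simp: has_real_derivative_iff_has_vector_derivative)

text \<open>The modulus in space is uniform in time, so continuity in time along each vertical line
  extends to both variables.\<close>

lemma joint_continuity:
  fixes f :: "real \<Rightarrow> real \<Rightarrow> real"
  assumes m: "modulus \<omega>" "\<And>t x y. t \<ge> 0 \<Longrightarrow> x \<in> \<Omega> \<Longrightarrow> y \<in> \<Omega> \<Longrightarrow> \<bar>f t x - f t y\<bar> \<le> \<omega> \<bar>x - y\<bar>"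
    and c: "\<And>x. x \<in> \<Omega> \<Longrightarrow> continuous_on {0..} (\<lambda>t. f t x)"
  shows "continuous_on ({0..} \<times> \<Omega>) (\<lambda>(t, x). f t x)"
  unfolding continuous_on_iff
proof (intro ballI allI impI)
  fix p :: "real \<times> real" and e :: real assume p: "p \<in> {0..} \<times> \<Omega>" and e: "e > 0"
  obtain t x where tx: "p = (t, x)" "t \<ge> 0" "x \<in> \<Omega>" using p by auto
  obtain d1 where d1: "d1 > 0" "\<And>r. 0 \<le> r \<Longrightarrow> r \<le> d1 \<Longrightarrow> \<omega> r < e/2"
    using modulusE[OF m(1), of "e/2"] e by auto
  obtain d2 where d2: "d2 > 0" "\<And>s. s \<ge> 0 \<Longrightarrow> dist s t < d2 \<Longrightarrow> dist (f s x) (f t x) < e/2"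
    using c[OF tx(3)] tx(2) e unfolding continuous_on_iff by (metis atLeast_iff half_gt_zero)
  have "dist (case p' of (t, x) \<Rightarrow> f t x) (case p of (t, x) \<Rightarrow> f t x) < e"
    if p': "p' \<in> {0..} \<times> \<Omega>" "dist p' p < min d1 d2" for p'
  proof -
    obtain s y where sy: "p' = (s, y)" "s \<ge> 0" "y \<in> \<Omega>" using p' by auto
    have "dist s t < d2" "dist y x < d1"
      using p'(2) dist_fst_le[of p' p] dist_snd_le[of p' p] sy tx by auto
    then have "\<bar>f s y - f s x\<bar> < e/2" "\<bar>f s x - f t x\<bar> < e/2"
      using m(2)[OF sy(2,3) tx(3)] d1(2)[of "\<bar>y - x\<bar>"] d2(2)[OF sy(2)] by (auto simp: dist_real_def)
    then have "\<bar>f s y - f t x\<bar> < e" by linarith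
    then show ?thesis using sy tx by (simp add: dist_real_def)
  qed
  then show "\<exists>d>0. \<forall>p'\<in>{0..} \<times> \<Omega>. dist p' p < d \<longrightarrow>
      dist (case p' of (t, x) \<Rightarrow> f t x) (case p of (t, x) \<Rightarrow> f t x) < e"
    using d1(1) d2(1) by (intro exI[of _ "min d1 d2"]) auto
qed

lemma continuous_on_time_modulus:
  assumes m: "modulus \<omega>" "\<And>s t. s \<ge> 0 \<Longrightarrow> t \<ge> 0 \<Longrightarrow> \<bar>f t - f s\<bar> \<le> \<omega> \<bar>t - s\<bar>"
  shows "continuous_on {0..} (f :: real \<Rightarrow> real)"
  unfolding continuous_on_iff
proof (intro ballI allI impI)
  fix t e :: real assume "t \<in> {0..}" and e: "e > 0"
  obtain d where d: "d > 0" "\<And>r. 0 \<le> r \<Longrightarrow> r \<le> d \<Longrightarrow> \<omega> r < e"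
    using modulusE[OF m(1) e] by blast
  have "dist (f s) (f t) < e" if "s \<in> {0..}" "dist s t < d" for s
    using m(2)[of t s] d(2)[of "\<bar>s - t\<bar>"] that \<open>t \<in> {0..}\<close> by (auto simp: dist_real_def)
  then show "\<exists>d>0. \<forall>s\<in>{0..}. dist s t < d \<longrightarrow> dist (f s) (f t) < e" using d(1) by blast
qed

lemma modulus_linear: assumes "M \<ge> 0" shows "modulus (\<lambda>r. M * r)"
  unfolding modulus_def
proof (intro conjI allI impI)
  fix e :: real assume e: "e > 0"
  have "M * (e / (M + 1)) < e" using e assms by (simp add: field_simps)
  then show "\<exists>d>0. M * d < e" using e assms by (intro exI[of _ "e / (M + 1)"]) auto
qed (use assms in \<open>auto intro: mult_left_mono\<close>)

lemma regularD:
  assumes "regular M w" "t \<ge> 0"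
  shows "C1_cylinder \<Omega> w" "\<exists>f2. H2 (w t) (Dx w t) f2" "Hnorm 2 \<Omega> (w t) \<le> M"
    "x \<in> \<Omega> \<Longrightarrow> \<bar>w t x\<bar> \<le> M" "x \<in> \<Omega> \<Longrightarrow> \<bar>Dt w t x\<bar> \<le> M" "x \<in> \<Omega> \<Longrightarrow> \<bar>Dx w t x\<bar> \<le> M"
    "x \<in> \<Omega> \<Longrightarrow> y \<in> \<Omega> \<Longrightarrow> \<bar>w t x - w t y\<bar> \<le> M * sqrt \<bar>x - y\<bar>"
    "x \<in> \<Omega> \<Longrightarrow> y \<in> \<Omega> \<Longrightarrow> \<bar>Dx w t x - Dx w t y\<bar> \<le> M * sqrt \<bar>x - y\<bar>"
    "x \<in> \<Omega> \<Longrightarrow> y \<in> \<Omega> \<Longrightarrow> \<bar>Dt w t x - Dt w t y\<bar> \<le> M * sqrt \<bar>x - y\<bar>"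
    "x \<in> \<Omega> \<Longrightarrow> s \<ge> 0 \<Longrightarrow> \<bar>Dt w t x - Dt w s x\<bar> \<le> M * sqrt (sqrt \<bar>t - s\<bar>)"
  using assms unfolding regular_def by blast+

lemma regular_nonneg: assumes "regular M w" shows "M \<ge> 0"
  using regularD(3)[OF assms order_refl] Hnorm_nonneg[of 2 "w 0"] by linarith

lemma regular_time_Lipschitz:
  assumes w: "regular M w" and t: "t \<ge> 0" "s \<ge> 0" and x: "x \<in> \<Omega>"
  shows "\<bar>w t x - w s x\<bar> \<le> M * \<bar>t - s\<bar>"
proof -
  have "norm (w t x - w s x) \<le> M * norm (t - s)"
  proof (rule field_differentiable_bound[of "{0..}" "\<lambda>s. w s x" "\<lambda>s. Dt w s x"])
    show "((\<lambda>s. w s x) has_field_derivative Dt w z x) (at z within {0..})" if "z \<in> {0..}" for z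
      using that x by (intro C1_cylinderD(2)[OF regularD(1)[OF w order_refl]]) auto
    show "norm (Dt w z x) \<le> M" if "z \<in> {0..}" for z
      using regularD(5)[OF w _ x, of z] that by simp
  qed (use t in auto)
  then show ?thesis by simp
qed

text \<open>Space derivatives converge by \<open>H2_weak_limit\<close>, time derivatives by
  \<open>derivative_limit\<close>; suprema and moduli pass to pointwise limits with the same
  M.\<close>

theorem regular_limit:
  assumes r: "\<And>n. regular M (w n)"
    and lim: "\<And>t x. t \<ge> 0 \<Longrightarrow> x \<in> \<Omega> \<Longrightarrow> (\<lambda>n. w n t x) \<longlonglongrightarrow> z t x"
  shows "regular M z"
    and "\<And>t x. t \<ge> 0 \<Longrightarrow> x \<in> \<Omega> \<Longrightarrow> (\<lambda>n. Dt (w n) t x) \<longlonglongrightarrow> Dt z t x"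
    and "\<And>t x. t \<ge> 0 \<Longrightarrow> x \<in> \<Omega> \<Longrightarrow> (\<lambda>n. Dx (w n) t x) \<longlonglongrightarrow> Dx z t x"
proof -
  have M0: "M \<ge> 0" using regular_nonneg[OF r] .
  have C: "C1_cylinder \<Omega> (w n)" for n using regularD(1)[OF r order_refl] .
  have H: "(\<exists>g2. H2 (z t) (Dx z t) g2) \<and> Hnorm 2 \<Omega> (z t) \<le> M \<and> (\<forall>x\<in>\<Omega>. (\<lambda>n. Dx (w n) t x) \<longlonglongrightarrow> Dx z t x)"
    if t: "t \<ge> 0" for t
  proof -
    have "\<forall>n. \<exists>f2. H2 (w n t) (Dx (w n) t) f2" using regularD(2)[OF r t] by blast
    then obtain f2 where f2: "\<And>n. H2 (w n t) (Dx (w n) t) (f2 n)" by metis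
    obtain g1 g2 where g: "H2 (z t) g1 g2" "\<And>x. x \<in> \<Omega> \<Longrightarrow> (\<lambda>n. Dx (w n) t x) \<longlonglongrightarrow> g1 x" "Hnorm 2 \<Omega> (z t) \<le> M"
      by (rule H2_weak_limit[OF f2 regularD(3)[OF r t] lim[OF t]]) blast+
    have eq: "Dx z t x = g1 x" if "x \<in> \<Omega>" for x
      unfolding Dx_def by (rule DERIV_imp_deriv[OF H2_DERIV[OF g(1) that]])
    have "H2 (z t) (Dx z t) g2"
      using g(1) eq unfolding H2_def primitive_def by simp
    then show ?thesis using g eq by auto
  qed
  show Dx: "\<And>t x. t \<ge> 0 \<Longrightarrow> x \<in> \<Omega> \<Longrightarrow> (\<lambda>n. Dx (w n) t x) \<longlonglongrightarrow> Dx z t x" using H by blast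
  have T: "(\<lambda>n. Dt (w n) t x) \<longlonglongrightarrow> Dt z t x \<and> ((\<lambda>s. z s x) has_real_derivative Dt z t x) (at t within {0..})"
    if t: "t \<ge> 0" and x: "x \<in> \<Omega>" for t x
  proof -
    obtain L where L: "(\<lambda>n. Dt (w n) t x) \<longlonglongrightarrow> L" "((\<lambda>s. z s x) has_real_derivative L) (at t within {0..})"
    proof (rule derivative_limit[of "{0..}" t "\<lambda>n s. w n s x" "\<lambda>n s. Dt (w n) s x" "\<lambda>r. M * sqrt (sqrt r)" "\<lambda>s. z s x"])
      show "((\<lambda>s. w n s x) has_real_derivative Dt (w n) s x) (at s within {0..})" if "s \<in> {0..}" for n s
        using that x by (intro C1_cylinderD(2)[OF C]) auto
      show "\<bar>Dt (w n) s x - Dt (w n) t x\<bar> \<le> M * sqrt (sqrt \<bar>s - t\<bar>)" if "s \<in> {0..}" for n s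
        using regularD(10)[OF r _ x t, of s n] that by simp
    qed (use t x lim M0 at_within_nonneg[OF t] modulus_sqrt_sqrt[OF M0] in auto)
    then show ?thesis using Dt_eqI[where w = z and x = x, OF t L(2)] by simp
  qed
  show Dt: "\<And>t x. t \<ge> 0 \<Longrightarrow> x \<in> \<Omega> \<Longrightarrow> (\<lambda>n. Dt (w n) t x) \<longlonglongrightarrow> Dt z t x" using T by blast
  have bnd: "\<bar>p\<bar> \<le> K" if "X \<longlonglongrightarrow> p" "\<And>n. \<bar>X n\<bar> \<le> K" for X :: "nat \<Rightarrow> real" and p K
    using tendsto_rabs[OF that(1)] that(2) by (intro LIMSEQ_le_const2) auto
  have space: "\<bar>z t x - z t y\<bar> \<le> M * sqrt \<bar>x - y\<bar> \<and> \<bar>Dx z t x - Dx z t y\<bar> \<le> M * sqrt \<bar>x - y\<bar> \<and>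
      \<bar>Dt z t x - Dt z t y\<bar> \<le> M * sqrt \<bar>x - y\<bar>" if t: "t \<ge> 0" and x: "x \<in> \<Omega>" "y \<in> \<Omega>" for t x y
    by (intro conjI bnd[OF tendsto_diff[OF lim[OF t x(1)] lim[OF t x(2)]] regularD(7)[OF r t x]]
          bnd[OF tendsto_diff[OF Dx[OF t x(1)] Dx[OF t x(2)]] regularD(8)[OF r t x]]
          bnd[OF tendsto_diff[OF Dt[OF t x(1)] Dt[OF t x(2)]] regularD(9)[OF r t x]])
  have time: "\<bar>Dt z t x - Dt z s x\<bar> \<le> M * sqrt (sqrt \<bar>t - s\<bar>)" "\<bar>z t x - z s x\<bar> \<le> M * \<bar>t - s\<bar>"
    if t: "t \<ge> 0" "s \<ge> 0" and x: "x \<in> \<Omega>" for t s x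
    by (rule bnd[OF tendsto_diff[OF Dt[OF t(1) x] Dt[OF t(2) x]] regularD(10)[OF r t(1) x t(2)]],
        rule bnd[OF tendsto_diff[OF lim[OF t(1) x] lim[OF t(2) x]] regular_time_Lipschitz[OF r t x]])
  have DERx: "(z t has_real_derivative Dx z t x) (at x)" if "t \<ge> 0" "x \<in> \<Omega>" for t x
    using H that H2_DERIV by blast
  \<comment> \<open>The bounds contain no time modulus for z_x. It is compared with difference
    quotients of a fixed width h, whose error is uniform in time and which are Lipschitz in
    time.\<close>
  have Dx_time: "continuous_on {0..} (\<lambda>t. Dx z t x)" if x: "x \<in> \<Omega>" for x
    unfolding continuous_on_iff
  proof (intro ballI allI impI)
    fix t e :: real assume t: "t \<in> {0..}" and e: "e > 0"
    obtain d where d: "d > 0" "\<And>r. 0 \<le> r \<Longrightarrow> r \<le> d \<Longrightarrow> M * sqrt r < e/4"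
      using modulusE[OF modulus_sqrt[OF M0], of "e/4"] e by auto
    define h where "h = min d ((b - x)/2)"
    have h: "h > 0" "h \<le> d" "x + h \<in> \<Omega>" using d x by (auto simp: h_def min_def field_simps)
    have near: "\<bar>z s (x + h) - z s x - h * Dx z s x\<bar> \<le> h * (e/4)" if s: "s \<ge> 0" for s
    proof -
      have "\<bar>z s (x + h) - z s x - ((x + h) - x) * Dx z s x\<bar> \<le> \<bar>(x + h) - x\<bar> * (e/4)"
      proof (rule derivative_remainder[of \<Omega> x "x + h" "z s" "Dx z s"])
        show "(z s has_real_derivative Dx z s y) (at y within \<Omega>)" if "y \<in> \<Omega>" for y
          using DERx[OF s that] by (rule has_field_derivative_at_within)
        show "\<bar>Dx z s y - Dx z s x\<bar> \<le> e/4" if "y \<in> \<Omega>" "\<bar>y - x\<bar> \<le> \<bar>(x + h) - x\<bar>" for y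
          using space[OF s that(1) x] d(2)[of "\<bar>y - x\<bar>"] that(2) h by auto
      qed (use x h in auto)
      then show ?thesis using h(1) by simp
    qed
    \<comment> \<open>Lipschitz constant in time of the difference quotient of width h.\<close>
    define K where "K = 2 * M / h"
    have K0: "K \<ge> 0" using M0 h by (simp add: K_def)
    have "dist (Dx z s x) (Dx z t x) < e" if s: "s \<in> {0..}" "dist s t < e / (4 * (K + 1))" for s
    proof -
      have st: "\<bar>s - t\<bar> \<le> e / (4 * (K + 1))" using s by (simp add: dist_real_def)
      have "\<bar>z s (x + h) - z t (x + h)\<bar> \<le> M * \<bar>s - t\<bar>" "\<bar>z s x - z t x\<bar> \<le> M * \<bar>s - t\<bar>"
        using time(2) s t x h by auto
      moreover have "\<bar>z s (x + h) - z s x - h * Dx z s x\<bar> \<le> h * (e/4)" "\<bar>z t (x + h) - z t x - h * Dx z t x\<bar> \<le> h * (e/4)"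
        using near s t by auto
      ultimately have "\<bar>h * Dx z s x - h * Dx z t x\<bar> \<le> h * (e/4) + h * (e/4) + 2 * M * \<bar>s - t\<bar>" by linarith
      moreover have "\<bar>h * Dx z s x - h * Dx z t x\<bar> = h * \<bar>Dx z s x - Dx z t x\<bar>"
        using h(1) by (simp add: abs_mult flip: right_diff_distrib)
      moreover have "h * (e/4) + h * (e/4) + 2 * M * \<bar>s - t\<bar> = h * (e/2 + K * \<bar>s - t\<bar>)"
        using h(1) by (simp add: K_def distrib_left)
      ultimately have "h * \<bar>Dx z s x - Dx z t x\<bar> \<le> h * (e/2 + K * \<bar>s - t\<bar>)" by linarith
      then have "\<bar>Dx z s x - Dx z t x\<bar> \<le> e/2 + K * \<bar>s - t\<bar>" using h(1) by simp
      also have "K * \<bar>s - t\<bar> \<le> (K + 1) * (e / (4 * (K + 1)))" using st K0 by (intro mult_mono) auto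
      also have "(K + 1) * (e / (4 * (K + 1))) = e/4" using K0 by (simp add: field_simps)
      finally show ?thesis using e by (simp add: dist_real_def)
    qed
    then show "\<exists>d>0. \<forall>s\<in>{0..}. dist s t < d \<longrightarrow> dist (Dx z s x) (Dx z t x) < e"
      using e K0 by (intro exI[of _ "e / (4 * (K + 1))"]) auto
  qed
  have "C1_cylinder \<Omega> z"
    unfolding C1_cylinder_def
  proof (intro conjI allI impI ballI)
    fix t x assume tx: "(0::real) \<le> t" "x \<in> \<Omega>"
    show "(\<lambda>s. z s x) differentiable (at t within {0..})"
      using T[OF tx] real_differentiable_def by blast
    show "z t differentiable (at x)" using DERx[OF tx] real_differentiable_def by blast
  next
    show "continuous_on ({0..} \<times> \<Omega>) (\<lambda>(t, x). z t x)"
      using space time(2) by (intro joint_continuity[OF modulus_sqrt[OF M0]] continuous_on_time_modulus[OF modulus_linear[OF M0]]) auto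
    show "continuous_on ({0..} \<times> \<Omega>) (\<lambda>(t, x). Dt z t x)"
      using space time(1) by (intro joint_continuity[OF modulus_sqrt[OF M0]] continuous_on_time_modulus[OF modulus_sqrt_sqrt[OF M0]]) auto
    show "continuous_on ({0..} \<times> \<Omega>) (\<lambda>(t, x). Dx z t x)"
      using space Dx_time by (intro joint_continuity[OF modulus_sqrt[OF M0]]) auto
  qed
  then show "regular M z"
    unfolding regular_def
  proof (intro conjI allI impI ballI)
    fix t :: real assume t: "t \<ge> 0"
    show "\<exists>f2. H2 (z t) (Dx z t) f2" "Hnorm 2 \<Omega> (z t) \<le> M" using H[OF t] by blast+
    show "\<bar>z t x\<bar> \<le> M" "\<bar>Dt z t x\<bar> \<le> M" "\<bar>Dx z t x\<bar> \<le> M" if x: "x \<in> \<Omega>" for x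
      by (rule bnd[OF lim[OF t x] regularD(4)[OF r t x]], rule bnd[OF Dt[OF t x] regularD(5)[OF r t x]],
          rule bnd[OF Dx[OF t x] regularD(6)[OF r t x]])
    show "\<bar>Dt z t x - Dt z s x\<bar> \<le> M * sqrt (sqrt \<bar>t - s\<bar>)" if "s \<ge> 0" "x \<in> \<Omega>" for s x
      using time(1)[OF t that] .
    fix x y assume "x \<in> \<Omega>" "y \<in> \<Omega>"
    then show "\<bar>z t x - z t y\<bar> \<le> M * sqrt \<bar>x - y\<bar>" "\<bar>Dx z t x - Dx z t y\<bar> \<le> M * sqrt \<bar>x - y\<bar>"
      "\<bar>Dt z t x - Dt z t y\<bar> \<le> M * sqrt \<bar>x - y\<bar>" using space[OF t] by blast+
  qed
qed

end

section \<open>Coefficients on the positive half-line\<close>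

definition C1_pos :: "(real \<Rightarrow> real) \<Rightarrow> bool" where
  "C1_pos f \<longleftrightarrow> (\<exists>f'. \<forall>x>0. (f has_real_derivative f' x) (at x) \<and> isCont f' x)"

lemma C1_posI: "(\<And>x. x > 0 \<Longrightarrow> (f has_real_derivative f' x) (at x)) \<Longrightarrow> (\<And>x. x > 0 \<Longrightarrow> isCont f' x) \<Longrightarrow> C1_pos f"
  by (auto simp: C1_pos_def)

lemma C1_posE:
  assumes "C1_pos f"
  obtains f' where "\<And>x. x > 0 \<Longrightarrow> (f has_real_derivative f' x) (at x)" "\<And>x. x > 0 \<Longrightarrow> isCont f' x"
    "\<And>x. x > 0 \<Longrightarrow> isCont f x"
  using assms unfolding C1_pos_def by (metis DERIV_isCont)

lemma C1_pos_diff: assumes "C1_pos f" "C1_pos g" shows "C1_pos (\<lambda>x. f x - g x)"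
proof -
  obtain f' g' where f: "\<And>x. x > 0 \<Longrightarrow> (f has_real_derivative f' x) (at x)" "\<And>x. x > 0 \<Longrightarrow> isCont f' x"
    and g: "\<And>x. x > 0 \<Longrightarrow> (g has_real_derivative g' x) (at x)" "\<And>x. x > 0 \<Longrightarrow> isCont g' x"
    using assms C1_posE by metis
  show ?thesis by (rule C1_posI[where f' = "\<lambda>x. f' x - g' x"]) (use f g in \<open>auto intro!: DERIV_diff\<close>)
qed

lemma C1_pos_mult: assumes "C1_pos f" "C1_pos g" shows "C1_pos (\<lambda>x. f x * g x)"
proof -
  obtain f' where f: "\<And>x. x > 0 \<Longrightarrow> (f has_real_derivative f' x) (at x)" "\<And>x. x > 0 \<Longrightarrow> isCont f' x" "\<And>x. x > 0 \<Longrightarrow> isCont f x"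
    by (rule C1_posE[OF assms(1)]) blast
  obtain g' where g: "\<And>x. x > 0 \<Longrightarrow> (g has_real_derivative g' x) (at x)" "\<And>x. x > 0 \<Longrightarrow> isCont g' x" "\<And>x. x > 0 \<Longrightarrow> isCont g x"
    by (rule C1_posE[OF assms(2)]) blast
  show ?thesis by (rule C1_posI[where f' = "\<lambda>x. f' x * g x + g' x * f x"]) (use f g in \<open>auto intro!: DERIV_mult\<close>)
qed

lemma C1_pos_divide:
  assumes "C1_pos f" "C1_pos g" and nz: "\<And>x. x > 0 \<Longrightarrow> g x \<noteq> 0"
  shows "C1_pos (\<lambda>x. f x / g x)"
proof -
  obtain f' where f: "\<And>x. x > 0 \<Longrightarrow> (f has_real_derivative f' x) (at x)" "\<And>x. x > 0 \<Longrightarrow> isCont f' x" "\<And>x. x > 0 \<Longrightarrow> isCont f x"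
    by (rule C1_posE[OF assms(1)]) blast
  obtain g' where g: "\<And>x. x > 0 \<Longrightarrow> (g has_real_derivative g' x) (at x)" "\<And>x. x > 0 \<Longrightarrow> isCont g' x" "\<And>x. x > 0 \<Longrightarrow> isCont g x"
    by (rule C1_posE[OF assms(2)]) blast
  show ?thesis
    by (rule C1_posI[where f' = "\<lambda>x. (f' x * g x - f x * g' x) / (g x * g x)"])
       (use f g nz in \<open>auto intro!: DERIV_divide continuous_intros\<close>)
qed

lemma C1_pos_id: "C1_pos (\<lambda>x. x)"
  by (rule C1_posI[where f' = "\<lambda>x. 1"]) auto

lemma C1_pos_const: "C1_pos (\<lambda>x. c)"
  by (rule C1_posI[where f' = "\<lambda>x. 0"]) auto

lemma smooth_coefficient_C1:
  assumes "smooth_coefficient f" shows "C1_pos ((deriv ^^ n) f)"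
proof (rule C1_posI[where f' = "(deriv ^^ Suc n) f"])
  fix x :: real assume x: "x > 0"
  have d: "(deriv ^^ k) f differentiable (at x)" for k using assms x by (simp add: smooth_coefficient_def)
  show "((deriv ^^ n) f has_real_derivative (deriv ^^ Suc n) f x) (at x)"
    using d[of n] DERIV_deriv_iff_real_differentiable by auto
  show "isCont ((deriv ^^ Suc n) f) x"
    using d[of "Suc n"] differentiable_imp_continuous_within by blast
qed

text \<open>Z is \<tau> times a function free of \<tau>, hence so are a and its derivative. The
  ratios of a to Z and to \<tau> g therefore keep their size as \<tau> tends to 0, whereas the
  correction in \<open>e_\<theta>\<close> vanishes.\<close>

lemma coefficient_a:
  assumes g: "smooth_coefficient g" and \<kappa>: "smooth_coefficient \<kappa>"
  obtains A A' where "\<And>\<tau> x. x > 0 \<Longrightarrow> relaxed_fluid.a g \<kappa> \<tau> x = \<tau> * A x"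
    "\<And>\<tau> x. x > 0 \<Longrightarrow> deriv (relaxed_fluid.a g \<kappa> \<tau>) x = \<tau> * A' x"
    "\<And>x. x > 0 \<Longrightarrow> isCont A x" "\<And>x. x > 0 \<Longrightarrow> isCont A' x"
proof -
  have \<kappa>0: "\<kappa> x \<noteq> 0" if "x > 0" for x using \<kappa> that by (auto simp: smooth_coefficient_def dest!: spec[of _ x])
  define Z1 where "Z1 x = g x / \<kappa> x" for x
  define Z' where "Z' x = (deriv g x * \<kappa> x - g x * deriv \<kappa> x) / (\<kappa> x * \<kappa> x)" for x
  note C = smooth_coefficient_C1[OF g, of 0] smooth_coefficient_C1[OF \<kappa>, of 0]
    smooth_coefficient_C1[OF g, of 1] smooth_coefficient_C1[OF \<kappa>, of 1]
  have D: "(g has_real_derivative deriv g x) (at x)" "(\<kappa> has_real_derivative deriv \<kappa> x) (at x)" if "x > 0" for x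
    using g \<kappa> that DERIV_deriv_iff_real_differentiable unfolding smooth_coefficient_def
    by (metis funpow_0)+
  have dZ: "(Z1 has_real_derivative Z' x) (at x)" if "x > 0" for x
    unfolding Z1_def Z'_def using D[OF that] \<kappa>0[OF that] by (rule DERIV_divide)
  have CZ1: "C1_pos Z1" unfolding Z1_def[abs_def] using C \<kappa>0 by (intro C1_pos_divide) auto
  have CZ': "C1_pos Z'" unfolding Z'_def[abs_def] using C \<kappa>0
    by (intro C1_pos_divide C1_pos_diff C1_pos_mult) auto
  define A where "A x = Z1 x / x - 1/2 * Z' x" for x
  have "C1_pos A" unfolding A_def[abs_def]
    by (intro C1_pos_diff C1_pos_divide C1_pos_mult C1_pos_const C1_pos_id CZ1 CZ') auto
  then obtain A' where A': "\<And>x. x > 0 \<Longrightarrow> (A has_real_derivative A' x) (at x)" "\<And>x. x > 0 \<Longrightarrow> isCont A' x"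
    "\<And>x. x > 0 \<Longrightarrow> isCont A x" using C1_posE by metis
  have Z: "relaxed_fluid.Z g \<kappa> \<tau> = (\<lambda>x. \<tau> * Z1 x)" for \<tau>
    by (simp add: relaxed_fluid.Z_def Z1_def fun_eq_iff)
  have a: "relaxed_fluid.a g \<kappa> \<tau> x = \<tau> * A x" if x: "x > 0" for \<tau> x
  proof -
    have "deriv (relaxed_fluid.Z g \<kappa> \<tau>) x = \<tau> * Z' x"
      unfolding Z by (intro DERIV_imp_deriv DERIV_cmult dZ x)
    then show ?thesis by (simp add: relaxed_fluid.a_def Z A_def algebra_simps)
  qed
  have da: "deriv (relaxed_fluid.a g \<kappa> \<tau>) x = \<tau> * A' x" if x: "x > 0" for \<tau> x
  proof (rule DERIV_imp_deriv)
    have "((\<lambda>x. \<tau> * A x) has_real_derivative \<tau> * A' x) (at x)" by (intro DERIV_cmult A' x)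
    then show "(relaxed_fluid.a g \<kappa> \<tau> has_real_derivative \<tau> * A' x) (at x)"
      by (rule has_field_derivative_transform_within_open[where S = "{0<..}"]) (use x a in auto)
  qed
  show thesis by (rule that[OF a da A'(3,2)])
qed

text \<open>The product filter says that f' n y is near N for all large n and all y near x at once,
  so the mean value estimate is uniform in n. It suits q and S - p, whose derivatives are known
  through the equations.\<close>

lemma derivative_of_limit:
  fixes f :: "nat \<Rightarrow> real \<Rightarrow> real"
  assumes S: "open S" "x \<in> S"
    and d: "\<And>n y. y \<in> S \<Longrightarrow> (f n has_real_derivative f' n y) (at y)"
    and l: "\<And>y. y \<in> S \<Longrightarrow> (\<lambda>n. f n y) \<longlonglongrightarrow> g y"
    and N: "((\<lambda>p. f' (fst p) (snd p)) \<longlongrightarrow> N) (sequentially \<times>\<^sub>F nhds x)"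
  shows "(g has_real_derivative N) (at x)"
  unfolding has_field_derivative_iff tendsto_iff
proof (intro allI impI)
  fix e :: real assume e: "e > 0"
  have "\<forall>\<^sub>F p in sequentially \<times>\<^sub>F nhds x. dist (f' (fst p) (snd p)) N < e/2"
    using N e by (intro tendstoD) auto
  then obtain P Q where PQ: "eventually P sequentially" "eventually Q (nhds x)"
    "\<And>n y. P n \<Longrightarrow> Q y \<Longrightarrow> dist (f' n y) N < e/2"
    unfolding eventually_prod_filter by auto
  have "\<forall>\<^sub>F y in nhds x. Q y \<and> y \<in> S" using PQ(2) S by (intro eventually_conj eventually_nhds_in_open)
  then obtain r where r: "r > 0" "\<And>y. dist y x < r \<Longrightarrow> Q y \<and> y \<in> S"
    unfolding eventually_nhds_metric by blast
  have rem: "\<bar>g y - g x - (y - x) * N\<bar> \<le> \<bar>y - x\<bar> * (e/2)" if y: "dist y x < r" for y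
  proof (rule tendsto_upperbound)
    show "(\<lambda>n. \<bar>f n y - f n x - (y - x) * N\<bar>) \<longlonglongrightarrow> \<bar>g y - g x - (y - x) * N\<bar>"
      using r(2)[OF y] S by (intro tendsto_intros l) auto
    show "\<forall>\<^sub>F n in sequentially. \<bar>f n y - f n x - (y - x) * N\<bar> \<le> \<bar>y - x\<bar> * (e/2)"
      using PQ(1)
    proof eventually_elim
      case (elim n)
      show ?case
      proof (rule derivative_remainder[of "ball x r" x y "f n" "f' n"])
        show "(f n has_real_derivative f' n z) (at z within ball x r)" if "z \<in> ball x r" for z
          using d[of z n] r(2)[of z] that by (auto simp: dist_commute intro: has_field_derivative_at_within)
        show "\<bar>f' n z - N\<bar> \<le> e/2" if z: "z \<in> ball x r" for z
        proof -
          have "Q z" using r(2)[of z] z by (simp add: dist_commute)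
          from PQ(3)[OF elim this] show ?thesis unfolding dist_real_def by (rule less_imp_le)
        qed
      qed (use y r in \<open>auto simp: dist_commute\<close>)
    qed
  qed simp
  have "\<forall>\<^sub>F y in at x. dist y x < r \<and> y \<noteq> x" using r(1) by (auto simp: eventually_at)
  then show "\<forall>\<^sub>F y in at x. dist ((g y - g x) / (y - x)) N < e"
  proof eventually_elim
    case (elim y)
    have "(g y - g x) / (y - x) - N = (g y - g x - (y - x) * N) / (y - x)"
      using elim by (simp add: field_simps)
    then have "\<bar>(g y - g x) / (y - x) - N\<bar> = \<bar>g y - g x - (y - x) * N\<bar> / \<bar>y - x\<bar>" by (simp add: abs_divide)
    also have "\<dots> \<le> e/2" using rem[of y] elim by (simp add: field_simps)
    finally show ?case using e by (simp add: dist_real_def)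
  qed
qed

text \<open>The situation sustains itself: while \<theta> is below m the flux grows and stays
  nonnegative; then \<theta> does not increase and stays below m.\<close>

lemma flux_grows_right:
  fixes \<theta> q \<theta>' q' :: "real \<Rightarrow> real"
  assumes d\<theta>: "\<And>y. x \<le> y \<Longrightarrow> y < b \<Longrightarrow> (\<theta> has_real_derivative \<theta>' y) (at y)"
    and dq: "\<And>y. x \<le> y \<Longrightarrow> y < b \<Longrightarrow> (q has_real_derivative q' y) (at y)"
    and sign: "\<And>y. x \<le> y \<Longrightarrow> y < b \<Longrightarrow> q y \<ge> 0 \<Longrightarrow> \<theta>' y \<le> 0"
    and q': "\<And>y. x \<le> y \<Longrightarrow> y < b \<Longrightarrow> \<theta> y < m \<Longrightarrow> q' y > e"
    and x: "\<theta> x < m" "q x \<ge> 0" and e: "e > 0" and z: "x \<le> z" "z < b"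
  shows "q z \<ge> q x + e * (z - x)"
proof -
  have grow: "q y \<ge> q x + e * (y - x)" if y: "x \<le> y" "y < b" and below: "\<And>r. x < r \<Longrightarrow> r < y \<Longrightarrow> \<theta> r < m" for y
  proof (cases "x = y")
    case False
    then have "x < y" using y by simp
    then obtain r where r: "x < r" "r < y" "q y - q x = (y - x) * q' r"
      using MVT2[of x y q q'] dq y by force
    have "q' r > e" using q'[of r] below[of r] r y by simp
    then have "(y - x) * e \<le> (y - x) * q' r" using \<open>x < y\<close> by (intro mult_left_mono) auto
    then show ?thesis using r(3) mult.commute[of e "y - x"] by linarith
  qed simp
  have all: "\<theta> y < m" if y: "x \<le> y" "y < b" for y
  proof (rule ccontr)
    assume not: "\<not> \<theta> y < m"
    \<comment> \<open>Its least element is the first point where \<theta> reaches m. The growth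
      estimate holds before it, so \<theta> cannot have risen on the way.\<close>
    let ?S = "{x..y} \<inter> \<theta> -` {m..}"
    have c: "continuous_on {x..y} \<theta>"
      using y by (intro continuous_at_imp_continuous_on ballI DERIV_isCont[OF d\<theta>]) auto
    have "compact ?S"
      using continuous_closed_preimage[OF c closed_atLeastAtMost closed_atLeast[of m]]
      by (metis Int_lower1 bounded_closed_imp_seq_compact bounded_subset compact_Icc compact_eq_bounded_closed)
    moreover have "y \<in> ?S" using y not by simp
    ultimately obtain s where s: "s \<in> ?S" "\<And>r. r \<in> ?S \<Longrightarrow> s \<le> r"
      using compact_attains_inf[of ?S] by blast
    have below: "\<theta> r < m" if "x \<le> r" "r < s" for r
      using s(2)[of r] that s(1) by force
    have xs: "x < s" using s(1) x(1) by (metis IntE atLeastAtMost_iff atLeast_iff less_le not_le vimageE)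
    obtain r where r: "x < r" "r < s" "\<theta> s - \<theta> x = (s - x) * \<theta>' r"
      using MVT2[OF xs, of \<theta> \<theta>'] d\<theta> s(1) y by force
    have rb: "r < b" using r s(1) y by simp
    have "q r \<ge> q x + e * (r - x)" using below r rb by (intro grow) auto
    moreover have "e * (r - x) \<ge> 0" using e r by simp
    ultimately have "\<theta>' r \<le> 0" using x(2) r rb by (intro sign) auto
    then have "(s - x) * \<theta>' r \<le> 0" using xs by (simp add: mult_nonneg_nonpos)
    then have "\<theta> s < m" using r x(1) by linarith
    then show False using s(1) by simp
  qed
  show ?thesis by (rule grow[OF z]) (use all z in auto)
qed

section \<open>Joint limits and boundary values\<close>

context bounded_interval
begin

text \<open>The modulus at x does not depend on n, so convergence at x becomes convergence in n and
  y together, as \<open>derivative_of_limit\<close> requires.\<close>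

lemma pair_tendsto:
  fixes X :: "nat \<Rightarrow> real \<Rightarrow> real"
  assumes x: "x \<in> \<Omega>" and l: "(\<lambda>n. X n x) \<longlonglongrightarrow> L"
    and m: "\<And>n y. y \<in> \<Omega> \<Longrightarrow> \<bar>X n y - X n x\<bar> \<le> M * sqrt \<bar>y - x\<bar>"
  shows "((\<lambda>p. X (fst p) (snd p)) \<longlongrightarrow> L) (sequentially \<times>\<^sub>F nhds x)"
proof -
  let ?F = "sequentially \<times>\<^sub>F nhds x"
  have 1: "((\<lambda>p. X (fst p) x) \<longlongrightarrow> L) ?F"
    by (rule filterlim_compose[OF l filterlim_fst])
  have sl: "(snd \<longlongrightarrow> x) ?F" using filterlim_snd[of "nhds x" sequentially] .
  have "((\<lambda>p. M * sqrt \<bar>snd p - x\<bar>) \<longlongrightarrow> M * sqrt \<bar>x - x\<bar>) ?F"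
    by (intro tendsto_intros sl)
  then have 2: "((\<lambda>p. M * sqrt \<bar>snd p - x\<bar>) \<longlongrightarrow> 0) ?F" by simp
  have "\<forall>\<^sub>F p in ?F. snd p \<in> \<Omega>"
    using sl x open_\<Omega> by (intro topological_tendstoD) auto
  then have "\<forall>\<^sub>F p in ?F. norm (X (fst p) (snd p) - X (fst p) x) \<le> M * sqrt \<bar>snd p - x\<bar>"
    by eventually_elim (simp add: m)
  then have "((\<lambda>p. X (fst p) (snd p) - X (fst p) x) \<longlongrightarrow> 0) ?F" by (rule Lim_null_comparison[OF _ 2])
  from tendsto_add[OF this 1] show ?thesis by simp
qed

lemma fluxD:
  assumes "flux M D q" "t \<ge> 0"
  shows "C1_cylinder \<Omega> q" "\<exists>f2. H2 (q t) (Dx q t) f2"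
    "x \<in> \<Omega> \<Longrightarrow> \<bar>q t x\<bar> \<le> M"
    "x \<in> \<Omega> \<Longrightarrow> y \<in> \<Omega> \<Longrightarrow> \<bar>q t x - q t y\<bar> \<le> M * sqrt \<bar>x - y\<bar>"
    "x \<in> \<Omega> \<Longrightarrow> s \<ge> 0 \<Longrightarrow> \<bar>q t x - q s x\<bar> \<le> M * sqrt \<bar>t - s\<bar>"
    "t > 0 \<Longrightarrow> (Hnorm 2 \<Omega> (q t))\<^sup>2 \<le> D t"
  using assms unfolding flux_def by blast+

text \<open>The continuous representative vanishes at both ends and f is Hoelder of exponent 1/2. In
  this quantitative form the boundary condition survives pointwise limits, and
  \<open>trace_zeroI\<close> translates it back.\<close>

lemma trace_zero_bound:
  assumes z: "trace_zero \<Omega> f" and c: "continuous_on \<Omega> f"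
    and m: "\<And>x y. x \<in> \<Omega> \<Longrightarrow> y \<in> \<Omega> \<Longrightarrow> \<bar>f x - f y\<bar> \<le> M * sqrt \<bar>x - y\<bar>" and x: "x \<in> \<Omega>"
  shows "\<bar>f x\<bar> \<le> M * sqrt (x - a)" "\<bar>f x\<bar> \<le> M * sqrt (b - x)"
proof -
  obtain h where h: "continuous_on (closure \<Omega>) h" "AE x in LL. h x = f x" "\<forall>x\<in>frontier \<Omega>. h x = 0"
    using z by (auto simp: trace_zero_def)
  have cl: "closure \<Omega> = {a..b}" using ab by simp
  have fr: "h a = 0" "h b = 0" using h(3) ab by (auto simp: frontier_def)
  have hc: "continuous_on \<Omega> h" using h(1) by (rule continuous_on_subset) (auto simp: cl)
  \<comment> \<open>Continuous functions that agree almost everywhere agree, since a nonempty open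
    set is not negligible.\<close>
  have eq: "h y = f y" if y: "y \<in> \<Omega>" for y
  proof (rule ccontr)
    assume ne: "h y \<noteq> f y"
    let ?U = "{z \<in> \<Omega>. h z - f z \<noteq> 0}"
    have U: "open ?U"
    proof -
      have "continuous_on \<Omega> (\<lambda>z. h z - f z)" by (intro continuous_intros hc c)
      then have "open (\<Omega> \<inter> (\<lambda>z. h z - f z) -` (- {0}))"
        by (rule continuous_open_preimage) auto
      moreover have "\<Omega> \<inter> (\<lambda>z. h z - f z) -` (- {0}) = ?U" by auto
      ultimately show ?thesis by simp
    qed
    have "AE z in lebesgue. z \<in> \<Omega> \<longrightarrow> h z = f z" using h(2) by (simp add: AE_lebesgue_on_iff)
    then have "AE z in lebesgue. z \<notin> ?U" by eventually_elim auto
    moreover have "?U \<in> sets lebesgue" using borel_open[OF U] sets_completionI_sets[of ?U lborel] by simp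
    ultimately have "?U \<in> null_sets lebesgue" by (simp add: AE_iff_null_sets)
    then have "negligible ?U" by (simp add: negligible_iff_null_sets)
    then have "?U = {}" using open_not_negligible[OF U] by blast
    moreover have "y \<in> ?U" using y ne by simp
    ultimately show False by blast
  qed
  have hx: "h x = f x" using eq x by blast
  have lima: "(h \<longlongrightarrow> h a) (at_right a)" and limb: "(h \<longlongrightarrow> h b) (at_left b)"
    using h(1) ab unfolding cl
    by (auto simp: continuous_on_Icc_at_rightD continuous_on_Icc_at_leftD)
  show "\<bar>f x\<bar> \<le> M * sqrt (x - a)"
  proof (rule tendsto_le[OF _ _ _ ])
    show "at_right a \<noteq> bot" by simp
    show "((\<lambda>y. M * sqrt \<bar>x - y\<bar>) \<longlongrightarrow> M * sqrt (x - a)) (at_right a)"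
    proof -
      have "((\<lambda>y. M * sqrt \<bar>x - y\<bar>) \<longlongrightarrow> M * sqrt \<bar>x - a\<bar>) (at_right a)" by (intro tendsto_intros)
      then show ?thesis using x by simp
    qed
    show "((\<lambda>y. \<bar>f x - h y\<bar>) \<longlongrightarrow> \<bar>f x\<bar>) (at_right a)"
      using tendsto_rabs[OF tendsto_diff[OF tendsto_const lima], of "f x"] fr by simp
    have "\<forall>\<^sub>F y in at_right a. y \<in> {a<..<b}" using ab by (rule eventually_at_right_real)
    then show "\<forall>\<^sub>F y in at_right a. \<bar>f x - h y\<bar> \<le> M * sqrt \<bar>x - y\<bar>"
      by eventually_elim (use m[OF x] eq in auto)
  qed
  show "\<bar>f x\<bar> \<le> M * sqrt (b - x)"
  proof (rule tendsto_le[OF _ _ _ ])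
    show "at_left b \<noteq> bot" by simp
    show "((\<lambda>y. M * sqrt \<bar>x - y\<bar>) \<longlongrightarrow> M * sqrt (b - x)) (at_left b)"
    proof -
      have "((\<lambda>y. M * sqrt \<bar>x - y\<bar>) \<longlongrightarrow> M * sqrt \<bar>x - b\<bar>) (at_left b)" by (intro tendsto_intros)
      then show ?thesis using x by (simp add: abs_minus_commute)
    qed
    show "((\<lambda>y. \<bar>f x - h y\<bar>) \<longlongrightarrow> \<bar>f x\<bar>) (at_left b)"
      using tendsto_rabs[OF tendsto_diff[OF tendsto_const limb], of "f x"] fr by simp
    have "\<forall>\<^sub>F y in at_left b. y \<in> {a<..<b}" using ab by (rule eventually_at_left_real)
    then show "\<forall>\<^sub>F y in at_left b. \<bar>f x - h y\<bar> \<le> M * sqrt \<bar>x - y\<bar>"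
      by eventually_elim (use m[OF x] eq in auto)
  qed
qed

text \<open>Extension by 0 to the ends is the continuous representative.\<close>

lemma trace_zeroI:
  assumes c: "continuous_on \<Omega> f" and m: "\<And>x. x \<in> \<Omega> \<Longrightarrow> \<bar>f x\<bar> \<le> M * sqrt (x - a)" "\<And>x. x \<in> \<Omega> \<Longrightarrow> \<bar>f x\<bar> \<le> M * sqrt (b - x)"
  shows "trace_zero \<Omega> f"
proof -
  define h where "h x = (if x \<in> \<Omega> then f x else 0)" for x
  have cl: "closure \<Omega> = {a..b}" using ab by simp
  have hm: "\<bar>h x\<bar> \<le> M * sqrt (x - a)" "\<bar>h x\<bar> \<le> M * sqrt (b - x)" if "x \<in> {a..b}" for x
  proof -
    have M0: "M \<ge> 0"
    proof -
      have "0 \<le> M * sqrt (mid - a)" using m(1)[OF mid_in] by linarith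
      then show ?thesis using mid_in by (simp add: zero_le_mult_iff)
    qed
    then show "\<bar>h x\<bar> \<le> M * sqrt (x - a)" "\<bar>h x\<bar> \<le> M * sqrt (b - x)"
      using m that by (auto simp: h_def)
  qed
  have "continuous_on {a..b} h"
    unfolding continuous_on_def
  proof
    fix x assume x: "x \<in> {a..b}"
    consider "x \<in> \<Omega>" | "x = a" | "x = b" using x by force
    then show "(h \<longlongrightarrow> h x) (at x within {a..b})"
    proof cases
      case 1
      have "isCont f x" using c 1 open_\<Omega> by (simp add: continuous_on_eq_continuous_at)
      then have "(f \<longlongrightarrow> f x) (at x)" by (simp add: isCont_def)
      moreover have "\<forall>\<^sub>F y in at x. f y = h y"
        using eventually_at_in_open'[OF open_\<Omega> 1] by eventually_elim (simp add: h_def)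
      ultimately have "(h \<longlongrightarrow> f x) (at x)" by (rule Lim_transform_eventually)
      then show ?thesis using 1 by (simp add: h_def tendsto_within_subset[of h _ x UNIV])
    next
      case 2
      have "((\<lambda>y. M * sqrt (y - a)) \<longlongrightarrow> M * sqrt (a - a)) (at a within {a..b})" by (intro tendsto_intros)
      then have "(h \<longlongrightarrow> 0) (at a within {a..b})"
        by (intro Lim_null_comparison[of h "\<lambda>y. M * sqrt (y - a)"]) (auto simp: eventually_at_filter hm)
      then show ?thesis using 2 by (simp add: h_def)
    next
      case 3
      have "((\<lambda>y. M * sqrt (b - y)) \<longlongrightarrow> M * sqrt (b - b)) (at b within {a..b})" by (intro tendsto_intros)
      then have "(h \<longlongrightarrow> 0) (at b within {a..b})"
        by (intro Lim_null_comparison[of h "\<lambda>y. M * sqrt (b - y)"]) (auto simp: eventually_at_filter hm)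
      then show ?thesis using 3 by (simp add: h_def)
    qed
  qed
  then show ?thesis
    unfolding trace_zero_def cl using ab by (intro exI[of _ h]) (auto simp: h_def frontier_def intro!: AE_I2)
qed

end

section \<open>Passage to the limit\<close>

lemma DERIV_reflect:
  assumes "(f has_real_derivative d) (at (- y))"
  shows "((\<lambda>y. f (- y)) has_real_derivative - d) (at y)"
proof -
  have "(uminus has_real_derivative - 1) (at y)" by (auto intro!: derivative_eq_intros)
  from DERIV_chain2[OF assms this] show ?thesis by simp
qed

lemma pressure_derivative:
  assumes "(f has_real_derivative f') (at x)" "(h has_real_derivative h') (at x)" "f x > 0"
  shows "((\<lambda>x. pressure R (f x) (h x)) has_real_derivative R * (h' * f x - h x * f') / (f x)\<^sup>2) (at x)"
  using assms unfolding pressure_def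
  by (auto intro!: derivative_eq_intros simp: power2_eq_square field_simps)

lemma continuous_on_C1_cylinder:
  assumes "C1_cylinder \<Omega> w"
  shows "continuous_on ({0..} \<times> \<Omega>) (\<lambda>p. w (fst p) (snd p))"
    "continuous_on ({0..} \<times> \<Omega>) (\<lambda>p. Dt w (fst p) (snd p))"
    "continuous_on ({0..} \<times> \<Omega>) (\<lambda>p. Dx w (fst p) (snd p))"
  using assms unfolding C1_cylinder_def case_prod_unfold by blast+

context bounded_interval
begin

lemma flux_limit:
  assumes f: "\<And>n. flux M (D n) (q n)"
    and l: "\<And>t x. t \<ge> 0 \<Longrightarrow> x \<in> \<Omega> \<Longrightarrow> (\<lambda>n. q n t x) \<longlonglongrightarrow> z t x"
  shows "\<And>t x. t \<ge> 0 \<Longrightarrow> x \<in> \<Omega> \<Longrightarrow> \<bar>z t x\<bar> \<le> M"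
    and "\<And>t x y. t \<ge> 0 \<Longrightarrow> x \<in> \<Omega> \<Longrightarrow> y \<in> \<Omega> \<Longrightarrow> \<bar>z t x - z t y\<bar> \<le> M * sqrt \<bar>x - y\<bar>"
    and "\<And>t s x. t \<ge> 0 \<Longrightarrow> s \<ge> 0 \<Longrightarrow> x \<in> \<Omega> \<Longrightarrow> \<bar>z t x - z s x\<bar> \<le> M * sqrt \<bar>t - s\<bar>"
    and "continuous_on ({0..} \<times> \<Omega>) (\<lambda>(t, x). z t x)"
proof -
  show 1: "\<bar>z t x\<bar> \<le> M" if "t \<ge> 0" "x \<in> \<Omega>" for t x
    by (rule LIMSEQ_le_const2[OF tendsto_rabs[OF l[OF that]]]) (use fluxD(3)[OF f] that in blast)
  show 2: "\<bar>z t x - z t y\<bar> \<le> M * sqrt \<bar>x - y\<bar>" if "t \<ge> 0" "x \<in> \<Omega>" "y \<in> \<Omega>" for t x y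
    by (rule LIMSEQ_le_const2[OF tendsto_rabs[OF tendsto_diff[OF l[OF that(1,2)] l[OF that(1,3)]]]])
       (use fluxD(4)[OF f] that in blast)
  show 3: "\<bar>z t x - z s x\<bar> \<le> M * sqrt \<bar>t - s\<bar>" if "t \<ge> 0" "s \<ge> 0" "x \<in> \<Omega>" for t s x
    by (rule LIMSEQ_le_const2[OF tendsto_rabs[OF tendsto_diff[OF l[OF that(1,3)] l[OF that(2,3)]]]])
       (use fluxD(5)[OF f] that in blast)
  have "M \<ge> 0" using 1[of 0 "(a + b) / 2"] ab by force
  then have m: "modulus (\<lambda>r. M * sqrt r)" by (rule modulus_sqrt)
  show "continuous_on ({0..} \<times> \<Omega>) (\<lambda>(t, x). z t x)"
    by (rule joint_continuity[OF m 2]) (auto intro!: continuous_on_time_modulus[OF m] 3)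
qed

text \<open>Otherwise \<open>q\<close> would grow linearly away from \<open>x\<close> in the direction in which \<open>\<theta>\<close> does not increase,
  against its decay at that end of the interval.\<close>

lemma flux_minimum:
  fixes \<theta> q \<theta>' q' :: "real \<Rightarrow> real"
  assumes d\<theta>: "\<And>y. y \<in> \<Omega> \<Longrightarrow> (\<theta> has_real_derivative \<theta>' y) (at y)"
    and dq: "\<And>y. y \<in> \<Omega> \<Longrightarrow> (q has_real_derivative q' y) (at y)"
    and sign: "\<And>y. y \<in> \<Omega> \<Longrightarrow> q y \<ge> 0 \<Longrightarrow> \<theta>' y \<le> 0" "\<And>y. y \<in> \<Omega> \<Longrightarrow> q y \<le> 0 \<Longrightarrow> \<theta>' y \<ge> 0"
    and bd: "\<And>y. y \<in> \<Omega> \<Longrightarrow> \<bar>q y\<bar> \<le> M * sqrt (y - a)" "\<And>y. y \<in> \<Omega> \<Longrightarrow> \<bar>q y\<bar> \<le> M * sqrt (b - y)"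
    and x: "x \<in> \<Omega>" "\<theta> x < m" and e: "e > 0"
  shows "\<exists>y\<in>\<Omega>. \<theta> y < m \<and> q' y \<le> e"
proof (rule ccontr)
  assume "\<not> ?thesis"
  then have no: "q' y > e" if "y \<in> \<Omega>" "\<theta> y < m" for y using that by force
  show False
  proof (cases "q x \<ge> 0")
    case True
    have grow: "q z \<ge> q x + e * (z - x)" if "x \<le> z" "z < b" for z
      by (rule flux_grows_right[where \<theta> = \<theta> and \<theta>' = \<theta>' and q' = q' and m = m and b = b])
         (use that x e True d\<theta> dq sign no in auto)
    \<comment> \<open>Linear growth of q from x on meets its decay at b: in the limit a positive
      number would be at most 0.\<close>
    have "e * (b - x) \<le> M * sqrt (b - b)"
    proof (rule tendsto_le[of "at_left b"])
      show "((\<lambda>z. M * sqrt (b - z)) \<longlongrightarrow> M * sqrt (b - b)) (at_left b)" by (intro tendsto_intros)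
      show "((\<lambda>z. e * (z - x)) \<longlongrightarrow> e * (b - x)) (at_left b)" by (intro tendsto_intros)
      have "\<forall>\<^sub>F z in at_left b. z \<in> {x<..<b}" using x by (intro eventually_at_left_real) auto
      then show "\<forall>\<^sub>F z in at_left b. e * (z - x) \<le> M * sqrt (b - z)"
      proof eventually_elim
        case (elim z)
        then show ?case using grow[of z] bd(2)[of z] True x by auto
      qed
    qed simp
    then have "e * (b - x) \<le> 0" by simp
    then show False using e x by (simp add: mult_le_0_iff)
  next
    case False
    \<comment> \<open>Mirror image of the first case; the sign of q is changed together with that of
      the variable, so that q_x keeps its sign.\<close>
    have grow: "- q (- z) \<ge> - q (- (- x)) + e * (z - (- x))" if "- x \<le> z" "z < - a" for z
    proof (rule flux_grows_right[where \<theta> = "\<lambda>y. \<theta> (- y)" and \<theta>' = "\<lambda>y. - \<theta>' (- y)"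
          and q = "\<lambda>y. - q (- y)" and q' = "\<lambda>y. q' (- y)" and m = m and b = "- a"])
      fix y assume y: "- x \<le> y" "y < - a"
      then have yO: "- y \<in> \<Omega>" using x by auto
      show "((\<lambda>y. \<theta> (- y)) has_real_derivative - \<theta>' (- y)) (at y)"
        by (rule DERIV_reflect[OF d\<theta>[OF yO]])
      show "((\<lambda>y. - q (- y)) has_real_derivative q' (- y)) (at y)"
        using DERIV_minus[OF DERIV_reflect[OF dq[OF yO]]] by simp
      show "- \<theta>' (- y) \<le> 0" if "0 \<le> - q (- y)" using sign(2)[OF yO] that by simp
      show "e < q' (- y)" if "\<theta> (- y) < m" using no[OF yO that] .
    qed (use that x e False in auto)
    have "e * (- a + x) \<le> M * sqrt (a - a)"
    proof (rule tendsto_le[of "at_right a"])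
      show "((\<lambda>z. M * sqrt (z - a)) \<longlongrightarrow> M * sqrt (a - a)) (at_right a)" by (intro tendsto_intros)
      show "((\<lambda>z. e * (- z + x)) \<longlongrightarrow> e * (- a + x)) (at_right a)" by (intro tendsto_intros)
      have "\<forall>\<^sub>F z in at_right a. z \<in> {a<..<x}" using x by (intro eventually_at_right_real) auto
      then show "\<forall>\<^sub>F z in at_right a. e * (- z + x) \<le> M * sqrt (z - a)"
      proof eventually_elim
        case (elim z)
        then have "- q z \<ge> - q x + e * (- z + x)" using grow[of "- z"] by simp
        then show ?case using bd(1)[of z] False x elim by auto
      qed
    qed simp
    then have "e * (- a + x) \<le> 0" by simp
    then show False using e x by (simp add: mult_le_0_iff)
  qed
qed

end

text \<open>The situation after a convergent subsequence has been extracted. The approximations are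
  positive without a uniform lower bound; the bound c concerns the limits at time 0.\<close>

locale relaxation_limit = bounded_interval a b for a b :: real +
  fixes R Cv \<mu> M c :: real and g \<kappa> :: "real \<Rightarrow> real" and \<tau> :: "nat \<Rightarrow> real"
    and D :: "nat \<Rightarrow> real \<Rightarrow> real" and v u \<theta> q S :: "nat \<Rightarrow> real \<Rightarrow> real \<Rightarrow> real"
    and vl ul \<theta>l ql Sl :: "real \<Rightarrow> real \<Rightarrow> real"
  assumes pos: "R > 0" "Cv > 0" "\<mu> > 0" "c > 0"
    and coeff: "smooth_coefficient g" "smooth_coefficient \<kappa>"
    and \<tau>: "\<And>n. \<tau> n > 0" "\<tau> \<longlonglongrightarrow> 0"
    and reg: "\<And>n. regular M (v n)" "\<And>n. regular M (u n)" "\<And>n. regular M (\<theta> n)"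
    and flx: "\<And>n. flux M (D n) (q n)" "\<And>n. flux M (D n) (S n)"
    and Dt_flx: "\<And>n t x. t \<ge> 0 \<Longrightarrow> x \<in> \<Omega> \<Longrightarrow> \<bar>sqrt (\<tau> n) * Dt (q n) t x\<bar> \<le> M"
      "\<And>n t x. t \<ge> 0 \<Longrightarrow> x \<in> \<Omega> \<Longrightarrow> \<bar>sqrt (\<tau> n) * Dt (S n) t x\<bar> \<le> M"
    and sol: "\<And>n t x. t \<ge> 0 \<Longrightarrow> x \<in> \<Omega> \<Longrightarrow> v n t x > 0"
      "\<And>n t x. t \<ge> 0 \<Longrightarrow> x \<in> \<Omega> \<Longrightarrow> \<theta> n t x > 0"
      "\<And>n t x. t \<ge> 0 \<Longrightarrow> x \<in> \<Omega> \<Longrightarrow> Dt (v n) t x = Dx (u n) t x"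
      "\<And>n t x. t \<ge> 0 \<Longrightarrow> x \<in> \<Omega> \<Longrightarrow>
        Dt (u n) t x + Dx (\<lambda>t x. pressure R (v n t x) (\<theta> n t x)) t x = Dx (S n) t x"
      "\<And>n t x. t \<ge> 0 \<Longrightarrow> x \<in> \<Omega> \<Longrightarrow>
        relaxed_fluid.e_\<theta> Cv g \<kappa> (\<tau> n) (\<theta> n t x) (q n t x) * Dt (\<theta> n) t x
          - 2 * relaxed_fluid.a g \<kappa> (\<tau> n) (\<theta> n t x) / relaxed_fluid.Z g \<kappa> (\<tau> n) (\<theta> n t x) * q n t x * Dx (\<theta> n) t x
          + R * \<theta> n t x * Dx (u n) t x / v n t x + Dx (q n) t x
        = 2 * relaxed_fluid.a g \<kappa> (\<tau> n) (\<theta> n t x) / (\<tau> n * g (\<theta> n t x)) * (q n t x)\<^sup>2 * v n t x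
          + (S n t x)\<^sup>2 * v n t x / \<mu>"
      "\<And>n t x. t \<ge> 0 \<Longrightarrow> x \<in> \<Omega> \<Longrightarrow>
        \<tau> n * g (\<theta> n t x) * Dt (q n) t x + v n t x * q n t x + \<kappa> (\<theta> n t x) * Dx (\<theta> n) t x = 0"
      "\<And>n t x. t \<ge> 0 \<Longrightarrow> x \<in> \<Omega> \<Longrightarrow> \<tau> n * Dt (S n) t x + v n t x * S n t x = \<mu> * Dx (u n) t x"
    and trace: "\<And>n t. t > 0 \<Longrightarrow> trace_zero \<Omega> (u n t)" "\<And>n t. t > 0 \<Longrightarrow> trace_zero \<Omega> (q n t)"
    and initial: "\<And>x. x \<in> \<Omega> \<Longrightarrow> vl 0 x \<ge> c" "\<And>x. x \<in> \<Omega> \<Longrightarrow> \<theta>l 0 x \<ge> c"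
    and lim: "\<And>t x. t \<ge> 0 \<Longrightarrow> x \<in> \<Omega> \<Longrightarrow> (\<lambda>n. v n t x) \<longlonglongrightarrow> vl t x"
      "\<And>t x. t \<ge> 0 \<Longrightarrow> x \<in> \<Omega> \<Longrightarrow> (\<lambda>n. u n t x) \<longlonglongrightarrow> ul t x"
      "\<And>t x. t \<ge> 0 \<Longrightarrow> x \<in> \<Omega> \<Longrightarrow> (\<lambda>n. \<theta> n t x) \<longlonglongrightarrow> \<theta>l t x"
      "\<And>t x. t \<ge> 0 \<Longrightarrow> x \<in> \<Omega> \<Longrightarrow> (\<lambda>n. q n t x) \<longlonglongrightarrow> ql t x"
      "\<And>t x. t \<ge> 0 \<Longrightarrow> x \<in> \<Omega> \<Longrightarrow> (\<lambda>n. S n t x) \<longlonglongrightarrow> Sl t x"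
begin

lemma regular_limits: "regular M vl" "regular M ul" "regular M \<theta>l"
  by (rule regular_limit(1)[OF reg(1) lim(1)] regular_limit(1)[OF reg(2) lim(2)]
      regular_limit(1)[OF reg(3) lim(3)]; assumption)+

lemma Dt_lim:
  assumes "t \<ge> 0" "x \<in> \<Omega>"
  shows "(\<lambda>n. Dt (v n) t x) \<longlonglongrightarrow> Dt vl t x" "(\<lambda>n. Dt (u n) t x) \<longlonglongrightarrow> Dt ul t x" "(\<lambda>n. Dt (\<theta> n) t x) \<longlonglongrightarrow> Dt \<theta>l t x"
proof -
  show "(\<lambda>n. Dt (v n) t x) \<longlonglongrightarrow> Dt vl t x"
    by (rule regular_limit(2)[of M v vl, OF reg(1) _ assms]) (rule lim(1))
  show "(\<lambda>n. Dt (u n) t x) \<longlonglongrightarrow> Dt ul t x"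
    by (rule regular_limit(2)[of M u ul, OF reg(2) _ assms]) (rule lim(2))
  show "(\<lambda>n. Dt (\<theta> n) t x) \<longlonglongrightarrow> Dt \<theta>l t x"
    by (rule regular_limit(2)[of M \<theta> \<theta>l, OF reg(3) _ assms]) (rule lim(3))
qed

lemma Dx_lim:
  assumes "t \<ge> 0" "x \<in> \<Omega>"
  shows "(\<lambda>n. Dx (v n) t x) \<longlonglongrightarrow> Dx vl t x" "(\<lambda>n. Dx (u n) t x) \<longlonglongrightarrow> Dx ul t x" "(\<lambda>n. Dx (\<theta> n) t x) \<longlonglongrightarrow> Dx \<theta>l t x"
proof -
  show "(\<lambda>n. Dx (v n) t x) \<longlonglongrightarrow> Dx vl t x"
    by (rule regular_limit(3)[of M v vl, OF reg(1) _ assms]) (rule lim(1))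
  show "(\<lambda>n. Dx (u n) t x) \<longlonglongrightarrow> Dx ul t x"
    by (rule regular_limit(3)[of M u ul, OF reg(2) _ assms]) (rule lim(2))
  show "(\<lambda>n. Dx (\<theta> n) t x) \<longlonglongrightarrow> Dx \<theta>l t x"
    by (rule regular_limit(3)[of M \<theta> \<theta>l, OF reg(3) _ assms]) (rule lim(3))
qed

lemma heat_flux_limit:
  shows "\<And>t x. t \<ge> 0 \<Longrightarrow> x \<in> \<Omega> \<Longrightarrow> \<bar>ql t x\<bar> \<le> M"
    and "continuous_on ({0..} \<times> \<Omega>) (\<lambda>(t, x). ql t x)"
  by (rule flux_limit(1,4)[OF flx(1) lim(4)]; assumption)+

lemma stress_limit:
  shows "\<And>t x. t \<ge> 0 \<Longrightarrow> x \<in> \<Omega> \<Longrightarrow> \<bar>Sl t x\<bar> \<le> M"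
    and "continuous_on ({0..} \<times> \<Omega>) (\<lambda>(t, x). Sl t x)"
  by (rule flux_limit(1,4)[OF flx(2) lim(5)]; assumption)+

lemma M_nonneg: "M \<ge> 0" by (rule regular_nonneg[OF reg(1)])

lemma C1_limits: "C1_cylinder \<Omega> vl" "C1_cylinder \<Omega> ul" "C1_cylinder \<Omega> \<theta>l"
  by (rule regularD(1)[OF regular_limits(1), of 0] regularD(1)[OF regular_limits(2), of 0] regularD(1)[OF regular_limits(3), of 0]; simp)+

lemma relaxation_term_vanishes:
  assumes z: "\<And>n. \<bar>sqrt (\<tau> n) * z n\<bar> \<le> M"
  shows "(\<lambda>n. \<tau> n * z n) \<longlonglongrightarrow> 0"
proof (rule Lim_null_comparison)
  show "(\<lambda>n. sqrt (\<tau> n) * M) \<longlonglongrightarrow> 0"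
    using tendsto_mult[OF tendsto_real_sqrt[OF \<tau>(2)] tendsto_const[of M]] by simp
  have "\<bar>\<tau> n * z n\<bar> \<le> sqrt (\<tau> n) * M" for n
  proof -
    have "\<tau> n = sqrt (\<tau> n) * sqrt (\<tau> n)" using \<tau>(1)[of n] by simp
    then have "\<tau> n * z n = sqrt (\<tau> n) * (sqrt (\<tau> n) * z n)" by (metis mult.assoc)
    then have "\<bar>\<tau> n * z n\<bar> = sqrt (\<tau> n) * \<bar>sqrt (\<tau> n) * z n\<bar>" using \<tau>(1)[of n] by (simp add: abs_mult)
    then show ?thesis using mult_left_mono[OF z[of n], of "sqrt (\<tau> n)"] \<tau>(1)[of n] by simp
  qed
  then show "\<forall>\<^sub>F n in sequentially. norm (\<tau> n * z n) \<le> sqrt (\<tau> n) * M" by simp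
qed

lemma volume_equation:
  assumes "t \<ge> 0" "x \<in> \<Omega>" shows "Dt vl t x = Dx ul t x"
  using LIMSEQ_unique[OF Dt_lim(1)[OF assms]] Dx_lim(2)[OF assms] sol(3)[OF assms] by simp

lemma stress_equation:
  assumes tx: "t \<ge> 0" "x \<in> \<Omega>" shows "vl t x * Sl t x = \<mu> * Dx ul t x"
proof -
  have "(\<lambda>n. \<tau> n * Dt (S n) t x + v n t x * S n t x) \<longlonglongrightarrow> 0 + vl t x * Sl t x"
    using Dt_flx(2)[OF tx] by (intro tendsto_intros relaxation_term_vanishes lim tx) auto
  moreover have "(\<lambda>n. \<tau> n * Dt (S n) t x + v n t x * S n t x) \<longlonglongrightarrow> \<mu> * Dx ul t x"
    unfolding sol(7)[OF tx] by (intro tendsto_intros Dx_lim tx)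
  ultimately have "0 + vl t x * Sl t x = \<mu> * Dx ul t x" by (rule LIMSEQ_unique)
  then show ?thesis by simp
qed

lemma vl_lower:
  assumes t: "t \<ge> 0" and x: "x \<in> \<Omega>"
  shows "vl t x \<ge> c * exp (- (M / \<mu>) * t)"
proof -
  let ?h = "\<lambda>s. vl s x * exp (M / \<mu> * s)"
  have nn: "vl s x \<ge> 0" if "s \<ge> 0" for s
    by (rule LIMSEQ_le_const[OF lim(1)[OF that x]]) (use sol(1)[OF that x] in \<open>auto intro: less_imp_le\<close>)
  \<comment> \<open>The exponential factor compensates the fastest possible decay, v_t = - M v /
    \<mu>, so the product does not decrease.\<close>
  have "?h 0 \<le> ?h t"
  proof (rule DERIV_nonneg_imp_increasing_open[OF t])
    fix s assume s: "0 < s" "s < t"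
    have d: "(?h has_real_derivative Dt vl s x * exp (M / \<mu> * s) + exp (M / \<mu> * s) * (M / \<mu>) * vl s x) (at s)"
      by (rule DERIV_mult[OF C1_cylinder_DERIV_time[OF C1_limits(1) s(1) x]]) (use pos(3) in \<open>auto intro!: derivative_eq_intros\<close>)
    have "Dt vl s x = vl s x * Sl s x / \<mu>"
      using volume_equation[of s x] stress_equation[of s x] s x pos(3) by simp
    moreover have "vl s x * Sl s x \<ge> vl s x * (- M)"
      using stress_limit(1)[of s x] nn[of s] s x by (intro mult_left_mono) auto
    ultimately have "Dt vl s x + (M / \<mu>) * vl s x \<ge> 0" using pos(3) by (simp add: field_simps)
    then have "exp (M / \<mu> * s) * (Dt vl s x + (M / \<mu>) * vl s x) \<ge> 0" by simp
    then show "\<exists>y. (?h has_real_derivative y) (at s) \<and> 0 \<le> y" using d by (auto simp: algebra_simps)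
  next
    have "continuous_on {0..t} (\<lambda>s. vl s x)"
      by (rule continuous_on_subset[OF C1_cylinderD(6)[OF C1_limits(1), of 0 x]]) (use x in auto)
    then show "continuous_on {0..t} ?h" by (intro continuous_intros)
  qed
  then have "c \<le> vl t x * exp (M / \<mu> * t)" using initial(1)[OF x] by simp
  then have "c * exp (- (M / \<mu> * t)) \<le> vl t x * exp (M / \<mu> * t) * exp (- (M / \<mu> * t))"
    by (rule mult_right_mono) simp
  also have "\<dots> = vl t x" by (simp add: mult.assoc flip: exp_add)
  finally show ?thesis by simp
qed

lemma vl_pos: "t \<ge> 0 \<Longrightarrow> x \<in> \<Omega> \<Longrightarrow> vl t x > 0"
  using vl_lower[of t x] pos(4) by (meson exp_gt_zero less_le_trans mult_pos_pos)

lemma coefficient_isCont: "x > 0 \<Longrightarrow> isCont g x" "x > 0 \<Longrightarrow> isCont \<kappa> x"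
  using coeff by (auto simp: smooth_coefficient_def elim!: allE[of _ "0::nat"]
      intro: differentiable_imp_continuous_within)

lemma coefficient_pos: "x > 0 \<Longrightarrow> g x > 0" "x > 0 \<Longrightarrow> \<kappa> x > 0"
  using coeff by (auto simp: smooth_coefficient_def)

text \<open>The coefficients are known to be continuous at positive temperatures only. Positivity at
  the one point enters as a hypothesis, since the proof of \<open>\<theta>l_pos\<close> itself
  relies on this law.\<close>

lemma Fourier_law:
  assumes tx: "t \<ge> 0" "x \<in> \<Omega>" and p: "\<theta>l t x > 0"
  shows "vl t x * ql t x + \<kappa> (\<theta>l t x) * Dx \<theta>l t x = 0"
proof -
  let ?f = "\<lambda>n. \<tau> n * Dt (q n) t x * g (\<theta> n t x) + v n t x * q n t x + \<kappa> (\<theta> n t x) * Dx (\<theta> n) t x"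
  have "?f \<longlonglongrightarrow> 0 * g (\<theta>l t x) + vl t x * ql t x + \<kappa> (\<theta>l t x) * Dx \<theta>l t x"
    using Dt_flx(1)[OF tx]
    by (intro tendsto_intros relaxation_term_vanishes lim tx Dx_lim
        isCont_tendsto_compose[OF coefficient_isCont(1)[OF p]] isCont_tendsto_compose[OF coefficient_isCont(2)[OF p]]) auto
  moreover have "?f = (\<lambda>n. 0)" using sol(6)[OF tx] by (auto simp: mult_ac)
  ultimately have "(\<lambda>n. 0) \<longlonglongrightarrow> 0 * g (\<theta>l t x) + vl t x * ql t x + \<kappa> (\<theta>l t x) * Dx \<theta>l t x"
    by (simp only:)
  from LIMSEQ_unique[OF this tendsto_const] show ?thesis by simp
qed

text \<open>By the momentum equation the space derivative of S - p is u_t, which has a modulus in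
  space independent of n. The derivative of the limit pressure is added back.\<close>

lemma Sl_derivative:
  assumes tx: "t \<ge> 0" "x \<in> \<Omega>"
  shows "(Sl t has_real_derivative Dt ul t x
    + R * (Dx \<theta>l t x * vl t x - \<theta>l t x * Dx vl t x) / (vl t x)\<^sup>2) (at x)"
proof -
  let ?p = "\<lambda>n t x. pressure R (v n t x) (\<theta> n t x)"
  have "((\<lambda>y. Sl t y - pressure R (vl t y) (\<theta>l t y)) has_real_derivative Dt ul t x) (at x)"
  proof (rule derivative_of_limit[where S = \<Omega> and f = "\<lambda>n y. S n t y - ?p n t y" and f' = "\<lambda>n y. Dt (u n) t y"])
    fix n y assume y: "y \<in> \<Omega>"
    have "(?p n t has_real_derivative Dx (?p n) t y) (at y)"
      using pressure_derivative[where R = R, OF C1_cylinderD(1)[OF regularD(1)[OF reg(1) tx(1)] tx(1) y]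
          C1_cylinderD(1)[OF regularD(1)[OF reg(3) tx(1)] tx(1) y] sol(1)[OF tx(1) y]]
      unfolding Dx_def by (metis DERIV_imp_deriv)
    from DERIV_diff[OF C1_cylinderD(1)[OF fluxD(1)[OF flx(2) tx(1)] tx(1) y] this]
    show "((\<lambda>y. S n t y - ?p n t y) has_real_derivative Dt (u n) t y) (at y)"
      using sol(4)[OF tx(1) y, of n] by (simp add: eq_diff_eq[symmetric])
  next
    fix y assume y: "y \<in> \<Omega>"
    show "(\<lambda>n. S n t y - ?p n t y) \<longlonglongrightarrow> Sl t y - pressure R (vl t y) (\<theta>l t y)"
      unfolding pressure_def using vl_pos[OF tx(1) y] by (intro tendsto_intros lim tx y) auto
  next
    show "((\<lambda>p. Dt (u (fst p)) t (snd p)) \<longlongrightarrow> Dt ul t x) (sequentially \<times>\<^sub>F nhds x)"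
      using regularD(9)[OF reg(2) tx(1)] tx by (intro pair_tendsto[where M = M] Dt_lim) auto
  qed (use tx in auto)
  from DERIV_add[OF this pressure_derivative[where R = R, OF C1_cylinderD(1)[OF C1_limits(1) tx] C1_cylinderD(1)[OF C1_limits(3) tx] vl_pos[OF tx]]]
  show ?thesis by simp
qed

lemma ql_derivative:
  assumes tx: "t \<ge> 0" "x \<in> \<Omega>" and p: "\<theta>l t x > 0"
  shows "(ql t has_real_derivative
    (Sl t x)\<^sup>2 * vl t x / \<mu> - Cv * Dt \<theta>l t x - R * \<theta>l t x * Dx ul t x / vl t x) (at x)"
proof -
  obtain A A' where A: "\<And>\<tau> x. x > 0 \<Longrightarrow> relaxed_fluid.a g \<kappa> \<tau> x = \<tau> * A x"
    "\<And>\<tau> x. x > 0 \<Longrightarrow> deriv (relaxed_fluid.a g \<kappa> \<tau>) x = \<tau> * A' x"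
    "\<And>x. x > 0 \<Longrightarrow> isCont A x" "\<And>x. x > 0 \<Longrightarrow> isCont A' x"
    by (rule coefficient_a[OF coeff]) blast
  let ?F = "sequentially \<times>\<^sub>F nhds x"
  \<comment> \<open>The energy equation solved for q_x, with the common factor \<tau> cancelled in 2
    a / Z and in 2 a / (\<tau> g). Every quantity in it converges jointly in n and y.\<close>
  let ?E = "\<lambda>n y. 2 * A (\<theta> n t y) / g (\<theta> n t y) * (q n t y)\<^sup>2 * v n t y + (S n t y)\<^sup>2 * v n t y / \<mu>
     - (Cv + \<tau> n * A' (\<theta> n t y) * (q n t y)\<^sup>2) * Dt (\<theta> n) t y
     + 2 * A (\<theta> n t y) * \<kappa> (\<theta> n t y) / g (\<theta> n t y) * q n t y * Dx (\<theta> n) t y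
     - R * \<theta> n t y * Dx (u n) t y / v n t y"
  have E: "Dx (q n) t y = ?E n y" if y: "y \<in> \<Omega>" for n y
  proof -
    have th: "\<theta> n t y > 0" using sol(2)[OF tx(1) y] .
    have z: "\<tau> n \<noteq> 0" "g (\<theta> n t y) \<noteq> 0" "\<kappa> (\<theta> n t y) \<noteq> 0"
      using \<tau>(1)[of n] coefficient_pos[OF th] by auto
    have "2 * (\<tau> n * A (\<theta> n t y)) / (\<tau> n * g (\<theta> n t y) / \<kappa> (\<theta> n t y))
        = 2 * A (\<theta> n t y) * \<kappa> (\<theta> n t y) / g (\<theta> n t y)"
      and "2 * (\<tau> n * A (\<theta> n t y)) / (\<tau> n * g (\<theta> n t y)) = 2 * A (\<theta> n t y) / g (\<theta> n t y)"
      using z by (simp_all add: field_simps)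
    then show ?thesis
      using sol(5)[OF tx(1) y, of n] A(1,2)[OF th]
      unfolding relaxed_fluid.e_\<theta>_def relaxed_fluid.Z_def by simp
  qed
  have P: "((\<lambda>p. \<theta> (fst p) t (snd p)) \<longlongrightarrow> \<theta>l t x) ?F" "((\<lambda>p. v (fst p) t (snd p)) \<longlongrightarrow> vl t x) ?F"
    "((\<lambda>p. q (fst p) t (snd p)) \<longlongrightarrow> ql t x) ?F" "((\<lambda>p. S (fst p) t (snd p)) \<longlongrightarrow> Sl t x) ?F"
    "((\<lambda>p. Dt (\<theta> (fst p)) t (snd p)) \<longlongrightarrow> Dt \<theta>l t x) ?F" "((\<lambda>p. Dx (\<theta> (fst p)) t (snd p)) \<longlongrightarrow> Dx \<theta>l t x) ?F"
    "((\<lambda>p. Dx (u (fst p)) t (snd p)) \<longlongrightarrow> Dx ul t x) ?F"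
    using regularD(7)[OF reg(3) tx(1)] regularD(7)[OF reg(1) tx(1)] fluxD(4)[OF flx(1) tx(1)]
      fluxD(4)[OF flx(2) tx(1)] regularD(9)[OF reg(3) tx(1)] regularD(8)[OF reg(3) tx(1)]
      regularD(8)[OF reg(2) tx(1)] tx
    by (auto intro!: pair_tendsto[where M = M] lim Dt_lim Dx_lim)
  have T: "((\<lambda>p. \<tau> (fst p)) \<longlongrightarrow> 0) ?F" by (rule filterlim_compose[OF \<tau>(2) filterlim_fst])
  have lim_E: "((\<lambda>p. ?E (fst p) (snd p)) \<longlongrightarrow>
     2 * A (\<theta>l t x) / g (\<theta>l t x) * (ql t x)\<^sup>2 * vl t x + (Sl t x)\<^sup>2 * vl t x / \<mu>
     - (Cv + 0 * A' (\<theta>l t x) * (ql t x)\<^sup>2) * Dt \<theta>l t x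
     + 2 * A (\<theta>l t x) * \<kappa> (\<theta>l t x) / g (\<theta>l t x) * ql t x * Dx \<theta>l t x
     - R * \<theta>l t x * Dx ul t x / vl t x) ?F" (is "(_ \<longlongrightarrow> ?N) _")
    using coefficient_pos(1)[OF p] vl_pos[OF tx] pos(3)
    by (intro tendsto_intros P T isCont_tendsto_compose[OF coefficient_isCont(1)[OF p]]
        isCont_tendsto_compose[OF coefficient_isCont(2)[OF p]]
        isCont_tendsto_compose[OF A(3)[OF p]] isCont_tendsto_compose[OF A(4)[OF p]]) auto
  have "(snd \<longlongrightarrow> x) ?F" using filterlim_snd[of "nhds x" sequentially] .
  then have "\<forall>\<^sub>F p in ?F. snd p \<in> \<Omega>" using tx by (intro topological_tendstoD) auto
  then have "\<forall>\<^sub>F p in ?F. ?E (fst p) (snd p) = Dx (q (fst p)) t (snd p)"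
    by eventually_elim (simp only: E)
  from Lim_transform_eventually[OF lim_E this]
  have L: "((\<lambda>p. Dx (q (fst p)) t (snd p)) \<longlongrightarrow> ?N) ?F" .
  have "(ql t has_real_derivative ?N) (at x)"
    by (rule derivative_of_limit[where S = \<Omega> and f = "\<lambda>n. q n t" and f' = "\<lambda>n. Dx (q n) t", OF _ _ _ _ L])
       (use tx in \<open>auto intro: lim C1_cylinderD(1)[OF fluxD(1)[OF flx(1) tx(1)] tx(1)]\<close>)
  moreover have "?N = (Sl t x)\<^sup>2 * vl t x / \<mu> - Cv * Dt \<theta>l t x - R * \<theta>l t x * Dx ul t x / vl t x"
  proof -
    have k: "\<kappa> (\<theta>l t x) * Dx \<theta>l t x = - vl t x * ql t x" using Fourier_law[OF tx p] by simp
    have "2 * A (\<theta>l t x) * \<kappa> (\<theta>l t x) / g (\<theta>l t x) * ql t x * Dx \<theta>l t x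
       = 2 * A (\<theta>l t x) / g (\<theta>l t x) * ql t x * (\<kappa> (\<theta>l t x) * Dx \<theta>l t x)" by simp
    also have "\<dots> = - (2 * A (\<theta>l t x) / g (\<theta>l t x) * (ql t x)\<^sup>2 * vl t x)"
      unfolding k by (simp add: power2_eq_square)
    finally show ?thesis by simp
  qed
  ultimately show ?thesis by (simp only:)
qed

lemma boundary_decay:
  assumes t: "t > 0" and x: "x \<in> \<Omega>"
  shows "\<bar>ul t x\<bar> \<le> M * sqrt (x - a)" "\<bar>ul t x\<bar> \<le> M * sqrt (b - x)"
    "\<bar>ql t x\<bar> \<le> M * sqrt (x - a)" "\<bar>ql t x\<bar> \<le> M * sqrt (b - x)"
proof -
  have t0: "t \<ge> 0" using t by simp
  have u: "\<bar>u n t x\<bar> \<le> M * sqrt (x - a)" "\<bar>u n t x\<bar> \<le> M * sqrt (b - x)" for n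
    by (rule trace_zero_bound[OF trace(1)[OF t] C1_cylinderD(3)[OF regularD(1)[OF reg(2) t0] t0]
          regularD(7)[OF reg(2) t0] x]; assumption)+
  have q: "\<bar>q n t x\<bar> \<le> M * sqrt (x - a)" "\<bar>q n t x\<bar> \<le> M * sqrt (b - x)" for n
    by (rule trace_zero_bound[OF trace(2)[OF t] C1_cylinderD(3)[OF fluxD(1)[OF flx(1) t0] t0]
          fluxD(4)[OF flx(1) t0] x]; assumption)+
  show "\<bar>ul t x\<bar> \<le> M * sqrt (x - a)" "\<bar>ul t x\<bar> \<le> M * sqrt (b - x)"
    using u by (auto intro!: LIMSEQ_le_const2[OF tendsto_rabs[OF lim(2)[OF t0 x]]])
  show "\<bar>ql t x\<bar> \<le> M * sqrt (x - a)" "\<bar>ql t x\<bar> \<le> M * sqrt (b - x)"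
    using q by (auto intro!: LIMSEQ_le_const2[OF tendsto_rabs[OF lim(4)[OF t0 x]]])
qed


section \<open>Positivity of the limit temperature\<close>

text \<open>Where q_x is at most 0, the energy equation gives Cv \<theta>_t \<ge> - R \<theta> u_x /
  v. With |u_x| at most M and the lower bound for v up to time T, the right side is at least - Cv
  \<theta> times this rate.\<close>

definition decay_rate :: "real \<Rightarrow> real" where
  "decay_rate T = R * M / (Cv * (c * exp (- (M / \<mu>) * T)))"

lemma decay_rate_nonneg: "decay_rate T \<ge> 0"
  using pos M_nonneg by (simp add: decay_rate_def)

text \<open>The infimum of \<open>\<theta>l t\<close> over the open interval need not be attained; the points provided by
  \<open>flux_minimum\<close> replace a minimum point, at the price of discretising time.\<close>

lemma minimum_step:
  assumes h: "0 < h" "h \<le> t" "t \<le> T" and x: "x \<in> \<Omega>"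
    and p: "\<And>y. y \<in> \<Omega> \<Longrightarrow> \<theta>l t y > 0" and m: "\<And>y. y \<in> \<Omega> \<Longrightarrow> \<theta>l (t - h) y \<ge> m"
  shows "\<theta>l t x \<ge> (m - h * (M * sqrt (sqrt h))) / (1 + decay_rate T * h)"
proof (rule ccontr)
  let ?\<omega> = "M * sqrt (sqrt h)" and ?K = "decay_rate T"
  let ?w = "c * exp (- (M / \<mu>) * T)"
  have t: "t \<ge> 0" "t > 0" using h by auto
  assume "\<not> ?thesis"
  \<comment> \<open>The strict gap between m' and the claimed bound pays for the error e allowed in
    q_x.\<close>
  then obtain m' where m': "\<theta>l t x < m'" "m' < (m - h * ?\<omega>) / (1 + ?K * h)"
    using dense[of "\<theta>l t x"] by (metis not_le)
  have den: "1 + ?K * h > 0" using decay_rate_nonneg[of T] h by (simp add: add_pos_nonneg)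
  \<comment> \<open>This gap, multiplied by 1 + K h and scaled so that h e / Cv equals it.\<close>
  define e where "e = (m - h * ?\<omega> - m' * (1 + ?K * h)) * Cv / h"
  have "m' * (1 + ?K * h) < m - h * ?\<omega>" using m'(2) den by (simp add: pos_less_divide_eq)
  then have e: "e > 0" using h pos by (simp add: e_def)
  let ?q' = "\<lambda>x. (Sl t x)\<^sup>2 * vl t x / \<mu> - Cv * Dt \<theta>l t x - R * \<theta>l t x * Dx ul t x / vl t x"
  have F: "\<kappa> (\<theta>l t y) * Dx \<theta>l t y = - (vl t y * ql t y)" if "y \<in> \<Omega>" for y
    using Fourier_law[OF t(1) that p[OF that]] by simp
  have "\<exists>y\<in>\<Omega>. \<theta>l t y < m' \<and> ?q' y \<le> e"
  proof (rule flux_minimum[of "\<theta>l t" "Dx \<theta>l t" "ql t" ?q' M x m' e])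
    fix y assume y: "y \<in> \<Omega>"
    have k: "\<kappa> (\<theta>l t y) > 0" "vl t y > 0" using coefficient_pos(2)[OF p[OF y]] vl_pos[OF t(1) y] .
    show "Dx \<theta>l t y \<le> 0" if "ql t y \<ge> 0"
    proof -
      have "vl t y * ql t y \<ge> 0" using k that by simp
      then have "\<kappa> (\<theta>l t y) * Dx \<theta>l t y \<le> 0" using F[OF y] by linarith
      then show ?thesis using k by (simp add: mult_le_0_iff)
    qed
    show "Dx \<theta>l t y \<ge> 0" if "ql t y \<le> 0"
    proof -
      have "vl t y * ql t y \<le> 0" using k that by (simp add: mult_le_0_iff)
      then have "\<kappa> (\<theta>l t y) * Dx \<theta>l t y \<ge> 0" using F[OF y] by linarith
      then show ?thesis using k by (simp add: zero_le_mult_iff)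
    qed
    show "(\<theta>l t has_real_derivative Dx \<theta>l t y) (at y)" by (rule C1_cylinderD(1)[OF C1_limits(3) t(1) y])
    show "(ql t has_real_derivative ?q' y) (at y)" by (rule ql_derivative[OF t(1) y p[OF y]])
    show "\<bar>ql t y\<bar> \<le> M * sqrt (y - a)" "\<bar>ql t y\<bar> \<le> M * sqrt (b - y)"
      using boundary_decay(3,4)[OF t(2) y] by blast+
  qed (fact x m'(1) e)+
  then obtain y where y: "y \<in> \<Omega>" "\<theta>l t y < m'" "?q' y \<le> e" by blast
  have th: "\<theta>l t y > 0" using p[OF y(1)] .
  have v: "vl t y > 0" using vl_pos[OF t(1) y(1)] .
  have w0: "?w > 0" using pos by simp
  have "exp (- (M / \<mu>) * T) \<le> exp (- (M / \<mu>) * t)"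
    using M_nonneg pos(3) h(3) by (simp add: mult_left_mono divide_right_mono)
  then have "?w \<le> c * exp (- (M / \<mu>) * t)" using pos(4) by simp
  then have wv: "?w \<le> vl t y" using vl_lower[OF t(1) y(1)] by linarith
  have K: "R * m' * M / ?w = Cv * (?K * m')" using pos by (simp add: decay_rate_def)
  have "R * \<theta>l t y * Dx ul t y \<le> R * \<theta>l t y * M"
    using regularD(6)[OF regular_limits(2) t(1) y(1)] pos th by (intro mult_left_mono) auto
  also have "\<dots> \<le> R * m' * M" using y(2) pos M_nonneg by (intro mult_right_mono mult_left_mono) auto
  finally have "R * \<theta>l t y * Dx ul t y / vl t y \<le> R * m' * M / vl t y" using v by (simp add: divide_right_mono)
  also have "\<dots> \<le> R * m' * M / ?w" by (rule divide_left_mono[OF wv _ mult_pos_pos[OF v w0]]) (use y(2) th pos M_nonneg in auto)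
  finally have 1: "R * \<theta>l t y * Dx ul t y / vl t y \<le> Cv * (?K * m')" using K by simp
  \<comment> \<open>Viscous heating only raises the temperature and is dropped.\<close>
  have "(Sl t y)\<^sup>2 * vl t y / \<mu> \<ge> 0" using v pos(3) by simp
  then have "Cv * Dt \<theta>l t y \<ge> - e - Cv * (?K * m')" using 1 y(3) by linarith
  then have "Cv * (Dt \<theta>l t y + ?K * m') \<ge> - e" by (simp add: distrib_left)
  then have D: "Dt \<theta>l t y \<ge> - (e / Cv) - ?K * m'" using pos(2) by (simp add: field_simps)
  \<comment> \<open>The mean value theorem on the time step yields \<theta>_t at an intermediate s;
    the time modulus of \<theta>_t compares it with the value at t at the cost
    \<open>?\<omega>\<close>.\<close>
  have "t - h < t" using h by simp
  moreover have "continuous_on {t - h..t} (\<lambda>r. \<theta>l r y)"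
    by (rule continuous_on_subset[OF C1_cylinderD(6)[OF C1_limits(3) t(1) y(1)]]) (use h in auto)
  moreover have "(\<lambda>r. \<theta>l r y) differentiable (at s)" if "t - h < s" "s < t" for s
    using C1_cylinder_DERIV_time[OF C1_limits(3) _ y(1), of s] that h real_differentiable_def by force
  ultimately obtain l s where s: "t - h < s" "s < t" "((\<lambda>r. \<theta>l r y) has_real_derivative l) (at s)"
    "\<theta>l t y - \<theta>l (t - h) y = (t - (t - h)) * l"
    using MVT[of "t - h" t "\<lambda>r. \<theta>l r y"] by metis
  have "l = Dt \<theta>l s y"
    using DERIV_unique[OF s(3) C1_cylinder_DERIV_time[OF C1_limits(3) _ y(1)]] s h by simp
  moreover have "\<bar>Dt \<theta>l t y - Dt \<theta>l s y\<bar> \<le> ?\<omega>"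
  proof -
    have "\<bar>Dt \<theta>l t y - Dt \<theta>l s y\<bar> \<le> M * sqrt (sqrt \<bar>t - s\<bar>)"
      by (rule regularD(10)[OF regular_limits(3) t(1) y(1)]) (use s h in simp)
    also have "\<dots> \<le> ?\<omega>" using s M_nonneg by (intro mult_left_mono real_sqrt_le_mono) auto
    finally show ?thesis .
  qed
  ultimately have l: "l \<ge> - (e / Cv) - ?K * m' - ?\<omega>" using D by linarith
  have eh: "h * (e / Cv) = m - h * ?\<omega> - m' * (1 + ?K * h)" using h pos(2) by (simp add: e_def)
  have "h * l \<ge> h * (- (e / Cv) - ?K * m' - ?\<omega>)" using l h by (intro mult_left_mono) auto
  moreover have "h * (- (e / Cv) - ?K * m' - ?\<omega>) = - (h * (e / Cv)) - h * (?K * m') - h * ?\<omega>"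
    by (simp add: right_diff_distrib)
  moreover have "m' * (1 + ?K * h) = m' + h * (?K * m')" by (simp add: distrib_left mult_ac)
  ultimately have "h * l \<ge> m' - m" using eh by linarith
  moreover have "\<theta>l t y = \<theta>l (t - h) y + h * l" using s(4) by simp
  ultimately show False using m[OF y(1)] y(2) by linarith
qed

text \<open>N implicit Euler steps of length h = t / N: each divides the lower bound by 1 + K h, and
  N of them cost at most the factor exp (- K t). The accumulated error is t M times the fourth root
  of t / N, which vanishes as N grows.\<close>

lemma minimum_principle:
  assumes t: "0 < t" "t \<le> T" and x: "x \<in> \<Omega>"
    and p: "\<And>s y. 0 < s \<Longrightarrow> s \<le> t \<Longrightarrow> y \<in> \<Omega> \<Longrightarrow> \<theta>l s y > 0"
  shows "\<theta>l t x \<ge> c * exp (- decay_rate T * t)"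
proof -
  let ?K = "decay_rate T"
  have "c * exp (- ?K * t) - t * (M * sqrt (sqrt (t / real N))) \<le> \<theta>l t x" if N: "N > 0" for N :: nat
  proof -
    define h where "h = t / real N"
    define r where "r = 1 + ?K * h"
    define w where "w = h * (M * sqrt (sqrt h))"
    have h: "h > 0" using t N by (simp add: h_def)
    have r: "r \<ge> 1" using h decay_rate_nonneg[of T] by (simp add: r_def)
    have w: "w \<ge> 0" using h M_nonneg by (simp add: w_def)
    have "\<forall>y\<in>\<Omega>. \<theta>l (real k * h) y \<ge> c / r ^ k - real k * w" if "k \<le> N" for k
      using that
    proof (induction k)
      case 0
      then show ?case using initial(2) by simp
    next
      case (Suc k)
      have kh: "real (Suc k) * h \<le> t"
      proof -
        have "real (Suc k) * h \<le> real N * h" using Suc.prems h by (intro mult_right_mono) auto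
        also have "\<dots> = t" using N by (simp add: h_def)
        finally show ?thesis .
      qed
      have sub: "real (Suc k) * h - h = real k * h" by (simp add: algebra_simps)
      show ?case
      proof
        fix y assume y: "y \<in> \<Omega>"
        have "\<theta>l (real (Suc k) * h) y \<ge> ((c / r ^ k - real k * w) - h * (M * sqrt (sqrt h))) / (1 + ?K * h)"
        proof (rule minimum_step[OF h _ _ y])
          show "h \<le> real (Suc k) * h" using h by simp
          show "real (Suc k) * h \<le> T" using kh t by simp
          show "0 < \<theta>l (real (Suc k) * h) z" if "z \<in> \<Omega>" for z
            using p[OF _ kh that] h by simp
          show "c / r ^ k - real k * w \<le> \<theta>l (real (Suc k) * h - h) z" if "z \<in> \<Omega>" for z
            unfolding sub using Suc that by simp
        qed
        moreover have "((c / r ^ k - real k * w) - h * (M * sqrt (sqrt h))) / (1 + ?K * h)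
            = c / r ^ Suc k - (real (Suc k) * w) / r"
          using r unfolding w_def[symmetric] r_def[symmetric] by (simp add: field_simps)
        moreover have "(real (Suc k) * w) / r \<le> real (Suc k) * w"
        proof -
          have "(real (Suc k) * w) * 1 \<le> (real (Suc k) * w) * r" using r w by (intro mult_left_mono) auto
          then show ?thesis using r by (simp add: pos_divide_le_eq)
        qed
        ultimately show "\<theta>l (real (Suc k) * h) y \<ge> c / r ^ Suc k - real (Suc k) * w" by linarith
      qed
    qed
    from this[of N] have 1: "\<theta>l t x \<ge> c / r ^ N - real N * w" using N x by (simp add: h_def)
    have Nw: "real N * w = t * (M * sqrt (sqrt (t / real N)))" using N by (simp add: w_def h_def)
    have "r \<le> exp (?K * h)" unfolding r_def by (rule exp_ge_add_one_self)
    then have "r ^ N \<le> exp (?K * h) ^ N" using r by (intro power_mono) auto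
    also have "\<dots> = exp (?K * t)" using N by (simp add: h_def flip: exp_of_nat_mult)
    finally have "c * exp (- (?K * t)) \<le> c / r ^ N"
      using r pos(4) by (simp add: exp_minus divide_inverse le_imp_inverse_le)
    then show ?thesis using 1 Nw by simp
  qed
  then have ev: "\<forall>\<^sub>F N in sequentially. c * exp (- ?K * t) - t * (M * sqrt (sqrt (t / real N))) \<le> \<theta>l t x"
    by (intro eventually_sequentiallyI[of 1]) auto
  have "(\<lambda>N. c * exp (- ?K * t) - t * (M * sqrt (sqrt (t / real N)))) \<longlonglongrightarrow> c * exp (- ?K * t) - t * (M * sqrt (sqrt 0))"
    by (intro tendsto_intros lim_const_over_n)
  then have "(\<lambda>N. c * exp (- ?K * t) - t * (M * sqrt (sqrt (t / real N)))) \<longlonglongrightarrow> c * exp (- ?K * t)" by simp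
  from tendsto_upperbound[OF this ev] show ?thesis by simp
qed

text \<open>At the first failure time T the infimum over \<Omega> might vanish without being
  attained. The minimum principle before T is uniform in x, and the Lipschitz bound in time carries
  the lower bound beyond T.\<close>

lemma \<theta>l_pos:
  assumes "t \<ge> 0" "x \<in> \<Omega>" shows "\<theta>l t x > 0"
proof (rule ccontr)
  assume not: "\<not> \<theta>l t x > 0"
  define X where "X = {t. t \<ge> 0 \<and> (\<exists>x\<in>\<Omega>. \<theta>l t x \<le> 0)}"
  define T where "T = Inf X"
  have "t \<in> X" using not assms unfolding X_def by force
  then have X: "X \<noteq> {}" "bdd_below X" by (auto simp: X_def intro: bdd_belowI[of _ 0])
  have T0: "T \<ge> 0" unfolding T_def by (rule cInf_greatest[OF X(1)]) (auto simp: X_def)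
  have P: "\<theta>l s y > 0" if "0 \<le> s" "s < T" "y \<in> \<Omega>" for s y
  proof (rule ccontr)
    assume "\<not> \<theta>l s y > 0"
    then have "s \<in> X" using that unfolding X_def by force
    then have "T \<le> s" unfolding T_def by (rule cInf_lower[OF _ X(2)])
    then show False using that by simp
  qed
  define \<delta> where "\<delta> = c * exp (- decay_rate T * T)"
  have \<delta>: "\<delta> > 0" "\<delta> \<le> c" using pos(4) decay_rate_nonneg[of T] T0 by (simp_all add: \<delta>_def)
  have low: "\<theta>l s y \<ge> \<delta>" if s: "s = 0 \<or> 0 < s \<and> s < T" and y: "y \<in> \<Omega>" for s y
  proof (cases "s = 0")
    case True then show ?thesis using initial(2)[OF y] \<delta> by simp
  next
    case False
    then have "\<theta>l s y \<ge> c * exp (- decay_rate T * s)"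
      using s P y by (intro minimum_principle) auto
    moreover have "\<delta> \<le> c * exp (- decay_rate T * s)"
      using s False pos(4) decay_rate_nonneg[of T] by (simp add: \<delta>_def mult_left_mono)
    ultimately show ?thesis by simp
  qed
  \<comment> \<open>Over a time 2 \<eta> the temperature changes by less than \<delta>; M + 1 covers
    M = 0.\<close>
  define \<eta> where "\<eta> = \<delta> / (2 * (M + 1))"
  have \<eta>: "\<eta> > 0" using \<delta> M_nonneg by (simp add: \<eta>_def)
  have "2 * \<eta> * M < \<delta>" using \<delta> M_nonneg by (simp add: \<eta>_def field_simps)
  obtain r where r: "r \<in> X" "r < T + \<eta>" using cInf_lessD[OF X(1), of "T + \<eta>"] \<eta> by (auto simp: T_def)
  have rT: "r \<ge> T" unfolding T_def by (rule cInf_lower[OF r(1) X(2)])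
  obtain y where y: "y \<in> \<Omega>" "\<theta>l r y \<le> 0" using r by (auto simp: X_def)
  \<comment> \<open>A time shortly before T, or 0 if T is too small for that; \<open>low\<close>
    holds in both cases.\<close>
  define s where "s = max 0 (T - \<eta>)"
  have "s = 0 \<or> 0 < s \<and> s < T" using \<eta> by (auto simp: s_def max_def)
  then have "\<theta>l s y \<ge> \<delta>" using y(1) by (rule low)
  moreover have "\<bar>\<theta>l r y - \<theta>l s y\<bar> \<le> M * \<bar>r - s\<bar>"
    using regular_time_Lipschitz[OF regular_limits(3) _ _ y(1), of r s] r T0 rT by (auto simp: s_def)
  moreover have "\<bar>r - s\<bar> \<le> 2 * \<eta>" using r rT T0 \<eta> by (auto simp: s_def max_def)
  then have "M * \<bar>r - s\<bar> \<le> M * (2 * \<eta>)" using M_nonneg by (rule mult_left_mono)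
  ultimately show False using y(2) \<open>2 * \<eta> * M < \<delta>\<close> by (simp add: mult.commute)
qed

lemma trace_zero_limits: "t > 0 \<Longrightarrow> trace_zero \<Omega> (ul t)" "t > 0 \<Longrightarrow> trace_zero \<Omega> (ql t)"
proof -
  assume t: "t > 0"
  show "trace_zero \<Omega> (ul t)"
    by (rule trace_zeroI[OF C1_cylinderD(3)[OF C1_limits(2)]]) (use t boundary_decay(1,2)[OF t] in auto)
  have "continuous_on \<Omega> (ql t)"
    using ql_derivative[OF _ _ \<theta>l_pos] t
    by (intro continuous_at_imp_continuous_on ballI DERIV_isCont) (use less_imp_le in blast)
  then show "trace_zero \<Omega> (ql t)"
    by (rule trace_zeroI) (use boundary_decay(3,4)[OF t] in auto)
qed

section \<open>Second space derivatives and the limit equations\<close>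

lemma constitutive_laws:
  assumes tx: "t \<ge> 0" "x \<in> \<Omega>"
  shows "ql t x = - (\<kappa> (\<theta>l t x) * Dx \<theta>l t x / vl t x)" "Sl t x = \<mu> * (Dx ul t x / vl t x)"
  using Fourier_law[OF tx \<theta>l_pos[OF tx]] stress_equation[OF tx] vl_pos[OF tx]
  by (simp_all add: field_simps)

text \<open>u_x equals v S / \<mu>, and both factors are differentiable. This gives a classical
  second derivative, where the bound in \<open>H\<^sup>2\<close> gives only a square integrable
  one.\<close>

lemma Dx_Dx_ul:
  assumes tx: "t \<ge> 0" "x \<in> \<Omega>"
  shows "(Dx ul t has_real_derivative (Dx vl t x * Sl t x + (Dt ul t x
    + R * (Dx \<theta>l t x * vl t x - \<theta>l t x * Dx vl t x) / (vl t x)\<^sup>2) * vl t x) / \<mu>) (at x)"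
proof -
  have "((\<lambda>y. vl t y * Sl t y / \<mu>) has_real_derivative (Dx vl t x * Sl t x + (Dt ul t x
    + R * (Dx \<theta>l t x * vl t x - \<theta>l t x * Dx vl t x) / (vl t x)\<^sup>2) * vl t x) / \<mu>) (at x)"
    by (rule DERIV_cdivide[OF DERIV_mult[OF C1_cylinderD(1)[OF C1_limits(1) tx] Sl_derivative[OF tx]]])
  then show ?thesis
    by (rule has_field_derivative_transform_within_open[where S = \<Omega>])
       (use tx stress_equation pos(3) in auto)
qed

lemmas continuous_limits = continuous_on_C1_cylinder[OF C1_limits(1)] continuous_on_C1_cylinder[OF C1_limits(2)]
  continuous_on_C1_cylinder[OF C1_limits(3)] heat_flux_limit(2)[unfolded case_prod_unfold] stress_limit(2)[unfolded case_prod_unfold]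

lemma continuous_coefficient:
  assumes "\<And>x. x > 0 \<Longrightarrow> isCont k x"
  shows "continuous_on ({0..} \<times> \<Omega>) (\<lambda>p. k (\<theta>l (fst p) (snd p)))"
proof (rule continuous_on_compose2[OF _ continuous_limits(7)])
  show "continuous_on {0<..} k" using assms by (intro continuous_at_imp_continuous_on) auto
qed (use \<theta>l_pos in auto)

lemma coefficients_nonzero:
  assumes "p \<in> {0..} \<times> \<Omega>"
  shows "vl (fst p) (snd p) \<noteq> 0" "\<kappa> (\<theta>l (fst p) (snd p)) \<noteq> 0"
  using vl_pos[of "fst p" "snd p"] coefficient_pos(2)[OF \<theta>l_pos[of "fst p" "snd p"]] assms
  by (auto simp: mem_Times_iff)

text \<open>By Fourier's law \<theta>_x equals - v q / \<kappa>(\<theta>), and q_x is an expression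
  that is continuous in time and space.\<close>

lemma Dx_Dx_\<theta>l:
  obtains F where "\<And>t x. t \<ge> 0 \<Longrightarrow> x \<in> \<Omega> \<Longrightarrow> (Dx \<theta>l t has_real_derivative F t x) (at x)"
    "continuous_on ({0..} \<times> \<Omega>) (\<lambda>p. F (fst p) (snd p))"
proof -
  obtain \<kappa>' where \<kappa>': "\<And>x. x > 0 \<Longrightarrow> ((deriv ^^ 0) \<kappa> has_real_derivative \<kappa>' x) (at x)" "\<And>x. x > 0 \<Longrightarrow> isCont \<kappa>' x"
    by (rule C1_posE[OF smooth_coefficient_C1[OF coeff(2), of 0]]) blast
  have d\<kappa>: "(\<kappa> has_real_derivative \<kappa>' x) (at x)" if "x > 0" for x using \<kappa>'(1)[OF that] by simp
  define G where "G t x = (Sl t x)\<^sup>2 * vl t x / \<mu> - Cv * Dt \<theta>l t x - R * \<theta>l t x * Dx ul t x / vl t x" for t x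
  define F where "F t x = (- (Dx vl t x * ql t x + G t x * vl t x) * \<kappa> (\<theta>l t x)
    - - (vl t x * ql t x) * (\<kappa>' (\<theta>l t x) * Dx \<theta>l t x)) / (\<kappa> (\<theta>l t x) * \<kappa> (\<theta>l t x))" for t x
  show thesis
  proof (rule that)
    fix t x :: real assume tx: "t \<ge> 0" "x \<in> \<Omega>"
    have k: "\<kappa> (\<theta>l t y) \<noteq> 0" if "y \<in> \<Omega>" for y
      using coefficient_pos(2)[OF \<theta>l_pos[OF tx(1) that]] by simp
    have "((\<lambda>y. (- (vl t y * ql t y)) / \<kappa> (\<theta>l t y)) has_real_derivative F t x) (at x)"
      unfolding F_def G_def
      by (rule DERIV_divide[OF DERIV_minus[OF DERIV_mult[OF C1_cylinderD(1)[OF C1_limits(1) tx]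
          ql_derivative[OF tx \<theta>l_pos[OF tx]]]]
          DERIV_chain2[OF d\<kappa>[OF \<theta>l_pos[OF tx]] C1_cylinderD(1)[OF C1_limits(3) tx]] k[OF tx(2)]])
    then show "(Dx \<theta>l t has_real_derivative F t x) (at x)"
    proof (rule has_field_derivative_transform_within_open[where S = \<Omega>])
      show "- (vl t y * ql t y) / \<kappa> (\<theta>l t y) = Dx \<theta>l t y" if y: "y \<in> \<Omega>" for y
        using Fourier_law[OF tx(1) y \<theta>l_pos[OF tx(1) y]] k[OF y] by (simp add: field_simps)
    qed (use tx in auto)
  next
    show "continuous_on ({0..} \<times> \<Omega>) (\<lambda>p. F (fst p) (snd p))"
      unfolding F_def G_def using coefficients_nonzero pos(3)
      by (intro continuous_intros continuous_limits continuous_coefficient \<kappa>'(2) coefficient_isCont(2)) auto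
  qed
qed

theorem limit_classical: "navier_stokes_classical \<Omega> R Cv \<mu> \<kappa> vl ul \<theta>l"
proof -
  let ?Q = "{0..} \<times> \<Omega>"
  obtain F where F: "\<And>t x. t \<ge> 0 \<Longrightarrow> x \<in> \<Omega> \<Longrightarrow> (Dx \<theta>l t has_real_derivative F t x) (at x)"
    "continuous_on ?Q (\<lambda>p. F (fst p) (snd p))"
    by (rule Dx_Dx_\<theta>l) blast
  have u: "continuous_on ?Q (\<lambda>p. Dx (Dx ul) (fst p) (snd p))"
  proof (rule continuous_on_eq)
    let ?uxx = "\<lambda>t x. (Dx vl t x * Sl t x + (Dt ul t x
      + R * (Dx \<theta>l t x * vl t x - \<theta>l t x * Dx vl t x) / (vl t x)\<^sup>2) * vl t x) / \<mu>"
    show "continuous_on ?Q (\<lambda>p. ?uxx (fst p) (snd p))"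
      using coefficients_nonzero pos(3) by (intro continuous_intros continuous_limits) auto
    show "?uxx (fst p) (snd p) = Dx (Dx ul) (fst p) (snd p)" if "p \<in> ?Q" for p
      using DERIV_imp_deriv[OF Dx_Dx_ul[of "fst p" "snd p"]] that by (simp add: Dx_def[of "Dx ul"] mem_Times_iff)
  qed
  have \<theta>: "continuous_on ?Q (\<lambda>p. Dx (Dx \<theta>l) (fst p) (snd p))"
  proof (rule continuous_on_eq[OF F(2)])
    show "F (fst p) (snd p) = Dx (Dx \<theta>l) (fst p) (snd p)" if "p \<in> ?Q" for p
      using DERIV_imp_deriv[OF F(1)[of "fst p" "snd p"]] that by (simp add: Dx_def[of "Dx \<theta>l"] mem_Times_iff)
  qed
  have eqs: "Dt ul t x + Dx (\<lambda>t x. pressure R (vl t x) (\<theta>l t x)) t x = Dx (\<lambda>t x. \<mu> * Dx ul t x / vl t x) t x"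
    "Cv * Dt \<theta>l t x + R * \<theta>l t x * Dx ul t x / vl t x
          = Dx (\<lambda>t x. \<kappa> (\<theta>l t x) * Dx \<theta>l t x / vl t x) t x + \<mu> * (Dx ul t x)\<^sup>2 / vl t x"
    if tx: "t \<ge> 0" "x \<in> \<Omega>" for t x
  proof -
    \<comment> \<open>By the constitutive laws the viscous stress is S and the conductive term is -
      q, so both space derivatives have already been computed.\<close>
    have "((\<lambda>y. \<mu> * Dx ul t y / vl t y) has_real_derivative Dt ul t x
      + R * (Dx \<theta>l t x * vl t x - \<theta>l t x * Dx vl t x) / (vl t x)\<^sup>2) (at x)"
      by (rule has_field_derivative_transform_within_open[OF Sl_derivative[OF tx], where S = \<Omega>])
         (use tx constitutive_laws(2) in auto)
    from DERIV_imp_deriv[OF this] DERIV_imp_deriv[OF pressure_derivative[where R = R, OF C1_cylinderD(1)[OF C1_limits(1) tx] C1_cylinderD(1)[OF C1_limits(3) tx] vl_pos[OF tx]]]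
    show "Dt ul t x + Dx (\<lambda>t x. pressure R (vl t x) (\<theta>l t x)) t x = Dx (\<lambda>t x. \<mu> * Dx ul t x / vl t x) t x"
      unfolding Dx_def by (simp add: Dx_def)
    let ?q' = "(Sl t x)\<^sup>2 * vl t x / \<mu> - Cv * Dt \<theta>l t x - R * \<theta>l t x * Dx ul t x / vl t x"
    have "((\<lambda>y. \<kappa> (\<theta>l t y) * Dx \<theta>l t y / vl t y) has_real_derivative - ?q') (at x)"
      by (rule has_field_derivative_transform_within_open[OF DERIV_minus[OF ql_derivative[OF tx \<theta>l_pos[OF tx]]], where S = \<Omega>])
         (use tx constitutive_laws(1) in auto)
    from DERIV_imp_deriv[OF this]
    have 1: "Dx (\<lambda>t x. \<kappa> (\<theta>l t x) * Dx \<theta>l t x / vl t x) t x = - ?q'" by (simp only: Dx_def[of "\<lambda>t x. \<kappa> (\<theta>l t x) * Dx \<theta>l t x / vl t x"])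
    have 2: "(Sl t x)\<^sup>2 * vl t x / \<mu> = \<mu> * (Dx ul t x)\<^sup>2 / vl t x"
      unfolding constitutive_laws(2)[OF tx] using vl_pos[OF tx] pos(3)
      by (simp add: power2_eq_square field_simps)
    show "Cv * Dt \<theta>l t x + R * \<theta>l t x * Dx ul t x / vl t x
          = Dx (\<lambda>t x. \<kappa> (\<theta>l t x) * Dx \<theta>l t x / vl t x) t x + \<mu> * (Dx ul t x)\<^sup>2 / vl t x"
      using 1 2 by linarith
  qed
  have d: "Dx ul t differentiable (at x)" "Dx \<theta>l t differentiable (at x)" if "t \<ge> 0" "x \<in> \<Omega>" for t x
    using Dx_Dx_ul[OF that] F(1)[OF that] real_differentiable_def by blast+
  have "\<forall>w\<in>{ul, \<theta>l}. (\<forall>t\<ge>0. \<forall>x\<in>\<Omega>. Dx w t differentiable (at x)) \<and>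
      continuous_on ?Q (\<lambda>p. Dx (Dx w) (fst p) (snd p))"
    using d u \<theta> by simp
  then show ?thesis
    unfolding navier_stokes_classical_def case_prod_unfold
    by (intro conjI C1_limits) (auto intro: vl_pos \<theta>l_pos volume_equation eqs simp del: greaterThanLessThan_iff)
qed

end

section \<open>Compactness\<close>

context bounded_interval
begin

lemma regular_mono:
  assumes "regular M w" "M \<le> N" shows "regular N w"
proof -
  have le: "M * sqrt r \<le> N * sqrt r" if "r \<ge> 0" for r using assms(2) that by (intro mult_right_mono) auto
  show ?thesis
    unfolding regular_def
    by (intro conjI allI impI ballI)
       (assumption | simp only: abs_ge_zero real_sqrt_ge_zero
        | rule regularD(1)[OF assms(1) order_refl] regularD(2)[OF assms(1)]
          order_trans[OF regularD(3)[OF assms(1)] assms(2)] order_trans[OF regularD(4)[OF assms(1)] assms(2)]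
          order_trans[OF regularD(5)[OF assms(1)] assms(2)] order_trans[OF regularD(6)[OF assms(1)] assms(2)]
          order_trans[OF regularD(7)[OF assms(1)] le] order_trans[OF regularD(8)[OF assms(1)] le]
          order_trans[OF regularD(9)[OF assms(1)] le] order_trans[OF regularD(10)[OF assms(1)] le])+
qed

lemma flux_mono:
  assumes "flux M D q" "M \<le> N" shows "flux N D q"
proof -
  have le: "M * sqrt r \<le> N * sqrt r" if "r \<ge> 0" for r using assms(2) that by (intro mult_right_mono) auto
  show ?thesis
    unfolding flux_def
    by (intro conjI allI impI ballI)
       (assumption | simp only: abs_ge_zero less_imp_le
        | rule fluxD(1)[OF assms(1) order_refl] fluxD(2)[OF assms(1)] fluxD(6)[OF assms(1)]
          order_trans[OF fluxD(3)[OF assms(1)] assms(2)]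
          order_trans[OF fluxD(4)[OF assms(1)] le] order_trans[OF fluxD(5)[OF assms(1)] le])+
qed

text \<open>A diagonal sequence serves all members of F at the rational points of time and space;
  the moduli, independent of n, spread the convergence to every point.\<close>

lemma equicontinuous_subsequence:
  fixes F :: "(nat \<Rightarrow> real \<Rightarrow> real \<Rightarrow> real) set"
  assumes F: "finite F"
    and bd: "\<And>w n t x. w \<in> F \<Longrightarrow> t \<ge> 0 \<Longrightarrow> x \<in> \<Omega> \<Longrightarrow> \<bar>w n t x\<bar> \<le> M"
    and mx: "\<And>w. w \<in> F \<Longrightarrow> \<exists>\<omega>. modulus \<omega> \<and> (\<forall>n. \<forall>t\<ge>0. \<forall>x\<in>\<Omega>. \<forall>y\<in>\<Omega>. \<bar>w n t x - w n t y\<bar> \<le> \<omega> \<bar>x - y\<bar>)"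
    and mt: "\<And>w. w \<in> F \<Longrightarrow> \<exists>\<omega>. modulus \<omega> \<and> (\<forall>n. \<forall>t\<ge>0. \<forall>s\<ge>0. \<forall>x\<in>\<Omega>. \<bar>w n t x - w n s x\<bar> \<le> \<omega> \<bar>t - s\<bar>)"
  obtains k :: "nat \<Rightarrow> nat" where "strict_mono k"
    "\<And>w t x. w \<in> F \<Longrightarrow> t \<ge> 0 \<Longrightarrow> x \<in> \<Omega> \<Longrightarrow> convergent (\<lambda>n. w (k n) t x)"
proof -
  define P where "P = F \<times> (\<rat> \<inter> {0::real..}) \<times> (\<rat> \<inter> \<Omega>)"
  have Q: "countable (\<rat> \<inter> X :: real set)" for X by (rule countable_subset[OF _ countable_rat]) auto
  have "countable P" unfolding P_def by (intro countable_SIGMA countable_finite[OF F] Q)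
  then obtain k :: "nat \<Rightarrow> nat" where k: "strict_mono k"
    "\<And>p. p \<in> P \<Longrightarrow> \<exists>l. (\<lambda>n. fst p (k n) (fst (snd p)) (snd (snd p))) \<longlonglongrightarrow> l"
    by (rule function_convergent_subsequence[of P "\<lambda>n p. fst p n (fst (snd p)) (snd (snd p))" M])
       (use bd in \<open>auto simp: P_def\<close>)
  show thesis
  proof (rule that[OF k(1)])
    fix w and t x :: real assume w: "w \<in> F" and t: "t \<ge> 0" and x: "x \<in> \<Omega>"
    obtain \<omega>1 where \<omega>1: "modulus \<omega>1" "\<And>n t x y. t \<ge> 0 \<Longrightarrow> x \<in> \<Omega> \<Longrightarrow> y \<in> \<Omega> \<Longrightarrow> \<bar>w n t x - w n t y\<bar> \<le> \<omega>1 \<bar>x - y\<bar>"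
      using mx[OF w] by blast
    obtain \<omega>2 where \<omega>2: "modulus \<omega>2" "\<And>n t s x. t \<ge> 0 \<Longrightarrow> s \<ge> 0 \<Longrightarrow> x \<in> \<Omega> \<Longrightarrow> \<bar>w n t x - w n s x\<bar> \<le> \<omega>2 \<bar>t - s\<bar>"
      using mt[OF w] by blast
    show "convergent (\<lambda>n. w (k n) t x)"
    proof (rule convergent_by_approximation)
      fix e :: real assume e: "e > 0"
      obtain d1 where d1: "d1 > 0" "\<And>r. 0 \<le> r \<Longrightarrow> r \<le> d1 \<Longrightarrow> \<omega>1 r < e/2"
        using modulusE[OF \<omega>1(1), of "e/2"] e by auto
      obtain d2 where d2: "d2 > 0" "\<And>r. 0 \<le> r \<Longrightarrow> r \<le> d2 \<Longrightarrow> \<omega>2 r < e/2"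
        using modulusE[OF \<omega>2(1), of "e/2"] e by auto
      obtain y where y: "y \<in> \<rat>" "max a (x - d1) < y" "y < x"
        using Rats_dense_in_real[of "max a (x - d1)" x] d1 x by auto
      \<comment> \<open>To the right of t, so that s is nonnegative even for t = 0.\<close>
      obtain s where s: "s \<in> \<rat>" "t < s" "s < t + d2"
        using Rats_dense_in_real[of t "t + d2"] d2 by auto
      have y\<Omega>: "y \<in> \<Omega>" using y x by auto
      have "(w, s, y) \<in> P" using y y\<Omega> s t w by (auto simp: P_def)
      then have "convergent (\<lambda>n. w (k n) s y)" using k(2) by (force simp: convergent_def)
      moreover have "\<bar>w (k n) t x - w (k n) s y\<bar> \<le> e" for n
      proof -
        have "\<bar>w (k n) t x - w (k n) t y\<bar> < e/2"
          using \<omega>1(2)[OF t x y\<Omega>, of "k n"] d1(2)[of "\<bar>x - y\<bar>"] y by auto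
        moreover have "\<bar>w (k n) t y - w (k n) s y\<bar> < e/2"
          using \<omega>2(2)[OF t _ y\<Omega>, of s "k n"] d2(2)[of "\<bar>t - s\<bar>"] s t by auto
        ultimately show ?thesis by linarith
      qed
      ultimately show "\<exists>Y. convergent Y \<and> (\<forall>n. \<bar>w (k n) t x - Y n\<bar> \<le> e)" by blast
    qed
  qed
qed

lemma C1_cylinder_measurable:
  assumes "C1_cylinder \<Omega> w" "x \<in> \<Omega>"
  shows "(\<lambda>t. w t x) \<in> borel_measurable TT"
proof (rule continuous_imp_measurable_on_sets_lebesgue)
  show "continuous_on {0<..} (\<lambda>t. w t x)"
    by (rule continuous_on_subset[OF C1_cylinderD(6)[OF assms(1), of 0 x]]) (use assms(2) in auto)
qed auto

lemma regular_weak_star: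
  assumes r: "\<And>n. regular M (w n)" and l: "\<And>t x. t \<ge> 0 \<Longrightarrow> x \<in> \<Omega> \<Longrightarrow> (\<lambda>n. w n t x) \<longlonglongrightarrow> z t x"
  shows "weak_star_Linf_H 2 \<Omega> w z"
proof (rule weak_star_Linf_H_2I)
  show "\<exists>f1 f2. H2 (w n t) f1 f2" "Hnorm 2 \<Omega> (w n t) \<le> M" if "t > 0" for n t
    using regularD(2,3)[OF r[of n], of t] that by auto
  show "(\<lambda>t. w n t x) \<in> borel_measurable TT" if "x \<in> \<Omega>" for n x
    by (rule C1_cylinder_measurable[OF regularD(1)[OF r, of 0] that]) simp
qed (use l in auto)

lemma flux_weak_L2:
  assumes f: "\<And>n. flux M (D n) (q n)" and D: "\<And>n. integrable TT (D n)" "\<And>n. (LINT t|TT. D n t) \<le> B"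
    and l: "\<And>t x. t \<ge> 0 \<Longrightarrow> x \<in> \<Omega> \<Longrightarrow> (\<lambda>n. q n t x) \<longlonglongrightarrow> z t x"
  shows "weak_L2_H 2 \<Omega> q z"
proof (rule weak_L2_H_2I[OF _ _ D])
  show "\<exists>f1 f2. H2 (q n t) f1 f2" if "t > 0" for n t
    using fluxD(2)[OF f[of n], of t] that by auto
  show "(Hnorm 2 \<Omega> (q n t))\<^sup>2 \<le> D n t" if "t > 0" for n t
    using fluxD(6)[OF f[of n], of t] that by auto
  show "(\<lambda>t. q n t x) \<in> borel_measurable TT" if "x \<in> \<Omega>" for n x
    by (rule C1_cylinder_measurable[OF fluxD(1)[OF f, of 0] that]) simp
qed (use l in auto)

lemma regular_flux_subsequence:
  assumes r: "\<And>n. regular M (v n)" "\<And>n. regular M (u n)" "\<And>n. regular M (\<theta> n)"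
    and f: "\<And>n. flux M (D n) (q n)" "\<And>n. flux M (D n) (S n)"
  obtains k :: "nat \<Rightarrow> nat" and vl ul \<theta>l ql Sl where "strict_mono k"
    "\<And>t x. t \<ge> 0 \<Longrightarrow> x \<in> \<Omega> \<Longrightarrow> (\<lambda>n. v (k n) t x) \<longlonglongrightarrow> vl t x"
    "\<And>t x. t \<ge> 0 \<Longrightarrow> x \<in> \<Omega> \<Longrightarrow> (\<lambda>n. u (k n) t x) \<longlonglongrightarrow> ul t x"
    "\<And>t x. t \<ge> 0 \<Longrightarrow> x \<in> \<Omega> \<Longrightarrow> (\<lambda>n. \<theta> (k n) t x) \<longlonglongrightarrow> \<theta>l t x"
    "\<And>t x. t \<ge> 0 \<Longrightarrow> x \<in> \<Omega> \<Longrightarrow> (\<lambda>n. q (k n) t x) \<longlonglongrightarrow> ql t x"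
    "\<And>t x. t \<ge> 0 \<Longrightarrow> x \<in> \<Omega> \<Longrightarrow> (\<lambda>n. S (k n) t x) \<longlonglongrightarrow> Sl t x"
proof -
  have M: "M \<ge> 0" by (rule regular_nonneg[OF r(1)])
  have bd: "\<bar>w n t x\<bar> \<le> M" if "w \<in> {v, u, \<theta>, q, S}" "t \<ge> 0" "x \<in> \<Omega>" for w n t x
    using that(1) regularD(4)[OF r(1)[of n] that(2,3)] regularD(4)[OF r(2)[of n] that(2,3)]
      regularD(4)[OF r(3)[of n] that(2,3)] fluxD(3)[OF f(1)[of n] that(2,3)] fluxD(3)[OF f(2)[of n] that(2,3)]
    by blast
  have mx: "\<bar>w n t x - w n t y\<bar> \<le> M * sqrt \<bar>x - y\<bar>"
    if "w \<in> {v, u, \<theta>, q, S}" "t \<ge> 0" "x \<in> \<Omega>" "y \<in> \<Omega>" for w n t x y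
    using that(1) regularD(7)[OF r(1)[of n] that(2-4)] regularD(7)[OF r(2)[of n] that(2-4)]
      regularD(7)[OF r(3)[of n] that(2-4)] fluxD(4)[OF f(1)[of n] that(2-4)] fluxD(4)[OF f(2)[of n] that(2-4)]
    by blast
  have mt: "\<exists>\<omega>. modulus \<omega> \<and> (\<forall>n. \<forall>t\<ge>0. \<forall>s\<ge>0. \<forall>x\<in>\<Omega>. \<bar>w n t x - w n s x\<bar> \<le> \<omega> \<bar>t - s\<bar>)"
    if "w \<in> {v, u, \<theta>, q, S}" for w
  proof (cases "w \<in> {v, u, \<theta>}")
    case True
    then show ?thesis
      using modulus_linear[OF M] regular_time_Lipschitz[OF r(1)] regular_time_Lipschitz[OF r(2)]
        regular_time_Lipschitz[OF r(3)] by (intro exI[of _ "\<lambda>r. M * r"] conjI allI impI ballI) blast+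
  next
    case False
    then have "w \<in> {q, S}" using that by blast
    then show ?thesis
      using modulus_sqrt[OF M] fluxD(5)[OF f(1)] fluxD(5)[OF f(2)]
      by (intro exI[of _ "\<lambda>r. M * sqrt r"] conjI allI impI ballI) blast+
  qed
  obtain k :: "nat \<Rightarrow> nat" where k: "strict_mono k"
    "\<And>w t x. w \<in> {v, u, \<theta>, q, S} \<Longrightarrow> t \<ge> 0 \<Longrightarrow> x \<in> \<Omega> \<Longrightarrow> convergent (\<lambda>n. w (k n) t x)"
  proof (rule equicontinuous_subsequence[of "{v, u, \<theta>, q, S}" M])
    show "finite {v, u, \<theta>, q, S}" by simp
    show "\<bar>w n t x\<bar> \<le> M" if "w \<in> {v, u, \<theta>, q, S}" "t \<ge> 0" "x \<in> \<Omega>" for w n t x by (rule bd[OF that])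
    show "\<exists>\<omega>. modulus \<omega> \<and> (\<forall>n. \<forall>t\<ge>0. \<forall>x\<in>\<Omega>. \<forall>y\<in>\<Omega>. \<bar>w n t x - w n t y\<bar> \<le> \<omega> \<bar>x - y\<bar>)"
      if "w \<in> {v, u, \<theta>, q, S}" for w
      using modulus_sqrt[OF M] mx[OF that] by (intro exI[of _ "\<lambda>r. M * sqrt r"]) blast
    show "\<exists>\<omega>. modulus \<omega> \<and> (\<forall>n. \<forall>t\<ge>0. \<forall>s\<ge>0. \<forall>x\<in>\<Omega>. \<bar>w n t x - w n s x\<bar> \<le> \<omega> \<bar>t - s\<bar>)"
      if "w \<in> {v, u, \<theta>, q, S}" for w by (rule mt[OF that])
  qed blast
  have "(\<lambda>n. w (k n) t x) \<longlonglongrightarrow> Topological_Spaces.lim (\<lambda>n. w (k n) t x)"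
    if "w \<in> {v, u, \<theta>, q, S}" "t \<ge> 0" "x \<in> \<Omega>" for w t x
    using k(2)[OF that] by (simp add: convergent_LIMSEQ_iff)
  then show thesis by (intro that[OF k(1)]) auto
qed

end

theorem theorem1p5:
  fixes \<Omega> :: "real set" and a b R Cv \<mu> \<epsilon>\<^sub>0 C :: real and g \<kappa> :: "real \<Rightarrow> real"
    and v\<^sub>0 u\<^sub>0 \<theta>\<^sub>0 :: "real \<Rightarrow> real" and q\<^sub>0 S\<^sub>0 :: "real \<Rightarrow> real \<Rightarrow> real"
    and v u \<theta> q S :: "real \<Rightarrow> real \<Rightarrow> real \<Rightarrow> real"
  assumes "a < b" and "\<Omega> = {a<..<b}"
    and "R > 0" and "Cv > 0" and "\<mu> > 0"
    and "smooth_coefficient g" and "smooth_coefficient \<kappa>"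
    and "\<epsilon>\<^sub>0 > 0" and "C > 0"
    and "\<exists>c>0. \<forall>x\<in>\<Omega>. v\<^sub>0 x \<ge> c \<and> \<theta>\<^sub>0 x \<ge> c"
    and "\<forall>\<tau>\<in>{0<..1}. relaxed_fluid.A2 \<Omega> R Cv \<mu> g \<kappa> \<tau>
           (relaxed_fluid.initial_state v\<^sub>0 u\<^sub>0 \<theta>\<^sub>0 (q\<^sub>0 \<tau>) (S\<^sub>0 \<tau>))"
    and "relaxed_fluid.A3 \<Omega> \<mu> \<kappa> v\<^sub>0 u\<^sub>0 \<theta>\<^sub>0 q\<^sub>0 S\<^sub>0"
    and "\<forall>\<tau>\<in>{0<..1}. relaxed_fluid.A4 \<Omega> R Cv \<mu> g \<kappa> \<tau>
           (relaxed_fluid.initial_state v\<^sub>0 u\<^sub>0 \<theta>\<^sub>0 (q\<^sub>0 \<tau>) (S\<^sub>0 \<tau>))"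
    and "\<forall>\<tau>\<in>{0<..1}. relaxed_fluid.E0 \<Omega> R Cv \<mu> g \<kappa> \<tau>
           (relaxed_fluid.initial_state v\<^sub>0 u\<^sub>0 \<theta>\<^sub>0 (q\<^sub>0 \<tau>) (S\<^sub>0 \<tau>)) < \<epsilon>\<^sub>0"
    and "\<forall>\<tau>\<in>{0<..1}. relaxed_fluid.global_solution \<Omega> R Cv \<mu> g \<kappa> C \<tau>
           v\<^sub>0 u\<^sub>0 \<theta>\<^sub>0 (q\<^sub>0 \<tau>) (S\<^sub>0 \<tau>) (v \<tau>) (u \<tau>) (\<theta> \<tau>) (q \<tau>) (S \<tau>)"
  shows "\<exists>vl ul \<theta>l ql Sl.
     vl \<in> Linf_H 2 \<Omega> \<and> ul \<in> Linf_H 2 \<Omega> \<and> \<theta>l \<in> Linf_H 2 \<Omega> \<and>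
     ql \<in> Lp_H 2 2 \<Omega> \<and> Sl \<in> Lp_H 2 2 \<Omega> \<and>
     (\<exists>\<tau>s :: nat \<Rightarrow> real. (\<forall>n. \<tau>s n \<in> {0<..1}) \<and> \<tau>s \<longlonglongrightarrow> 0 \<and>
        weak_star_Linf_H 2 \<Omega> (\<lambda>n. v (\<tau>s n)) vl \<and>
        weak_star_Linf_H 2 \<Omega> (\<lambda>n. u (\<tau>s n)) ul \<and>
        weak_star_Linf_H 2 \<Omega> (\<lambda>n. \<theta> (\<tau>s n)) \<theta>l \<and>
        weak_L2_H 2 \<Omega> (\<lambda>n. q (\<tau>s n)) ql \<and>
        weak_L2_H 2 \<Omega> (\<lambda>n. S (\<tau>s n)) Sl) \<and>
     navier_stokes_classical \<Omega> R Cv \<mu> \<kappa> vl ul \<theta>l \<and>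
     (\<forall>t>0. trace_zero \<Omega> (ul t) \<and> trace_zero \<Omega> (ql t)) \<and>
     (\<forall>x\<in>\<Omega>. vl 0 x = v\<^sub>0 x \<and> ul 0 x = u\<^sub>0 x \<and> \<theta>l 0 x = \<theta>\<^sub>0 x) \<and>
     (\<forall>t\<ge>0. \<forall>x\<in>\<Omega>. ql t x = - (\<kappa> (\<theta>l t x) * Dx \<theta>l t x / vl t x) \<and>
                       Sl t x = \<mu> * (Dx ul t x / vl t x))"
proof -
  interpret bounded_interval a b using assms(1) by unfold_locales
  note [simp] = assms(2)
  \<comment> \<open>Any sequence of admissible parameters tending to 0 would do.\<close>
  define \<sigma> :: "nat \<Rightarrow> real" where "\<sigma> n = 1 / real (Suc n)" for n
  have \<sigma>: "\<sigma> n \<in> {0<..1}" for n by (simp add: \<sigma>_def)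
  have "\<sigma> \<longlonglongrightarrow> 0" unfolding \<sigma>_def by (rule LIMSEQ_Suc[OF lim_const_over_n])
  obtain c where c: "c > 0" "\<And>x. x \<in> {a<..<b} \<Longrightarrow> v\<^sub>0 x \<ge> c" "\<And>x. x \<in> {a<..<b} \<Longrightarrow> \<theta>\<^sub>0 x \<ge> c"
    using assms(10) by auto
  define B where "B = C * \<epsilon>\<^sub>0"
  define E where "E = sqrt B + Hnorm 2 {a<..<b} (\<lambda>x. 1)"
  \<comment> \<open>One constant for all suprema and moduli; it is independent of \<tau> because the
    energy is at most \<open>C * \<epsilon>\<^sub>0\<close>.\<close>
  define M where "M = regular_const E + flux_const E + sup_const * E"
  have E: "E \<ge> 0"
    using assms(8,9) unfolding E_def B_def by (intro add_nonneg_nonneg) (auto simp: Hnorm_nonneg)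
  have M: "regular_const E \<le> M" "flux_const E \<le> M" "sup_const * E \<le> M"
  proof -
    have "regular_const E \<ge> 0" "flux_const E \<ge> 0" "sup_const * E \<ge> 0"
      using regular_const_ge(5)[OF E] E sup_const_pos by (auto simp: flux_const_def)
    then show "regular_const E \<le> M" "flux_const E \<le> M" "sup_const * E \<le> M" unfolding M_def by linarith+
  qed
  have glob: "relaxed_fluid.problem_P {a<..<b} R Cv \<mu> g \<kappa> \<tau> v\<^sub>0 u\<^sub>0 \<theta>\<^sub>0 (q\<^sub>0 \<tau>) (S\<^sub>0 \<tau>) (v \<tau>) (u \<tau>) (\<theta> \<tau>) (q \<tau>) (S \<tau>)"
    "\<exists>D. integrable (lebesgue_on {0<..}) D \<and> (LINT t|lebesgue_on {0<..}. D t) \<le> B \<and>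
      regular M (v \<tau>) \<and> regular M (u \<tau>) \<and> regular M (\<theta> \<tau>) \<and> flux M D (q \<tau>) \<and> flux M D (S \<tau>) \<and>
      (\<forall>t\<ge>0. \<forall>x\<in>{a<..<b}. \<bar>sqrt \<tau> * Dt (q \<tau>) t x\<bar> \<le> M \<and> \<bar>sqrt \<tau> * Dt (S \<tau>) t x\<bar> \<le> M)"
    if \<tau>: "\<tau> \<in> {0<..1}" for \<tau>
  proof -
    let ?E = "relaxed_fluid.E0 {a<..<b} R Cv \<mu> g \<kappa> \<tau> (relaxed_fluid.initial_state v\<^sub>0 u\<^sub>0 \<theta>\<^sub>0 (q\<^sub>0 \<tau>) (S\<^sub>0 \<tau>))"
    have sol: "relaxed_fluid.global_solution {a<..<b} R Cv \<mu> g \<kappa> C \<tau>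
           v\<^sub>0 u\<^sub>0 \<theta>\<^sub>0 (q\<^sub>0 \<tau>) (S\<^sub>0 \<tau>) (v \<tau>) (u \<tau>) (\<theta> \<tau>) (q \<tau>) (S \<tau>)"
      using assms(15) \<tau> by simp
    then show "relaxed_fluid.problem_P {a<..<b} R Cv \<mu> g \<kappa> \<tau> v\<^sub>0 u\<^sub>0 \<theta>\<^sub>0 (q\<^sub>0 \<tau>) (S\<^sub>0 \<tau>) (v \<tau>) (u \<tau>) (\<theta> \<tau>) (q \<tau>) (S \<tau>)"
      unfolding relaxed_fluid.global_solution_def by blast
    have est: "relaxed_fluid.energy_estimate {a<..<b} \<tau> (C * ?E) (v \<tau>) (u \<tau>) (\<theta> \<tau>) (q \<tau>) (S \<tau>)"
      using sol unfolding relaxed_fluid.global_solution_def by blast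
    have C1: "C1_cylinder {a<..<b} (v \<tau>)" "C1_cylinder {a<..<b} (u \<tau>)" "C1_cylinder {a<..<b} (\<theta> \<tau>)"
      "C1_cylinder {a<..<b} (q \<tau>)" "C1_cylinder {a<..<b} (S \<tau>)"
      using sol unfolding relaxed_fluid.global_solution_def relaxed_fluid.regularity_class_def by blast+
    have "?E < \<epsilon>\<^sub>0" using assms(14) \<tau> by simp
    then have le: "C * ?E \<le> B" using assms(9) by (simp add: B_def)
    have \<tau>0: "\<tau> > 0" using \<tau> by simp
    obtain D where "integrable (lebesgue_on {0<..}) D" "(LINT t|lebesgue_on {0<..}. D t) \<le> B"
      "regular (regular_const E) (v \<tau>)" "regular (regular_const E) (u \<tau>)" "regular (regular_const E) (\<theta> \<tau>)"
      "flux (flux_const E) D (q \<tau>)" "flux (flux_const E) D (S \<tau>)"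
      "\<And>t x. t \<ge> 0 \<Longrightarrow> x \<in> {a<..<b} \<Longrightarrow> \<bar>sqrt \<tau> * Dt (q \<tau>) t x\<bar> \<le> sup_const * E"
      "\<And>t x. t \<ge> 0 \<Longrightarrow> x \<in> {a<..<b} \<Longrightarrow> \<bar>sqrt \<tau> * Dt (S \<tau>) t x\<bar> \<le> sup_const * E"
      by (rule energy_estimate_bounds[OF est le \<tau>0 C1 E_def]) blast
    then show "\<exists>D. integrable (lebesgue_on {0<..}) D \<and> (LINT t|lebesgue_on {0<..}. D t) \<le> B \<and>
      regular M (v \<tau>) \<and> regular M (u \<tau>) \<and> regular M (\<theta> \<tau>) \<and> flux M D (q \<tau>) \<and> flux M D (S \<tau>) \<and>
      (\<forall>t\<ge>0. \<forall>x\<in>{a<..<b}. \<bar>sqrt \<tau> * Dt (q \<tau>) t x\<bar> \<le> M \<and> \<bar>sqrt \<tau> * Dt (S \<tau>) t x\<bar> \<le> M)"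
      using M by (intro exI[of _ D]) (blast intro: regular_mono flux_mono order_trans)
  qed
  obtain D where D: "\<And>n. integrable (lebesgue_on {0<..}) (D n)" "\<And>n. (LINT t|lebesgue_on {0<..}. D n t) \<le> B"
      "\<And>n. regular M (v (\<sigma> n))" "\<And>n. regular M (u (\<sigma> n))" "\<And>n. regular M (\<theta> (\<sigma> n))"
      "\<And>n. flux M (D n) (q (\<sigma> n))" "\<And>n. flux M (D n) (S (\<sigma> n))"
      "\<And>n t x. t \<ge> 0 \<Longrightarrow> x \<in> {a<..<b} \<Longrightarrow> \<bar>sqrt (\<sigma> n) * Dt (q (\<sigma> n)) t x\<bar> \<le> M"
      "\<And>n t x. t \<ge> 0 \<Longrightarrow> x \<in> {a<..<b} \<Longrightarrow> \<bar>sqrt (\<sigma> n) * Dt (S (\<sigma> n)) t x\<bar> \<le> M"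
    using glob(2)[OF \<sigma>] by metis
  obtain k :: "nat \<Rightarrow> nat" and vl ul \<theta>l ql Sl where k: "strict_mono k"
    and l: "\<And>t x. t \<ge> 0 \<Longrightarrow> x \<in> {a<..<b} \<Longrightarrow> (\<lambda>n. v (\<sigma> (k n)) t x) \<longlonglongrightarrow> vl t x"
    "\<And>t x. t \<ge> 0 \<Longrightarrow> x \<in> {a<..<b} \<Longrightarrow> (\<lambda>n. u (\<sigma> (k n)) t x) \<longlonglongrightarrow> ul t x"
    "\<And>t x. t \<ge> 0 \<Longrightarrow> x \<in> {a<..<b} \<Longrightarrow> (\<lambda>n. \<theta> (\<sigma> (k n)) t x) \<longlonglongrightarrow> \<theta>l t x"
    "\<And>t x. t \<ge> 0 \<Longrightarrow> x \<in> {a<..<b} \<Longrightarrow> (\<lambda>n. q (\<sigma> (k n)) t x) \<longlonglongrightarrow> ql t x"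
    "\<And>t x. t \<ge> 0 \<Longrightarrow> x \<in> {a<..<b} \<Longrightarrow> (\<lambda>n. S (\<sigma> (k n)) t x) \<longlonglongrightarrow> Sl t x"
    by (rule regular_flux_subsequence[where v = "\<lambda>n. v (\<sigma> n)" and u = "\<lambda>n. u (\<sigma> n)" and \<theta> = "\<lambda>n. \<theta> (\<sigma> n)"
          and q = "\<lambda>n. q (\<sigma> n)" and S = "\<lambda>n. S (\<sigma> n)", OF D(3-7)]) blast
  define \<tau>s where "\<tau>s n = \<sigma> (k n)" for n
  have \<tau>s: "\<tau>s n \<in> {0<..1}" for n using \<sigma> by (simp only: \<tau>s_def)
  have \<tau>s_lim: "\<tau>s \<longlonglongrightarrow> 0"
    using LIMSEQ_subseq_LIMSEQ[OF \<open>\<sigma> \<longlonglongrightarrow> 0\<close> k] unfolding o_def \<tau>s_def[symmetric] .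
  have P: "relaxed_fluid.problem_P {a<..<b} R Cv \<mu> g \<kappa> (\<tau>s n) v\<^sub>0 u\<^sub>0 \<theta>\<^sub>0 (q\<^sub>0 (\<tau>s n)) (S\<^sub>0 (\<tau>s n))
     (v (\<tau>s n)) (u (\<tau>s n)) (\<theta> (\<tau>s n)) (q (\<tau>s n)) (S (\<tau>s n))" for n
    by (rule glob(1)[OF \<tau>s])
  note l = l[folded \<tau>s_def]
  have Dk: "regular M (v (\<tau>s n))" "regular M (u (\<tau>s n))" "regular M (\<theta> (\<tau>s n))"
    "flux M (D (k n)) (q (\<tau>s n))" "flux M (D (k n)) (S (\<tau>s n))"
    "t \<ge> 0 \<Longrightarrow> x \<in> {a<..<b} \<Longrightarrow> \<bar>sqrt (\<tau>s n) * Dt (q (\<tau>s n)) t x\<bar> \<le> M"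
    "t \<ge> 0 \<Longrightarrow> x \<in> {a<..<b} \<Longrightarrow> \<bar>sqrt (\<tau>s n) * Dt (S (\<tau>s n)) t x\<bar> \<le> M" for n t x
    unfolding \<tau>s_def by (fact D)+
  \<comment> \<open>The initial v, u, \<theta> do not depend on \<tau>, so at time 0 these sequences
    are constant.\<close>
  have init: "vl 0 x = v\<^sub>0 x" "ul 0 x = u\<^sub>0 x" "\<theta>l 0 x = \<theta>\<^sub>0 x" if x: "x \<in> {a<..<b}" for x
  proof -
    have "v (\<tau>s n) 0 x = v\<^sub>0 x" "u (\<tau>s n) 0 x = u\<^sub>0 x" "\<theta> (\<tau>s n) 0 x = \<theta>\<^sub>0 x" for n
      using P[of n] x unfolding relaxed_fluid.problem_P_def by blast+
    then show "vl 0 x = v\<^sub>0 x" "ul 0 x = u\<^sub>0 x" "\<theta>l 0 x = \<theta>\<^sub>0 x"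
      using l(1-3)[OF order_refl x] by (simp_all add: LIMSEQ_const_iff)
  qed
  interpret relaxation_limit a b R Cv \<mu> M c g \<kappa> \<tau>s "\<lambda>n. D (k n)" "\<lambda>n. v (\<tau>s n)" "\<lambda>n. u (\<tau>s n)"
    "\<lambda>n. \<theta> (\<tau>s n)" "\<lambda>n. q (\<tau>s n)" "\<lambda>n. S (\<tau>s n)" vl ul \<theta>l ql Sl
  proof unfold_locales
    show "R > 0" "Cv > 0" "\<mu> > 0" "c > 0" "smooth_coefficient g" "smooth_coefficient \<kappa>"
      by (fact assms c)+
    show "\<tau>s n > 0" for n using \<tau>s[of n] by simp
    show "vl 0 x \<ge> c" "\<theta>l 0 x \<ge> c" if "x \<in> {a<..<b}" for x
      using init[OF that] c(2,3)[OF that] by simp_all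
  next
    fix n and t x :: real assume tx: "t \<ge> 0" "x \<in> {a<..<b}"
    note eqs = P[of n, unfolded relaxed_fluid.problem_P_def, THEN conjunct1, rule_format, OF tx]
    show "v (\<tau>s n) t x > 0" "\<theta> (\<tau>s n) t x > 0" "Dt (v (\<tau>s n)) t x = Dx (u (\<tau>s n)) t x"
      "Dt (u (\<tau>s n)) t x + Dx (\<lambda>t x. pressure R (v (\<tau>s n) t x) (\<theta> (\<tau>s n) t x)) t x = Dx (S (\<tau>s n)) t x"
      "relaxed_fluid.e_\<theta> Cv g \<kappa> (\<tau>s n) (\<theta> (\<tau>s n) t x) (q (\<tau>s n) t x) * Dt (\<theta> (\<tau>s n)) t x
        - 2 * relaxed_fluid.a g \<kappa> (\<tau>s n) (\<theta> (\<tau>s n) t x) / relaxed_fluid.Z g \<kappa> (\<tau>s n) (\<theta> (\<tau>s n) t x)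
            * q (\<tau>s n) t x * Dx (\<theta> (\<tau>s n)) t x
        + R * \<theta> (\<tau>s n) t x * Dx (u (\<tau>s n)) t x / v (\<tau>s n) t x + Dx (q (\<tau>s n)) t x
       = 2 * relaxed_fluid.a g \<kappa> (\<tau>s n) (\<theta> (\<tau>s n) t x) / (\<tau>s n * g (\<theta> (\<tau>s n) t x)) * (q (\<tau>s n) t x)\<^sup>2 * v (\<tau>s n) t x
         + (S (\<tau>s n) t x)\<^sup>2 * v (\<tau>s n) t x / \<mu>"
      "\<tau>s n * g (\<theta> (\<tau>s n) t x) * Dt (q (\<tau>s n)) t x + v (\<tau>s n) t x * q (\<tau>s n) t x
        + \<kappa> (\<theta> (\<tau>s n) t x) * Dx (\<theta> (\<tau>s n)) t x = 0"
      "\<tau>s n * Dt (S (\<tau>s n)) t x + v (\<tau>s n) t x * S (\<tau>s n) t x = \<mu> * Dx (u (\<tau>s n)) t x"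
      using eqs by blast+
  next
    fix n and t :: real assume "t > 0"
    then show "trace_zero {a<..<b} (u (\<tau>s n) t)" "trace_zero {a<..<b} (q (\<tau>s n) t)"
      using P[of n] unfolding relaxed_fluid.problem_P_def by blast+
  qed (fact \<tau>s_lim Dk l)+
  show ?thesis
  proof (intro exI conjI)
    show weak: "weak_star_Linf_H 2 \<Omega> (\<lambda>n. v (\<tau>s n)) vl" "weak_star_Linf_H 2 \<Omega> (\<lambda>n. u (\<tau>s n)) ul"
        "weak_star_Linf_H 2 \<Omega> (\<lambda>n. \<theta> (\<tau>s n)) \<theta>l"
      unfolding assms(2) by (rule regular_weak_star[OF Dk(1) l(1)] regular_weak_star[OF Dk(2) l(2)]
          regular_weak_star[OF Dk(3) l(3)]; assumption)+
    show weak2: "weak_L2_H 2 \<Omega> (\<lambda>n. q (\<tau>s n)) ql" "weak_L2_H 2 \<Omega> (\<lambda>n. S (\<tau>s n)) Sl"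
      unfolding assms(2) by (rule flux_weak_L2[OF Dk(4) D(1,2) l(4)] flux_weak_L2[OF Dk(5) D(1,2) l(5)]; assumption)+
    show "vl \<in> Linf_H 2 \<Omega>" "ul \<in> Linf_H 2 \<Omega>" "\<theta>l \<in> Linf_H 2 \<Omega>" "ql \<in> Lp_H 2 2 \<Omega>" "Sl \<in> Lp_H 2 2 \<Omega>"
      using weak weak2 unfolding weak_star_Linf_H_def weak_L2_H_def by blast+
    show "\<forall>n. \<tau>s n \<in> {0<..1}" "\<tau>s \<longlonglongrightarrow> 0" using \<tau>s \<tau>s_lim by blast+
    show "navier_stokes_classical \<Omega> R Cv \<mu> \<kappa> vl ul \<theta>l" unfolding assms(2) by (rule limit_classical)
    show "\<forall>t>0. trace_zero \<Omega> (ul t) \<and> trace_zero \<Omega> (ql t)" unfolding assms(2) using trace_zero_limits by blast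
    show "\<forall>x\<in>\<Omega>. vl 0 x = v\<^sub>0 x \<and> ul 0 x = u\<^sub>0 x \<and> \<theta>l 0 x = \<theta>\<^sub>0 x" unfolding assms(2) using init by blast
    show "\<forall>t\<ge>0. \<forall>x\<in>\<Omega>. ql t x = - (\<kappa> (\<theta>l t x) * Dx \<theta>l t x / vl t x) \<and> Sl t x = \<mu> * (Dx ul t x / vl t x)"
      unfolding assms(2) using constitutive_laws by blast
  qed
qed

end
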